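(* There exists a minimizer $u \in W^{1,p}_\phi(\Omega)$ of the functional $\mathfrak{F}(v)=\int_\Omega F(X,v,\nabla v)\,dX$ over $W^{1,p}_\phi(\Omega)$. Furthermore $u \ge 0$ in $\Omega$.
   Context: Setting. $\Omega\subset\mathbb{R}^n$ is a bounded smooth domain, $2\le p<n$, and $\phi\in W^{1,p}(\Omega)$ is a bounded nonnegative function. $W^{1,p}_\phi(\Omega)$ is the set of functions in $W^{1,p}(\Omega)$ with trace value $\phi$ on $\partial\Omega$. The kernel $F:\Omega\times\mathbb{R}\times\mathbb{R}^n\to\mathbb{R}$ has the form $F(X,u,\xi)=G(X,\xi)+g(X,u)$, where: (1) for all $\xi\in\mathbb{R}^n$ the map $X\mapsto G(X,\xi)$ is continuous; (2) there is $\lambda>0$ with $\lambda|\xi|^p\le G(X,\xi)\le\lambda^{-1}|\xi|^p$; (3) for almost all $X\in\Omega$ the map $\xi\mapsto G(X,\xi)$ is strictly convex, differentiable, and $G(X,t\xi)=|t|^pG(X,\xi)$ for all $t\in\mathbb{R}$, $\xi\in\mathbb{R}^n$; (4) $g(X,u)=f(X)(u^+)^m+Q(X)\chi_{\{u>0\}}$ with $1\le m<p$, $f$ measurable with $-K\le f\le K$ for some $K>0$, and $Q\in C^{0,\beta}$ with $0<\epsilon<Q<\epsilon^{-1}$ for some $\epsilon>0$. A minimizer of $\mathfrak{F}$ is $u\in W^{1,p}_\phi(\Omega)$ with $\mathfrak{F}(u)\le\mathfrak{F}(v)$ for all $v\in W^{1,p}_\phi(\Omega)$. *)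

theory Defs
  imports "HOL-Analysis.Analysis"
begin

subsection \<open>Smooth functions and smooth domains\<close>

definition partial :: "'n \<Rightarrow> (real^'n \<Rightarrow> real) \<Rightarrow> real^'n::finite \<Rightarrow> real" where
  "partial i f x = frechet_derivative f (at x) (axis i 1)"

definition grad :: "(real^'n \<Rightarrow> real) \<Rightarrow> real^'n::finite \<Rightarrow> real^'n" where
  "grad f x = (\<chi> i. partial i f x)"

text \<open>Intended for open \<open>S\<close> only: the derivatives are taken in the whole space.\<close>

fun Ck_on :: "nat \<Rightarrow> (real^'n::finite) set \<Rightarrow> (real^'n \<Rightarrow> real) \<Rightarrow> bool" where
  "Ck_on 0 S f \<longleftrightarrow> continuous_on S f"
| "Ck_on (Suc k) S f \<longleftrightarrow> (\<forall>x\<in>S. f differentiable (at x)) \<and> (\<forall>i. Ck_on k S (partial i f))"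

definition smooth_on :: "(real^'n::finite) set \<Rightarrow> (real^'n \<Rightarrow> real) \<Rightarrow> bool" where
  "smooth_on S f \<longleftrightarrow> (\<forall>k. Ck_on k S f)"

text \<open>
  Smoothness of the boundary is expressed by local defining functions: near each boundary point
  the domain is a strict sublevel set of a smooth function without critical points. So the boundary
  is a smooth hypersurface, and the domain lies locally on one side of it.
\<close>

definition bounded_smooth_domain :: "(real^'n::finite) set \<Rightarrow> bool" where
  "bounded_smooth_domain \<Omega> \<longleftrightarrow>
     open \<Omega> \<and> connected \<Omega> \<and> \<Omega> \<noteq> {} \<and> bounded \<Omega> \<and>
     (\<forall>x\<in>frontier \<Omega>. \<exists>U \<rho>. open U \<and> x \<in> U \<and> smooth_on U \<rho> \<and>
        (\<forall>y\<in>U. grad \<rho> y \<noteq> 0) \<and> \<Omega> \<inter> U = {y\<in>U. \<rho> y < 0})"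

subsection \<open>Hausdorff measure\<close>

text \<open>
  The normalisation is the one for which the measure of dimension \<open>n - 1\<close> is the surface
  measure of hypersurfaces in \<open>n\<close>-space. Intended for \<open>d > 0\<close>, where the empty set
  contributes \<open>0 powr d = 0\<close>; boundedness is demanded because \<open>diameter\<close> is
  meaningless on unbounded sets.
\<close>

definition hausdorff_content :: "real \<Rightarrow> real \<Rightarrow> 'a::metric_space set \<Rightarrow> ennreal" where
  "hausdorff_content d \<delta> A =
     (INF U\<in>{U :: nat \<Rightarrow> 'a set. A \<subseteq> (\<Union>i. U i) \<and> (\<forall>i. bounded (U i) \<and> diameter (U i) \<le> \<delta>)}.
        \<Sum>i. ennreal (unit_ball_vol d * (diameter (U i) / 2) powr d))"

definition hausdorff_outer :: "real \<Rightarrow> 'a::metric_space set \<Rightarrow> ennreal" where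
  "hausdorff_outer d A = (SUP \<delta>\<in>{0<..}. hausdorff_content d \<delta> A)"

definition hausdorff_measure :: "real \<Rightarrow> 'a::metric_space measure" where
  "hausdorff_measure d = measure_of UNIV (sets borel) (hausdorff_outer d)"

definition surface_measure :: "(real^'n::finite) set \<Rightarrow> (real^'n) measure" where
  "surface_measure \<Omega> =
     restrict_space (hausdorff_measure (real CARD('n) - 1)) (frontier \<Omega>)"

subsection \<open>Lebesgue and Sobolev spaces\<close>

text \<open>
  Elements of these spaces are represented by functions on the whole space, of which only the
  values on \<open>\<Omega>\<close> matter, and those only up to a null set.
\<close>

definition in_Lp :: "'a measure \<Rightarrow> real \<Rightarrow> ('a \<Rightarrow> 'b::euclidean_space) \<Rightarrow> bool" where
  "in_Lp M p f \<longleftrightarrow> f \<in> borel_measurable M \<and> integrable M (\<lambda>x. norm (f x) powr p)"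

definition tendsto_Lp ::
  "'a measure \<Rightarrow> real \<Rightarrow> (nat \<Rightarrow> 'a \<Rightarrow> 'b::euclidean_space) \<Rightarrow> ('a \<Rightarrow> 'b) \<Rightarrow> bool" where
  "tendsto_Lp M p w f \<longleftrightarrow> (\<lambda>k. \<integral>\<^sup>+ x. ennreal (norm (w k x - f x) powr p) \<partial>M) \<longlonglongrightarrow> 0"

definition locally_integrable :: "(real^'n::finite) set \<Rightarrow> (real^'n \<Rightarrow> 'b::euclidean_space) \<Rightarrow> bool" where
  "locally_integrable \<Omega> f \<longleftrightarrow> (\<forall>K. compact K \<and> K \<subseteq> \<Omega> \<longrightarrow> set_integrable lebesgue K f)"

definition test_fun :: "(real^'n::finite) set \<Rightarrow> (real^'n \<Rightarrow> real) \<Rightarrow> bool" where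
  "test_fun \<Omega> \<psi> \<longleftrightarrow>
     smooth_on UNIV \<psi> \<and> compact (closure {x. \<psi> x \<noteq> 0}) \<and> closure {x. \<psi> x \<noteq> 0} \<subseteq> \<Omega>"

definition is_weak_gradient ::
  "(real^'n::finite) set \<Rightarrow> (real^'n \<Rightarrow> real) \<Rightarrow> (real^'n \<Rightarrow> real^'n) \<Rightarrow> bool" where
  "is_weak_gradient \<Omega> u V \<longleftrightarrow>
     locally_integrable \<Omega> u \<and> locally_integrable \<Omega> V \<and>
     (\<forall>\<psi> i. test_fun \<Omega> \<psi> \<longrightarrow>
        (\<integral>x. u x * partial i \<psi> x \<partial>lebesgue_on \<Omega>) = - (\<integral>x. V x $ i * \<psi> x \<partial>lebesgue_on \<Omega>))"

definition weak_grad :: "(real^'n::finite) set \<Rightarrow> (real^'n \<Rightarrow> real) \<Rightarrow> real^'n \<Rightarrow> real^'n" where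
  "weak_grad \<Omega> u = (SOME V. is_weak_gradient \<Omega> u V)"

definition sobolev :: "real \<Rightarrow> (real^'n::finite) set \<Rightarrow> (real^'n \<Rightarrow> real) set" where
  "sobolev p \<Omega> =
     {u. in_Lp (lebesgue_on \<Omega>) p u \<and>
         (\<exists>V. is_weak_gradient \<Omega> u V) \<and> in_Lp (lebesgue_on \<Omega>) p (weak_grad \<Omega> u)}"

text \<open>
  The graph of the trace operator: the restriction to the boundary of functions that are smooth
  up to the boundary, extended by density from the Sobolev space to \<open>L\<^sup>p\<close> of the boundary.
\<close>

definition has_trace ::
  "real \<Rightarrow> (real^'n::finite) set \<Rightarrow> (real^'n \<Rightarrow> real) \<Rightarrow> (real^'n \<Rightarrow> real) \<Rightarrow> bool" where
  "has_trace p \<Omega> u h \<longleftrightarrow>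
     u \<in> sobolev p \<Omega> \<and> in_Lp (surface_measure \<Omega>) p h \<and>
     (\<exists>w. (\<forall>k. smooth_on UNIV (w k)) \<and>
          tendsto_Lp (lebesgue_on \<Omega>) p w u \<and>
          tendsto_Lp (lebesgue_on \<Omega>) p (\<lambda>k. grad (w k)) (weak_grad \<Omega> u) \<and>
          tendsto_Lp (surface_measure \<Omega>) p w h)"

text \<open>
  The trace being linear, \<open>u\<close> has the same trace as \<open>\<phi>\<close> iff \<open>u - \<phi>\<close> has trace zero.
\<close>

definition sobolev_bdry ::
  "real \<Rightarrow> (real^'n::finite) set \<Rightarrow> (real^'n \<Rightarrow> real) \<Rightarrow> (real^'n \<Rightarrow> real) set" where
  "sobolev_bdry p \<Omega> \<phi> = {u \<in> sobolev p \<Omega>. has_trace p \<Omega> (\<lambda>x. u x - \<phi> x) (\<lambda>x. 0)}"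

subsection \<open>The functional\<close>

definition strictly_convex :: "(real^'n::finite \<Rightarrow> real) \<Rightarrow> bool" where
  "strictly_convex h \<longleftrightarrow>
     (\<forall>\<xi> \<eta> t. \<xi> \<noteq> \<eta> \<and> 0 < t \<and> t < 1 \<longrightarrow>
        h (t *\<^sub>R \<xi> + (1 - t) *\<^sub>R \<eta>) < t * h \<xi> + (1 - t) * h \<eta>)"

definition holder_on :: "real \<Rightarrow> (real^'n::finite) set \<Rightarrow> (real^'n \<Rightarrow> real) \<Rightarrow> bool" where
  "holder_on \<beta> \<Omega> q \<longleftrightarrow> (\<exists>C. \<forall>x\<in>\<Omega>. \<forall>y\<in>\<Omega>. \<bar>q x - q y\<bar> \<le> C * dist x y powr \<beta>)"

definition energy ::
  "(real^'n::finite) set \<Rightarrow> (real^'n \<Rightarrow> real \<Rightarrow> real^'n \<Rightarrow> real) \<Rightarrow> (real^'n \<Rightarrow> real) \<Rightarrow> real" where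
  "energy \<Omega> F v = (\<integral>X. F X (v X) (weak_grad \<Omega> v X) \<partial>lebesgue_on \<Omega>)"

definition is_minimizer ::
  "real \<Rightarrow> (real^'n::finite) set \<Rightarrow> (real^'n \<Rightarrow> real) \<Rightarrow>
   (real^'n \<Rightarrow> real \<Rightarrow> real^'n \<Rightarrow> real) \<Rightarrow> (real^'n \<Rightarrow> real) \<Rightarrow> bool" where
  "is_minimizer p \<Omega> \<phi> F u \<longleftrightarrow>
     u \<in> sobolev_bdry p \<Omega> \<phi> \<and> (\<forall>v\<in>sobolev_bdry p \<Omega> \<phi>. energy \<Omega> F u \<le> energy \<Omega> F v)"

end

theory Submission
  imports Defs "HOL-Library.Diagonal_Subsequence"
begin

text \<open>
  The existence of a minimizer follows by the direct method. Since \<open>m < p\<close>, the term \<open>g\<close> of lower order costs at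
  most a small multiple of \<open>|u|\<^sup>p\<close>, which Poincare's inequality bounds by the gradient; so the functional is coercive
  (\<open>coercive\<close>) and a minimizing sequence is bounded. Two kinds of convergence are extracted from it. By
  Rellich's theorem (\<open>rellich_AE\<close>) a subsequence \<open>u\<^sub>k\<close> converges almost everywhere; this is enough for the term \<open>g\<close>,
  which is lower semicontinuous in \<open>u\<close> (\<open>Ig_lower_semicontinuous\<close>). For the gradients no weak topology is used: as
  \<open>p \<ge> 2\<close>, Clarkson's inequality shows that suitable iterated midpoints of tails of the sequence converge strongly
  (\<open>midhull_cauchy\<close>), and convexity of \<open>G\<close> bounds their energies by those of the tails. Both limits are the same
  function, and it minimizes (\<open>minimizer_exists\<close>).

  A nonnegative minimizer is obtained by passing from \<open>u\<close> to its positive part. On the set where \<open>u < 0\<close> this removes the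
  gradient, which cannot increase \<open>G\<close> by homogeneity, and \<open>g\<close> depends on the positive part only. What has to be
  shown is that the boundary values are kept, that is, that \<open>u\<^sup>-\<close> has trace zero. As \<open>\<phi> \<ge> 0\<close>, it is dominated by
  \<open>|u - \<phi>|\<close>, and a Sobolev function dominated by one of trace zero has trace zero (\<open>trace_zero_dominated\<close>): it is
  the limit of its products with cutoff functions, because a function \<open>z\<close> of trace zero satisfies
  \<open>\<integral> |z|\<^sup>p \<le> C d\<^sup>p \<integral> |\<nabla>z|\<^sup>p\<close> over strips of width of order \<open>d\<close> along the boundary (\<open>strip_estimate\<close>).

  This estimate and Poincare's inequality come from the same source (\<open>exit_estimate\<close>): a smooth function is integrated
  along parallel segments up to the point where they leave the domain. The values at the exit points are controlled by
  the trace, since the set swept out by moving a piece \<open>A\<close> of the boundary through a distance \<open>L\<close> has volume at most a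
  constant times \<open>L\<close> times the Hausdorff measure of \<open>A\<close> (\<open>emeasure_sweep_le\<close>); for functions of trace zero this
  term disappears in the limit.
\<close>

section \<open>Calculus of smooth functions\<close>

lemma partial_eqI: "(f has_derivative D) (at x) ==> partial i f x = D (axis i 1)"
 unfolding partial_def using frechet_derivative_at by metis

lemma has_derivative_grad:
 assumes "f differentiable (at x)"
 shows "(f has_derivative (\<lambda>v. grad f x \<bullet> v)) (at x)"
proof -
 define D where "D = frechet_derivative f (at x)"
 have D: "(f has_derivative D) (at x)"
  using assms unfolding D_def by (simp add: frechet_derivative_works)
 then have lin: "linear D" using has_derivative_linear by blast
 have "D v = grad f x \<bullet> v" for v
 proof -
  have "D v = D (\<Sum>i\<in>UNIV. v $ i *\<^sub>R axis i 1)"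
   using basis_expansion[of v] by (simp add: scalar_mult_eq_scaleR)
  also have "\<dots> = (\<Sum>i\<in>UNIV. v $ i * D (axis i 1))"
   using lin by (simp add: linear_sum linear_cmul)
  also have "\<dots> = grad f x \<bullet> v"
   by (simp add: grad_def partial_def inner_vec_def D_def mult.commute)
  finally show ?thesis .
 qed
 then have "D = (\<lambda>v. grad f x \<bullet> v)" by auto
 then show ?thesis using D by simp
qed

lemma partial_gradI:
 assumes "(f has_derivative (\<lambda>v. w \<bullet> v)) (at x)"
 shows "partial i f x = w $ i" and "grad f x = w"
 using partial_eqI[OF assms] by (simp_all add: grad_def vec_eq_iff inner_axis)

lemma Ck_SucD: "Ck_on (Suc k) UNIV f ==> Ck_on k UNIV f"
proof (induction k arbitrary: f)
 case 0
 then show ?case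
  by (auto intro!: differentiable_imp_continuous_on simp: differentiable_on_def)
next
 case (Suc k)
 then have "Ck_on k UNIV (partial i f)" for i
  by (metis Ck_on.simps(2))
 with Suc.prems show ?case by auto
qed

lemma Ck_partial: "Ck_on (Suc k) UNIV f ==> Ck_on k UNIV (partial i f)"
 by simp

lemma Ck_continuous: "Ck_on k UNIV f ==> continuous_on UNIV f"
proof (induction k)
 case (Suc k)
 then show ?case using Ck_SucD by blast
qed simp

lemma Ck_const: "Ck_on k UNIV (\<lambda>x :: real^'n::finite. c)"
proof (induction k arbitrary: c)
 case (Suc k)
 have "partial i (\<lambda>x. c) = (\<lambda>x. 0)" for i :: 'n and c
  by (rule ext, subst partial_eqI[where D="\<lambda>v. 0"]) auto
 with Suc show ?case by simp
qed auto

lemma partial_add: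
 assumes "f differentiable (at x)" "g differentiable (at x)"
 shows "partial i (\<lambda>x. f x + g x) x = partial i f x + partial i g x"
 using partial_eqI[OF has_derivative_add[OF has_derivative_grad[OF assms(1)] has_derivative_grad[OF assms(2)]]]
 by (simp add: inner_axis grad_def)

lemma partial_mult:
 assumes "f differentiable (at x)" "g differentiable (at x)"
 shows "partial i (\<lambda>x. f x * g x) x = f x * partial i g x + partial i f x * g x"
 using partial_eqI[OF has_derivative_mult[OF has_derivative_grad[OF assms(1)] has_derivative_grad[OF assms(2)]]]
 by (simp add: inner_axis grad_def)

lemma Ck_add:
 assumes "Ck_on k UNIV f" "Ck_on k UNIV g"
 shows "Ck_on k UNIV (\<lambda>x. f x + g x)"
 using assms
proof (induction k arbitrary: f g)
 case 0
 then show ?case by (simp add: continuous_on_add continuous_on_mult)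
next
 case (Suc k)
 have "partial i (\<lambda>x. f x + g x) = (\<lambda>x. partial i f x + partial i g x)" for i
  using Suc.prems by (auto simp: partial_add)
 with Suc show ?case by auto
qed

lemma Ck_mult:
 assumes "Ck_on k UNIV f" "Ck_on k UNIV g"
 shows "Ck_on k UNIV (\<lambda>x. f x * g x)"
 using assms
proof (induction k arbitrary: f g)
 case 0
 then show ?case by (simp add: continuous_on_add continuous_on_mult)
next
 case (Suc k)
 have "partial i (\<lambda>x. f x * g x) = (\<lambda>x. f x * partial i g x + partial i f x * g x)" for i
  using Suc.prems by (auto simp: partial_mult)
 moreover have "Ck_on k UNIV (\<lambda>x. f x * partial i g x + partial i f x * g x)" for i
  using Suc.prems Ck_SucD[OF Suc.prems(1)] Ck_SucD[OF Suc.prems(2)]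
  by (intro Ck_add Suc.IH) simp_all
 ultimately show ?case using Suc.prems by auto
qed

lemma partial_affine:
 fixes a x :: "real^'n::finite"
 assumes "f differentiable (at (a + c *\<^sub>R x))"
 shows "partial i (\<lambda>x. f (a + c *\<^sub>R x)) x = c * partial i f (a + c *\<^sub>R x)"
proof -
 have "((\<lambda>x. a + c *\<^sub>R x) has_derivative (\<lambda>v. c *\<^sub>R v)) (at x)"
  by (auto intro!: derivative_eq_intros)
 from partial_eqI[OF has_derivative_compose[OF this has_derivative_grad[OF assms]]]
 show ?thesis
  by (simp add: inner_axis grad_def)
qed

lemma Ck_affine:
 assumes "Ck_on k UNIV f"
 shows "Ck_on k UNIV (\<lambda>x. f (a + c *\<^sub>R x))"
 using assms
proof (induction k arbitrary: f)
 case 0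
 then have "continuous_on UNIV (f \<circ> (\<lambda>x. a + c *\<^sub>R x))"
  by (intro continuous_on_compose continuous_intros) (auto elim: continuous_on_subset)
 then show ?case by (simp add: o_def)
next
 case (Suc k)
 have "partial i (\<lambda>x. f (a + c *\<^sub>R x)) = (\<lambda>x. c * partial i f (a + c *\<^sub>R x))" for i
  using Suc.prems by (auto simp: partial_affine)
 moreover have "Ck_on k UNIV (\<lambda>x. c * partial i f (a + c *\<^sub>R x))" for i
  using Suc.prems by (intro Ck_mult Ck_const Suc.IH) auto
 moreover have "(\<lambda>x. f (a + c *\<^sub>R x)) differentiable (at x)" for x
 proof -
  have "(\<lambda>x. a + c *\<^sub>R x) differentiable (at x)" by simp
  moreover have "f differentiable (at (a + c *\<^sub>R x))" using Suc.prems by simp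
  ultimately show ?thesis using differentiable_chain_at[of "\<lambda>x. a + c *\<^sub>R x" x f]
   by (simp add: o_def)
 qed
 ultimately show ?case by auto
qed

lemma Ck_component: "Ck_on k UNIV (\<lambda>x. x $ i)"
proof (cases k)
 case (Suc k)
 have "partial j (\<lambda>x. x $ i) = (\<lambda>x. axis j 1 $ i)" for j :: 'a
  by (rule ext, rule partial_eqI, rule bounded_linear_imp_has_derivative)
   (rule bounded_linear_vec_nth)
 moreover have "(\<lambda>x :: real^'a. x $ i) differentiable (at x)" for x
  by (rule bounded_linear_imp_differentiable) (rule bounded_linear_vec_nth)
 ultimately show ?thesis unfolding Suc by (auto intro: Ck_const)
qed (simp add: continuous_on_component)

text \<open>Once differentiability is needed only to first order, a chain rule for one real variable
 suffices.\<close>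

lemma C1_compose:
 assumes w: "Ck_on 1 UNIV w" and b: "\<And>t. (b has_real_derivative b' t) (at t)"
  and b': "continuous_on UNIV b'"
 shows "Ck_on 1 UNIV (\<lambda>x. b (w x))" "partial i (\<lambda>x. b (w x)) x = b' (w x) * partial i w x"
proof -
 have d: "((\<lambda>x. b (w x)) has_derivative (\<lambda>v. (b' (w x) *\<^sub>R grad w x) \<bullet> v)) (at x)" for x
 proof -
  have "w differentiable (at x)" using w by simp
  from has_derivative_compose[OF has_derivative_grad[OF this], of b "\<lambda>h. b' (w x) * h"]
  show ?thesis using b by (simp add: has_field_derivative_def)
 qed
 have p: "partial i (\<lambda>x. b (w x)) x = b' (w x) * partial i w x" for i x
  using partial_gradI(1)[OF d] by (simp add: grad_def)
 show "partial i (\<lambda>x. b (w x)) x = b' (w x) * partial i w x" by (rule p)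
 have "continuous_on UNIV w" using w Ck_continuous by blast
 then have "continuous_on UNIV (\<lambda>x. b' (w x))"
  using b' continuous_on_compose2 by blast
 moreover have "continuous_on UNIV (partial i w)" for i using w by simp
 ultimately have "continuous_on UNIV (\<lambda>x. b' (w x) * partial i w x)" for i
  by (intro continuous_intros)
 moreover have "(\<lambda>x. b (w x)) differentiable (at x)" for x
  using d differentiable_def by blast
 ultimately show "Ck_on 1 UNIV (\<lambda>x. b (w x))"
  using p by simp
qed

lemma smooth_onI: "(\<And>k. Ck_on k S f) ==> smooth_on S f"
 by (simp add: smooth_on_def)

lemma smooth_Ck: "smooth_on S f ==> Ck_on k S f"
 by (simp add: smooth_on_def)

lemma smooth_differentiable: "smooth_on UNIV f ==> f differentiable (at x)"
 using smooth_Ck[of UNIV f 1] by simp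

lemma smooth_partial: "smooth_on UNIV f ==> smooth_on UNIV (partial i f)"
 unfolding smooth_on_def using Ck_partial by blast

lemma smooth_continuous: "smooth_on UNIV f ==> continuous_on UNIV f"
 using smooth_Ck[of UNIV f 0] by simp

lemma smooth_add: "smooth_on UNIV f ==> smooth_on UNIV g ==> smooth_on UNIV (\<lambda>x. f x + g x)"
 by (simp add: smooth_on_def Ck_add)

lemma smooth_mult: "smooth_on UNIV f ==> smooth_on UNIV g ==> smooth_on UNIV (\<lambda>x. f x * g x)"
 by (simp add: smooth_on_def Ck_mult)

lemma smooth_const: "smooth_on UNIV (\<lambda>x. c)"
 by (simp add: smooth_on_def Ck_const)

lemma smooth_affine: "smooth_on UNIV f ==> smooth_on UNIV (\<lambda>x. f (a + c *\<^sub>R x))"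
 by (simp add: smooth_on_def Ck_affine)

lemma smooth_grad_continuous: "smooth_on UNIV f ==> continuous_on UNIV (grad f)"
 unfolding grad_def by (intro continuous_on_vec_lambda smooth_continuous smooth_partial)

lemma grad_linear_combination:
 assumes "f differentiable (at x)" "g differentiable (at x)"
 shows "grad (\<lambda>x. a * f x + b * g x) x = a *\<^sub>R grad f x + b *\<^sub>R grad g x"
proof (rule partial_gradI(2))
 show "((\<lambda>x. a * f x + b * g x) has_derivative (\<bullet>) (a *\<^sub>R grad f x + b *\<^sub>R grad g x)) (at x)"
  by (rule has_derivative_eq_rhs, rule has_derivative_add)
   (auto intro!: has_derivative_mult_right has_derivative_grad assms simp: inner_add_left)
qed

section \<open>Bump functions\<close>

text \<open>The functions \<open>exp (-1/t) / t ^ n\<close>, extended by zero to \<open>t \<le> 0\<close>, form a family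
 whose span is closed under differentiation. This is all that is needed to see that each of them is
 smooth.\<close>

definition flat_exp :: "nat => real => real" where
 "flat_exp n t = (if t > 0 then exp (- (1 / t)) * (1 / t) ^ n else 0)"

lemma flat_exp_nonneg: "0 \<le> flat_exp n t"
 by (simp add: flat_exp_def)

lemma flat_exp_tendsto_0: "(flat_exp n \<longlongrightarrow> 0) (at 0)"
proof -
 have "((\<lambda>h. (1/h) ^ n / exp (1/h)) \<longlongrightarrow> 0) (at_right (0::real))"
  using filterlim_compose[OF tendsto_power_div_exp_0[of n] filterlim_inverse_at_top_right]
  by (simp add: divide_inverse)
 then have "(flat_exp n \<longlongrightarrow> 0) (at_right 0)"
  by (rule Lim_transform_eventually)
   (auto simp: eventually_at_right_less flat_exp_def exp_minus divide_inverse
    intro!: eventually_mono[OF eventually_at_right_less])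
 moreover have "(flat_exp n \<longlongrightarrow> 0) (at_left 0)"
  by (rule Lim_transform_eventually[OF tendsto_const])
   (auto simp: flat_exp_def eventually_at_filter)
 ultimately show ?thesis using filterlim_split_at by blast
qed

lemma flat_exp_derivative:
 "(flat_exp n has_real_derivative (flat_exp (n+2) t - real n * flat_exp (n+1) t)) (at t)"
proof -
 consider "t > 0" | "t < 0" | "t = 0" by linarith
 then show ?thesis
 proof cases
  case 1
  have "((\<lambda>t. exp (- (1 / t)) * (1 / t) ^ n) has_real_derivative
    (flat_exp (n+2) t - real n * flat_exp (n+1) t)) (at t)"
  proof (cases n)
   case 0
   then show ?thesis using 1
    by (auto intro!: derivative_eq_intros simp: flat_exp_def field_simps power2_eq_square)
  next
   case (Suc k)
   then show ?thesis using 1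
    by (auto intro!: derivative_eq_intros simp: flat_exp_def field_simps power2_eq_square)
     (metis One_nat_def power_eq_if)
  qed
  then show ?thesis
   by (rule has_field_derivative_transform_within_open[where S="{0<..}"])
    (use 1 in \<open>auto simp: flat_exp_def\<close>)
 next
  case 2
  have "((\<lambda>t. 0) has_real_derivative (flat_exp (n+2) t - real n * flat_exp (n+1) t)) (at t)"
   using 2 by (auto simp: flat_exp_def)
  then show ?thesis
   by (rule has_field_derivative_transform_within_open[where S="{..<0}"])
    (use 2 in \<open>auto simp: flat_exp_def\<close>)
 next
  case 3
  have "((\<lambda>h. (flat_exp n (0+h) - flat_exp n 0) / h) \<longlongrightarrow> 0) (at 0)"
   by (rule Lim_transform_eventually[OF flat_exp_tendsto_0[of "Suc n"]])
    (auto simp: flat_exp_def eventually_at_filter)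
  then show ?thesis using 3 by (simp add: DERIV_def flat_exp_def)
 qed
qed

definition bump :: "nat => real^'n::finite => real" where
 "bump n x = flat_exp n (1 - x \<bullet> x)"

lemma bump_derivative:
 "(bump n has_derivative
   (\<lambda>v. ((flat_exp (n+2) (1 - x \<bullet> x) - real n * flat_exp (n+1) (1 - x \<bullet> x)) *\<^sub>R (-2 *\<^sub>R x)) \<bullet> v)) (at x)"
proof -
 have "((\<lambda>x. 1 - x \<bullet> x) has_derivative (\<lambda>v. (-2 *\<^sub>R x) \<bullet> v)) (at x)"
  by (auto intro!: derivative_eq_intros simp: inner_commute)
 from has_derivative_compose[OF this, of "flat_exp n",
   OF flat_exp_derivative[of n, unfolded has_field_derivative_def]]
 show ?thesis unfolding bump_def by (simp add: algebra_simps)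
qed

lemma Ck_bump: "Ck_on k UNIV (bump n)"
proof (induction k arbitrary: n)
 case 0
 have "bump n differentiable (at x)" for x :: "real^'a"
  using bump_derivative differentiable_def by blast
 then have "continuous_on UNIV (bump n :: real^'a => real)"
  by (intro differentiable_imp_continuous_on) (auto simp: differentiable_on_def)
 then show ?case by simp
next
 case (Suc k)
 have "partial i (bump n) = (\<lambda>x. (bump (n+2) x + (- real n) * bump (n+1) x) * (-2 * x $ i))" for i :: 'a
  by (rule ext, subst partial_gradI(1)[OF bump_derivative]) (simp add: bump_def)
 moreover have "Ck_on k UNIV (\<lambda>x. (bump (n+2) x + (- real n) * bump (n+1) x) * (-2 * x $ i))" for i :: 'a
  by (intro Ck_mult Ck_add Suc Ck_const Ck_component)
 moreover have "bump n differentiable (at x)" for x :: "real^'a"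
  using bump_derivative differentiable_def by blast
 ultimately show ?case by simp
qed

lemma smooth_bump: "smooth_on UNIV (bump n)"
 by (simp add: smooth_on_def Ck_bump)

lemma bump_nonneg: "0 \<le> bump n x"
 by (simp add: bump_def flat_exp_nonneg)

lemma bump_eq_0: "1 \<le> norm x ==> bump n x = 0"
 by (auto simp: bump_def flat_exp_def dot_square_norm abs_square_less_1)

lemma bump_pos: "norm x < 1 ==> 0 < bump n x"
 by (auto simp: bump_def flat_exp_def dot_square_norm abs_square_less_1)

section \<open>Mollification\<close>

definition supported_in_ball :: "real => (real^'n::finite => real) => bool" where
 "supported_in_ball R \<rho> \<longleftrightarrow> (\<forall>x. R \<le> norm x \<longrightarrow> \<rho> x = 0)"

lemma supported_bounded:
 assumes "continuous_on UNIV \<rho>" "supported_in_ball R \<rho>"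
 obtains M where "M > 0" "\<And>x. \<bar>\<rho> x\<bar> \<le> M"
proof -
 have "compact (\<rho> ` cball 0 R)"
  by (rule compact_continuous_image[OF continuous_on_subset[OF assms(1)]]) auto
 then obtain M where M: "M > 0" "\<And>y. y \<in> \<rho> ` cball 0 R ==> norm y \<le> M"
  using compact_imp_bounded[of "\<rho> ` cball 0 R"] unfolding bounded_pos by auto
 have "\<bar>\<rho> x\<bar> \<le> M" for x
 proof (cases "R \<le> norm x")
  case True
  then show ?thesis using assms(2) M(1) by (simp add: supported_in_ball_def)
 next
  case False
  then show ?thesis using M(2)[of "\<rho> x"] by auto
 qed
 with M(1) show ?thesis by (rule that)
qed

lemma supported_grad_eq_0:
 assumes "supported_in_ball R \<rho>" "R < norm x"
 shows "grad \<rho> x = 0"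
proof (rule partial_gradI(2))
 have "(\<bullet>) 0 = (\<lambda>v::real^'a. 0 :: real)" by auto
 then have "((\<lambda>x. 0) has_derivative (\<bullet>) 0) (at x)" by simp
 then show "(\<rho> has_derivative (\<bullet>) 0) (at x)"
 proof (rule has_derivative_transform_within_open[where s="{y. R < norm y}"])
  show "open {y::real^'a. R < norm y}" by (intro open_Collect_less continuous_intros)
 qed (use assms in \<open>auto simp: supported_in_ball_def\<close>)
qed

lemma supported_partial:
 assumes "supported_in_ball R \<rho>"
 shows "supported_in_ball (R+1) (partial i \<rho>)"
 unfolding supported_in_ball_def
proof (intro allI impI)
 fix x :: "real^'a" assume "R + 1 \<le> norm x"
 then have "grad \<rho> x = 0" using supported_grad_eq_0[OF assms] by auto
 then show "partial i \<rho> x = 0" by (simp add: grad_def vec_eq_iff)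
qed

lemma borel_measurable_lebesgue_continuous:
 fixes f :: "real^'n::finite => 'b::topological_space"
 assumes "continuous_on UNIV f"
 shows "f \<in> borel_measurable lebesgue" "f \<in> borel_measurable borel"
  "f \<in> borel_measurable lborel"
 using borel_measurable_continuous_onI[OF assms] by (auto intro: measurable_completion)

text \<open>First order Taylor expansion, uniformly in the base point.\<close>

lemma uniform_differentiability:
 assumes "smooth_on UNIV \<rho>" "supported_in_ball R \<rho>" "0 < e"
 obtains d where "d > 0"
  "\<And>z v. norm v < d ==> \<bar>\<rho> (z + v) - \<rho> z - grad \<rho> z \<bullet> v\<bar> \<le> e * norm v"
proof -
 have "uniformly_continuous_on (cball 0 (R+2)) (grad \<rho>)"
  using smooth_grad_continuous[OF assms(1)]
  by (intro compact_uniformly_continuous) (auto elim: continuous_on_subset)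
 then obtain d where d: "d > 0" "\<And>x y. x \<in> cball 0 (R+2) ==> y \<in> cball 0 (R+2) ==>
   dist x y < d ==> dist (grad \<rho> x) (grad \<rho> y) < e"
  unfolding uniformly_continuous_on_def using assms(3) by metis
 show ?thesis
 proof (rule that[of "min d 1"])
  show "0 < min d 1" using d by simp
  fix z v :: "real^'a" assume v: "norm v < min d 1"
  have der: "((\<lambda>t. \<rho> (z + t *\<^sub>R v)) has_real_derivative (grad \<rho> (z + t *\<^sub>R v) \<bullet> v)) (at t)" for t
  proof -
   have "((\<lambda>t. z + t *\<^sub>R v) has_derivative (\<lambda>h. h *\<^sub>R v)) (at t)"
    by (auto intro!: derivative_eq_intros)
   from has_derivative_compose[OF this has_derivative_grad[OF smooth_differentiable[OF assms(1)]]]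
   show ?thesis by (rule has_derivative_imp_has_field_derivative) simp
  qed
  obtain t where t: "0 < t" "t < 1" "\<rho> (z + v) - \<rho> z = grad \<rho> (z + t *\<^sub>R v) \<bullet> v"
   using MVT2[of 0 1 "\<lambda>t. \<rho> (z + t *\<^sub>R v)" "\<lambda>t. grad \<rho> (z + t *\<^sub>R v) \<bullet> v"] der by auto
  have tv: "norm (t *\<^sub>R v) \<le> norm v" using t by (simp add: mult_left_le_one_le)
  have "norm (grad \<rho> (z + t *\<^sub>R v) - grad \<rho> z) \<le> e"
  proof (cases "norm z \<le> R + 1")
   case True
   have "norm (z + t *\<^sub>R v) \<le> R + 2"
    using norm_triangle_ineq[of z "t *\<^sub>R v"] tv v True by linarith
   moreover have "norm (t *\<^sub>R v) < d" using tv v by linarith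
   ultimately show ?thesis using d(2)[of "z + t *\<^sub>R v" z] True
    unfolding dist_norm by (simp add: norm_minus_commute)
  next
   case False
   have "norm (z + t *\<^sub>R v) > R"
    using norm_diff_ineq[of z "t *\<^sub>R v"] tv v False by linarith
   then show ?thesis using False supported_grad_eq_0[OF assms(2)] assms(3) by simp
  qed
  then have "norm (grad \<rho> (z + t *\<^sub>R v) - grad \<rho> z) * norm v \<le> e * norm v"
   by (simp add: mult_right_mono)
  moreover have "\<rho> (z + v) - \<rho> z - grad \<rho> z \<bullet> v = (grad \<rho> (z + t *\<^sub>R v) - grad \<rho> z) \<bullet> v"
   using t by (simp add: inner_diff_left)
  ultimately show "\<bar>\<rho> (z + v) - \<rho> z - grad \<rho> z \<bullet> v\<bar> \<le> e * norm v"
   using Cauchy_Schwarz_ineq2[of "grad \<rho> (z + t *\<^sub>R v) - grad \<rho> z" v] by linarith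
 qed
qed

definition conv :: "(real^'n::finite => real) => (real^'n => real) => real^'n => real" where
 "conv h \<rho> x = (\<integral>y. h y * \<rho> (x - y) \<partial>lebesgue)"

lemma conv_integrable:
 assumes h: "integrable lebesgue h" and "continuous_on UNIV \<rho>" "supported_in_ball R \<rho>"
 shows "integrable lebesgue (\<lambda>y. h y * \<rho> (x - y))"
proof -
 obtain M where M: "M > 0" "\<And>x. \<bar>\<rho> x\<bar> \<le> M" using supported_bounded assms by metis
 have "continuous_on UNIV (\<lambda>y. \<rho> (x - y))"
  by (rule continuous_on_compose2[OF assms(2)]) (auto intro: continuous_intros)
 then have m: "(\<lambda>y. \<rho> (x - y)) \<in> borel_measurable lebesgue"
  by (rule borel_measurable_lebesgue_continuous)
 show ?thesis
 proof (rule Bochner_Integration.integrable_bound)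
  show "integrable lebesgue (\<lambda>y. M * h y)" using h by simp
  show "(\<lambda>y. h y * \<rho> (x - y)) \<in> borel_measurable lebesgue"
   using borel_measurable_integrable[OF h] m by measurable
  show "AE y in lebesgue. norm (h y * \<rho> (x - y)) \<le> norm (M * h y)"
  proof (rule AE_I2)
   fix y
   have "\<bar>h y\<bar> * \<bar>\<rho> (x - y)\<bar> \<le> \<bar>h y\<bar> * M" using M(2) by (intro mult_left_mono) auto
   then show "norm (h y * \<rho> (x - y)) \<le> norm (M * h y)" using M(1) by (simp add: abs_mult mult.commute)
  qed
 qed
qed

text \<open>The first order expansion of the kernel is uniform in the base point, so the remainder, integrated against
 \<open>h\<close>, is a small multiple of the integral of \<open>|h|\<close>.\<close>

lemma conv_has_derivative:
 assumes h: "integrable lebesgue h" and \<rho>: "smooth_on UNIV \<rho>" "supported_in_ball R \<rho>"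
 shows "(conv h \<rho> has_derivative (\<lambda>v. (\<chi> i. conv h (partial i \<rho>) x) \<bullet> v)) (at x)"
 unfolding has_derivative_at_alt
proof (intro conjI allI impI)
 show "bounded_linear ((\<bullet>) (\<chi> i. conv h (partial i \<rho>) x))" by (rule bounded_linear_inner_right)
 fix e :: real assume e: "e > 0"
 define N where "N = (\<integral>y. \<bar>h y\<bar> \<partial>lebesgue)"
 have N: "N \<ge> 0" by (simp add: N_def)
 have "e / (N + 1) > 0" using e N by simp
 then obtain d where d: "d > 0" "\<And>z v. norm v < d ==>
   \<bar>\<rho> (z + v) - \<rho> z - grad \<rho> z \<bullet> v\<bar> \<le> e / (N+1) * norm v"
  using uniform_differentiability[OF \<rho>] by metis
 have cont: "continuous_on UNIV \<rho>" "\<And>i. continuous_on UNIV (partial i \<rho>)"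
  using smooth_continuous smooth_partial \<rho>(1) by blast+
 note int = conv_integrable[OF h cont(1) \<rho>(2)] conv_integrable[OF h cont(2) supported_partial[OF \<rho>(2)]]
 show "\<exists>d>0. \<forall>y. norm (y - x) < d \<longrightarrow> norm (conv h \<rho> y - conv h \<rho> x
   - (\<chi> i. conv h (partial i \<rho>) x) \<bullet> (y - x)) \<le> e * norm (y - x)"
 proof (intro exI[of _ d] conjI allI impI)
  show "d > 0" by fact
  fix y assume y: "norm (y - x) < d"
  define v where "v = y - x"
  have v: "norm v < d" "y = x + v" using y by (auto simp: v_def)
  let ?r = "\<lambda>z. h z * (\<rho> (x - z + v) - \<rho> (x - z) - grad \<rho> (x - z) \<bullet> v)"
  have eq: "?r z = h z * \<rho> (y - z) - h z * \<rho> (x - z) - (\<Sum>i\<in>UNIV. h z * partial i \<rho> (x - z) * v $ i)" for z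
   unfolding v(2)
   by (simp add: grad_def inner_vec_def sum_distrib_left algebra_simps)
  have iS: "integrable lebesgue (\<lambda>z. \<Sum>i\<in>UNIV. h z * partial i \<rho> (x - z) * v $ i)"
   by (intro Bochner_Integration.integrable_sum integrable_mult_left int(2))
  have iD: "integrable lebesgue (\<lambda>z. h z * \<rho> (y - z) - h z * \<rho> (x - z))"
   by (intro Bochner_Integration.integrable_diff int(1))
  have intr: "integrable lebesgue ?r"
   unfolding eq by (rule Bochner_Integration.integrable_diff[OF iD iS])
  have "(\<integral>z. ?r z \<partial>lebesgue) = (\<integral>z. h z * \<rho> (y - z) - h z * \<rho> (x - z) \<partial>lebesgue)
    - (\<integral>z. (\<Sum>i\<in>UNIV. h z * partial i \<rho> (x - z) * v $ i) \<partial>lebesgue)"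
   unfolding eq by (rule Bochner_Integration.integral_diff[OF iD iS])
  also have "(\<integral>z. h z * \<rho> (y - z) - h z * \<rho> (x - z) \<partial>lebesgue) = conv h \<rho> y - conv h \<rho> x"
   unfolding conv_def by (rule Bochner_Integration.integral_diff[OF int(1) int(1)])
  also have "(\<integral>z. (\<Sum>i\<in>UNIV. h z * partial i \<rho> (x - z) * v $ i) \<partial>lebesgue)
    = (\<Sum>i\<in>UNIV. \<integral>z. h z * partial i \<rho> (x - z) * v $ i \<partial>lebesgue)"
   by (rule Bochner_Integration.integral_sum) (intro integrable_mult_left int(2))
  also have "\<dots> = (\<chi> i. conv h (partial i \<rho>) x) \<bullet> v"
   by (simp add: inner_vec_def conv_def)
  finally have "conv h \<rho> y - conv h \<rho> x - (\<chi> i. conv h (partial i \<rho>) x) \<bullet> v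
    = (\<integral>z. ?r z \<partial>lebesgue)" by simp
  then have "norm (conv h \<rho> y - conv h \<rho> x - (\<chi> i. conv h (partial i \<rho>) x) \<bullet> v)
    = norm (\<integral>z. ?r z \<partial>lebesgue)" by simp
  also have "\<dots> \<le> (\<integral>z. norm (?r z) \<partial>lebesgue)" by (rule integral_norm_bound)
  also have "\<dots> \<le> (\<integral>z. \<bar>h z\<bar> * (e / (N+1) * norm v) \<partial>lebesgue)"
  proof (rule integral_mono)
   show "integrable lebesgue (\<lambda>z. norm (?r z))" using intr by (rule integrable_norm)
   show "integrable lebesgue (\<lambda>z. \<bar>h z\<bar> * (e / (N+1) * norm v))" using h by simp
   show "norm (?r z) \<le> \<bar>h z\<bar> * (e / (N+1) * norm v)" for z
    using mult_left_mono[OF d(2)[OF v(1), of "x - z"], of "\<bar>h z\<bar>"] by (simp add: abs_mult)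
  qed
  also have "\<dots> = N * (e / (N+1) * norm v)" by (simp add: N_def)
  also have "\<dots> = N / (N+1) * (e * norm v)" by simp
  also have "\<dots> \<le> 1 * (e * norm v)"
   using N e by (intro mult_right_mono) auto
  also have "\<dots> = e * norm v" by simp
  finally show "norm (conv h \<rho> y - conv h \<rho> x
   - (\<chi> i. conv h (partial i \<rho>) x) \<bullet> (y - x)) \<le> e * norm (y - x)"
   by (simp add: v_def)
 qed
qed

lemma partial_conv:
 assumes "integrable lebesgue h" "smooth_on UNIV \<rho>" "supported_in_ball R \<rho>"
 shows "partial i (conv h \<rho>) = conv h (partial i \<rho>)"
 using partial_gradI(1)[OF conv_has_derivative[OF assms]] by auto

lemma smooth_conv:
 assumes h: "integrable lebesgue h" and "smooth_on UNIV \<rho>" "supported_in_ball R \<rho>"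
 shows "smooth_on UNIV (conv h \<rho>)"
proof (rule smooth_onI)
 show "Ck_on k UNIV (conv h \<rho>)" for k
  using assms(2,3)
 proof (induction k arbitrary: \<rho> R)
  case 0
  then have "conv h \<rho> differentiable (at x)" for x
   using conv_has_derivative[OF h] differentiable_def by blast
  then show ?case
   by (auto intro!: differentiable_imp_continuous_on simp: differentiable_on_def)
 next
  case (Suc k)
  have "conv h \<rho> differentiable (at x)" for x
   using conv_has_derivative[OF h] Suc.prems differentiable_def by blast
  then show ?case
   using Suc.IH[OF smooth_partial[OF Suc.prems(1)] supported_partial[OF Suc.prems(2)]]
    partial_conv[OF h Suc.prems] by simp
 qed
qed

lemma conv_diff:
 assumes "integrable lebesgue h" "integrable lebesgue h'" "continuous_on UNIV \<rho>" "supported_in_ball R \<rho>"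
 shows "conv (\<lambda>x. h x - h' x) \<rho> x = conv h \<rho> x - conv h' \<rho> x"
 unfolding conv_def left_diff_distrib
 by (rule Bochner_Integration.integral_diff) (use conv_integrable assms in blast)+

lemma conv_cong_AE:
 assumes "AE x in lebesgue. h x = h' x" "h \<in> borel_measurable lebesgue" "h' \<in> borel_measurable lebesgue"
  "continuous_on UNIV \<rho>"
 shows "conv h \<rho> x = conv h' \<rho> x"
proof -
 have "continuous_on UNIV (\<lambda>y. \<rho> (x - y))"
  by (rule continuous_on_compose2[OF assms(4)]) (auto intro: continuous_intros)
 then have m: "(\<lambda>y. \<rho> (x - y)) \<in> borel_measurable lebesgue"
  by (rule borel_measurable_lebesgue_continuous)
 show ?thesis unfolding conv_def
  by (rule integral_cong_AE) (use assms m in auto)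
qed

lemma nn_integral_lborel_shift:
 fixes f :: "real^'n::finite => ennreal"
 assumes "f \<in> borel_measurable borel"
 shows "(\<integral>\<^sup>+x. f (x + a) \<partial>lborel) = (\<integral>\<^sup>+x. f x \<partial>lborel)"
proof -
 have "(\<integral>\<^sup>+x. f x \<partial>lborel) = (\<integral>\<^sup>+x. f x \<partial>distr lborel borel ((+) a))"
  by (simp add: lborel_distr_plus)
 also have "\<dots> = (\<integral>\<^sup>+x. f (a + x) \<partial>lborel)"
  using assms by (subst nn_integral_distr) auto
 finally show ?thesis by (simp add: add.commute)
qed

lemma nn_integral_lborel_scale:
 fixes f :: "real^'n::finite => ennreal"
 assumes "f \<in> borel_measurable borel" "c > 0"
 shows "(\<integral>\<^sup>+x. f x \<partial>lborel) = ennreal (c ^ CARD('n)) * (\<integral>\<^sup>+x. f (c *\<^sub>R x) \<partial>lborel)"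
proof -
 have "(\<integral>\<^sup>+x. f x \<partial>lborel) =
   (\<integral>\<^sup>+x. f x \<partial>density (distr lborel borel (\<lambda>x. 0 + c *\<^sub>R x)) (\<lambda>_. \<bar>c\<bar>^DIM(real^'n)))"
  using lborel_affine[of c "0 :: real^'n"] assms(2) by simp
 also have "\<dots> = (\<integral>\<^sup>+x. ennreal (c ^ CARD('n)) * f (c *\<^sub>R x) \<partial>lborel)"
  using assms by (simp add: nn_integral_density nn_integral_distr)
 also have "\<dots> = ennreal (c ^ CARD('n)) * (\<integral>\<^sup>+x. f (c *\<^sub>R x) \<partial>lborel)"
  using assms by (intro nn_integral_cmult) auto
 finally show ?thesis .
qed

definition mollifier :: "real => real^'n::finite => real" where
 "mollifier e x = bump 0 ((1/e) *\<^sub>R x) / (\<integral>y. bump 0 ((1/e) *\<^sub>R y :: real^'n) \<partial>lebesgue)"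

lemma supported_integrable:
 assumes "continuous_on UNIV \<rho>" "supported_in_ball R \<rho>"
 shows "integrable lebesgue \<rho>" "integrable lborel \<rho>"
proof -
 obtain M where M: "M > 0" "\<And>x. \<bar>\<rho> x\<bar> \<le> M" using supported_bounded assms by metis
 have m: "\<rho> \<in> borel_measurable lborel"
  using borel_measurable_lebesgue_continuous(3)[OF assms(1)] .
 show *: "integrable lborel \<rho>"
 proof (rule Bochner_Integration.integrable_bound[OF _ m])
  show "integrable lborel (\<lambda>x. M * indicator (cball 0 R) x)"
   by (intro integrable_mult_right integrable_real_indicator emeasure_lborel_cball_finite) auto
  show "AE x in lborel. norm (\<rho> x) \<le> norm (M * indicator (cball 0 R) x)"
   using M assms(2) by (auto simp: indicator_def supported_in_ball_def)
 qed
 show "integrable lebesgue \<rho>" using * m by (simp add: integrable_completion)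
qed

context
 fixes e :: real
 assumes e: "e > 0"
begin

lemma supported_scaled:
 assumes "supported_in_ball R \<rho>"
 shows "supported_in_ball (e * R) (\<lambda>x. \<rho> ((1/e) *\<^sub>R x))"
 using assms e by (auto simp: supported_in_ball_def field_simps)

lemma smooth_scaled_bump: "smooth_on UNIV (\<lambda>x. bump 0 ((1/e) *\<^sub>R x :: real^'n::finite))"
 using smooth_affine[OF smooth_bump, of 0 0 "1/e"] by simp

lemma supported_scaled_bump: "supported_in_ball e (\<lambda>x. bump 0 ((1/e) *\<^sub>R x :: real^'n::finite))"
 using supported_scaled[of 1 "bump 0"] bump_eq_0 by (auto simp: supported_in_ball_def)

lemma integral_scaled_bump_pos: "0 < (\<integral>y. bump 0 ((1/e) *\<^sub>R y :: real^'n::finite) \<partial>lebesgue)"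
proof -
 have int: "integrable lebesgue (\<lambda>y. bump 0 ((1/e) *\<^sub>R y :: real^'n))"
  by (rule supported_integrable[OF smooth_continuous[OF smooth_scaled_bump] supported_scaled_bump])
 have "(\<integral>y. bump 0 ((1/e) *\<^sub>R y :: real^'n) \<partial>lebesgue) \<noteq> 0"
 proof
  assume "(\<integral>y. bump 0 ((1/e) *\<^sub>R y :: real^'n) \<partial>lebesgue) = 0"
  then have "AE y in lebesgue. bump 0 ((1/e) *\<^sub>R y :: real^'n) = 0"
   using integral_nonneg_eq_0_iff_AE[OF int] by (simp add: bump_nonneg)
  then have "AE y in lebesgue. y \<notin> ball (0 :: real^'n) e"
  proof eventually_elim
   case (elim y)
   show ?case
   proof
    assume "y \<in> ball 0 e"
    then have "norm ((1/e) *\<^sub>R y) < 1" using e by (simp add: field_simps)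
    then show False using bump_pos[of "(1/e) *\<^sub>R y" 0] elim by simp
   qed
  qed
  then have "ball (0 :: real^'n) e \<in> null_sets lebesgue"
   by (subst (asm) AE_iff_null_sets[symmetric]) auto
  then show False
   using open_not_negligible[of "ball (0 :: real^'n) e"] e by (simp add: negligible_iff_null_sets)
 qed
 moreover have "0 \<le> (\<integral>y. bump 0 ((1/e) *\<^sub>R y :: real^'n) \<partial>lebesgue)"
  by (rule Bochner_Integration.integral_nonneg) (simp add: bump_nonneg)
 ultimately show ?thesis by linarith
qed

lemma smooth_mollifier: "smooth_on UNIV (mollifier e :: real^'n::finite => real)"
 using smooth_mult[OF smooth_scaled_bump smooth_const] 
 unfolding mollifier_def divide_inverse by fastforce

lemma continuous_mollifier: "continuous_on UNIV (mollifier e :: real^'n::finite => real)"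
 by (rule smooth_continuous[OF smooth_mollifier])

lemma supported_mollifier: "supported_in_ball e (mollifier e :: real^'n::finite => real)"
 using supported_scaled_bump by (auto simp: supported_in_ball_def mollifier_def)

lemma mollifier_nonneg: "0 \<le> mollifier e (x :: real^'n::finite)"
 using integral_scaled_bump_pos[where 'n='n] by (simp add: mollifier_def bump_nonneg)

lemma mollifier_integral:
 "integrable lebesgue (mollifier e :: real^'n::finite => real)" "(\<integral>x. mollifier e (x :: real^'n) \<partial>lebesgue) = 1"
proof -
 show "integrable lebesgue (mollifier e :: real^'n::finite => real)"
  by (rule supported_integrable[OF continuous_mollifier supported_mollifier])
 show "(\<integral>x. mollifier e (x :: real^'n) \<partial>lebesgue) = 1"
  using integral_scaled_bump_pos[where 'n='n] by (simp add: mollifier_def)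
qed

lemma mollifier_nn_integral: "(\<integral>\<^sup>+x. ennreal (mollifier e (x + a :: real^'n::finite)) \<partial>lborel) = 1"
 "(\<integral>\<^sup>+y. ennreal (mollifier e (a - y :: real^'n::finite)) \<partial>lborel) = 1"
proof -
 have m: "(\<lambda>x. ennreal (mollifier e (x :: real^'n))) \<in> borel_measurable borel"
  by (rule measurable_compose[OF borel_measurable_lebesgue_continuous(2)[OF continuous_mollifier]
     measurable_ennreal])
 have 1: "(\<integral>\<^sup>+x. ennreal (mollifier e (x :: real^'n)) \<partial>lborel) = 1"
  using nn_integral_eq_integral[OF mollifier_integral(1)[where 'n='n] AE_I2[OF mollifier_nonneg]]
   mollifier_integral(2)[where 'n='n]
  by (simp add: nn_integral_completion)
 show 2: "(\<integral>\<^sup>+x. ennreal (mollifier e (x + a :: real^'n::finite)) \<partial>lborel) = 1" for a :: "real^'n"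
  using nn_integral_lborel_shift[OF m] 1 by simp
 have even: "mollifier e (- y) = mollifier e y" for y :: "real^'n"
  by (simp add: mollifier_def bump_def)
 show "(\<integral>\<^sup>+y. ennreal (mollifier e (a - y :: real^'n::finite)) \<partial>lborel) = 1"
  using 2[of "-a"] even[of "a - y" for y] by simp
qed

lemma mollifier_reflected_integral:
 "integrable lebesgue (\<lambda>y. mollifier e (a - y :: real^'n::finite))"
 "(\<integral>y. mollifier e (a - y :: real^'n::finite) \<partial>lebesgue) = 1"
proof -
 have "continuous_on UNIV (\<lambda>y. mollifier e (a - y :: real^'n))"
  by (rule continuous_on_compose2[OF continuous_mollifier]) (auto intro: continuous_intros)
 then have m: "(\<lambda>y. mollifier e (a - y :: real^'n)) \<in> borel_measurable lebesgue"
  by (rule borel_measurable_lebesgue_continuous)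
 have one: "(\<integral>\<^sup>+y. ennreal (mollifier e (a - y :: real^'n)) \<partial>lebesgue) = 1"
  using mollifier_nn_integral(2)[of a] by (simp add: nn_integral_completion)
 show i: "integrable lebesgue (\<lambda>y. mollifier e (a - y :: real^'n))"
  by (rule integrableI_nonneg[OF m AE_I2[OF mollifier_nonneg]]) (simp add: one)
 show "(\<integral>y. mollifier e (a - y :: real^'n) \<partial>lebesgue) = 1"
  using nn_integral_eq_integral[OF i AE_I2[OF mollifier_nonneg]] one
  by (metis ennreal_1 ennreal_inj mollifier_nonneg zero_le_one Bochner_Integration.integral_nonneg)
qed

end

lemma nn_integral_abs_partial_mollifier:
 obtains C where "C > 0"
  "\<And>e i. e > 0 ==> (\<integral>\<^sup>+x. ennreal \<bar>partial i (mollifier e) (x :: real^'n::finite)\<bar> \<partial>lborel) \<le> ennreal (C / e)"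
proof -
 let ?b = "bump 0 :: real^'n => real"
 let ?I = "\<integral>y. ?b y \<partial>lebesgue"
 let ?D = "\<lambda>i. \<integral>x. \<bar>partial i ?b x\<bar> \<partial>lebesgue"
 have sb: "supported_in_ball 1 ?b" using bump_eq_0 by (auto simp: supported_in_ball_def)
 have cb: "continuous_on UNIV ?b" by (rule smooth_continuous[OF smooth_bump])
 have cp: "continuous_on UNIV (partial i ?b)" for i by (intro smooth_continuous smooth_partial smooth_bump)
 have mb: "?b \<in> borel_measurable borel" "partial i ?b \<in> borel_measurable borel" for i
  using borel_measurable_lebesgue_continuous(2) cb cp by auto
 have I: "?I > 0" using integral_scaled_bump_pos[of 1, where 'n='n] by simp
 define C where "C = (\<Sum>i\<in>UNIV. ?D i) / ?I + 1"
 have D0: "?D i \<ge> 0" for i by simp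
 have S0: "0 \<le> (\<Sum>i\<in>UNIV. ?D i)" by (rule sum_nonneg) simp
 show ?thesis
 proof (rule that[of C])
  show "C > 0" using S0 I by (simp add: C_def add_nonneg_pos)
  fix e :: real and i assume e: "e > 0"
  let ?J = "\<integral>y. ?b ((1/e) *\<^sub>R y) \<partial>lebesgue"
  have J: "?J > 0" using integral_scaled_bump_pos[OF e] .
  have intJ: "integrable lebesgue (\<lambda>y. ?b ((1/e) *\<^sub>R y))"
   using supported_integrable(1)[OF smooth_continuous[OF smooth_scaled_bump[OF e]] supported_scaled_bump[OF e]] .
  have intI: "integrable lebesgue ?b" using supported_integrable(1)[OF cb sb] .
  have scale: "(\<integral>\<^sup>+x. f ((1/e) *\<^sub>R x) \<partial>lborel) = ennreal (e ^ CARD('n)) * (\<integral>\<^sup>+x. f x \<partial>lborel)"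
   if "f \<in> borel_measurable borel" for f :: "real^'n => ennreal"
  proof -
   have "(\<lambda>x. f ((1/e) *\<^sub>R x)) \<in> borel_measurable borel" using that by measurable
   from nn_integral_lborel_scale[OF this e] e show ?thesis by simp
  qed
  have "ennreal ?J = ennreal (e ^ CARD('n)) * ennreal ?I"
   using scale[of "\<lambda>x. ennreal (?b x)"] mb(1) nn_integral_eq_integral[OF intJ] nn_integral_eq_integral[OF intI]
   by (simp add: bump_nonneg nn_integral_completion)
  then have JI: "?J = e ^ CARD('n) * ?I"
   using J I e by (simp add: ennreal_mult[symmetric])
  have p: "partial i (mollifier e) x = (1/e) * partial i ?b ((1/e) *\<^sub>R x) / ?J" for x :: "real^'n"
  proof -
   have d: "?b differentiable (at y)" for y by (rule smooth_differentiable[OF smooth_bump])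
   have d1: "(\<lambda>x. ?b (0 + (1/e) *\<^sub>R x)) differentiable (at x)"
    by (rule smooth_differentiable[OF smooth_affine[OF smooth_bump]])
   have "partial i (mollifier e) x = partial i (\<lambda>x. inverse ?J * ?b (0 + (1/e) *\<^sub>R x)) x"
    by (simp add: mollifier_def[abs_def] divide_inverse mult.commute)
   also have "\<dots> = inverse ?J * partial i (\<lambda>x. ?b (0 + (1/e) *\<^sub>R x)) x"
    using partial_eqI[OF has_derivative_mult_right[OF has_derivative_grad[OF d1]]]
    by (simp add: inner_axis grad_def)
   also have "\<dots> = inverse ?J * ((1/e) * partial i ?b (0 + (1/e) *\<^sub>R x))"
    by (subst partial_affine[OF d]) simp
   finally show ?thesis by (simp add: field_simps)
  qed
  have intD: "integrable lebesgue (\<lambda>x. \<bar>partial i ?b x\<bar>)"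
   using supported_integrable(1)[OF cp supported_partial[OF sb]] by simp
  have "(\<integral>\<^sup>+x. ennreal \<bar>partial i (mollifier e) (x :: real^'n)\<bar> \<partial>lborel)
    = (\<integral>\<^sup>+x. ennreal (1 / (e * ?J)) * ennreal \<bar>partial i ?b ((1/e) *\<^sub>R x)\<bar> \<partial>lborel)"
   using e J by (auto intro!: nn_integral_cong simp: p ennreal_mult[symmetric] abs_mult)
  also have "\<dots> = ennreal (1 / (e * ?J)) * (\<integral>\<^sup>+x. ennreal \<bar>partial i ?b ((1/e) *\<^sub>R x)\<bar> \<partial>lborel)"
   using mb by (intro nn_integral_cmult) auto
  also have "(\<integral>\<^sup>+x. ennreal \<bar>partial i ?b ((1/e) *\<^sub>R x)\<bar> \<partial>lborel)
    = ennreal (e ^ CARD('n)) * (\<integral>\<^sup>+x. ennreal \<bar>partial i ?b x\<bar> \<partial>lborel)"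
   using scale[of "\<lambda>x. ennreal \<bar>partial i ?b x\<bar>"] mb by simp
  also have "(\<integral>\<^sup>+x. ennreal \<bar>partial i ?b x\<bar> \<partial>lborel) = ennreal (?D i)"
   using nn_integral_eq_integral[OF intD] by (simp add: nn_integral_completion)
  also have "ennreal (1 / (e * ?J)) * (ennreal (e ^ CARD('n)) * ennreal (?D i)) = ennreal (?D i / ?I / e)"
   using e J I D0[of i] by (simp add: ennreal_mult[symmetric] JI)
  also have "\<dots> \<le> ennreal (C / e)"
  proof -
   have "?D i \<le> (\<Sum>i\<in>UNIV. ?D i)" by (rule member_le_sum) auto
   then have "?D i / ?I \<le> C" using I unfolding C_def
    by (meson add_increasing2 divide_right_mono less_imp_le zero_le_one order_trans)
   then show ?thesis using e by (intro ennreal_leI divide_right_mono) auto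
  qed
  finally show "(\<integral>\<^sup>+x. ennreal \<bar>partial i (mollifier e) (x :: real^'n)\<bar> \<partial>lborel) \<le> ennreal (C / e)" .
 qed
qed

lemma powr_tangent:
 fixes a b p :: real
 assumes "0 \<le> a" "0 \<le> b" "1 \<le> p"
 shows "b powr p + p * b powr (p - 1) * (a - b) \<le> a powr p"
proof (cases "b = 0 \<or> a = 0")
 case True
 have "b powr p \<le> p * (b powr (p - 1) * b)"
  using assms powr_mult_base[of b "p-1"] mult_right_mono[of 1 p "b powr p"] by (simp add: mult.commute)
 then show ?thesis using True assms by (auto simp: algebra_simps)
next
 case False
 have "a powr p - b powr p \<ge> p * b powr (p - 1) * (a - b)"
 proof (rule convex_on_imp_above_tangent[OF powr_convex[OF assms(3)]])
  show "((\<lambda>x. x powr p) has_field_derivative p * b powr (p - 1)) (at b within {0<..})"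
   using False assms by (auto intro!: derivative_eq_intros)
 qed (use False assms in \<open>auto simp: interior_open\<close>)
 then show ?thesis by simp
qed

lemma lebesgue_borel_representative:
 fixes h :: "real^'n::finite => real"
 assumes "h \<in> borel_measurable lebesgue"
 obtains h' where "h' \<in> borel_measurable borel" "AE x in lborel. h x = h' x" "AE x in lebesgue. h x = h' x"
  "h' \<in> borel_measurable lebesgue"
proof -
 obtain h' where "h' \<in> borel_measurable lborel" "AE x in lborel. h x = h' x"
  using completion_ex_borel_measurable_real[OF assms] by auto
 then show ?thesis using that[of h'] by (auto simp: AE_completion measurable_completion)
qed

text \<open>Averaging against a probability density does not increase \<open>L\<^sup>p\<close> norms, by Jensen's inequality
 and Tonelli's theorem.\<close>

lemma nn_integral_conv_powr_le:
 fixes h :: "real^'n::finite => real"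
 assumes h: "integrable lebesgue h" and p: "1 \<le> p" and e: "0 < e"
 shows "(\<integral>\<^sup>+x. ennreal (\<bar>conv h (mollifier e) x\<bar> powr p) \<partial>lebesgue)
   \<le> (\<integral>\<^sup>+x. ennreal (\<bar>h x\<bar> powr p) \<partial>lebesgue)"
proof -
 let ?\<rho> = "mollifier e :: real^'n => real"
 obtain h' where h': "h' \<in> borel_measurable borel" "AE x in lborel. h x = h' x"
   "AE x in lebesgue. h x = h' x" "h' \<in> borel_measurable lebesgue"
  by (rule lebesgue_borel_representative[OF borel_measurable_integrable[OF h]])
 have inth': "integrable lebesgue h'"
  using h h' integrable_cong_AE[of h lebesgue h'] borel_measurable_integrable[OF h] by auto
 have eq: "conv h ?\<rho> x = conv h' ?\<rho> x" for x
  by (rule conv_cong_AE[OF h'(3) borel_measurable_integrable[OF h] h'(4) continuous_mollifier[OF e]])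
 have [measurable]: "?\<rho> \<in> borel_measurable borel" "h' \<in> borel_measurable borel"
  using borel_measurable_lebesgue_continuous(2)[OF continuous_mollifier[OF e]] h' by auto
 have pt: "ennreal (\<bar>conv h' ?\<rho> x\<bar> powr p) \<le> (\<integral>\<^sup>+y. ennreal (\<bar>h' y\<bar> powr p) * ennreal (?\<rho> (x - y)) \<partial>lborel)" for x
 proof (cases "(\<integral>\<^sup>+y. ennreal (\<bar>h' y\<bar> powr p) * ennreal (?\<rho> (x - y)) \<partial>lborel) = \<infinity>")
  case False
  let ?a = "\<lambda>y. \<bar>h' y\<bar> powr p * ?\<rho> (x - y)"
  have nn: "(\<integral>\<^sup>+y. ennreal (\<bar>h' y\<bar> powr p) * ennreal (?\<rho> (x - y)) \<partial>lborel) = (\<integral>\<^sup>+y. ennreal (?a y) \<partial>lborel)"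
   by (intro nn_integral_cong) (simp add: ennreal_mult mollifier_nonneg[OF e, where 'n='n])
  have inta: "integrable lborel ?a"
  proof (rule integrableI_bounded)
   show "(\<integral>\<^sup>+y. ennreal (norm (?a y)) \<partial>lborel) < \<infinity>"
    using False nn mollifier_nonneg[OF e, where 'n='n] by (simp add: abs_mult top.not_eq_extremum)
  qed measurable
  have intb: "integrable lborel (\<lambda>y. \<bar>h' y\<bar> * ?\<rho> (x - y))"
  proof -
   have "integrable lebesgue (\<lambda>y. \<bar>h' y\<bar> * ?\<rho> (x - y))"
    using conv_integrable[OF _ continuous_mollifier[OF e] supported_mollifier[OF e]] inth' by blast
   then show ?thesis by (subst (asm) integrable_completion) auto
  qed
  have int1: "integrable lborel (\<lambda>y. ?\<rho> (x - y))"
  proof (rule integrableI_bounded)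
   show "(\<integral>\<^sup>+y. ennreal (norm (?\<rho> (x - y))) \<partial>lborel) < \<infinity>"
    using mollifier_nn_integral(2)[OF e, of x] mollifier_nonneg[OF e, where 'n='n] by simp
  qed measurable
  have one: "(\<integral>y. ?\<rho> (x - y) \<partial>lborel) = 1"
   using mollifier_reflected_integral(2)[OF e, of x] by (simp add: integral_completion)
  define b where "b = (\<integral>y. \<bar>h' y\<bar> * ?\<rho> (x - y) \<partial>lborel)"
  have b0: "b \<ge> 0" unfolding b_def by (rule Bochner_Integration.integral_nonneg) (simp add: mollifier_nonneg[OF e, where 'n='n])
  have "conv h' ?\<rho> x = (\<integral>y. h' y * ?\<rho> (x - y) \<partial>lborel)"
   unfolding conv_def by (rule integral_completion) measurable
  also have "\<bar>\<dots>\<bar> \<le> (\<integral>y. \<bar>h' y * ?\<rho> (x - y)\<bar> \<partial>lborel)" by (rule integral_abs_bound)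
  finally have conv_le: "\<bar>conv h' ?\<rho> x\<bar> \<le> b"
   using mollifier_nonneg[OF e, where 'n='n] by (simp add: b_def abs_mult)
  let ?l = "\<lambda>y. (b powr p - p * b powr (p-1) * b) * ?\<rho> (x - y) + p * b powr (p-1) * (\<bar>h' y\<bar> * ?\<rho> (x - y))"
  have intl: "integrable lborel ?l" using intb int1 by simp
  have "b powr p = (\<integral>y. ?l y \<partial>lborel)" using intb int1 one by (simp add: b_def[symmetric])
  also have "\<dots> \<le> (\<integral>y. ?a y \<partial>lborel)"
  proof (rule integral_mono[OF intl inta])
   fix y
   have "b powr p + p * b powr (p - 1) * (\<bar>h' y\<bar> - b) \<le> \<bar>h' y\<bar> powr p"
    by (rule powr_tangent) (use b0 p in auto)
   from mult_right_mono[OF this mollifier_nonneg[OF e, of "x - y"]]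
   show "?l y \<le> ?a y" by (simp add: algebra_simps)
  qed
  finally have "\<bar>conv h' ?\<rho> x\<bar> powr p \<le> (\<integral>y. ?a y \<partial>lborel)"
   using powr_mono2[of p "\<bar>conv h' ?\<rho> x\<bar>" b] conv_le p by simp
  then show ?thesis
   unfolding nn using nn_integral_eq_integral[OF inta] mollifier_nonneg[OF e, where 'n='n] by (simp add: ennreal_leI)
 qed simp
 have "(\<integral>\<^sup>+x. ennreal (\<bar>conv h ?\<rho> x\<bar> powr p) \<partial>lebesgue) = (\<integral>\<^sup>+x. ennreal (\<bar>conv h' ?\<rho> x\<bar> powr p) \<partial>lborel)"
  by (simp add: eq nn_integral_completion)
 also have "\<dots> \<le> (\<integral>\<^sup>+x. (\<integral>\<^sup>+y. ennreal (\<bar>h' y\<bar> powr p) * ennreal (?\<rho> (x - y)) \<partial>lborel) \<partial>lborel)"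
  by (rule nn_integral_mono) (rule pt)
 also have "\<dots> = (\<integral>\<^sup>+y. (\<integral>\<^sup>+x. ennreal (\<bar>h' y\<bar> powr p) * ennreal (?\<rho> (x - y)) \<partial>lborel) \<partial>lborel)"
  by (rule lborel_pair.Fubini'[symmetric]) measurable
 also have "\<dots> = (\<integral>\<^sup>+y. ennreal (\<bar>h' y\<bar> powr p) * (\<integral>\<^sup>+x. ennreal (?\<rho> (x - y)) \<partial>lborel) \<partial>lborel)"
  by (intro nn_integral_cong nn_integral_cmult) measurable
 also have "\<dots> = (\<integral>\<^sup>+y. ennreal (\<bar>h' y\<bar> powr p) \<partial>lborel)"
  using mollifier_nn_integral(1)[OF e, where a="- y" and 'n='n for y] by simp
 also have "\<dots> = (\<integral>\<^sup>+y. ennreal (\<bar>h y\<bar> powr p) \<partial>lborel)"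
  by (rule nn_integral_cong_AE) (use h'(2) in auto)
 finally show ?thesis by (simp add: nn_integral_completion)
qed

lemma ennreal_tendsto_0_iff:
 fixes X :: "nat => ennreal"
 shows "X \<longlonglongrightarrow> 0 \<longleftrightarrow> (\<forall>\<eta>>0. \<forall>\<^sub>F k in sequentially. X k \<le> ennreal \<eta>)"
proof
 assume *: "X \<longlonglongrightarrow> 0"
 show "\<forall>\<eta>>0. \<forall>\<^sub>F k in sequentially. X k \<le> ennreal \<eta>"
 proof (intro allI impI)
  fix \<eta> :: real assume "\<eta> > 0"
  then have "\<forall>\<^sub>F k in sequentially. X k < ennreal \<eta>"
   using order_tendstoD(2)[OF *, of "ennreal \<eta>"] by simp
  then show "\<forall>\<^sub>F k in sequentially. X k \<le> ennreal \<eta>" by eventually_elim auto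
 qed
next
 assume *: "\<forall>\<eta>>0. \<forall>\<^sub>F k in sequentially. X k \<le> ennreal \<eta>"
 show "X \<longlonglongrightarrow> 0"
 proof (rule order_tendstoI)
  fix a :: ennreal assume "0 < a"
  then obtain b where b: "0 < b" "b < a" using dense by blast
  then have fin: "b < top" using top.not_eq_extremum by fastforce
  have "0 < enn2real b" using b fin by (simp add: enn2real_positive_iff)
  with * have "\<forall>\<^sub>F k in sequentially. X k \<le> ennreal (enn2real b)" by blast
  then show "\<forall>\<^sub>F k in sequentially. X k < a"
   by eventually_elim (use b fin in \<open>auto simp: ennreal_enn2real_if split: if_splits\<close>)
 qed simp
qed

lemma ennreal_tendsto_0_mono:
 fixes X Y :: "nat => ennreal"
 assumes "\<And>k. X k \<le> Y k" "Y \<longlonglongrightarrow> 0"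
 shows "X \<longlonglongrightarrow> 0"
 by (rule tendsto_sandwich[OF _ _ tendsto_const assms(2)]) (auto simp: assms(1))

lemma tendsto_0_subseq_criterion:
 fixes X :: "nat => ennreal"
 assumes "\<And>s :: nat => nat. strict_mono s ==> \<exists>r :: nat => nat. strict_mono r \<and> (\<lambda>k. X (s (r k))) \<longlonglongrightarrow> 0"
 shows "X \<longlonglongrightarrow> 0"
proof (rule ccontr)
 assume "\<not> X \<longlonglongrightarrow> 0"
 then obtain \<eta> where \<eta>: "\<eta> > 0" "\<not> (\<forall>\<^sub>F k in sequentially. X k \<le> ennreal \<eta>)"
  unfolding ennreal_tendsto_0_iff by auto
 then have "infinite {k. \<not> X k \<le> ennreal \<eta>}"
  by (simp add: cofinite_eq_sequentially[symmetric] eventually_cofinite)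
 then obtain s :: "nat => nat" where s: "strict_mono s" "\<And>n. s n \<in> {k. \<not> X k \<le> ennreal \<eta>}"
  using infinite_enumerate by blast
 from assms[OF s(1)] obtain r :: "nat => nat" where "strict_mono r" "(\<lambda>k. X (s (r k))) \<longlonglongrightarrow> 0" by blast
 then have "\<forall>\<^sub>F k in sequentially. X (s (r k)) \<le> ennreal \<eta>" using \<eta>(1) unfolding ennreal_tendsto_0_iff by blast
 then show False using s(2) by (auto simp: eventually_sequentially)
qed

declare of_nat_Suc [simp del]

abbreviation moll_seq :: "nat => real^'n::finite => real" where
 "moll_seq k \<equiv> mollifier (1 / real (Suc k))"

text \<open>A predicate, because it is established along the construction of integrable functions from open sets.\<close>

definition moll_L1 :: "(real^'n::finite => real) => bool" where
 "moll_L1 h \<longleftrightarrow> (\<lambda>k. \<integral>\<^sup>+x. ennreal \<bar>conv h (moll_seq k) x - h x\<bar> \<partial>lebesgue) \<longlonglongrightarrow> 0"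

lemma conv_measurable:
 assumes "integrable lebesgue h" "0 < e"
 shows "conv h (mollifier e) \<in> borel_measurable lebesgue" "continuous_on UNIV (conv h (mollifier e))"
proof -
 show "continuous_on UNIV (conv h (mollifier e))"
  by (rule smooth_continuous[OF smooth_conv[OF assms(1) smooth_mollifier[OF assms(2)] supported_mollifier[OF assms(2)]]])
 then show "conv h (mollifier e) \<in> borel_measurable lebesgue"
  by (rule borel_measurable_lebesgue_continuous)
qed

lemma moll_L1_closed:
 fixes h :: "real^'n::finite => real"
 assumes h: "integrable lebesgue h"
  and ex: "\<And>\<eta>. \<eta> > 0 ==> \<exists>h'. integrable lebesgue h' \<and> moll_L1 h' \<and>
    (\<integral>\<^sup>+x. ennreal \<bar>h x - h' x\<bar> \<partial>lebesgue) \<le> ennreal \<eta>"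
 shows "moll_L1 h"
 unfolding moll_L1_def ennreal_tendsto_0_iff
proof (intro allI impI)
 fix \<eta> :: real assume "\<eta> > 0"
 then have "\<eta> / 3 > 0" by simp
 from ex[OF this] obtain h' where h': "integrable lebesgue h'" "moll_L1 h'"
  "(\<integral>\<^sup>+x. ennreal \<bar>h x - h' x\<bar> \<partial>lebesgue) \<le> ennreal (\<eta>/3)" by blast
 note [measurable] = borel_measurable_integrable[OF h] borel_measurable_integrable[OF h'(1)]
 have "\<forall>\<^sub>F k in sequentially. (\<integral>\<^sup>+x. ennreal \<bar>conv h' (moll_seq k) x - h' x\<bar> \<partial>lebesgue) \<le> ennreal (\<eta>/3)"
  using h'(2) \<open>\<eta> / 3 > 0\<close> unfolding moll_L1_def ennreal_tendsto_0_iff by blast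
 then show "\<forall>\<^sub>F k in sequentially. (\<integral>\<^sup>+x. ennreal \<bar>conv h (moll_seq k) x - h x\<bar> \<partial>lebesgue) \<le> ennreal \<eta>"
 proof eventually_elim
  case (elim k)
  let ?\<rho> = "moll_seq k :: real^'n => real"
  have e: "1 / real (Suc k) > 0" by simp
  note [measurable] = conv_measurable(1)[OF h e] conv_measurable(1)[OF h'(1) e]
   conv_measurable(1)[OF Bochner_Integration.integrable_diff[OF h h'(1)] e]
  have "ennreal \<bar>conv h ?\<rho> x - h x\<bar> \<le> ennreal \<bar>conv (\<lambda>x. h x - h' x) ?\<rho> x\<bar>
    + (ennreal \<bar>conv h' ?\<rho> x - h' x\<bar> + ennreal \<bar>h x - h' x\<bar>)" for x
   by (subst conv_diff[OF h h'(1) continuous_mollifier[OF e] supported_mollifier[OF e]])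
    (auto simp: ennreal_plus[symmetric] simp del: ennreal_plus intro!: ennreal_leI)
  then have "(\<integral>\<^sup>+x. ennreal \<bar>conv h ?\<rho> x - h x\<bar> \<partial>lebesgue) \<le> (\<integral>\<^sup>+x. ennreal \<bar>conv (\<lambda>x. h x - h' x) ?\<rho> x\<bar>
    + (ennreal \<bar>conv h' ?\<rho> x - h' x\<bar> + ennreal \<bar>h x - h' x\<bar>) \<partial>lebesgue)"
   by (rule nn_integral_mono)
  also have "\<dots> = (\<integral>\<^sup>+x. ennreal \<bar>conv (\<lambda>x. h x - h' x) ?\<rho> x\<bar> \<partial>lebesgue)
    + ((\<integral>\<^sup>+x. ennreal \<bar>conv h' ?\<rho> x - h' x\<bar> \<partial>lebesgue) + (\<integral>\<^sup>+x. ennreal \<bar>h x - h' x\<bar> \<partial>lebesgue))"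
   by (subst nn_integral_add; (subst nn_integral_add)?) auto
  also have "\<dots> \<le> ennreal (\<eta>/3) + (ennreal (\<eta>/3) + ennreal (\<eta>/3))"
   using nn_integral_conv_powr_le[OF Bochner_Integration.integrable_diff[OF h h'(1)] order_refl e] h'(3) elim
   by (intro add_mono) auto
  also have "\<dots> = ennreal \<eta>" using \<open>\<eta> > 0\<close> by (simp add: ennreal_plus[symmetric] del: ennreal_plus)
  finally show ?case .
 qed
qed

text \<open>For the indicator of an open set the mollified functions converge pointwise on the set from below,
 and their total mass is at most that of the set; hence nothing is lost outside.\<close>

lemma moll_L1_open:
 fixes U :: "(real^'n::finite) set"
 assumes U: "open U" "emeasure lborel U < \<infinity>"
 shows "moll_L1 (indicator U)"
proof -
 let ?g = "\<lambda>k. conv (indicator U) (moll_seq k)"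
 let ?u = "indicator U :: real^'n => real"
 have intU: "integrable lebesgue ?u" using U by (simp add: integrable_completion)
 have e: "1 / real (Suc k) > 0" for k by simp
 have [measurable]: "?u \<in> borel_measurable lebesgue" using intU by auto
 note [measurable] = conv_measurable(1)[OF intU e]
 have conv01: "0 \<le> ?g k x \<and> ?g k x \<le> 1" for k x
 proof
  show "0 \<le> ?g k x" unfolding conv_def by (rule Bochner_Integration.integral_nonneg) (simp add: mollifier_nonneg[OF e, where 'n='n])
  have "?g k x \<le> (\<integral>y. moll_seq k (x - y) \<partial>lebesgue)" unfolding conv_def
   by (rule integral_mono[OF conv_integrable[OF intU continuous_mollifier[OF e] supported_mollifier[OF e]]
      mollifier_reflected_integral(1)[OF e]])
    (use mollifier_nonneg[OF e, where 'n='n] in \<open>auto simp: indicator_def\<close>)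
  then show "?g k x \<le> 1" using mollifier_reflected_integral(2)[OF e, of k x] by simp
 qed
 have inside: "\<forall>\<^sub>F k in sequentially. ?g k x = 1" if xU: "x \<in> U" for x
 proof -
  obtain r where r: "r > 0" "ball x r \<subseteq> U" by (rule openE[OF U(1) xU])
  obtain N where N: "1 / real (Suc N) < r" by (rule nat_approx_posE[OF r(1)])
  have "?g k x = 1" if "k \<ge> N" for k
  proof -
   have k: "1 / real (Suc k) \<le> r" using that N frac_le[of 1 1 "real (Suc N)" "real (Suc k)"] by simp
   have "indicator U y * moll_seq k (x - y) = (moll_seq k (x - y) :: real)" for y
   proof (cases "y \<in> U")
    case False
    then have "1 / real (Suc k) \<le> norm (x - y)" using r k by (force simp: dist_norm)
    then show ?thesis using supported_mollifier[OF e, of k, where 'n='n] by (simp add: supported_in_ball_def)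
   qed simp
   then have "?g k x = (\<integral>y. moll_seq k (x - y) \<partial>lebesgue)" unfolding conv_def
    by (rule Bochner_Integration.integral_cong[OF refl])
   also have "\<dots> = 1" by (rule mollifier_reflected_integral(2)[OF e])
   finally show ?thesis .
  qed
  then show ?thesis by (auto simp: eventually_sequentially)
 qed
 let ?d = "\<lambda>k x. ennreal (max 0 (?u x - ?g k x))"
 have "(\<lambda>k. \<integral>\<^sup>+x. ?d k x \<partial>lebesgue) \<longlonglongrightarrow> (\<integral>\<^sup>+x. 0 \<partial>(lebesgue :: (real^'n) measure))"
 proof (rule nn_integral_dominated_convergence[where w="\<lambda>x. ennreal (?u x)"])
  show "AE x in lebesgue. ?d j x \<le> ennreal (?u x)" for j
   using conv01 by (intro AE_I2 ennreal_leI) (auto simp: indicator_def)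
  show "(\<integral>\<^sup>+x. ennreal (?u x) \<partial>lebesgue) < \<infinity>"
   using U by (simp add: nn_integral_completion ennreal_indicator)
  show "AE x in lebesgue. (\<lambda>i. ?d i x) \<longlonglongrightarrow> 0"
  proof (rule AE_I2)
   fix x
   have "\<forall>\<^sub>F k in sequentially. ?d k x = 0"
   proof (cases "x \<in> U")
    case True
    from inside[OF this] show ?thesis by eventually_elim (use True in simp)
   next
    case False
    then show ?thesis using conv01 by simp
   qed
   then show "(\<lambda>i. ?d i x) \<longlonglongrightarrow> 0" by (rule tendsto_eventually)
  qed
 qed auto
 then have d0: "(\<lambda>k. 2 * (\<integral>\<^sup>+x. ?d k x \<partial>lebesgue)) \<longlonglongrightarrow> 0"
  using ennreal_tendsto_cmult[of 2 "\<lambda>k. \<integral>\<^sup>+x. ?d k x \<partial>lebesgue" 0] by simp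
 have fin: "(\<integral>\<^sup>+x. ennreal (?u x) \<partial>lebesgue) < \<infinity>"
  using U by (simp add: nn_integral_completion ennreal_indicator)
 have "(\<integral>\<^sup>+x. ennreal \<bar>?g k x - ?u x\<bar> \<partial>lebesgue) \<le> 2 * (\<integral>\<^sup>+x. ?d k x \<partial>lebesgue)" for k
 proof -
  have "(\<integral>\<^sup>+x. ennreal \<bar>?g k x - ?u x\<bar> \<partial>lebesgue) + (\<integral>\<^sup>+x. ennreal (?u x) \<partial>lebesgue)
    = (\<integral>\<^sup>+x. ennreal (\<bar>?g k x - ?u x\<bar> + ?u x) \<partial>lebesgue)"
   by (subst nn_integral_add[symmetric]) (auto simp: ennreal_plus)
  also have "\<dots> = (\<integral>\<^sup>+x. ennreal (?g k x) + 2 * ?d k x \<partial>lebesgue)"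
  proof (rule nn_integral_cong)
   fix x
   have "ennreal (?g k x) + 2 * ?d k x = ennreal (?g k x + 2 * max 0 (?u x - ?g k x))"
    using conv01 by (simp add: ennreal_plus ennreal_mult)
   also have "?g k x + 2 * max 0 (?u x - ?g k x) = \<bar>?g k x - ?u x\<bar> + ?u x"
    by (simp add: max_def abs_if)
   finally show "ennreal (\<bar>?g k x - ?u x\<bar> + ?u x) = ennreal (?g k x) + 2 * ?d k x" by simp
  qed
  also have "\<dots> = (\<integral>\<^sup>+x. ennreal (?g k x) \<partial>lebesgue) + 2 * (\<integral>\<^sup>+x. ?d k x \<partial>lebesgue)"
   by (subst nn_integral_add) (auto simp: nn_integral_cmult)
  also have "\<dots> \<le> (\<integral>\<^sup>+x. ennreal (?u x) \<partial>lebesgue) + 2 * (\<integral>\<^sup>+x. ?d k x \<partial>lebesgue)"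
   using nn_integral_conv_powr_le[OF intU order_refl e, of k] conv01
   by (intro add_mono order_refl) simp
  finally show ?thesis using fin by (simp add: add.commute ennreal_add_left_cancel_le less_top[symmetric])
 qed
 then show ?thesis unfolding moll_L1_def
  using d0 by (rule ennreal_tendsto_0_mono)
qed

lemma moll_L1_indicator:
 fixes A :: "(real^'n::finite) set"
 assumes A: "A \<in> sets borel" "emeasure lborel A < \<infinity>"
 shows "moll_L1 (indicator A)"
proof (rule moll_L1_closed)
 show "integrable lebesgue (indicator A :: _ => real)"
  using A by (simp add: integrable_completion)
 fix \<eta> :: real assume \<eta>: "\<eta> > 0"
 obtain U where U: "open U" "A \<subseteq> U" "emeasure lborel (U - A) < \<eta>"
  by (rule outer_regular_lborel[OF A(1) \<eta>])
 have [measurable]: "U \<in> sets borel" "A \<in> sets borel" using U(1) A(1) by auto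
 have "emeasure lborel U = emeasure lborel (A \<union> (U - A))" using U(2) by (simp add: Un_absorb1)
 also have "\<dots> \<le> emeasure lborel A + emeasure lborel (U - A)"
  by (rule emeasure_subadditive) auto
 also have "\<dots> < \<infinity>" using A(2) U(3) by (auto simp: less_top[symmetric] ennreal_add_eq_top)
 finally have finU: "emeasure lborel U < \<infinity>" .
 have "(\<integral>\<^sup>+x. ennreal \<bar>indicator A x - indicator U x\<bar> \<partial>lebesgue) = (\<integral>\<^sup>+x. indicator (U - A) x \<partial>lborel)"
  unfolding nn_integral_completion using U(2) by (intro nn_integral_cong) (auto simp: indicator_def)
 also have "\<dots> \<le> ennreal \<eta>" using U(3) by (simp add: less_imp_le)
 finally show "\<exists>h'. integrable lebesgue h' \<and> moll_L1 h' \<and>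
   (\<integral>\<^sup>+x. ennreal \<bar>indicator A x - h' x\<bar> \<partial>lebesgue) \<le> ennreal \<eta>"
  using moll_L1_open[OF U(1) finU] finU
  by (intro exI[of _ "indicator U"]) (auto simp: integrable_completion)
qed

lemma moll_L1_cmult:
 assumes h: "integrable lebesgue h" "moll_L1 h"
 shows "moll_L1 (\<lambda>x. h x * c)"
proof -
 have e: "1 / real (Suc k) > 0" for k by simp
 note [measurable] = borel_measurable_integrable[OF h(1)] conv_measurable(1)[OF h(1) e]
 have "(\<integral>\<^sup>+x. ennreal \<bar>conv (\<lambda>x. h x * c) (moll_seq k) x - h x * c\<bar> \<partial>lebesgue)
   = ennreal \<bar>c\<bar> * (\<integral>\<^sup>+x. ennreal \<bar>conv h (moll_seq k) x - h x\<bar> \<partial>lebesgue)" for k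
 proof (subst nn_integral_cmult[symmetric])
  have "conv (\<lambda>x. h x * c) (moll_seq k) x = conv h (moll_seq k) x * c" for x
   unfolding conv_def by (subst integral_mult_left_zero[symmetric]) (simp add: mult_ac)
  then show "(\<integral>\<^sup>+x. ennreal \<bar>conv (\<lambda>x. h x * c) (moll_seq k) x - h x * c\<bar> \<partial>lebesgue)
    = (\<integral>\<^sup>+x. ennreal \<bar>c\<bar> * ennreal \<bar>conv h (moll_seq k) x - h x\<bar> \<partial>lebesgue)"
   by (intro nn_integral_cong) (simp add: ennreal_mult[symmetric] abs_mult[symmetric] algebra_simps)
 qed measurable
 then show ?thesis using h(2) unfolding moll_L1_def
  using ennreal_tendsto_cmult[of "ennreal \<bar>c\<bar>" _ 0] by simp
qed

lemma moll_L1_add: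
 assumes h: "integrable lebesgue h" "moll_L1 h" and g: "integrable lebesgue g" "moll_L1 g"
 shows "moll_L1 (\<lambda>x. h x + g x)"
proof -
 have e: "1 / real (Suc k) > 0" for k by simp
 note [measurable] = borel_measurable_integrable[OF h(1)] conv_measurable(1)[OF h(1) e]
  borel_measurable_integrable[OF g(1)] conv_measurable(1)[OF g(1) e]
 have "(\<integral>\<^sup>+x. ennreal \<bar>conv (\<lambda>x. h x + g x) (moll_seq k) x - (h x + g x)\<bar> \<partial>lebesgue)
   \<le> (\<integral>\<^sup>+x. ennreal \<bar>conv h (moll_seq k) x - h x\<bar> \<partial>lebesgue)
    + (\<integral>\<^sup>+x. ennreal \<bar>conv g (moll_seq k) x - g x\<bar> \<partial>lebesgue)" for k
 proof -
  have "conv (\<lambda>x. h x + g x) (moll_seq k) x = conv h (moll_seq k) x + conv g (moll_seq k) x" for x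
   unfolding conv_def distrib_right
   by (rule Bochner_Integration.integral_add)
    (intro conv_integrable[OF h(1) continuous_mollifier[OF e] supported_mollifier[OF e]]
     conv_integrable[OF g(1) continuous_mollifier[OF e] supported_mollifier[OF e]])+
  then have "ennreal \<bar>conv (\<lambda>x. h x + g x) (moll_seq k) x - (h x + g x)\<bar>
    \<le> ennreal \<bar>conv h (moll_seq k) x - h x\<bar> + ennreal \<bar>conv g (moll_seq k) x - g x\<bar>" for x
   by (auto simp: ennreal_plus[symmetric] simp del: ennreal_plus intro!: ennreal_leI)
  then have "(\<integral>\<^sup>+x. ennreal \<bar>conv (\<lambda>x. h x + g x) (moll_seq k) x - (h x + g x)\<bar> \<partial>lebesgue)
    \<le> (\<integral>\<^sup>+x. ennreal \<bar>conv h (moll_seq k) x - h x\<bar> + ennreal \<bar>conv g (moll_seq k) x - g x\<bar> \<partial>lebesgue)"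
   by (rule nn_integral_mono)
  also have "\<dots> = (\<integral>\<^sup>+x. ennreal \<bar>conv h (moll_seq k) x - h x\<bar> \<partial>lebesgue)
    + (\<integral>\<^sup>+x. ennreal \<bar>conv g (moll_seq k) x - g x\<bar> \<partial>lebesgue)"
   by (rule nn_integral_add) measurable
  finally show ?thesis .
 qed
 moreover have "(\<lambda>k. (\<integral>\<^sup>+x. ennreal \<bar>conv h (moll_seq k) x - h x\<bar> \<partial>lebesgue)
    + (\<integral>\<^sup>+x. ennreal \<bar>conv g (moll_seq k) x - g x\<bar> \<partial>lebesgue)) \<longlonglongrightarrow> 0"
  using tendsto_add[OF h(2)[unfolded moll_L1_def] g(2)[unfolded moll_L1_def]] by simp
 ultimately show ?thesis unfolding moll_L1_def
  by (rule ennreal_tendsto_0_mono)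
qed

lemma moll_L1_integrable:
 fixes h :: "real^'n::finite => real"
 assumes "integrable lebesgue h"
 shows "moll_L1 h"
proof -
 have lborel: "moll_L1 f" if "integrable lborel f" for f :: "real^'n => real"
  using that
 proof (induction rule: integrable_induct)
  case (base A c)
  have "integrable lebesgue (indicator A :: _ => real)"
   using base by (simp add: integrable_completion)
  from moll_L1_cmult[OF this moll_L1_indicator[of A], of c] base show ?case by simp
 next
  case (add f g)
  then show ?case by (intro moll_L1_add) (auto simp: integrable_completion)
 next
  case (lim f s)
  note [measurable] = borel_measurable_integrable[OF lim(1)] borel_measurable_integrable[OF lim(4)]
  have "(\<lambda>i. \<integral>\<^sup>+x. ennreal (norm (f x - s i x)) \<partial>lborel) \<longlonglongrightarrow> 0"
  proof (rule nn_integral_dominated_convergence_norm[where w="\<lambda>x. 2 * norm (f x)"])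
   show "(\<integral>\<^sup>+x. ennreal (2 * norm (f x)) \<partial>lborel) < \<infinity>"
    using lim(4) by (simp add: integrable_iff_bounded ennreal_mult nn_integral_cmult ennreal_mult_less_top)
  qed (use lim in auto)
  then have *: "\<forall>\<eta>>0. \<forall>\<^sub>F i in sequentially. (\<integral>\<^sup>+x. ennreal (norm (f x - s i x)) \<partial>lborel) \<le> ennreal \<eta>"
   unfolding ennreal_tendsto_0_iff .
  show ?case
  proof (rule moll_L1_closed)
   show "integrable lebesgue f" using lim(4) by (simp add: integrable_completion)
   fix \<eta> :: real assume "\<eta> > 0"
   with * obtain i where "(\<integral>\<^sup>+x. ennreal (norm (f x - s i x)) \<partial>lborel) \<le> ennreal \<eta>"
    by (auto simp: eventually_sequentially)
   then show "\<exists>h'. integrable lebesgue h' \<and> moll_L1 h' \<and>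
     (\<integral>\<^sup>+x. ennreal \<bar>f x - h' x\<bar> \<partial>lebesgue) \<le> ennreal \<eta>"
    using lim(1,5)[of i] by (intro exI[of _ "s i"]) (simp add: integrable_completion nn_integral_completion)
  qed
 qed
 obtain h' where h': "h' \<in> borel_measurable borel" "AE x in lborel. h x = h' x"
   "AE x in lebesgue. h x = h' x" "h' \<in> borel_measurable lebesgue"
  by (rule lebesgue_borel_representative[OF borel_measurable_integrable[OF assms]])
 have inth': "integrable lebesgue h'"
  using assms h' integrable_cong_AE[of h lebesgue h'] borel_measurable_integrable[OF assms] by auto
 have "(\<integral>\<^sup>+x. ennreal \<bar>h x - h' x\<bar> \<partial>lebesgue) = 0"
  using h' borel_measurable_integrable[OF assms] by (subst nn_integral_0_iff_AE) auto
 then show ?thesis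
  using inth' h'(1) lborel[of h'] assms
  by (intro moll_L1_closed) (auto simp: integrable_completion intro!: exI[of _ h'])
qed

lemma norm_add_powr_le:
 fixes a b :: "'b::real_normed_vector"
 assumes "0 \<le> p"
 shows "norm (a + b) powr p \<le> 2 powr p * (norm a powr p + norm b powr p)"
proof -
 let ?m = "max (norm a) (norm b)"
 have "norm (a + b) \<le> 2 * ?m" using norm_triangle_ineq[of a b] by linarith
 then have "norm (a + b) powr p \<le> (2 * ?m) powr p" using assms by (intro powr_mono2) auto
 also have "\<dots> = 2 powr p * ?m powr p" by (simp add: powr_mult)
 also have "?m powr p \<le> norm a powr p + norm b powr p" by (auto simp: max_def)
 finally show ?thesis by simp
qed

lemma norm_diff_powr_le:
 fixes a b :: "'b::real_normed_vector"
 assumes "0 \<le> p"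
 shows "norm (a - b) powr p \<le> 2 powr p * (norm a powr p + norm b powr p)"
 using norm_add_powr_le[OF assms, of a "- b"] by simp

text \<open>Almost everywhere convergence together with non-increase of the \<open>L\<^sup>p\<close> norms gives strong
 convergence: Fatou's lemma applies to the nonnegative functions
 \<open>2\<^sup>p (|f\<^sub>k|\<^sup>p + |g|\<^sup>p) - |f\<^sub>k - g|\<^sup>p\<close>.\<close>

lemma tendsto_Lp_if_AE_and_norms_le:
 fixes f :: "nat => 'a => real"
 assumes [measurable]: "\<And>k. f k \<in> borel_measurable M" "g \<in> borel_measurable M"
  and ae: "AE x in M. (\<lambda>k. f k x) \<longlonglongrightarrow> g x" and p: "1 \<le> p"
  and le: "\<And>k. (\<integral>\<^sup>+x. ennreal (\<bar>f k x\<bar> powr p) \<partial>M) \<le> (\<integral>\<^sup>+x. ennreal (\<bar>g x\<bar> powr p) \<partial>M)"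
  and fin: "(\<integral>\<^sup>+x. ennreal (\<bar>g x\<bar> powr p) \<partial>M) < \<infinity>"
 shows "(\<lambda>k. \<integral>\<^sup>+x. ennreal (\<bar>f k x - g x\<bar> powr p) \<partial>M) \<longlonglongrightarrow> 0"
proof -
 define A where "A = enn2real (\<integral>\<^sup>+x. ennreal (\<bar>g x\<bar> powr p) \<partial>M)"
 have A: "(\<integral>\<^sup>+x. ennreal (\<bar>g x\<bar> powr p) \<partial>M) = ennreal A" "0 \<le> A"
  using fin by (simp_all add: A_def less_top)
 define c where "c = 2 powr p * (A + A)"
 have c0: "c \<ge> 0" using A by (simp add: c_def)
 let ?\<phi> = "\<lambda>k x. 2 powr p * (\<bar>f k x\<bar> powr p + \<bar>g x\<bar> powr p) - \<bar>f k x - g x\<bar> powr p"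
 have \<phi>0: "?\<phi> k x \<ge> 0" for k x using norm_diff_powr_le[of p "f k x" "g x"] p by simp
 have sum: "(\<integral>\<^sup>+x. ennreal (?\<phi> k x) \<partial>M) + (\<integral>\<^sup>+x. ennreal (\<bar>f k x - g x\<bar> powr p) \<partial>M) \<le> ennreal c" for k
 proof -
  have "(\<integral>\<^sup>+x. ennreal (?\<phi> k x) \<partial>M) + (\<integral>\<^sup>+x. ennreal (\<bar>f k x - g x\<bar> powr p) \<partial>M)
    = (\<integral>\<^sup>+x. ennreal (?\<phi> k x) + ennreal (\<bar>f k x - g x\<bar> powr p) \<partial>M)"
   by (rule nn_integral_add[symmetric]) measurable
  also have "\<dots> = (\<integral>\<^sup>+x. ennreal (2 powr p) * (ennreal (\<bar>f k x\<bar> powr p) + ennreal (\<bar>g x\<bar> powr p)) \<partial>M)"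
   by (intro nn_integral_cong, subst ennreal_plus[symmetric])
    (use \<phi>0 in \<open>auto simp: ennreal_plus[symmetric] ennreal_mult[symmetric] simp del: ennreal_plus\<close>)
  also have "\<dots> = ennreal (2 powr p) * ((\<integral>\<^sup>+x. ennreal (\<bar>f k x\<bar> powr p) \<partial>M) + (\<integral>\<^sup>+x. ennreal (\<bar>g x\<bar> powr p) \<partial>M))"
   by (subst nn_integral_cmult, measurable, subst nn_integral_add) measurable
  also have "\<dots> \<le> ennreal (2 powr p) * (ennreal A + ennreal A)"
   using le[of k] unfolding A(1) by (intro mult_left_mono add_mono) auto
  also have "\<dots> = ennreal c"
   unfolding c_def using A(2) by (simp add: ennreal_plus[symmetric] ennreal_mult[symmetric] del: ennreal_plus)
  finally show ?thesis .
 qed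
 have fatou: "ennreal c \<le> liminf (\<lambda>k. \<integral>\<^sup>+x. ennreal (?\<phi> k x) \<partial>M)"
 proof -
  have "ennreal c = (\<integral>\<^sup>+x. ennreal (2 powr p) * (ennreal (\<bar>g x\<bar> powr p) + ennreal (\<bar>g x\<bar> powr p)) \<partial>M)"
   by (subst nn_integral_cmult, measurable, subst nn_integral_add)
    (use A in \<open>auto simp: c_def ennreal_plus[symmetric] ennreal_mult[symmetric] simp del: ennreal_plus\<close>)
  also have "\<dots> = (\<integral>\<^sup>+x. liminf (\<lambda>k. ennreal (?\<phi> k x)) \<partial>M)"
  proof (rule nn_integral_cong_AE, use ae in eventually_elim)
   case (elim x)
   have "(\<lambda>k. ?\<phi> k x) \<longlonglongrightarrow> 2 powr p * (\<bar>g x\<bar> powr p + \<bar>g x\<bar> powr p) - \<bar>g x - g x\<bar> powr p"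
    using elim p by (intro tendsto_intros tendsto_powr') auto
   then have "(\<lambda>k. ennreal (?\<phi> k x)) \<longlonglongrightarrow> ennreal (2 powr p * (\<bar>g x\<bar> powr p + \<bar>g x\<bar> powr p))"
    by (intro tendsto_ennrealI) simp
   then have "liminf (\<lambda>k. ennreal (?\<phi> k x)) = ennreal (2 powr p * (\<bar>g x\<bar> powr p + \<bar>g x\<bar> powr p))"
    by (rule lim_imp_Liminf[OF sequentially_bot])
   then show ?case by (simp add: ennreal_plus[symmetric] ennreal_mult[symmetric] del: ennreal_plus)
  qed
  also have "\<dots> \<le> liminf (\<lambda>k. \<integral>\<^sup>+x. ennreal (?\<phi> k x) \<partial>M)"
   by (rule nn_integral_liminf) measurable
  finally show ?thesis .
 qed
 show ?thesis unfolding ennreal_tendsto_0_iff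
 proof (intro allI impI)
  fix \<eta> :: real assume \<eta>: "\<eta> > 0"
  show "\<forall>\<^sub>F k in sequentially. (\<integral>\<^sup>+x. ennreal (\<bar>f k x - g x\<bar> powr p) \<partial>M) \<le> ennreal \<eta>"
  proof (cases "c \<le> \<eta>")
   case True
   then show ?thesis
    using order_trans[OF order_trans[OF add_increasing sum] ennreal_leI] by (intro always_eventually) auto
  next
   case False
   then have "ennreal (c - \<eta>) < ennreal c" using \<eta> by (intro ennreal_lessI) auto
   then have "ennreal (c - \<eta>) < liminf (\<lambda>k. \<integral>\<^sup>+x. ennreal (?\<phi> k x) \<partial>M)" using fatou by order
   from less_LiminfD[OF this] show ?thesis
   proof eventually_elim
    case (elim k)
    have "ennreal (c - \<eta>) + (\<integral>\<^sup>+x. ennreal (\<bar>f k x - g x\<bar> powr p) \<partial>M) \<le> ennreal c"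
     using order_trans[OF add_right_mono[OF less_imp_le[OF elim]] sum] .
    also have "\<dots> = ennreal (c - \<eta>) + ennreal \<eta>"
     using False \<eta> by (simp add: ennreal_plus[symmetric] del: ennreal_plus)
    finally show ?case by (simp add: ennreal_add_left_cancel_le)
   qed
  qed
 qed
qed

text \<open>Every subsequence has a further one along which the mollifications converge almost everywhere, and
 mollification does not increase the norm.\<close>

lemma mollify_tendsto_Lp:
 fixes h :: "real^'n::finite => real"
 assumes h: "integrable lebesgue h" and p: "1 \<le> p"
  and hp: "(\<integral>\<^sup>+x. ennreal (\<bar>h x\<bar> powr p) \<partial>lebesgue) < \<infinity>"
 shows "(\<lambda>k. \<integral>\<^sup>+x. ennreal (\<bar>conv h (moll_seq k) x - h x\<bar> powr p) \<partial>lebesgue) \<longlonglongrightarrow> 0"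
proof (rule tendsto_0_subseq_criterion)
 fix s :: "nat => nat" assume s: "strict_mono s"
 have e: "1 / real (Suc k) > 0" for k by simp
 note [measurable] = borel_measurable_integrable[OF h] conv_measurable(1)[OF h e]
 have intc: "integrable lebesgue (conv h (moll_seq k))" for k
 proof (rule integrableI_bounded)
  show "(\<integral>\<^sup>+x. ennreal (norm (conv h (moll_seq k) x)) \<partial>lebesgue) < \<infinity>"
   using nn_integral_conv_powr_le[OF h order_refl e, of k] h
   by (auto simp: integrable_iff_bounded intro: le_less_trans)
 qed measurable
 let ?u = "\<lambda>k x. conv h (moll_seq (s k)) x - h x"
 have intu: "integrable lebesgue (?u k)" for k using intc h by simp
 have "(\<lambda>k. ennreal (\<integral>x. norm (?u k x) \<partial>lebesgue)) \<longlonglongrightarrow> 0"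
  using LIMSEQ_subseq_LIMSEQ[OF moll_L1_integrable[OF h, unfolded moll_L1_def] s]
   nn_integral_eq_integral[OF integrable_norm[OF intu]] by (simp add: o_def)
 then have "(\<lambda>k. \<integral>x. norm (?u k x) \<partial>lebesgue) \<longlonglongrightarrow> 0"
  by (subst tendsto_ennreal_iff[symmetric]) auto
 from tendsto_L1_AE_subseq[OF intu this] obtain r where
  r: "strict_mono r" "AE x in lebesgue. (\<lambda>n. ?u (r n) x) \<longlonglongrightarrow> 0" by blast
 have "AE x in lebesgue. (\<lambda>n. conv h (moll_seq (s (r n))) x) \<longlonglongrightarrow> h x"
  using r(2) by eventually_elim (simp add: LIM_zero_iff)
 then have "(\<lambda>n. \<integral>\<^sup>+x. ennreal (\<bar>conv h (moll_seq (s (r n))) x - h x\<bar> powr p) \<partial>lebesgue) \<longlonglongrightarrow> 0"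
  by (intro tendsto_Lp_if_AE_and_norms_le p hp nn_integral_conv_powr_le h e) measurable
 with r(1) show "\<exists>r. strict_mono r \<and>
   (\<lambda>k. \<integral>\<^sup>+x. ennreal (\<bar>conv h (moll_seq (s (r k))) x - h x\<bar> powr p) \<partial>lebesgue) \<longlonglongrightarrow> 0" by blast
qed

declare of_nat_Suc [simp]

section \<open>Cutoff functions\<close>

lemma nn_integral_lborel_reflect:
 fixes f :: "real^'n::finite => ennreal"
 assumes "f \<in> borel_measurable borel"
 shows "(\<integral>\<^sup>+x. f (a - x) \<partial>lborel) = (\<integral>\<^sup>+x. f x \<partial>lborel)"
proof -
 have "lborel = density (distr lborel borel (\<lambda>x. a - x)) (\<lambda>_. 1)"
  using lborel_affine[of "-1" a] by simp
 from arg_cong[OF this, of "\<lambda>M. nn_integral M f"]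
 have "(\<integral>\<^sup>+x. f x \<partial>lborel) =
   (\<integral>\<^sup>+x. f x \<partial>density (distr lborel borel (\<lambda>x. a - x)) (\<lambda>_. 1))" .
 also have "\<dots> = (\<integral>\<^sup>+x. f (a - x) \<partial>lborel)"
  using assms by (simp add: nn_integral_density nn_integral_distr)
 finally show ?thesis by simp
qed

text \<open>The indicator of a neighbourhood of \<open>A\<close>, mollified at a scale comparable to \<open>\<delta>\<close>.\<close>

lemma cutoff_exists:
 obtains C where "C > 0"
  "\<And>(A :: (real^'n::finite) set) \<delta>. A \<noteq> {} ==> bounded A ==> 0 < \<delta> ==>
    \<exists>\<eta>. smooth_on UNIV \<eta> \<and> (\<forall>x. 0 \<le> \<eta> x \<and> \<eta> x \<le> 1) \<and> (\<forall>x. infdist x A < \<delta> \<longrightarrow> \<eta> x = 1) \<and>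
     (\<forall>x. 2 * \<delta> \<le> infdist x A \<longrightarrow> \<eta> x = 0) \<and> (\<forall>x i. \<bar>partial i \<eta> x\<bar> \<le> C / \<delta>)"
proof -
 obtain C where C: "C > 0" "\<And>e i. e > 0 ==>
   (\<integral>\<^sup>+x. ennreal \<bar>partial i (mollifier e) (x :: real^'n)\<bar> \<partial>lborel) \<le> ennreal (C / e)"
  using nn_integral_abs_partial_mollifier[where 'n='n] by blast
 show ?thesis
 proof (rule that[of "2 * C"])
  show "2 * C > 0" using C by simp
  fix A :: "(real^'n) set" and \<delta> :: real
  assume A: "A \<noteq> {}" "bounded A" and \<delta>: "0 < \<delta>"
  let ?S = "{x. infdist x A < \<delta> * 3/2}"
  let ?h = "indicator ?S :: real^'n => real"
  let ?\<rho> = "mollifier (\<delta>/2) :: real^'n => real"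
  have e: "\<delta>/2 > 0" using \<delta> by simp
  have oS: "open ?S" by (intro open_Collect_less continuous_intros)
  obtain R where R: "\<And>x. x \<in> A ==> norm x \<le> R" using A(2) bounded_iff by blast
  have bS: "bounded ?S"
  proof (rule boundedI)
   fix x assume "x \<in> ?S"
   then obtain a where "a \<in> A" "dist x a < \<delta> * 3/2"
    using cInf_lessD[of "(\<lambda>a. dist x a) ` A" "\<delta> * 3/2"] A(1) by (auto simp: infdist_notempty)
   then show "norm x \<le> R + \<delta> * 3/2"
    using R[of a] norm_triangle_sub[of x a] by (simp add: dist_norm)
  qed
  have finS: "emeasure lborel ?S < \<infinity>" using bS emeasure_bounded_finite by blast
  have inth: "integrable lebesgue ?h" using oS finS by (simp add: integrable_completion)
  note m = smooth_mollifier[OF e, where 'n='n] supported_mollifier[OF e, where 'n='n]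
   continuous_mollifier[OF e, where 'n='n]
  have inf_tri: "infdist x A \<le> infdist y A + norm (x - y)" for x y
   using infdist_triangle[of x A y] by (simp add: dist_norm)
  have off: "?\<rho> (x - y) = 0" if "\<delta>/2 \<le> norm (x - y)" for x y
   using m(2) that by (simp add: supported_in_ball_def)
  show "\<exists>\<eta>. smooth_on UNIV \<eta> \<and> (\<forall>x. 0 \<le> \<eta> x \<and> \<eta> x \<le> 1) \<and> (\<forall>x. infdist x A < \<delta> \<longrightarrow> \<eta> x = 1) \<and>
     (\<forall>x. 2 * \<delta> \<le> infdist x A \<longrightarrow> \<eta> x = 0) \<and> (\<forall>x i. \<bar>partial i \<eta> x\<bar> \<le> 2 * C / \<delta>)"
  proof (intro exI[of _ "conv ?h ?\<rho>"] conjI allI impI)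
   show "smooth_on UNIV (conv ?h ?\<rho>)" by (rule smooth_conv[OF inth m(1,2)])
   fix x
   show "0 \<le> conv ?h ?\<rho> x" unfolding conv_def
    by (rule Bochner_Integration.integral_nonneg) (simp add: mollifier_nonneg[OF e])
   have "conv ?h ?\<rho> x \<le> (\<integral>y. ?\<rho> (x - y) \<partial>lebesgue)" unfolding conv_def
    by (rule integral_mono[OF conv_integrable[OF inth m(3,2)] mollifier_reflected_integral(1)[OF e]])
     (auto simp: indicator_def mollifier_nonneg[OF e])
   then show "conv ?h ?\<rho> x \<le> 1" using mollifier_reflected_integral(2)[OF e, of x] by simp
   show "conv ?h ?\<rho> x = 1" if "infdist x A < \<delta>"
   proof -
    have "?h y * ?\<rho> (x - y) = ?\<rho> (x - y)" for y
    proof (cases "y \<in> ?S")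
     case False
     then have "\<delta>/2 \<le> norm (x - y)" using that inf_tri[of y x] by (simp add: norm_minus_commute)
     then show ?thesis using off by simp
    qed simp
    then have "conv ?h ?\<rho> x = (\<integral>y. ?\<rho> (x - y) \<partial>lebesgue)" unfolding conv_def
     by (rule Bochner_Integration.integral_cong[OF refl])
    then show ?thesis using mollifier_reflected_integral(2)[OF e, of x] by simp
   qed
   show "conv ?h ?\<rho> x = 0" if "2 * \<delta> \<le> infdist x A"
   proof -
    have "?h y * ?\<rho> (x - y) = 0" for y
    proof (cases "y \<in> ?S")
     case True
     then have "\<delta>/2 \<le> norm (x - y)" using that inf_tri[of x y] by simp
     then show ?thesis using off by simp
    qed simp
    then have "conv ?h ?\<rho> x = (\<integral>y. 0 \<partial>(lebesgue :: (real^'n) measure))" unfolding conv_def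
     by (rule Bochner_Integration.integral_cong[OF refl])
    then show ?thesis by simp
   qed
   fix i
   have cp: "continuous_on UNIV (partial i ?\<rho>)" by (intro smooth_continuous smooth_partial m)
   have [measurable]: "(\<lambda>y. partial i ?\<rho> (x - y)) \<in> borel_measurable lebesgue"
    by (intro borel_measurable_lebesgue_continuous continuous_on_compose2[OF cp]) (auto intro: continuous_intros)
   have "ennreal \<bar>conv ?h (partial i ?\<rho>) x\<bar> \<le> (\<integral>\<^sup>+y. ennreal (norm (?h y * partial i ?\<rho> (x - y))) \<partial>lebesgue)"
    unfolding conv_def
    using integral_norm_bound_ennreal[OF conv_integrable[OF inth cp supported_partial[OF m(2)], of x]] by simp
   also have "\<dots> \<le> (\<integral>\<^sup>+y. ennreal \<bar>partial i ?\<rho> (x - y)\<bar> \<partial>lborel)"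
    unfolding nn_integral_completion by (intro nn_integral_mono ennreal_leI) (auto simp: indicator_def)
   also have "\<dots> = (\<integral>\<^sup>+y. ennreal \<bar>partial i ?\<rho> y\<bar> \<partial>lborel)"
    by (rule nn_integral_lborel_reflect) (use borel_measurable_lebesgue_continuous(2)[OF cp] in measurable)
   also have "\<dots> \<le> ennreal (C / (\<delta>/2))" by (rule C(2)[OF e])
   finally have "\<bar>conv ?h (partial i ?\<rho>) x\<bar> \<le> C / (\<delta>/2)"
    using C(1) \<delta> by (subst (asm) ennreal_le_iff) auto
   then show "\<bar>partial i (conv ?h ?\<rho>) x\<bar> \<le> 2 * C / \<delta>"
    unfolding partial_conv[OF inth m(1,2)] by (simp add: mult.commute)
  qed
 qed
qed

lemma test_funD:
 assumes "test_fun \<Omega> \<psi>"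
 shows "smooth_on UNIV \<psi>" "compact (closure {x. \<psi> x \<noteq> 0})" "closure {x. \<psi> x \<noteq> 0} \<subseteq> \<Omega>"
  "\<exists>R. supported_in_ball R \<psi>"
proof -
 show *: "smooth_on UNIV \<psi>" "compact (closure {x. \<psi> x \<noteq> 0})" "closure {x. \<psi> x \<noteq> 0} \<subseteq> \<Omega>"
  using assms by (auto simp: test_fun_def)
 have "bounded {x. \<psi> x \<noteq> 0}" using * by (metis bounded_closure_image compact_closure image_ident)
 then obtain R where "\<And>x. \<psi> x \<noteq> 0 ==> norm x \<le> R" unfolding bounded_iff by auto
 then have "supported_in_ball (R + 1) \<psi>" unfolding supported_in_ball_def by force
 then show "\<exists>R. supported_in_ball R \<psi>" ..
qed

lemma test_funI:
 assumes "smooth_on UNIV \<psi>" "closed K" "bounded K" "K \<subseteq> \<Omega>" "\<And>x. x \<notin> K ==> \<psi> x = 0"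
 shows "test_fun \<Omega> \<psi>"
proof -
 have "closure {x. \<psi> x \<noteq> 0} \<subseteq> K" using assms(2,5) by (intro closure_minimal) auto
 then show ?thesis unfolding test_fun_def
  using assms bounded_subset compact_eq_bounded_closed closed_closure by blast
qed

lemma test_fun_supported: "smooth_on UNIV \<psi> ==> supported_in_ball R \<psi> ==> test_fun UNIV \<psi>"
 by (rule test_funI[where K="cball 0 R"]) (auto simp: supported_in_ball_def)

lemma test_fun_mult_left:
 assumes "test_fun \<Omega> \<psi>" "smooth_on UNIV \<eta>"
 shows "test_fun \<Omega> (\<lambda>x. \<eta> x * \<psi> x)"
proof (rule test_funI[where K="closure {x. \<psi> x \<noteq> 0}"])
 note t = test_funD[OF assms(1)]
 show "smooth_on UNIV (\<lambda>x. \<eta> x * \<psi> x)" by (rule smooth_mult[OF assms(2) t(1)])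
 show "bounded (closure {x. \<psi> x \<noteq> 0})" by (rule compact_imp_bounded[OF t(2)])
 show "\<eta> x * \<psi> x = 0" if "x \<notin> closure {x. \<psi> x \<noteq> 0}" for x
  using that closure_subset[of "{x. \<psi> x \<noteq> 0}"] by auto
qed (use test_funD[OF assms(1)] in auto)

lemma test_fun_zero_off: "test_fun \<Omega> \<psi> ==> x \<notin> \<Omega> ==> \<psi> x = 0"
 using test_funD(3)[of \<Omega> \<psi>] closure_subset[of "{x. \<psi> x \<noteq> 0}"] by auto

lemma grad_zero_off_closure:
 assumes "x \<notin> closure {x. \<psi> x \<noteq> 0}"
 shows "grad \<psi> x = 0" "partial i \<psi> x = 0"
proof -
 have "(\<bullet>) 0 = (\<lambda>v::real^'a. 0 :: real)" by auto
 then have "((\<lambda>x. 0) has_derivative (\<bullet>) 0) (at x)" by simp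
 then have "(\<psi> has_derivative (\<bullet>) 0) (at x)"
  by (rule has_derivative_transform_within_open[where s="- closure {x. \<psi> x \<noteq> 0}"])
   (use assms closure_subset[of "{x. \<psi> x \<noteq> 0}"] in auto)
 from partial_gradI[OF this] show "grad \<psi> x = 0" "partial i \<psi> x = 0" by auto
qed

lemma test_fun_cutoff:
 assumes "compact K" "K \<subseteq> \<Omega>" "open \<Omega>"
 obtains \<eta> U where "test_fun \<Omega> \<eta>" "\<And>x. 0 \<le> \<eta> x \<and> \<eta> x \<le> 1" "open U" "K \<subseteq> U" "\<And>x. x \<in> U ==> \<eta> x = 1"
proof (cases "K = {}")
 case True
 show ?thesis
  by (rule that[of "\<lambda>x. 0" "{}"]) (auto simp: True intro!: test_funI[where K="{}"] smooth_const)
next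
 case False
 have "closed (- \<Omega>)" "K \<inter> - \<Omega> = {}" using assms by auto
 from separate_compact_closed[OF assms(1) this]
 obtain d where d: "d > 0" "\<And>x y. x \<in> K ==> y \<in> - \<Omega> ==> d \<le> dist x y" by blast
 obtain C where C: "\<And>(A :: (real^'a) set) \<delta>. A \<noteq> {} ==> bounded A ==> 0 < \<delta> ==>
    \<exists>\<eta>. smooth_on UNIV \<eta> \<and> (\<forall>x. 0 \<le> \<eta> x \<and> \<eta> x \<le> 1) \<and> (\<forall>x. infdist x A < \<delta> \<longrightarrow> \<eta> x = 1) \<and>
     (\<forall>x. 2 * \<delta> \<le> infdist x A \<longrightarrow> \<eta> x = 0) \<and> (\<forall>x i. \<bar>partial i \<eta> x\<bar> \<le> C / \<delta>)"
  by (rule cutoff_exists) blast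
 have "d/4 > 0" using d by simp
 from C[OF False compact_imp_bounded[OF assms(1)] this] obtain \<eta> where \<eta>: "smooth_on UNIV \<eta>"
  "\<And>x. 0 \<le> \<eta> x \<and> \<eta> x \<le> 1" "\<And>x. infdist x K < d/4 ==> \<eta> x = 1" "\<And>x. 2 * (d/4) \<le> infdist x K ==> \<eta> x = 0"
  by blast
 have near: "\<exists>a\<in>K. infdist x K = dist x a" for x
  using infdist_attains_inf[OF compact_imp_closed[OF assms(1)] False, of x] by metis
 let ?L = "{x. infdist x K \<le> d/2}"
 obtain R where R: "\<And>x. x \<in> K ==> norm x \<le> R"
  using compact_imp_bounded[OF assms(1)] bounded_iff by blast
 show ?thesis
 proof (rule that[of \<eta> "{x. infdist x K < d/4}"])
  show "test_fun \<Omega> \<eta>"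
  proof (rule test_funI[where K="?L"])
   show "closed ?L" by (intro closed_Collect_le continuous_intros)
   show "bounded ?L"
   proof (rule boundedI)
    fix x assume "x \<in> ?L"
    moreover obtain a where "a \<in> K" "infdist x K = dist x a" using near by blast
    ultimately show "norm x \<le> R + d/2"
     using R[of a] norm_triangle_sub[of x a] by (simp add: dist_norm)
   qed
   show "?L \<subseteq> \<Omega>"
   proof
    fix x assume x: "x \<in> ?L"
    obtain a where a: "a \<in> K" "infdist x K = dist x a" using near by blast
    show "x \<in> \<Omega>"
    proof (rule ccontr)
     assume "x \<notin> \<Omega>"
     then have "d \<le> dist a x" using d(2)[OF a(1)] by auto
     then show False using x a d(1) by (simp add: dist_commute)
    qed
   qed
  qed (use \<eta> in auto)
  show "open {x. infdist x K < d/4}" by (intro open_Collect_less continuous_intros)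
  show "K \<subseteq> {x. infdist x K < d/4}" using d by auto
 qed (use \<eta> in auto)
qed

section \<open>Weak gradients\<close>

lemma integral_lebesgue_on_zero_off:
 fixes f :: "real^'n::finite => real"
 assumes "open \<Omega>" "\<And>x. x \<notin> \<Omega> ==> f x = 0"
 shows "(\<integral>x. f x \<partial>lebesgue_on \<Omega>) = (\<integral>x. f x \<partial>lebesgue)"
proof -
 have "(\<integral>x. f x \<partial>lebesgue_on \<Omega>) = (\<integral>x. indicator \<Omega> x *\<^sub>R f x \<partial>lebesgue)"
  using assms(1) by (subst integral_restrict_space) (auto simp: Int_absorb1)
 also have "\<dots> = (\<integral>x. f x \<partial>lebesgue)"
  by (rule Bochner_Integration.integral_cong) (use assms(2) in \<open>auto simp: indicator_def\<close>)
 finally show ?thesis .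
qed

lemma locally_integrable_mult:
 fixes h :: "real^'n::finite => real"
 assumes "locally_integrable \<Omega> h" "continuous_on UNIV f" "compact K" "K \<subseteq> \<Omega>" "\<And>x. x \<notin> K ==> f x = 0"
 shows "integrable lebesgue (\<lambda>x. h x * f x)"
proof -
 have i: "integrable lebesgue (\<lambda>x. indicator K x *\<^sub>R h x)"
  using assms by (auto simp: locally_integrable_def set_integrable_def)
 have "bounded (f ` K)"
  using assms by (intro compact_imp_bounded compact_continuous_image) (auto elim: continuous_on_subset)
 then obtain M where M: "M > 0" "\<And>x. x \<in> K ==> \<bar>f x\<bar> \<le> M" unfolding bounded_pos by auto
 have eq: "h x * f x = (indicator K x *\<^sub>R h x) * f x" for x using assms(5)[of x] by (auto simp: indicator_def)
 show ?thesis
 proof (rule Bochner_Integration.integrable_bound)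
  show "integrable lebesgue (\<lambda>x. M *\<^sub>R (indicator K x *\<^sub>R h x))" using i by simp
  show "(\<lambda>x. h x * f x) \<in> borel_measurable lebesgue"
   unfolding eq using borel_measurable_integrable[OF i] borel_measurable_lebesgue_continuous(1)[OF assms(2)]
   by measurable
  show "AE x in lebesgue. norm (h x * f x) \<le> norm (M *\<^sub>R indicat_real K x *\<^sub>R h x)"
  proof (rule AE_I2)
   fix x
   show "norm (h x * f x) \<le> norm (M *\<^sub>R indicat_real K x *\<^sub>R h x)"
   proof (cases "x \<in> K")
    case True
    then have "\<bar>h x\<bar> * \<bar>f x\<bar> \<le> \<bar>h x\<bar> * M" using M(2) by (intro mult_left_mono) auto
    then show ?thesis using True M(1) by (simp add: abs_mult mult.commute)
   qed (use assms(5) in auto)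
  qed
 qed
qed

lemma locally_integrable_test:
 fixes h :: "real^'n::finite => real"
 assumes "locally_integrable \<Omega> h" "test_fun \<Omega> \<psi>"
 shows "integrable lebesgue (\<lambda>x. h x * \<psi> x)" "integrable lebesgue (\<lambda>x. h x * partial i \<psi> x)"
proof -
 note t = test_funD[OF assms(2)]
 show "integrable lebesgue (\<lambda>x. h x * \<psi> x)"
  by (rule locally_integrable_mult[OF assms(1) smooth_continuous[OF t(1)] t(2,3)])
   (use closure_subset[of "{x. \<psi> x \<noteq> 0}"] in auto)
 show "integrable lebesgue (\<lambda>x. h x * partial i \<psi> x)"
  by (rule locally_integrable_mult[OF assms(1) smooth_continuous[OF smooth_partial[OF t(1)]] t(2,3)])
   (rule grad_zero_off_closure)
qed

lemma locally_integrable_component: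
 "locally_integrable \<Omega> V ==> locally_integrable \<Omega> (\<lambda>x. V x $ i)"
 unfolding locally_integrable_def set_integrable_def
proof (intro allI impI)
 fix K assume *: "\<forall>K. compact K \<and> K \<subseteq> \<Omega> \<longrightarrow> integrable lebesgue (\<lambda>x. indicat_real K x *\<^sub>R V x)"
  and "compact K \<and> K \<subseteq> \<Omega>"
 then have "integrable lebesgue (\<lambda>x. (indicat_real K x *\<^sub>R V x) $ i)"
  by (intro integrable_bounded_linear[OF bounded_linear_vec_nth]) auto
 then show "integrable lebesgue (\<lambda>x. indicat_real K x *\<^sub>R V x $ i)" by simp
qed

lemma test_fun_reflected:
 fixes \<rho> :: "real^'n::finite => real" and x y :: "real^'n"
 assumes "smooth_on UNIV \<rho>" "supported_in_ball R \<rho>"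
 shows "test_fun UNIV (\<lambda>y. \<rho> (x - y))" "partial i (\<lambda>y. \<rho> (x - y)) y = - partial i \<rho> (x - y)"
proof -
 have eq: "(\<lambda>y. \<rho> (x - y)) = (\<lambda>y. \<rho> (x + (-1) *\<^sub>R y))" by simp
 have s: "smooth_on UNIV (\<lambda>y. \<rho> (x - y))"
  unfolding eq by (rule smooth_affine[OF assms(1)])
 have "supported_in_ball (R + norm x) (\<lambda>y. \<rho> (x - y))"
  unfolding supported_in_ball_def
 proof (intro allI impI)
  fix y :: "real^'n" assume "R + norm x \<le> norm y"
  then have "R \<le> norm (x - y)" using norm_triangle_ineq3[of y x] by (simp add: norm_minus_commute)
  then show "\<rho> (x - y) = 0" using assms(2) by (simp add: supported_in_ball_def)
 qed
 then show "test_fun UNIV (\<lambda>y. \<rho> (x - y))" by (rule test_fun_supported[OF s])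
 show "partial i (\<lambda>y. \<rho> (x - y)) y = - partial i \<rho> (x - y)"
  unfolding eq using partial_affine[of \<rho> x "-1" y i] smooth_differentiable[OF assms(1)] by simp
qed

text \<open>Testing against \<open>y \<mapsto> \<eta> y * mollifier e (x - y)\<close> shows that all mollifications of \<open>\<eta> h\<close> vanish;
 since these converge to \<open>\<eta> h\<close>, that function is zero.\<close>

lemma fundamental_lemma:
 fixes h :: "real^'n::finite => real"
 assumes \<Omega>: "open \<Omega>" and h: "locally_integrable \<Omega> h"
  and test: "\<And>\<psi>. test_fun \<Omega> \<psi> ==> (\<integral>x. h x * \<psi> x \<partial>lebesgue_on \<Omega>) = 0"
 shows "AE x in lebesgue. x \<in> \<Omega> \<longrightarrow> h x = 0"
proof -
 have K: "AE x in lebesgue. x \<in> K \<longrightarrow> h x = 0" if K: "compact K" "K \<subseteq> \<Omega>" for K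
 proof -
  obtain \<eta> U where \<eta>: "test_fun \<Omega> \<eta>" "K \<subseteq> U" "\<And>x. x \<in> U ==> \<eta> x = 1"
   using test_fun_cutoff[OF K \<Omega>] by metis
  let ?g = "\<lambda>x. h x * \<eta> x"
  have intg: "integrable lebesgue ?g" by (rule locally_integrable_test(1)[OF h \<eta>(1)])
  have e: "1 / real (Suc k) > 0" for k by simp
  have "conv ?g (moll_seq k) x = 0" for k x
  proof -
   let ?\<psi> = "\<lambda>y. moll_seq k (x - y) * \<eta> y"
   have s: "smooth_on UNIV (\<lambda>y. moll_seq k (x - y :: real^'n))"
    by (rule test_funD(1)[OF test_fun_reflected(1)[OF smooth_mollifier[OF e] supported_mollifier[OF e]]])
   have t: "test_fun \<Omega> ?\<psi>" by (rule test_fun_mult_left[OF \<eta>(1) s])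
   have "conv ?g (moll_seq k) x = (\<integral>y. h y * ?\<psi> y \<partial>lebesgue)"
    unfolding conv_def by (rule Bochner_Integration.integral_cong) auto
   also have "\<dots> = (\<integral>y. h y * ?\<psi> y \<partial>lebesgue_on \<Omega>)"
    by (rule integral_lebesgue_on_zero_off[symmetric, OF \<Omega>]) (use test_fun_zero_off[OF t] in auto)
   also have "\<dots> = 0" by (rule test[OF t])
   finally show ?thesis .
  qed
  then have "(\<lambda>k::nat. \<integral>\<^sup>+x. ennreal \<bar>?g x\<bar> \<partial>lebesgue) \<longlonglongrightarrow> 0"
   using moll_L1_integrable[OF intg] by (simp add: moll_L1_def)
  then have "(\<integral>\<^sup>+x. ennreal \<bar>?g x\<bar> \<partial>lebesgue) = 0"
   using LIMSEQ_unique tendsto_const by blast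
  then have "AE x in lebesgue. ?g x = 0"
   using borel_measurable_integrable[OF intg] by (subst (asm) nn_integral_0_iff_AE) auto
  then show ?thesis
   by eventually_elim (use \<eta> in auto)
 qed
 show ?thesis
 proof (rule open_Union_compact_subsets[OF \<Omega>])
  fix C :: "nat => (real^'n) set" assume C: "\<And>n. compact (C n)" "\<And>n. C n \<subseteq> \<Omega>" "\<Union> (range C) = \<Omega>"
  have "AE x in lebesgue. \<forall>n::nat. x \<in> C n \<longrightarrow> h x = 0"
   unfolding AE_all_countable using K C by blast
  then show ?thesis by eventually_elim (use C(3) in auto)
 qed
qed

lemma AE_lebesgue_on_iff:
 assumes "open \<Omega>"
 shows "(AE x in lebesgue_on \<Omega>. P x) \<longleftrightarrow> (AE x in lebesgue. x \<in> \<Omega> \<longrightarrow> P x)"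
 using assms by (subst AE_restrict_space_iff) auto

lemma integrable_component_vec:
 fixes V :: "'a => real^'n::finite"
 assumes "\<And>i. integrable M (\<lambda>x. V x $ i)"
 shows "integrable M V"
proof -
 have "(\<lambda>x. \<Sum>i\<in>UNIV. V x $ i *\<^sub>R axis i 1) = V"
  using basis_expansion[of "V x" for x] by (auto simp: scalar_mult_eq_scaleR)
 moreover have "integrable M (\<lambda>x. \<Sum>i\<in>UNIV. V x $ i *\<^sub>R (axis i 1 :: real^'n))"
  by (intro Bochner_Integration.integrable_sum integrable_scaleR_left assms)
 ultimately show ?thesis by simp
qed

lemma locally_integrable_linear:
 assumes "locally_integrable \<Omega> f" "locally_integrable \<Omega> g"
 shows "locally_integrable \<Omega> (\<lambda>x. a *\<^sub>R f x + b *\<^sub>R g x)"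
 using assms unfolding locally_integrable_def
 by (auto simp: scaleR_right_distrib set_integrable_def
   simp flip: scaleR_scaleR intro!: Bochner_Integration.integrable_add
   simp add: scaleR_left_commute)

lemma is_weak_gradientD:
 assumes "is_weak_gradient \<Omega> u V"
 shows "locally_integrable \<Omega> u" "locally_integrable \<Omega> V"
  "test_fun \<Omega> \<psi> ==> (\<integral>x. u x * partial i \<psi> x \<partial>lebesgue_on \<Omega>) = - (\<integral>x. V x $ i * \<psi> x \<partial>lebesgue_on \<Omega>)"
 using assms unfolding is_weak_gradient_def by blast+

lemma test_integral_UNIV:
 assumes "open \<Omega>" "test_fun \<Omega> \<psi>"
 shows "(\<integral>x. h x * \<psi> x \<partial>lebesgue_on \<Omega>) = (\<integral>x. h x * \<psi> x \<partial>lebesgue)"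
  "(\<integral>x. h x * partial i \<psi> x \<partial>lebesgue_on \<Omega>) = (\<integral>x. h x * partial i \<psi> x \<partial>lebesgue)"
proof -
 show "(\<integral>x. h x * \<psi> x \<partial>lebesgue_on \<Omega>) = (\<integral>x. h x * \<psi> x \<partial>lebesgue)"
  by (rule integral_lebesgue_on_zero_off[OF assms(1)]) (use test_fun_zero_off[OF assms(2)] in auto)
 show "(\<integral>x. h x * partial i \<psi> x \<partial>lebesgue_on \<Omega>) = (\<integral>x. h x * partial i \<psi> x \<partial>lebesgue)"
  by (rule integral_lebesgue_on_zero_off[OF assms(1)])
   (use test_funD(3)[OF assms(2)] grad_zero_off_closure(2)[of _ \<psi>] in auto)
qed

lemma weak_gradient_unique:
 fixes V V' :: "real^'n::finite => real^'n"
 assumes \<Omega>: "open \<Omega>" and V: "is_weak_gradient \<Omega> u V" and V': "is_weak_gradient \<Omega> u V'"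
 shows "AE x in lebesgue. x \<in> \<Omega> \<longrightarrow> V x = V' x"
proof -
 have "AE x in lebesgue. x \<in> \<Omega> \<longrightarrow> V x $ i - V' x $ i = 0" for i
 proof (rule fundamental_lemma[OF \<Omega>])
  note l = locally_integrable_component[OF is_weak_gradientD(2)[OF V], of i]
   locally_integrable_component[OF is_weak_gradientD(2)[OF V'], of i]
  show "locally_integrable \<Omega> (\<lambda>x. V x $ i - V' x $ i)"
   using locally_integrable_linear[OF l, of 1 "-1"] by simp
  fix \<psi> assume t: "test_fun \<Omega> \<psi>"
  have "(\<integral>x. V x $ i * \<psi> x \<partial>lebesgue) = (\<integral>x. V' x $ i * \<psi> x \<partial>lebesgue)"
   using is_weak_gradientD(3)[OF V t, of i] is_weak_gradientD(3)[OF V' t, of i]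
   by (simp add: test_integral_UNIV[OF \<Omega> t])
  then show "(\<integral>x. (V x $ i - V' x $ i) * \<psi> x \<partial>lebesgue_on \<Omega>) = 0"
   using locally_integrable_test(1)[OF l(1) t] locally_integrable_test(1)[OF l(2) t]
   by (subst test_integral_UNIV(1)[OF \<Omega> t])
    (simp add: left_diff_distrib Bochner_Integration.integral_diff)
 qed
 then have "AE x in lebesgue. \<forall>i. x \<in> \<Omega> \<longrightarrow> V x $ i - V' x $ i = 0"
  by (subst AE_all_countable) auto
 then show ?thesis by eventually_elim (auto simp: vec_eq_iff)
qed

lemma is_weak_gradient_linear:
 assumes \<Omega>: "open \<Omega>" and u: "is_weak_gradient \<Omega> u V" and v: "is_weak_gradient \<Omega> v W"
 shows "is_weak_gradient \<Omega> (\<lambda>x. a * u x + b * v x) (\<lambda>x. a *\<^sub>R V x + b *\<^sub>R W x)"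
 unfolding is_weak_gradient_def
proof (intro conjI allI impI)
 note lu = is_weak_gradientD(1,2)[OF u] and lv = is_weak_gradientD(1,2)[OF v]
 show "locally_integrable \<Omega> (\<lambda>x. a * u x + b * v x)"
  using locally_integrable_linear[OF lu(1) lv(1), of a b] by simp
 show "locally_integrable \<Omega> (\<lambda>x. a *\<^sub>R V x + b *\<^sub>R W x)"
  by (rule locally_integrable_linear[OF lu(2) lv(2)])
 fix \<psi> i assume t: "test_fun \<Omega> \<psi>"
 note ints = locally_integrable_test(2)[OF lu(1) t, of i] locally_integrable_test(2)[OF lv(1) t, of i]
  locally_integrable_test(1)[OF locally_integrable_component[OF lu(2)] t, of i]
  locally_integrable_test(1)[OF locally_integrable_component[OF lv(2)] t, of i]
 have split: "(\<integral>x. (a * f x + b * g x) * k x \<partial>lebesgue) = a * (\<integral>x. f x * k x \<partial>lebesgue) + b * (\<integral>x. g x * k x \<partial>lebesgue)"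
  if "integrable lebesgue (\<lambda>x. f x * k x)" "integrable lebesgue (\<lambda>x. g x * k x)" for f g k :: "real^'a => real"
 proof -
  have "(\<integral>x. (a * f x + b * g x) * k x \<partial>lebesgue) = (\<integral>x. a * (f x * k x) + b * (g x * k x) \<partial>lebesgue)"
   by (rule Bochner_Integration.integral_cong) (auto simp: algebra_simps)
  then show ?thesis using that by simp
 qed
 show "(\<integral>x. (a * u x + b * v x) * partial i \<psi> x \<partial>lebesgue_on \<Omega>)
   = - (\<integral>x. (a *\<^sub>R V x + b *\<^sub>R W x) $ i * \<psi> x \<partial>lebesgue_on \<Omega>)"
  using is_weak_gradientD(3)[OF u t, of i] is_weak_gradientD(3)[OF v t, of i]
  by (simp add: test_integral_UNIV[OF \<Omega> t] split ints)
qed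

lemma is_weak_gradient_mult:
 fixes s :: "real^'n::finite => real"
 assumes \<Omega>: "open \<Omega>" and \<eta>: "test_fun \<Omega> \<eta>" and s: "is_weak_gradient \<Omega> s V"
 defines "W \<equiv> (\<lambda>x. \<eta> x *\<^sub>R V x + s x *\<^sub>R grad \<eta> x)"
 shows "integrable lebesgue (\<lambda>x. \<eta> x * s x)" "integrable lebesgue W"
  "is_weak_gradient UNIV (\<lambda>x. \<eta> x * s x) W"
proof -
 note l = is_weak_gradientD(1,2)[OF s]
 note lc = locally_integrable_component[OF l(2)]
 show i1: "integrable lebesgue (\<lambda>x. \<eta> x * s x)"
  using locally_integrable_test(1)[OF l(1) \<eta>] by (simp add: mult.commute)
 have ic: "integrable lebesgue (\<lambda>x. V x $ i * \<eta> x)" "integrable lebesgue (\<lambda>x. s x * partial i \<eta> x)" for i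
  using locally_integrable_test[OF lc \<eta>] locally_integrable_test[OF l(1) \<eta>] by auto
 show i2: "integrable lebesgue W"
  by (rule integrable_component_vec) (use ic in \<open>simp add: W_def grad_def mult.commute\<close>)
 have loc: "locally_integrable UNIV f" if "integrable lebesgue f" for f :: "real^'n => 'c::euclidean_space"
  unfolding locally_integrable_def set_integrable_def
  using that integrable_mult_indicator[of _ lebesgue f] lmeasurable_compact
  by (auto simp: fmeasurable_def)
 show "is_weak_gradient UNIV (\<lambda>x. \<eta> x * s x) W"
  unfolding is_weak_gradient_def
 proof (intro conjI allI impI loc i1 i2)
  fix \<psi> :: "real^'n => real" and i assume t: "test_fun UNIV \<psi>"
  have t': "test_fun \<Omega> (\<lambda>x. \<psi> x * \<eta> x)" by (rule test_fun_mult_left[OF \<eta> test_funD(1)[OF t]])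
  have p: "partial i (\<lambda>x. \<psi> x * \<eta> x) x = \<psi> x * partial i \<eta> x + partial i \<psi> x * \<eta> x" for x
   by (rule partial_mult) (use smooth_differentiable test_funD(1) t \<eta> in blast)+
  have "integrable lebesgue (\<lambda>x. s x * partial i (\<lambda>x. \<psi> x * \<eta> x) x)"
   by (rule locally_integrable_test(2)[OF l(1) t'])
  have bd: "integrable lebesgue (\<lambda>x. f x * \<psi> x)" if "integrable lebesgue f" for f
   by (rule locally_integrable_test(1)[OF loc[OF that] t])
  have ia: "integrable lebesgue (\<lambda>x. s x * (\<psi> x * partial i \<eta> x))"
   using bd[OF ic(2)[of i]] by (simp add: mult_ac)
  have ib: "integrable lebesgue (\<lambda>x. s x * (partial i \<psi> x * \<eta> x))"
   using locally_integrable_test(2)[OF loc[OF i1] t, of i] by (simp add: mult_ac)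
  have iv: "integrable lebesgue (\<lambda>x. V x $ i * (\<psi> x * \<eta> x))"
   using bd[OF ic(1)[of i]] by (simp add: mult_ac)
  have "(\<integral>x. s x * (\<psi> x * partial i \<eta> x) \<partial>lebesgue) + (\<integral>x. s x * (partial i \<psi> x * \<eta> x) \<partial>lebesgue)
    = (\<integral>x. s x * partial i (\<lambda>x. \<psi> x * \<eta> x) x \<partial>lebesgue)"
   by (subst Bochner_Integration.integral_add[OF ia ib, symmetric]) (simp add: p distrib_left)
  also have "\<dots> = - (\<integral>x. V x $ i * (\<psi> x * \<eta> x) \<partial>lebesgue)"
   using is_weak_gradientD(3)[OF s t', of i] by (simp add: test_integral_UNIV[OF \<Omega> t'])
  finally have main: "(\<integral>x. s x * (partial i \<psi> x * \<eta> x) \<partial>lebesgue)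
    = - ((\<integral>x. V x $ i * (\<psi> x * \<eta> x) \<partial>lebesgue) + (\<integral>x. s x * (\<psi> x * partial i \<eta> x) \<partial>lebesgue))"
   by simp
  have "(\<integral>x. W x $ i * \<psi> x \<partial>lebesgue)
    = (\<integral>x. V x $ i * (\<psi> x * \<eta> x) \<partial>lebesgue) + (\<integral>x. s x * (\<psi> x * partial i \<eta> x) \<partial>lebesgue)"
   by (subst Bochner_Integration.integral_add[OF iv ia, symmetric])
    (simp add: W_def grad_def algebra_simps)
  with main show "(\<integral>x. \<eta> x * s x * partial i \<psi> x \<partial>lebesgue_on UNIV)
    = - (\<integral>x. W x $ i * \<psi> x \<partial>lebesgue_on UNIV)"
   by (simp add: lebesgue_on_UNIV_eq mult_ac)
 qed
qed

lemma partial_mollified: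
 fixes u :: "real^'n::finite => real"
 assumes u: "integrable lebesgue u" and w: "is_weak_gradient UNIV u V" and e: "0 < e"
 shows "partial i (conv u (mollifier e)) = conv (\<lambda>x. V x $ i) (mollifier e)"
proof
 fix x
 note m = smooth_mollifier[OF e, where 'n='n] supported_mollifier[OF e, where 'n='n]
 have "partial i (conv u (mollifier e)) x = (\<integral>y. u y * partial i (mollifier e) (x - y) \<partial>lebesgue)"
  unfolding partial_conv[OF u m] conv_def ..
 also have "\<dots> = - (\<integral>y. u y * partial i (\<lambda>y. mollifier e (x - y)) y \<partial>lebesgue)"
  unfolding test_fun_reflected(2)[OF m] by simp
 also have "\<dots> = (\<integral>y. V y $ i * mollifier e (x - y) \<partial>lebesgue)"
  using is_weak_gradientD(3)[OF w test_fun_reflected(1)[OF m, where x=x], of i] by (simp add: lebesgue_on_UNIV_eq)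
 finally show "partial i (conv u (mollifier e)) x = conv (\<lambda>x. V x $ i) (mollifier e) x"
  by (simp add: conv_def)
qed

section \<open>The chain rule for the negative part\<close>

lemma lborel_integral_shift:
 fixes f :: "real^'n::finite => real"
 assumes "f \<in> borel_measurable borel"
 shows "(\<integral>x. f (x + a) \<partial>lborel) = (\<integral>x. f x \<partial>lborel)"
proof -
 have "(\<integral>x. f x \<partial>lborel) = (\<integral>x. f x \<partial>distr lborel borel ((+) a))"
  by (simp add: lborel_distr_plus)
 also have "\<dots> = (\<integral>x. f (a + x) \<partial>lborel)"
  using assms by (subst integral_distr) auto
 finally show ?thesis by (simp add: add.commute)
qed

text \<open>The difference quotients of a compactly supported function have integral zero by translation
 invariance, and they converge boundedly to the partial derivative.\<close>

lemma integral_partial_eq_0: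
 fixes F :: "real^'n::finite => real"
 assumes F: "Ck_on 1 UNIV F" and R: "supported_in_ball R F"
 shows "(\<integral>x. partial i F x \<partial>lebesgue) = 0"
proof -
 let ?P = "partial i F" and ?e = "axis i 1 :: real^'n"
 have cF: "continuous_on UNIV F" and cP: "continuous_on UNIV ?P"
  using Ck_continuous[OF F] F by auto
 have dF: "F differentiable (at x)" for x using F by simp
 obtain M where M: "M > 0" "\<And>x. \<bar>?P x\<bar> \<le> M"
  using supported_bounded[OF cP supported_partial[OF R]] by blast
 define h where "h k = 1 / real (Suc k)" for k
 have h: "0 < h k" "h k \<le> 1" for k by (auto simp: h_def)
 let ?D = "\<lambda>k x. (F (x + h k *\<^sub>R ?e) - F x) / h k"
 have [measurable]: "F \<in> borel_measurable borel" "?P \<in> borel_measurable borel"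
  using borel_measurable_lebesgue_continuous(2) cF cP by auto
 have intF: "integrable lborel F" by (rule supported_integrable(2)[OF cF R])
 have der: "((\<lambda>t. F (x + t *\<^sub>R ?e)) has_real_derivative ?P (x + t *\<^sub>R ?e)) (at t)" for x t
 proof -
  have "((\<lambda>t. x + t *\<^sub>R ?e) has_derivative (\<lambda>h. h *\<^sub>R ?e)) (at t)"
   by (auto intro!: derivative_eq_intros)
  from has_derivative_compose[OF this has_derivative_grad[OF dF]]
  show ?thesis by (rule has_derivative_imp_has_field_derivative) (simp add: inner_axis grad_def)
 qed
 have intS: "integrable lborel (\<lambda>x. F (x + a))" for a
 proof (rule supported_integrable(2))
  show "continuous_on UNIV (\<lambda>x. F (x + a))"
   by (rule continuous_on_compose2[OF cF]) (auto intro: continuous_intros)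
  show "supported_in_ball (R + norm a) (\<lambda>x. F (x + a))" unfolding supported_in_ball_def
  proof (intro allI impI)
   fix x :: "real^'n" assume "R + norm a \<le> norm x"
   then have "R \<le> norm (x + a)" using norm_diff_ineq[of x a] by linarith
   then show "F (x + a) = 0" using R by (simp add: supported_in_ball_def)
  qed
 qed
 have zero: "(\<integral>x. ?D k x \<partial>lborel) = 0" for k
  using lborel_integral_shift[of F "h k *\<^sub>R ?e"] intS intF by simp
 have "(\<lambda>k. \<integral>x. ?D k x \<partial>lborel) \<longlonglongrightarrow> (\<integral>x. ?P x \<partial>lborel)"
 proof (rule integral_dominated_convergence[where w="\<lambda>x. M * indicator (cball 0 (R+1)) x"])
  show "integrable lborel (\<lambda>x. M * indicator (cball 0 (R+1)) x)"
   by (intro integrable_mult_right integrable_real_indicator emeasure_lborel_cball_finite) auto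
  show "AE x in lborel. (\<lambda>k. ?D k x) \<longlonglongrightarrow> ?P x"
  proof (rule AE_I2)
   fix x
   have "((\<lambda>t. (F (x + t *\<^sub>R ?e) - F x) / t) \<longlongrightarrow> ?P x) (at 0)"
    using der[of x 0] by (simp add: DERIV_def)
   moreover have "filterlim h (at 0) sequentially"
    unfolding filterlim_at
   proof
    show "\<forall>\<^sub>F k in sequentially. h k \<in> UNIV \<and> h k \<noteq> 0"
     using h(1) by (simp add: less_imp_neq[symmetric])
    show "h \<longlonglongrightarrow> 0"
     unfolding h_def[abs_def] using LIMSEQ_inverse_real_of_nat by (simp add: inverse_eq_divide)
   qed
   ultimately show "(\<lambda>k. ?D k x) \<longlonglongrightarrow> ?P x" by (rule filterlim_compose)
  qed
  show "AE x in lborel. norm (?D k x) \<le> M * indicator (cball 0 (R+1)) x" for k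
  proof (rule AE_I2)
   fix x
   show "norm (?D k x) \<le> M * indicator (cball 0 (R+1)) x"
   proof (cases "norm x \<le> R + 1")
    case True
    obtain t where "0 < t" "t < h k" "F (x + h k *\<^sub>R ?e) - F (x + 0 *\<^sub>R ?e) = (h k - 0) * ?P (x + t *\<^sub>R ?e)"
     using MVT2[of 0 "h k" "\<lambda>t. F (x + t *\<^sub>R ?e)" "\<lambda>t. ?P (x + t *\<^sub>R ?e)"] h der by blast
    then have "?D k x = ?P (x + t *\<^sub>R ?e)" using h[of k] by simp
    then show ?thesis using True M(2) by simp
   next
    case False
    have "norm (x + h k *\<^sub>R ?e) \<ge> R"
     using norm_diff_ineq[of x "h k *\<^sub>R ?e"] False h[of k] by simp
    then show ?thesis using R False by (simp add: supported_in_ball_def)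
   qed
  qed
 qed measurable
 then have "(\<integral>x. ?P x \<partial>lborel) = 0" unfolding zero by (simp add: LIMSEQ_const_iff)
 then show ?thesis by (simp add: integral_completion)
qed

lemma mollify_L1_real:
 fixes h :: "real^'n::finite => real"
 assumes h: "integrable lebesgue h"
 shows "integrable lebesgue (conv h (moll_seq k))"
  "(\<lambda>k. \<integral>x. \<bar>conv h (moll_seq k) x - h x\<bar> \<partial>lebesgue) \<longlonglongrightarrow> 0"
proof -
 have e: "1 / real (Suc k) > 0" for k by simp
 show intc: "integrable lebesgue (conv h (moll_seq k))" for k
 proof (rule integrableI_bounded)
  show "(\<integral>\<^sup>+x. ennreal (norm (conv h (moll_seq k) x)) \<partial>lebesgue) < \<infinity>"
   using nn_integral_conv_powr_le[OF h order_refl e, of k] h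
   by (auto simp: integrable_iff_bounded simp del: of_nat_Suc intro: le_less_trans)
 qed (rule conv_measurable(1)[OF h e])
 have i: "integrable lebesgue (\<lambda>x. \<bar>conv h (moll_seq k) x - h x\<bar>)" for k
  using intc h by (intro integrable_abs Bochner_Integration.integrable_diff)
 have "(\<lambda>k. ennreal (\<integral>x. \<bar>conv h (moll_seq k) x - h x\<bar> \<partial>lebesgue)) \<longlonglongrightarrow> ennreal 0"
  using moll_L1_integrable[OF h] nn_integral_eq_integral[OF i]
  by (simp add: moll_L1_def del: of_nat_Suc)
 then show "(\<lambda>k. \<integral>x. \<bar>conv h (moll_seq k) x - h x\<bar> \<partial>lebesgue) \<longlonglongrightarrow> 0"
  by (subst (asm) tendsto_ennreal_iff) auto
qed

lemma real_tendsto_0_mono: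
 fixes X Y :: "nat => real"
 assumes "\<And>k. 0 \<le> X k" "\<And>k. X k \<le> Y k" "Y \<longlonglongrightarrow> 0"
 shows "X \<longlonglongrightarrow> 0"
 by (rule tendsto_sandwich[OF _ _ tendsto_const assms(3)]) (auto simp: assms)

lemma integrable_mult_bounded:
 fixes f g :: "'a => real"
 assumes f: "integrable M f" and g: "g \<in> borel_measurable M" "\<And>x. \<bar>g x\<bar> \<le> B"
 shows "integrable M (\<lambda>x. f x * g x)"
proof (rule Bochner_Integration.integrable_bound)
 show "integrable M (\<lambda>x. f x * B)" using f by simp
 show "(\<lambda>x. f x * g x) \<in> borel_measurable M" using g(1) borel_measurable_integrable[OF f] by measurable
 show "AE x in M. norm (f x * g x) \<le> norm (f x * B)"
 proof (rule AE_I2)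
  fix x
  have "\<bar>f x\<bar> * \<bar>g x\<bar> \<le> \<bar>f x\<bar> * B" "0 \<le> B" using g(2)[of x] by (auto intro: mult_left_mono)
  then show "norm (f x * g x) \<le> norm (f x * B)" by (simp add: abs_mult)
 qed
qed

lemma integral_bounded_mult_tendsto_0:
 fixes a c :: "nat => 'a => real"
 assumes a: "\<And>k. integrable M (a k)" "(\<lambda>k. \<integral>x. \<bar>a k x\<bar> \<partial>M) \<longlonglongrightarrow> 0"
  and c: "\<And>k. c k \<in> borel_measurable M" "\<And>k x. \<bar>c k x\<bar> \<le> B"
 shows "integrable M (\<lambda>x. c k x * a k x)" "(\<lambda>k. \<integral>x. c k x * a k x \<partial>M) \<longlonglongrightarrow> 0"
proof -
 have bd: "\<bar>c k x * a k x\<bar> \<le> B * \<bar>a k x\<bar>" for k x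
  using c(2)[of k x] by (simp add: abs_mult mult_right_mono)
 show int: "integrable M (\<lambda>x. c k x * a k x)" for k
  using integrable_mult_bounded[OF a(1) c] by (simp add: mult.commute)
 have "\<bar>\<integral>x. c k x * a k x \<partial>M\<bar> \<le> B * (\<integral>x. \<bar>a k x\<bar> \<partial>M)" for k
 proof -
  have "\<bar>\<integral>x. c k x * a k x \<partial>M\<bar> \<le> (\<integral>x. \<bar>c k x * a k x\<bar> \<partial>M)" by (rule integral_abs_bound)
  also have "\<dots> \<le> (\<integral>x. B * \<bar>a k x\<bar> \<partial>M)"
   by (intro integral_mono integrable_abs int integrable_mult_right a(1) bd)
  finally show ?thesis by simp
 qed
 moreover have "(\<lambda>k. B * (\<integral>x. \<bar>a k x\<bar> \<partial>M)) \<longlonglongrightarrow> 0" using tendsto_mult_left[OF a(2), of B] by simp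
 ultimately have "(\<lambda>k. \<bar>\<integral>x. c k x * a k x \<partial>M\<bar>) \<longlonglongrightarrow> 0"
  by (rule real_tendsto_0_mono[rotated]) simp
 then show "(\<lambda>k. \<integral>x. c k x * a k x \<partial>M) \<longlonglongrightarrow> 0"
  by (rule tendsto_rabs_zero_cancel)
qed

text \<open>For mollifications this is the classical chain rule with an integration by parts. It survives the limit
 because \<open>b'\<close> is bounded and continuous.\<close>

lemma weak_chain_rule:
 fixes u :: "real^'n::finite => real"
 assumes u: "integrable lebesgue u" and V: "integrable lebesgue V" and w: "is_weak_gradient UNIV u V"
  and b: "\<And>t. (b has_real_derivative b' t) (at t)" "continuous_on UNIV b'" "\<And>t. \<bar>b' t\<bar> \<le> 1" "b 0 = 0"
  and \<psi>: "test_fun UNIV \<psi>"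
 shows "(\<integral>x. b (u x) * partial i \<psi> x \<partial>lebesgue) = - (\<integral>x. b' (u x) * V x $ i * \<psi> x \<partial>lebesgue)"
proof -
 obtain R where R: "supported_in_ball R \<psi>" using test_funD(4)[OF \<psi>] by blast
 note s\<psi> = test_funD(1)[OF \<psi>]
 have c\<psi>: "continuous_on UNIV \<psi>" "continuous_on UNIV (partial i \<psi>)"
  using s\<psi> by (auto intro: smooth_continuous smooth_partial)
 obtain M0 where M0: "M0 > 0" "\<And>x. \<bar>\<psi> x\<bar> \<le> M0" using supported_bounded[OF c\<psi>(1) R] by blast
 obtain M1 where M1: "M1 > 0" "\<And>x. \<bar>partial i \<psi> x\<bar> \<le> M1"
  using supported_bounded[OF c\<psi>(2) supported_partial[OF R]] by blast
 have e: "1 / real (Suc k) > 0" for k by simp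
 have Vi: "integrable lebesgue (\<lambda>x. V x $ i)"
  by (rule integrable_bounded_linear[OF bounded_linear_vec_nth V])
 have lip: "\<bar>b s - b t\<bar> \<le> \<bar>s - t\<bar>" for s t
 proof -
  have "norm (b s - b t) \<le> 1 * norm (s - t)"
  proof (rule differentiable_bound[of UNIV b "\<lambda>t. (*) (b' t)"])
   show "onorm ((*) (b' t)) \<le> 1" for t
    by (rule onorm_le) (use b(3)[of t] in \<open>auto simp: abs_mult intro: mult_left_le_one_le\<close>)
  qed (use b(1) in \<open>auto simp: has_field_derivative_def\<close>)
  then show ?thesis by simp
 qed
 have cb: "continuous_on UNIV b"
  using b(1) DERIV_isCont continuous_at_imp_continuous_on by blast
 have [measurable]: "b \<in> borel_measurable borel" "b' \<in> borel_measurable borel"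
  using cb b(2) by (auto intro: borel_measurable_continuous_onI)
 have [measurable]: "\<psi> \<in> borel_measurable lebesgue" "partial i \<psi> \<in> borel_measurable lebesgue"
  using c\<psi> by (auto intro: borel_measurable_lebesgue_continuous)
 have [measurable]: "u \<in> borel_measurable lebesgue" "(\<lambda>x. V x $ i) \<in> borel_measurable lebesgue"
  using u Vi by auto
 define v where "v k = conv u (moll_seq k)" for k
 define g where "g k = conv (\<lambda>x. V x $ i) (moll_seq k)" for k
 have sv: "smooth_on UNIV (v k)" for k
  unfolding v_def by (rule smooth_conv[OF u smooth_mollifier[OF e] supported_mollifier[OF e]])
 have pv: "partial i (v k) = g k" for k
  unfolding v_def g_def by (rule partial_mollified[OF u w e])
 have iv: "integrable lebesgue (v k)" "(\<lambda>k. \<integral>x. \<bar>v k x - u x\<bar> \<partial>lebesgue) \<longlonglongrightarrow> 0" for k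
  unfolding v_def using mollify_L1_real[OF u] by auto
 have ig: "integrable lebesgue (g k)" "(\<lambda>k. \<integral>x. \<bar>g k x - V x $ i\<bar> \<partial>lebesgue) \<longlonglongrightarrow> 0" for k
  unfolding g_def using mollify_L1_real[OF Vi] by auto
 have [measurable]: "v k \<in> borel_measurable lebesgue" "g k \<in> borel_measurable lebesgue" for k
  using iv(1) ig(1) by auto
 have ib: "integrable lebesgue (\<lambda>x. b (f x))" if "integrable lebesgue f" for f
 proof (rule Bochner_Integration.integrable_bound[OF that])
  show "(\<lambda>x. b (f x)) \<in> borel_measurable lebesgue" using borel_measurable_integrable[OF that] by measurable
  show "AE x in lebesgue. norm (b (f x)) \<le> norm (f x)" 
  proof (rule AE_I2)
   fix x
   show "norm (b (f x)) \<le> norm (f x)" using lip[of "f x" 0] b(4) by simp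
  qed
 qed
 have by_parts: "(\<integral>x. b (v k x) * partial i \<psi> x \<partial>lebesgue) = - (\<integral>x. b' (v k x) * g k x * \<psi> x \<partial>lebesgue)" for k
 proof -
  have C1v: "Ck_on 1 UNIV (v k)" by (rule smooth_Ck[OF sv])
  note C1b = C1_compose[OF C1v b(1,2)]
  have C1\<psi>: "Ck_on 1 UNIV \<psi>" by (rule smooth_Ck[OF s\<psi>])
  have "partial i (\<lambda>x. b (v k x) * \<psi> x) x = b (v k x) * partial i \<psi> x + b' (v k x) * g k x * \<psi> x" for x
   by (subst partial_mult) (use C1b(1) C1\<psi> in \<open>auto simp: C1b(2) pv\<close>)
  moreover have "(\<integral>x. partial i (\<lambda>x. b (v k x) * \<psi> x) x \<partial>lebesgue) = 0"
   by (rule integral_partial_eq_0[OF Ck_mult[OF C1b(1) C1\<psi>]])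
    (use R in \<open>auto simp: supported_in_ball_def\<close>)
  ultimately have "(\<integral>x. b (v k x) * partial i \<psi> x + b' (v k x) * g k x * \<psi> x \<partial>lebesgue) = 0" by simp
  moreover have "integrable lebesgue (\<lambda>x. b (v k x) * partial i \<psi> x)"
   by (rule integrable_mult_bounded[OF ib[OF iv(1)] _ M1(2)]) measurable
  moreover have "integrable lebesgue (\<lambda>x. g k x * (b' (v k x) * \<psi> x))"
  proof (rule integrable_mult_bounded[OF ig(1), where B=M0])
   show "\<bar>b' (v k x) * \<psi> x\<bar> \<le> M0" for x
    using mult_mono[OF b(3)[of "v k x"] M0(2)[of x]] by (simp add: abs_mult)
  qed measurable
  ultimately show ?thesis by (simp add: mult_ac)
 qed
 have L: "(\<lambda>k. \<integral>x. b (v k x) * partial i \<psi> x \<partial>lebesgue) \<longlonglongrightarrow> (\<integral>x. b (u x) * partial i \<psi> x \<partial>lebesgue)"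
 proof -
  have ia: "integrable lebesgue (\<lambda>x. b (v k x) - b (u x))" for k
   by (intro Bochner_Integration.integrable_diff ib iv(1) u)
  have "(\<lambda>k. \<integral>x. \<bar>b (v k x) - b (u x)\<bar> \<partial>lebesgue) \<longlonglongrightarrow> 0"
  proof (rule tendsto_sandwich[OF _ _ tendsto_const iv(2)])
   show "\<forall>\<^sub>F k in sequentially. 0 \<le> (\<integral>x. \<bar>b (v k x) - b (u x)\<bar> \<partial>lebesgue)" by simp
   have "(\<integral>x. \<bar>b (v k x) - b (u x)\<bar> \<partial>lebesgue) \<le> (\<integral>x. \<bar>v k x - u x\<bar> \<partial>lebesgue)" for k
    by (rule integral_mono[OF integrable_abs[OF ia] integrable_abs[OF Bochner_Integration.integrable_diff[OF iv(1) u]] lip])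
   then show "\<forall>\<^sub>F k in sequentially. (\<integral>x. \<bar>b (v k x) - b (u x)\<bar> \<partial>lebesgue) \<le> (\<integral>x. \<bar>v k x - u x\<bar> \<partial>lebesgue)"
    by simp
  qed
  then have *: "(\<lambda>k. \<integral>x. partial i \<psi> x * (b (v k x) - b (u x)) \<partial>lebesgue) \<longlonglongrightarrow> 0"
   by (rule integral_bounded_mult_tendsto_0(2)[OF ia _ _ M1(2)]) measurable
  have i1: "integrable lebesgue (\<lambda>x. b (f x) * partial i \<psi> x)" if "integrable lebesgue f" for f
   by (rule integrable_mult_bounded[OF ib[OF that] _ M1(2)]) measurable
  have "(\<integral>x. partial i \<psi> x * (b (v k x) - b (u x)) \<partial>lebesgue)
    = (\<integral>x. b (v k x) * partial i \<psi> x \<partial>lebesgue) - (\<integral>x. b (u x) * partial i \<psi> x \<partial>lebesgue)" for k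
   by (subst Bochner_Integration.integral_diff[OF i1[OF iv(1)] i1[OF u], symmetric]) (simp add: algebra_simps)
  with * have "(\<lambda>k. (\<integral>x. b (v k x) * partial i \<psi> x \<partial>lebesgue) - (\<integral>x. b (u x) * partial i \<psi> x \<partial>lebesgue)) \<longlonglongrightarrow> 0"
   by simp
  then show ?thesis by (rule LIM_zero_cancel)
 qed
 from tendsto_L1_AE_subseq[of lebesgue "\<lambda>k x. v k x - u x"] iv u
 obtain r where r: "strict_mono r" "AE x in lebesgue. (\<lambda>n. v (r n) x - u x) \<longlonglongrightarrow> 0" by auto
 have Rt: "(\<lambda>k. \<integral>x. b' (v (r k) x) * g (r k) x * \<psi> x \<partial>lebesgue) \<longlonglongrightarrow> (\<integral>x. b' (u x) * V x $ i * \<psi> x \<partial>lebesgue)"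
 proof -
  have bd: "\<bar>b' s * \<psi> x\<bar> \<le> M0" for s x
   using mult_mono[OF b(3)[of s] M0(2)[of x]] by (simp add: abs_mult)
  have ia: "integrable lebesgue (\<lambda>x. g (r k) x - V x $ i)" for k
   by (intro Bochner_Integration.integrable_diff ig(1) Vi)
  have "(\<lambda>k. \<integral>x. \<bar>g (r k) x - V x $ i\<bar> \<partial>lebesgue) \<longlonglongrightarrow> 0"
   using LIMSEQ_subseq_LIMSEQ[OF ig(2) r(1)] by (simp add: o_def)
  then have 1: "(\<lambda>k. \<integral>x. b' (v (r k) x) * \<psi> x * (g (r k) x - V x $ i) \<partial>lebesgue) \<longlonglongrightarrow> 0"
   by (rule integral_bounded_mult_tendsto_0(2)[OF ia _ _ bd]) measurable
  have 2: "(\<lambda>k. \<integral>x. V x $ i * (b' (v (r k) x) * \<psi> x) \<partial>lebesgue) \<longlonglongrightarrow> (\<integral>x. V x $ i * (b' (u x) * \<psi> x) \<partial>lebesgue)"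
  proof (rule integral_dominated_convergence[where w="\<lambda>x. \<bar>V x $ i\<bar> * M0"])
   show "integrable lebesgue (\<lambda>x. \<bar>V x $ i\<bar> * M0)" using Vi by simp
   show "AE x in lebesgue. (\<lambda>k. V x $ i * (b' (v (r k) x) * \<psi> x)) \<longlonglongrightarrow> V x $ i * (b' (u x) * \<psi> x)"
    using r(2)
   proof eventually_elim
    case (elim x)
    then have "(\<lambda>k. v (r k) x) \<longlonglongrightarrow> u x" by (rule LIM_zero_cancel)
    then have "(\<lambda>k. b' (v (r k) x)) \<longlonglongrightarrow> b' (u x)"
     using b(2) continuous_on_tendsto_compose[OF b(2), of _ "u x"] by auto
    then show ?case by (intro tendsto_intros)
   qed
   show "AE x in lebesgue. norm (V x $ i * (b' (v (r k) x) * \<psi> x)) \<le> \<bar>V x $ i\<bar> * M0" for k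
    using bd by (intro AE_I2) (auto simp: abs_mult[of "V _ $ i"] intro!: mult_left_mono)
  qed measurable
  have 3: "(\<integral>x. b' (v (r k) x) * g (r k) x * \<psi> x \<partial>lebesgue)
    = (\<integral>x. b' (v (r k) x) * \<psi> x * (g (r k) x - V x $ i) \<partial>lebesgue)
     + (\<integral>x. V x $ i * (b' (v (r k) x) * \<psi> x) \<partial>lebesgue)" for k
  proof -
   have j1: "integrable lebesgue (\<lambda>x. b' (v (r k) x) * \<psi> x * (g (r k) x - V x $ i))"
   proof -
    have "integrable lebesgue (\<lambda>x. (g (r k) x - V x $ i) * (b' (v (r k) x) * \<psi> x))"
     by (rule integrable_mult_bounded[OF ia _ bd]) measurable
    then show ?thesis by (simp add: mult.commute)
   qed
   have j2: "integrable lebesgue (\<lambda>x. V x $ i * (b' (v (r k) x) * \<psi> x))"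
    by (rule integrable_mult_bounded[OF Vi _ bd]) measurable
   show ?thesis
    by (subst Bochner_Integration.integral_add[OF j1 j2, symmetric]) (simp add: algebra_simps)
  qed
  show ?thesis using tendsto_add[OF 1 2] unfolding 3 by (simp add: mult_ac)
 qed
 have "(\<lambda>k. \<integral>x. b (v (r k) x) * partial i \<psi> x \<partial>lebesgue) \<longlonglongrightarrow> (\<integral>x. b (u x) * partial i \<psi> x \<partial>lebesgue)"
  using LIMSEQ_subseq_LIMSEQ[OF L r(1)] by (simp add: o_def)
 then have "(\<lambda>k. - (\<integral>x. b' (v (r k) x) * g (r k) x * \<psi> x \<partial>lebesgue)) \<longlonglongrightarrow> (\<integral>x. b (u x) * partial i \<psi> x \<partial>lebesgue)"
  unfolding by_parts .
 from LIMSEQ_unique[OF this tendsto_minus[OF Rt]] show ?thesis .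
qed

text \<open>The functions \<open>(sqrt (t\<^sup>2 + d\<^sup>2) - d - t) / 2\<close> are smooth and converge to the negative part of \<open>t\<close>.
 On the set where \<open>u\<close> vanishes the limit of their derivatives assigns the factor \<open>-1/2\<close>.\<close>

lemma weak_gradient_negpart_UNIV:
 fixes u :: "real^'n::finite => real"
 assumes u: "integrable lebesgue u" and V: "integrable lebesgue V" and w: "is_weak_gradient UNIV u V"
  and \<psi>: "test_fun UNIV \<psi>"
 shows "(\<integral>x. max 0 (- u x) * partial i \<psi> x \<partial>lebesgue) = - (\<integral>x. (sgn (u x) - 1) / 2 * V x $ i * \<psi> x \<partial>lebesgue)"
proof -
 define d where "d k = 1 / real (Suc k)" for k
 have d: "d k > 0" "d \<longlonglongrightarrow> 0" for k
  unfolding d_def[abs_def] using LIMSEQ_inverse_real_of_nat by (auto simp: inverse_eq_divide)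
 define b where "b k t = (sqrt (t\<^sup>2 + (d k)\<^sup>2) - d k - t) / 2" for k and t :: real
 define b' where "b' k t = (t / sqrt (t\<^sup>2 + (d k)\<^sup>2) - 1) / 2" for k and t :: real
 have pos: "0 < t\<^sup>2 + (d k)\<^sup>2" for k t using d(1)[of k] by (simp add: add_nonneg_pos)
 have der: "(b k has_real_derivative b' k t) (at t)" for k t
  unfolding b_def[abs_def] b'_def using pos[of t k]
  by (auto intro!: derivative_eq_intros simp: field_simps)
 have cb': "continuous_on UNIV (b' k)" for k
  unfolding b'_def[abs_def] using d(1)[of k] by (intro continuous_intros) auto
 have frac: "\<bar>t / sqrt (t\<^sup>2 + (d k)\<^sup>2)\<bar> \<le> 1" for k t
 proof -
  have "\<bar>t\<bar> \<le> sqrt (t\<^sup>2 + (d k)\<^sup>2)" by (rule real_le_rsqrt) simp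
  then show ?thesis using pos[of t k] by (simp add: divide_le_eq_1)
 qed
 have b'1: "\<bar>b' k t\<bar> \<le> 1" for k t
 proof -
  have "\<bar>(q - 1) / 2\<bar> \<le> 1" if "\<bar>q\<bar> \<le> 1" for q :: real
   using that by (simp add: abs_le_iff)
  from this[OF frac[of t k]] show ?thesis unfolding b'_def .
 qed
 have b0: "b k 0 = 0" for k unfolding b_def using d(1)[of k] by simp
 have eq: "(\<integral>x. b k (u x) * partial i \<psi> x \<partial>lebesgue) = - (\<integral>x. b' k (u x) * V x $ i * \<psi> x \<partial>lebesgue)" for k
  by (rule weak_chain_rule[OF u V w der cb' b'1 b0 \<psi>])
 have bt: "\<bar>b k t\<bar> \<le> \<bar>t\<bar>" for k t
 proof -
  have "sqrt (t\<^sup>2 + (d k)\<^sup>2) \<le> \<bar>t\<bar> + d k"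
   using sqrt_sum_squares_le_sum_abs[of t "d k"] d(1)[of k] by simp
  moreover have "d k \<le> sqrt (t\<^sup>2 + (d k)\<^sup>2)" by (rule real_le_rsqrt) simp
  moreover have "\<bar>(q - d k - t) / 2\<bar> \<le> \<bar>t\<bar>" if "q \<le> \<bar>t\<bar> + d k" "d k \<le> q" for q
   using that by (cases "0 \<le> t") (simp_all add: abs_le_iff)
  ultimately show ?thesis unfolding b_def by blast
 qed
 have lim_sqrt: "(\<lambda>k. sqrt (t\<^sup>2 + (d k)\<^sup>2)) \<longlonglongrightarrow> \<bar>t\<bar>" for t
 proof -
  have "(\<lambda>k. sqrt (t\<^sup>2 + (d k)\<^sup>2)) \<longlonglongrightarrow> sqrt (t\<^sup>2 + 0\<^sup>2)" by (intro tendsto_intros d)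
  then show ?thesis by simp
 qed
 have lim_b: "(\<lambda>k. b k t) \<longlonglongrightarrow> max 0 (- t)" for t
 proof -
  have "(\<lambda>k. b k t) \<longlonglongrightarrow> (\<bar>t\<bar> - 0 - t) / 2" unfolding b_def by (intro tendsto_intros lim_sqrt d) auto
  moreover have "(\<bar>t\<bar> - 0 - t) / 2 = max 0 (- t)" by (simp add: max_def abs_if)
  ultimately show ?thesis by simp
 qed
 have lim_b': "(\<lambda>k. b' k t) \<longlonglongrightarrow> (sgn t - 1) / 2" for t
 proof (cases "t = 0")
  case False
  have "(\<lambda>k. b' k t) \<longlonglongrightarrow> (t / \<bar>t\<bar> - 1) / 2"
   unfolding b'_def by (intro tendsto_intros lim_sqrt) (use False in auto)
  moreover have "t / \<bar>t\<bar> = sgn t" using False by (simp add: sgn_if abs_if)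
  ultimately show ?thesis by simp
 qed (simp add: b'_def)
 obtain R where R: "supported_in_ball R \<psi>" using test_funD(4)[OF \<psi>] by blast
 note s\<psi> = test_funD(1)[OF \<psi>]
 have c\<psi>: "continuous_on UNIV \<psi>" "continuous_on UNIV (partial i \<psi>)"
  using s\<psi> by (auto intro: smooth_continuous smooth_partial)
 obtain M0 where M0: "M0 > 0" "\<And>x. \<bar>\<psi> x\<bar> \<le> M0" using supported_bounded[OF c\<psi>(1) R] by blast
 obtain M1 where M1: "M1 > 0" "\<And>x. \<bar>partial i \<psi> x\<bar> \<le> M1"
  using supported_bounded[OF c\<psi>(2) supported_partial[OF R]] by blast
 have [measurable]: "\<psi> \<in> borel_measurable lebesgue" "partial i \<psi> \<in> borel_measurable lebesgue"
  using c\<psi> by (auto intro: borel_measurable_lebesgue_continuous)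
 have Vi: "integrable lebesgue (\<lambda>x. V x $ i)"
  by (rule integrable_bounded_linear[OF bounded_linear_vec_nth V])
 have [measurable]: "u \<in> borel_measurable lebesgue" "(\<lambda>x. V x $ i) \<in> borel_measurable lebesgue"
  using u Vi by auto
 have [measurable]: "b k \<in> borel_measurable borel" "b' k \<in> borel_measurable borel" for k
  unfolding b_def[abs_def] b'_def[abs_def] by measurable
 have L: "(\<lambda>k. \<integral>x. b k (u x) * partial i \<psi> x \<partial>lebesgue) \<longlonglongrightarrow> (\<integral>x. max 0 (- u x) * partial i \<psi> x \<partial>lebesgue)"
 proof (rule integral_dominated_convergence[where w="\<lambda>x. \<bar>u x\<bar> * M1"])
  show "integrable lebesgue (\<lambda>x. \<bar>u x\<bar> * M1)" using u by simp
  show "AE x in lebesgue. (\<lambda>k. b k (u x) * partial i \<psi> x) \<longlonglongrightarrow> max 0 (- u x) * partial i \<psi> x"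
   by (intro AE_I2 tendsto_intros lim_b)
  show "AE x in lebesgue. norm (b k (u x) * partial i \<psi> x) \<le> \<bar>u x\<bar> * M1" for k
   by (intro AE_I2) (auto simp: abs_mult intro!: mult_mono bt M1)
 qed measurable
 have Rt: "(\<lambda>k. \<integral>x. b' k (u x) * V x $ i * \<psi> x \<partial>lebesgue) \<longlonglongrightarrow> (\<integral>x. (sgn (u x) - 1) / 2 * V x $ i * \<psi> x \<partial>lebesgue)"
 proof (rule integral_dominated_convergence[where w="\<lambda>x. \<bar>V x $ i\<bar> * M0"])
  show "integrable lebesgue (\<lambda>x. \<bar>V x $ i\<bar> * M0)" using Vi by simp
  show "AE x in lebesgue. (\<lambda>k. b' k (u x) * V x $ i * \<psi> x) \<longlonglongrightarrow> (sgn (u x) - 1) / 2 * V x $ i * \<psi> x"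
   by (intro AE_I2 tendsto_mult lim_b' tendsto_const)
  show "AE x in lebesgue. norm (b' k (u x) * V x $ i * \<psi> x) \<le> \<bar>V x $ i\<bar> * M0" for k
  proof (rule AE_I2)
   fix x
   have "\<bar>b' k (u x)\<bar> * \<bar>V x $ i\<bar> * \<bar>\<psi> x\<bar> \<le> 1 * \<bar>V x $ i\<bar> * M0"
    by (intro mult_mono b'1 M0) auto
   then show "norm (b' k (u x) * V x $ i * \<psi> x) \<le> \<bar>V x $ i\<bar> * M0" by (simp add: abs_mult)
  qed
 qed measurable
 show ?thesis using LIMSEQ_unique[OF L[unfolded eq] tendsto_minus[OF Rt]] .
qed

text \<open>Multiplication by a cutoff function reduces this to integrable functions on the whole space.\<close>

lemma is_weak_gradient_negpart:
 fixes u :: "real^'n::finite => real"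
 assumes \<Omega>: "open \<Omega>" and w: "is_weak_gradient \<Omega> u V"
 shows "is_weak_gradient \<Omega> (\<lambda>x. max 0 (- u x)) (\<lambda>x. ((sgn (u x) - 1) / 2) *\<^sub>R V x)"
 unfolding is_weak_gradient_def
proof (intro conjI allI impI)
 note l = is_weak_gradientD(1,2)[OF w]
 have K: "integrable lebesgue (\<lambda>x. indicat_real K x * u x)" "integrable lebesgue (\<lambda>x. indicat_real K x *\<^sub>R V x)"
  if "compact K" "K \<subseteq> \<Omega>" for K
  using l that by (auto simp: locally_integrable_def set_integrable_def)
 show "locally_integrable \<Omega> (\<lambda>x. max 0 (- u x))"
  unfolding locally_integrable_def set_integrable_def
 proof (intro allI impI)
  fix K assume "compact K \<and> K \<subseteq> \<Omega>"
  note i = K(1)[of K]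
  have eq: "indicat_real K x *\<^sub>R max 0 (- u x) = max 0 (- (indicat_real K x * u x))" for x
   by (auto simp: indicator_def)
  show "integrable lebesgue (\<lambda>x. indicat_real K x *\<^sub>R max 0 (- u x))"
   unfolding eq using i \<open>compact K \<and> K \<subseteq> \<Omega>\<close> by (intro integrable_max) auto
 qed
 show "locally_integrable \<Omega> (\<lambda>x. ((sgn (u x) - 1) / 2) *\<^sub>R V x)"
  unfolding locally_integrable_def set_integrable_def
 proof (intro allI impI)
  fix K :: "(real^'n) set" assume K': "compact K \<and> K \<subseteq> \<Omega>"
  have i: "integrable lebesgue (\<lambda>x. indicat_real K x * u x)" "integrable lebesgue (\<lambda>x. indicat_real K x *\<^sub>R V x)"
   using K[of K] K' by auto
  have eq: "indicat_real K x *\<^sub>R ((sgn (u x) - 1) / 2) *\<^sub>R V x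
    = ((sgn (indicat_real K x * u x) - 1) / 2) *\<^sub>R (indicat_real K x *\<^sub>R V x)" for x
   by (auto simp: indicator_def)
  show "integrable lebesgue (\<lambda>x. indicat_real K x *\<^sub>R ((sgn (u x) - 1) / 2) *\<^sub>R V x)"
   unfolding eq
  proof (rule Bochner_Integration.integrable_bound[OF i(2)])
   show "(\<lambda>x. ((sgn (indicat_real K x * u x) - 1) / 2) *\<^sub>R (indicat_real K x *\<^sub>R V x)) \<in> borel_measurable lebesgue"
    using borel_measurable_integrable[OF i(1)] borel_measurable_integrable[OF i(2)] by measurable
   show "AE x in lebesgue. norm (((sgn (indicat_real K x * u x) - 1) / 2) *\<^sub>R (indicat_real K x *\<^sub>R V x))
     \<le> norm (indicat_real K x *\<^sub>R V x)"
    by (intro AE_I2) (auto simp: sgn_if intro!: mult_left_le_one_le)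
  qed
 qed
 fix \<psi> :: "real^'n => real" and i assume t: "test_fun \<Omega> \<psi>"
 note tD = test_funD[OF t]
 obtain \<eta> U where \<eta>: "test_fun \<Omega> \<eta>" "open U" "closure {x. \<psi> x \<noteq> 0} \<subseteq> U" "\<And>x. x \<in> U ==> \<eta> x = 1"
  using test_fun_cutoff[OF tD(2,3) \<Omega>] by metis
 define W where "W = (\<lambda>x. \<eta> x *\<^sub>R V x + u x *\<^sub>R grad \<eta> x)"
 note m = is_weak_gradient_mult[OF \<Omega> \<eta>(1) w, folded W_def]
 have t1: "test_fun UNIV \<psi>" using tD by (simp add: test_fun_def)
 have W: "W x = V x" if "x \<in> U" for x
 proof -
  have "(\<bullet>) 0 = (\<lambda>v::real^'n. 0 :: real)" by auto
  then have "((\<lambda>x. 1) has_derivative (\<bullet>) 0) (at x)" by simp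
  then have "(\<eta> has_derivative (\<bullet>) 0) (at x)"
   by (rule has_derivative_transform_within_open[OF _ \<eta>(2) that]) (simp add: \<eta>(4))
  from partial_gradI(2)[OF this] show ?thesis using \<eta>(4)[OF that] by (simp add: W_def)
 qed
 have zero: "\<psi> x = 0" "partial i \<psi> x = 0" if "x \<notin> U" for x
  using that \<eta>(3) closure_subset[of "{x. \<psi> x \<noteq> 0}"] grad_zero_off_closure(2)[of x \<psi> i] by auto
 have "(\<integral>x. max 0 (- u x) * partial i \<psi> x \<partial>lebesgue) = (\<integral>x. max 0 (- (\<eta> x * u x)) * partial i \<psi> x \<partial>lebesgue)"
 proof (rule Bochner_Integration.integral_cong[OF refl])
  show "max 0 (- u x) * partial i \<psi> x = max 0 (- (\<eta> x * u x)) * partial i \<psi> x" for x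
   by (cases "x \<in> U") (simp_all add: zero \<eta>(4))
 qed
 also have "\<dots> = - (\<integral>x. (sgn (\<eta> x * u x) - 1) / 2 * W x $ i * \<psi> x \<partial>lebesgue)"
  by (rule weak_gradient_negpart_UNIV[OF m t1])
 also have "(\<integral>x. (sgn (\<eta> x * u x) - 1) / 2 * W x $ i * \<psi> x \<partial>lebesgue)
   = (\<integral>x. (((sgn (u x) - 1) / 2) *\<^sub>R V x) $ i * \<psi> x \<partial>lebesgue)"
 proof (rule Bochner_Integration.integral_cong[OF refl])
  show "(sgn (\<eta> x * u x) - 1) / 2 * W x $ i * \<psi> x = (((sgn (u x) - 1) / 2) *\<^sub>R V x) $ i * \<psi> x" for x
   by (cases "x \<in> U") (simp_all add: zero \<eta>(4) W)
 qed
 finally show "(\<integral>x. max 0 (- u x) * partial i \<psi> x \<partial>lebesgue_on \<Omega>)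
   = - (\<integral>x. (((sgn (u x) - 1) / 2) *\<^sub>R V x) $ i * \<psi> x \<partial>lebesgue_on \<Omega>)"
  unfolding test_integral_UNIV[OF \<Omega> t] .
qed

section \<open>Lebesgue spaces\<close>

definition Lp_pow :: "'a measure => real => ('a => 'b::real_normed_vector) => ennreal" where
 "Lp_pow M p f = (\<integral>\<^sup>+x. ennreal (norm (f x) powr p) \<partial>M)"

lemma tendsto_Lp_iff: "tendsto_Lp M p w f \<longleftrightarrow> (\<lambda>k. Lp_pow M p (\<lambda>x. w k x - f x)) \<longlonglongrightarrow> 0"
 by (simp add: tendsto_Lp_def Lp_pow_def)

lemma in_Lp_iff: "in_Lp M p f \<longleftrightarrow> f \<in> borel_measurable M \<and> Lp_pow M p f < \<infinity>"
 unfolding in_Lp_def Lp_pow_def integrable_iff_bounded by auto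

lemma in_Lp_measurable [measurable_dest]: "in_Lp M p f ==> f \<in> borel_measurable M"
 by (simp add: in_Lp_def)

lemma Lp_pow_mono:
 assumes "\<And>x. x \<in> space M ==> norm (f x) \<le> norm (g x)" "0 \<le> p"
 shows "Lp_pow M p f \<le> Lp_pow M p g"
 unfolding Lp_pow_def by (intro nn_integral_mono ennreal_leI powr_mono2) (use assms in auto)

lemma Lp_pow_cong_AE: "AE x in M. f x = g x ==> Lp_pow M p f = Lp_pow M p g"
 unfolding Lp_pow_def by (intro nn_integral_cong_AE) auto

lemma Lp_pow_add_le:
 fixes f g :: "'a => 'b::euclidean_space"
 assumes [measurable]: "f \<in> borel_measurable M" "g \<in> borel_measurable M" and p: "0 \<le> p"
 shows "Lp_pow M p (\<lambda>x. f x + g x) \<le> ennreal (2 powr p) * (Lp_pow M p f + Lp_pow M p g)"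
proof -
 have "Lp_pow M p (\<lambda>x. f x + g x)
   \<le> (\<integral>\<^sup>+x. ennreal (2 powr p) * (ennreal (norm (f x) powr p) + ennreal (norm (g x) powr p)) \<partial>M)"
  unfolding Lp_pow_def
 proof (intro nn_integral_mono)
  fix x
  have "ennreal (norm (f x + g x) powr p) \<le> ennreal (2 powr p * (norm (f x) powr p + norm (g x) powr p))"
   by (rule ennreal_leI[OF norm_add_powr_le[OF p]])
  then show "ennreal (norm (f x + g x) powr p)
    \<le> ennreal (2 powr p) * (ennreal (norm (f x) powr p) + ennreal (norm (g x) powr p))"
   by (simp add: ennreal_mult ennreal_plus)
 qed
 also have "\<dots> = ennreal (2 powr p) * (Lp_pow M p f + Lp_pow M p g)"
  unfolding Lp_pow_def by (subst nn_integral_cmult, measurable, subst nn_integral_add) measurable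
 finally show ?thesis .
qed

lemma Lp_pow_scaleR:
 fixes f :: "'a => 'b::euclidean_space"
 assumes [measurable]: "f \<in> borel_measurable M"
 shows "Lp_pow M p (\<lambda>x. c *\<^sub>R f x) = ennreal (\<bar>c\<bar> powr p) * Lp_pow M p f"
 unfolding Lp_pow_def
 by (subst nn_integral_cmult[symmetric]) (auto simp: powr_mult ennreal_mult)

lemma Lp_pow_diff_commute: "Lp_pow M p (\<lambda>x. f x - g x) = Lp_pow M p (\<lambda>x. g x - f x)"
 by (simp add: Lp_pow_def norm_minus_commute)

lemma Lp_pow_diff_triangle:
 fixes f g h :: "'a => 'b::euclidean_space"
 assumes [measurable]: "f \<in> borel_measurable M" "g \<in> borel_measurable M" "h \<in> borel_measurable M" and p: "0 \<le> p"
 shows "Lp_pow M p (\<lambda>x. f x - h x) \<le> ennreal (2 powr p) * (Lp_pow M p (\<lambda>x. f x - g x) + Lp_pow M p (\<lambda>x. g x - h x))"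
 using Lp_pow_add_le[of "\<lambda>x. f x - g x" M "\<lambda>x. g x - h x" p] p by simp

lemma in_Lp_linear:
 assumes f: "in_Lp M p f" and g: "in_Lp M p g" and p: "0 \<le> p"
 shows "in_Lp M p (\<lambda>x. a *\<^sub>R f x + b *\<^sub>R g x)"
proof -
 have [measurable]: "f \<in> borel_measurable M" "g \<in> borel_measurable M" using f g by (auto simp: in_Lp_iff)
 have "Lp_pow M p (\<lambda>x. a *\<^sub>R f x + b *\<^sub>R g x)
   \<le> ennreal (2 powr p) * (ennreal (\<bar>a\<bar> powr p) * Lp_pow M p f + ennreal (\<bar>b\<bar> powr p) * Lp_pow M p g)"
  using Lp_pow_add_le[of "\<lambda>x. a *\<^sub>R f x" M "\<lambda>x. b *\<^sub>R g x" p] p by (simp add: Lp_pow_scaleR)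
 also have "\<dots> < \<infinity>"
  using f g by (auto simp: in_Lp_iff less_top[symmetric] ennreal_mult_eq_top_iff ennreal_add_eq_top)
 finally show ?thesis by (simp add: in_Lp_iff)
qed

lemma in_Lp_add: "in_Lp M p f ==> in_Lp M p g ==> 0 \<le> p ==> in_Lp M p (\<lambda>x. f x + g x)"
 using in_Lp_linear[of M p f g 1 1] by simp

lemma in_Lp_diff: "in_Lp M p f ==> in_Lp M p g ==> 0 \<le> p ==> in_Lp M p (\<lambda>x. f x - g x)"
 using in_Lp_linear[of M p f g 1 "-1"] by simp

lemma in_Lp_bound:
 assumes "in_Lp M p g" "f \<in> borel_measurable M" "\<And>x. x \<in> space M ==> norm (f x) \<le> norm (g x)" "0 \<le> p"
 shows "in_Lp M p f"
 using assms Lp_pow_mono[of M f g p] by (auto simp: in_Lp_iff intro: le_less_trans)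

lemma tendsto_Lp_linear:
 fixes w w' :: "nat => 'a => 'b::euclidean_space"
 assumes "tendsto_Lp M p w f" "tendsto_Lp M p w' g" and p: "0 \<le> p"
  and [measurable]: "\<And>k. w k \<in> borel_measurable M" "\<And>k. w' k \<in> borel_measurable M"
   "f \<in> borel_measurable M" "g \<in> borel_measurable M"
 shows "tendsto_Lp M p (\<lambda>k x. a *\<^sub>R w k x + b *\<^sub>R w' k x) (\<lambda>x. a *\<^sub>R f x + b *\<^sub>R g x)"
 unfolding tendsto_Lp_iff
proof (rule ennreal_tendsto_0_mono)
 let ?A = "\<lambda>k. Lp_pow M p (\<lambda>x. w k x - f x)" and ?B = "\<lambda>k. Lp_pow M p (\<lambda>x. w' k x - g x)"
 show "Lp_pow M p (\<lambda>x. a *\<^sub>R w k x + b *\<^sub>R w' k x - (a *\<^sub>R f x + b *\<^sub>R g x))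
   \<le> ennreal (2 powr p) * (ennreal (\<bar>a\<bar> powr p) * ?A k + ennreal (\<bar>b\<bar> powr p) * ?B k)" for k
 proof -
  have "a *\<^sub>R w k x + b *\<^sub>R w' k x - (a *\<^sub>R f x + b *\<^sub>R g x) = a *\<^sub>R (w k x - f x) + b *\<^sub>R (w' k x - g x)" for x
   by (simp add: algebra_simps)
  then show ?thesis
   using Lp_pow_add_le[of "\<lambda>x. a *\<^sub>R (w k x - f x)" M "\<lambda>x. b *\<^sub>R (w' k x - g x)" p] p
   by (simp add: Lp_pow_scaleR)
 qed
 have "(\<lambda>k. ennreal (2 powr p) * (ennreal (\<bar>a\<bar> powr p) * ?A k + ennreal (\<bar>b\<bar> powr p) * ?B k))
   \<longlonglongrightarrow> ennreal (2 powr p) * (ennreal (\<bar>a\<bar> powr p) * 0 + ennreal (\<bar>b\<bar> powr p) * 0)"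
  using assms(1,2) unfolding tendsto_Lp_iff by (intro ennreal_tendsto_cmult tendsto_add) auto
 then show "(\<lambda>k. ennreal (2 powr p) * (ennreal (\<bar>a\<bar> powr p) * ?A k + ennreal (\<bar>b\<bar> powr p) * ?B k)) \<longlonglongrightarrow> 0" by simp
qed

lemma real_le_eps_plus_powr:
 fixes a \<eta> p :: real
 assumes "0 \<le> a" "0 < \<eta>" "1 \<le> p"
 shows "a \<le> \<eta> + \<eta> powr (1 - p) * a powr p"
proof (cases "a \<le> \<eta>")
 case False
 have "a = a powr (1 - p) * a powr p" using assms False by (simp add: powr_add[symmetric])
 also have "a powr (1 - p) \<le> \<eta> powr (1 - p)"
  using assms False by (intro powr_mono2') auto
 finally have "a \<le> \<eta> powr (1 - p) * a powr p" by (simp add: mult_right_mono)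
 then show ?thesis using assms by linarith
next
 case True
 then show ?thesis by (smt (verit) mult_nonneg_nonneg powr_ge_zero)
qed

lemma in_Lp_integrable:
 assumes "finite_measure M" "in_Lp M p f" "1 \<le> p"
 shows "integrable M f"
proof (rule Bochner_Integration.integrable_bound)
 interpret finite_measure M by fact
 show "integrable M (\<lambda>x. 1 + norm (f x) powr p)" using assms by (simp add: in_Lp_def)
 show "f \<in> borel_measurable M" using assms by (simp add: in_Lp_def)
 show "AE x in M. norm (f x) \<le> norm (1 + norm (f x) powr p)"
  using real_le_eps_plus_powr[of "norm (f _)" 1 p] assms by (intro AE_I2) simp
qed

lemma tendsto_Lp_imp_L1:
 fixes a :: "nat => 'a => 'b::euclidean_space"
 assumes M: "finite_measure M" and a: "\<And>k. in_Lp M p (a k)" "(\<lambda>k. Lp_pow M p (a k)) \<longlonglongrightarrow> 0" and p: "1 \<le> p"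
 shows "(\<lambda>k. \<integral>\<^sup>+x. ennreal (norm (a k x)) \<partial>M) \<longlonglongrightarrow> 0" "(\<lambda>k. \<integral>x. norm (a k x) \<partial>M) \<longlonglongrightarrow> 0"
proof -
 interpret finite_measure M by fact
 have [measurable]: "a k \<in> borel_measurable M" for k using a(1) by (simp add: in_Lp_iff)
 define m where "m = measure M (space M)"
 have m: "emeasure M (space M) = ennreal m" "0 \<le> m" by (auto simp: m_def emeasure_eq_measure)
 show nn: "(\<lambda>k. \<integral>\<^sup>+x. ennreal (norm (a k x)) \<partial>M) \<longlonglongrightarrow> 0"
  unfolding ennreal_tendsto_0_iff
 proof (intro allI impI)
  fix e :: real assume e: "e > 0"
  define \<eta> where "\<eta> = e / (2 * (m + 1))"
  have \<eta>: "\<eta> > 0" "\<eta> * m \<le> e / 2" using e m(2) by (auto simp: \<eta>_def field_simps)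
  define c where "c = \<eta> powr (1 - p)"
  have c: "c > 0" using \<eta> by (simp add: c_def)
  have "e / (2 * c) > 0" using e c by simp
  with a(2) have "\<forall>\<^sub>F k in sequentially. Lp_pow M p (a k) \<le> ennreal (e / (2 * c))"
   unfolding ennreal_tendsto_0_iff by blast
  then show "\<forall>\<^sub>F k in sequentially. (\<integral>\<^sup>+x. ennreal (norm (a k x)) \<partial>M) \<le> ennreal e"
  proof eventually_elim
   case (elim k)
   have "(\<integral>\<^sup>+x. ennreal (norm (a k x)) \<partial>M) \<le> (\<integral>\<^sup>+x. ennreal \<eta> + ennreal c * ennreal (norm (a k x) powr p) \<partial>M)"
   proof (rule nn_integral_mono)
    fix x
    have "ennreal (norm (a k x)) \<le> ennreal (\<eta> + c * norm (a k x) powr p)"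
     unfolding c_def by (rule ennreal_leI[OF real_le_eps_plus_powr]) (use \<eta> p in auto)
    then show "ennreal (norm (a k x)) \<le> ennreal \<eta> + ennreal c * ennreal (norm (a k x) powr p)"
     using \<eta> c by (simp add: ennreal_plus ennreal_mult)
   qed
   also have "\<dots> = ennreal \<eta> * ennreal m + ennreal c * Lp_pow M p (a k)"
    unfolding Lp_pow_def by (subst nn_integral_add) (auto simp: nn_integral_cmult m)
   also have "\<dots> \<le> ennreal (e/2) + ennreal c * ennreal (e / (2 * c))"
    using elim \<eta> m(2) by (intro add_mono mult_left_mono) (auto simp: ennreal_mult[symmetric] intro!: ennreal_leI)
   also have "\<dots> = ennreal e"
    using c e by (simp add: ennreal_mult[symmetric] ennreal_plus[symmetric] del: ennreal_plus)
   finally show ?case .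
  qed
 qed
 have i: "integrable M (\<lambda>x. norm (a k x))" for k
  using in_Lp_integrable[OF M a(1) p] by simp
 have "(\<lambda>k. ennreal (\<integral>x. norm (a k x) \<partial>M)) \<longlonglongrightarrow> ennreal 0"
  using nn nn_integral_eq_integral[OF i] by simp
 then show "(\<lambda>k. \<integral>x. norm (a k x) \<partial>M) \<longlonglongrightarrow> 0"
  by (subst (asm) tendsto_ennreal_iff) auto
qed

section \<open>Sobolev functions and zero traces\<close>

lemma finite_measure_bounded_open:
 assumes "open (\<Omega> :: (real^'n::finite) set)" "bounded \<Omega>"
 shows "finite_measure (lebesgue_on \<Omega>)"
 using assms by (intro finite_measure_lebesgue_on) (simp add: lmeasurable_open)

lemma measurable_lebesgue_on_AE_cong:
 fixes f g :: "real^'n::finite => 'b::euclidean_space"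
 assumes \<Omega>: "open \<Omega>" and f: "f \<in> borel_measurable (lebesgue_on \<Omega>)"
  and ae: "AE x in lebesgue_on \<Omega>. f x = g x"
 shows "g \<in> borel_measurable (lebesgue_on \<Omega>)"
proof -
 have S: "\<Omega> \<in> sets lebesgue" using \<Omega> by auto
 have "(\<lambda>x. if x \<in> \<Omega> then f x else 0) \<in> borel_measurable lebesgue"
  using f by (simp add: borel_measurable_if[OF S])
 moreover have "AE x in lebesgue. (if x \<in> \<Omega> then f x else 0) = (if x \<in> \<Omega> then g x else 0)"
  using ae unfolding AE_lebesgue_on_iff[OF \<Omega>] by eventually_elim auto
 ultimately have "(\<lambda>x. if x \<in> \<Omega> then g x else 0) \<in> borel_measurable lebesgue"
  by (rule borel_measurable_AE)
 then show ?thesis by (simp add: borel_measurable_if[OF S])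
qed

lemma in_Lp_AE_cong:
 fixes f g :: "real^'n::finite => 'b::euclidean_space"
 assumes "open \<Omega>" "in_Lp (lebesgue_on \<Omega>) p f" "AE x in lebesgue_on \<Omega>. f x = g x"
 shows "in_Lp (lebesgue_on \<Omega>) p g"
 using assms measurable_lebesgue_on_AE_cong[OF assms(1) _ assms(3)] Lp_pow_cong_AE[OF assms(3), of p]
 by (simp add: in_Lp_iff)

lemma continuous_measurable_lebesgue_on:
 fixes f :: "real^'n::finite => 'b::euclidean_space"
 assumes "continuous_on UNIV f"
 shows "f \<in> borel_measurable (lebesgue_on \<Omega>)"
 using borel_measurable_lebesgue_continuous(1)[OF assms] by (rule measurable_restrict_space1)

lemma locally_integrable_of_integrable:
 fixes f :: "real^'n::finite => 'b::euclidean_space"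
 assumes "open \<Omega>" "integrable (lebesgue_on \<Omega>) f"
 shows "locally_integrable \<Omega> f"
 unfolding locally_integrable_def
proof (intro allI impI)
 fix K assume K: "compact K \<and> K \<subseteq> \<Omega>"
 have "set_integrable lebesgue \<Omega> f"
  using assms by (simp add: set_integrable_def integrable_restrict_space)
 then show "set_integrable lebesgue K f"
  by (rule set_integrable_subset) (use K in \<open>auto intro: fmeasurableD lmeasurable_compact\<close>)
qed

text \<open>A weak gradient is determined only up to a null set; carrying it along explicitly avoids the choice made
 by \<open>weak_grad\<close>.\<close>

definition W1p :: "real => (real^'n::finite) set => (real^'n => real) => (real^'n => real^'n) => bool" where
 "W1p p \<Omega> u V \<longleftrightarrow> in_Lp (lebesgue_on \<Omega>) p u \<and> in_Lp (lebesgue_on \<Omega>) p V \<and> is_weak_gradient \<Omega> u V"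

lemma W1p_D:
 assumes "W1p p \<Omega> u V"
 shows "in_Lp (lebesgue_on \<Omega>) p u" "in_Lp (lebesgue_on \<Omega>) p V" "is_weak_gradient \<Omega> u V"
  "u \<in> borel_measurable (lebesgue_on \<Omega>)" "V \<in> borel_measurable (lebesgue_on \<Omega>)"
 using assms by (auto simp: W1p_def in_Lp_iff)

lemma W1p_linear:
 assumes "open \<Omega>" "W1p p \<Omega> u V" "W1p p \<Omega> v W" "0 \<le> p"
 shows "W1p p \<Omega> (\<lambda>x. a * u x + b * v x) (\<lambda>x. a *\<^sub>R V x + b *\<^sub>R W x)"
 using assms in_Lp_linear[of "lebesgue_on \<Omega>" p u v a b] in_Lp_linear[of "lebesgue_on \<Omega>" p V W a b]
 unfolding W1p_def by (auto intro: is_weak_gradient_linear)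

lemma weak_grad_AE:
 assumes "open \<Omega>" "is_weak_gradient \<Omega> u V"
 shows "AE x in lebesgue_on \<Omega>. weak_grad \<Omega> u x = V x"
 unfolding AE_lebesgue_on_iff[OF assms(1)] weak_grad_def
 by (rule weak_gradient_unique[OF assms(1) someI[of "is_weak_gradient \<Omega> u"] assms(2)]) (rule assms(2))

lemma sobolev_W1p:
 assumes \<Omega>: "open \<Omega>"
 shows "u \<in> sobolev p \<Omega> \<longleftrightarrow> (\<exists>V. W1p p \<Omega> u V)"
proof
 assume "u \<in> sobolev p \<Omega>"
 then have "W1p p \<Omega> u (weak_grad \<Omega> u)"
  unfolding sobolev_def W1p_def weak_grad_def using someI[of "is_weak_gradient \<Omega> u"] by blast
 then show "\<exists>V. W1p p \<Omega> u V" by blast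
next
 assume "\<exists>V. W1p p \<Omega> u V"
 then obtain V where V: "W1p p \<Omega> u V" ..
 note D = W1p_D[OF V]
 have "AE x in lebesgue_on \<Omega>. V x = weak_grad \<Omega> u x"
  using weak_grad_AE[OF \<Omega> D(3)] by eventually_elim auto
 from in_Lp_AE_cong[OF \<Omega> D(2) this] show "u \<in> sobolev p \<Omega>"
  using D unfolding sobolev_def by blast
qed

definition trace_zero :: "real => (real^'n::finite) set => (real^'n => real) => (real^'n => real^'n) => bool" where
 "trace_zero p \<Omega> z Z \<longleftrightarrow> W1p p \<Omega> z Z \<and>
   (\<exists>w. (\<forall>k. smooth_on UNIV (w k)) \<and> tendsto_Lp (lebesgue_on \<Omega>) p w z \<and>
    tendsto_Lp (lebesgue_on \<Omega>) p (\<lambda>k. grad (w k)) Z \<and> tendsto_Lp (surface_measure \<Omega>) p w (\<lambda>x. 0))"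

lemma tendsto_Lp_cong_AE:
 assumes "AE x in M. f x = g x"
 shows "tendsto_Lp M p w f \<longleftrightarrow> tendsto_Lp M p w g"
proof -
 have "Lp_pow M p (\<lambda>x. w k x - f x) = Lp_pow M p (\<lambda>x. w k x - g x)" for k
  by (rule Lp_pow_cong_AE) (use assms in auto)
 then show ?thesis by (simp add: tendsto_Lp_iff)
qed

lemma has_trace_zero_iff:
 assumes \<Omega>: "open \<Omega>"
 shows "has_trace p \<Omega> z (\<lambda>x. 0) \<longleftrightarrow> (\<exists>Z. trace_zero p \<Omega> z Z)"
proof
 assume "has_trace p \<Omega> z (\<lambda>x. 0)"
 then have "trace_zero p \<Omega> z (weak_grad \<Omega> z)"
  unfolding has_trace_def trace_zero_def sobolev_def W1p_def weak_grad_def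
  using someI[of "is_weak_gradient \<Omega> z"] by blast
 then show "\<exists>Z. trace_zero p \<Omega> z Z" by blast
next
 assume "\<exists>Z. trace_zero p \<Omega> z Z"
 then obtain Z where Z: "trace_zero p \<Omega> z Z" ..
 then have W: "W1p p \<Omega> z Z" by (simp add: trace_zero_def)
 have "AE x in lebesgue_on \<Omega>. weak_grad \<Omega> z x = Z x" by (rule weak_grad_AE[OF \<Omega> W1p_D(3)[OF W]])
 from tendsto_Lp_cong_AE[OF this] Z W show "has_trace p \<Omega> z (\<lambda>x. 0)"
  unfolding has_trace_def trace_zero_def sobolev_W1p[OF \<Omega>] by (auto simp: in_Lp_def)
qed

lemma is_weak_gradient_limit:
 fixes u :: "real^'n::finite => real"
 assumes \<Omega>: "open \<Omega>" "bounded \<Omega>" and p: "1 \<le> p" and uk: "\<And>k. W1p p \<Omega> (uk k) (Vk k)"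
  and u: "in_Lp (lebesgue_on \<Omega>) p u" "in_Lp (lebesgue_on \<Omega>) p V"
  and lim: "tendsto_Lp (lebesgue_on \<Omega>) p uk u" "tendsto_Lp (lebesgue_on \<Omega>) p Vk V"
 shows "W1p p \<Omega> u V"
proof -
 note fin = finite_measure_bounded_open[OF \<Omega>]
 note int = in_Lp_integrable[OF fin _ p]
 have p0: "0 \<le> p" using p by simp
 have "is_weak_gradient \<Omega> u V" unfolding is_weak_gradient_def
 proof (intro conjI allI impI)
  show "locally_integrable \<Omega> u" "locally_integrable \<Omega> V"
   by (intro locally_integrable_of_integrable[OF \<Omega>(1)] int u)+
  fix \<psi> :: "real^'n => real" and i assume t: "test_fun \<Omega> \<psi>"
  obtain R where R: "supported_in_ball R \<psi>" using test_funD(4)[OF t] by blast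
  note s\<psi> = test_funD(1)[OF t]
  have c\<psi>: "continuous_on UNIV \<psi>" "continuous_on UNIV (partial i \<psi>)"
   using s\<psi> by (auto intro: smooth_continuous smooth_partial)
  obtain M0 where M0: "M0 > 0" "\<And>x. \<bar>\<psi> x\<bar> \<le> M0" using supported_bounded[OF c\<psi>(1) R] by blast
  obtain M1 where M1: "M1 > 0" "\<And>x. \<bar>partial i \<psi> x\<bar> \<le> M1"
   using supported_bounded[OF c\<psi>(2) supported_partial[OF R]] by blast
  have lim_int: "(\<lambda>k. \<integral>x. f k x * c x \<partial>lebesgue_on \<Omega>) \<longlonglongrightarrow> (\<integral>x. g x * c x \<partial>lebesgue_on \<Omega>)"
   if f: "\<And>k. integrable (lebesgue_on \<Omega>) (f k)" and g: "integrable (lebesgue_on \<Omega>) g"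
    and c: "continuous_on UNIV c" "\<And>x. \<bar>c x\<bar> \<le> B"
    and lim: "(\<lambda>k. \<integral>x. \<bar>f k x - g x\<bar> \<partial>lebesgue_on \<Omega>) \<longlonglongrightarrow> 0"
   for f :: "nat => real^'n => real" and g c B
  proof -
   note cm = continuous_measurable_lebesgue_on[OF c(1), of \<Omega>]
   have i: "integrable (lebesgue_on \<Omega>) (\<lambda>x. f k x - g x)" for k using f g by simp
   have *: "(\<lambda>k. \<integral>x. c x * (f k x - g x) \<partial>lebesgue_on \<Omega>) \<longlonglongrightarrow> 0"
    by (rule integral_bounded_mult_tendsto_0(2)[OF i lim cm c(2)])
   have "(\<integral>x. c x * (f k x - g x) \<partial>lebesgue_on \<Omega>)
     = (\<integral>x. f k x * c x \<partial>lebesgue_on \<Omega>) - (\<integral>x. g x * c x \<partial>lebesgue_on \<Omega>)" for k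
    by (subst Bochner_Integration.integral_diff[OF integrable_mult_bounded[OF f cm c(2)]
       integrable_mult_bounded[OF g cm c(2)], symmetric]) (simp add: algebra_simps)
   with * have "(\<lambda>k. (\<integral>x. f k x * c x \<partial>lebesgue_on \<Omega>) - (\<integral>x. g x * c x \<partial>lebesgue_on \<Omega>)) \<longlonglongrightarrow> 0" by simp
   then show ?thesis by (rule LIM_zero_cancel)
  qed
  have Li: "(\<lambda>k. \<integral>x. \<bar>uk k x - u x\<bar> \<partial>lebesgue_on \<Omega>) \<longlonglongrightarrow> 0"
   using tendsto_Lp_imp_L1(2)[OF fin in_Lp_diff[OF W1p_D(1)[OF uk] u(1) p0] _ p] lim(1)
   by (simp add: tendsto_Lp_iff)
  have LV: "(\<lambda>k. \<integral>x. norm (Vk k x - V x) \<partial>lebesgue_on \<Omega>) \<longlonglongrightarrow> 0"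
   using tendsto_Lp_imp_L1(2)[OF fin in_Lp_diff[OF W1p_D(2)[OF uk] u(2) p0] _ p] lim(2)
   by (simp add: tendsto_Lp_iff)
  have iV: "integrable (lebesgue_on \<Omega>) (\<lambda>x. Vk k x $ i)" "integrable (lebesgue_on \<Omega>) (\<lambda>x. V x $ i)" for k
   by (intro integrable_bounded_linear[OF bounded_linear_vec_nth] int W1p_D(2)[OF uk] u)+
  have LVi: "(\<lambda>k. \<integral>x. \<bar>Vk k x $ i - V x $ i\<bar> \<partial>lebesgue_on \<Omega>) \<longlonglongrightarrow> 0"
  proof (rule real_tendsto_0_mono[OF _ _ LV])
   fix k
   show "(\<integral>x. \<bar>Vk k x $ i - V x $ i\<bar> \<partial>lebesgue_on \<Omega>) \<le> (\<integral>x. norm (Vk k x - V x) \<partial>lebesgue_on \<Omega>)"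
   proof (rule integral_mono)
    show "integrable (lebesgue_on \<Omega>) (\<lambda>x. \<bar>Vk k x $ i - V x $ i\<bar>)" using iV(1)[of k] iV(2) by simp
    show "integrable (lebesgue_on \<Omega>) (\<lambda>x. norm (Vk k x - V x))"
     by (intro integrable_norm int in_Lp_diff[OF W1p_D(2)[OF uk] u(2) p0])
    show "\<bar>Vk k x $ i - V x $ i\<bar> \<le> norm (Vk k x - V x)" for x
     by (metis component_le_norm_cart vector_minus_component)
   qed
  qed simp
  have "(\<lambda>k. \<integral>x. uk k x * partial i \<psi> x \<partial>lebesgue_on \<Omega>) \<longlonglongrightarrow> (\<integral>x. u x * partial i \<psi> x \<partial>lebesgue_on \<Omega>)"
   by (rule lim_int[OF int[OF W1p_D(1)[OF uk]] int[OF u(1)] c\<psi>(2) M1(2) Li])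
  moreover have "(\<lambda>k. \<integral>x. Vk k x $ i * \<psi> x \<partial>lebesgue_on \<Omega>) \<longlonglongrightarrow> (\<integral>x. V x $ i * \<psi> x \<partial>lebesgue_on \<Omega>)"
   by (rule lim_int[OF iV c\<psi>(1) M0(2) LVi])
  moreover have "(\<integral>x. uk k x * partial i \<psi> x \<partial>lebesgue_on \<Omega>) = - (\<integral>x. Vk k x $ i * \<psi> x \<partial>lebesgue_on \<Omega>)" for k
   by (rule is_weak_gradientD(3)[OF W1p_D(3)[OF uk] t])
  ultimately show "(\<integral>x. u x * partial i \<psi> x \<partial>lebesgue_on \<Omega>) = - (\<integral>x. V x $ i * \<psi> x \<partial>lebesgue_on \<Omega>)"
   using LIMSEQ_unique[OF _ tendsto_minus] by simp
 qed
 then show ?thesis using u by (simp add: W1p_def)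
qed

lemma sets_surface_measure: "(\<And>x. f \<in> borel_measurable borel) ==> f \<in> borel_measurable (surface_measure \<Omega>)"
 unfolding surface_measure_def hausdorff_measure_def
 by (intro measurable_restrict_space1) (simp add: measurable_def)

lemma trace_zero_W1p: "trace_zero p \<Omega> z Z ==> W1p p \<Omega> z Z"
 by (simp add: trace_zero_def)

lemma smooth_measurable:
 assumes "smooth_on UNIV w"
 shows "w \<in> borel_measurable (lebesgue_on \<Omega>)" "grad w \<in> borel_measurable (lebesgue_on \<Omega>)"
  "w \<in> borel_measurable (surface_measure \<Omega>)"
  "w \<in> borel_measurable borel" "grad w \<in> borel_measurable borel"
proof -
 note c = smooth_continuous[OF assms] smooth_grad_continuous[OF assms]
 show "w \<in> borel_measurable (lebesgue_on \<Omega>)" "grad w \<in> borel_measurable (lebesgue_on \<Omega>)"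
  using c by (auto intro: continuous_measurable_lebesgue_on)
 show b: "w \<in> borel_measurable borel" "grad w \<in> borel_measurable borel"
  using c by (auto intro: borel_measurable_lebesgue_continuous)
 show "w \<in> borel_measurable (surface_measure \<Omega>)" using b by (intro sets_surface_measure)
qed

lemma trace_zeroE:
 assumes "trace_zero p \<Omega> z Z"
 obtains w where "\<forall>k. smooth_on UNIV (w k)" "tendsto_Lp (lebesgue_on \<Omega>) p w z"
  "tendsto_Lp (lebesgue_on \<Omega>) p (\<lambda>k. grad (w k)) Z" "tendsto_Lp (surface_measure \<Omega>) p w (\<lambda>x. 0)"
 using assms unfolding trace_zero_def by (elim conjE exE) (rule that)

lemma trace_zero_linear:
 fixes z v :: "real^'n::finite => real"
 assumes \<Omega>: "open \<Omega>" and z: "trace_zero p \<Omega> z Z" and v: "trace_zero p \<Omega> v Y" and p: "0 \<le> p"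
 shows "trace_zero p \<Omega> (\<lambda>x. a * z x + b * v x) (\<lambda>x. a *\<^sub>R Z x + b *\<^sub>R Y x)"
proof -
 obtain w1 where w1: "\<forall>k. smooth_on UNIV (w1 k)" "tendsto_Lp (lebesgue_on \<Omega>) p w1 z"
  "tendsto_Lp (lebesgue_on \<Omega>) p (\<lambda>k. grad (w1 k)) Z" "tendsto_Lp (surface_measure \<Omega>) p w1 (\<lambda>x. 0)"
  by (rule trace_zeroE[OF z])
 obtain w2 where w2: "\<forall>k. smooth_on UNIV (w2 k)" "tendsto_Lp (lebesgue_on \<Omega>) p w2 v"
  "tendsto_Lp (lebesgue_on \<Omega>) p (\<lambda>k. grad (w2 k)) Y" "tendsto_Lp (surface_measure \<Omega>) p w2 (\<lambda>x. 0)"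
  by (rule trace_zeroE[OF v])
 note Dz = W1p_D[OF trace_zero_W1p[OF z]] and Dv = W1p_D[OF trace_zero_W1p[OF v]]
 define w where "w k x = a * w1 k x + b * w2 k x" for k and x :: "real^'n"
 have 1: "smooth_on UNIV (w k)" for k
  unfolding w_def by (intro smooth_add smooth_mult smooth_const w1(1)[rule_format] w2(1)[rule_format])
 have 2: "tendsto_Lp (lebesgue_on \<Omega>) p w (\<lambda>x. a * z x + b * v x)"
  using tendsto_Lp_linear[OF w1(2) w2(2) p, of a b] w1(1) w2(1) Dz Dv
  by (simp add: w_def[abs_def] smooth_measurable)
 have "grad (w k) x = a *\<^sub>R grad (w1 k) x + b *\<^sub>R grad (w2 k) x" for k x
  unfolding w_def by (rule grad_linear_combination) (use w1(1) w2(1) smooth_differentiable in auto)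
 then have 3: "tendsto_Lp (lebesgue_on \<Omega>) p (\<lambda>k. grad (w k)) (\<lambda>x. a *\<^sub>R Z x + b *\<^sub>R Y x)"
  using tendsto_Lp_linear[OF w1(3) w2(3) p, of a b] w1(1) w2(1) Dz Dv
  by (simp add: smooth_measurable tendsto_Lp_iff)
 have 4: "tendsto_Lp (surface_measure \<Omega>) p w (\<lambda>x. 0)"
  using tendsto_Lp_linear[OF w1(4) w2(4) p, of a b] w1(1) w2(1)
  by (simp add: w_def[abs_def] smooth_measurable)
 show ?thesis
  unfolding trace_zero_def
  by (intro conjI allI exI[of _ w] W1p_linear[OF \<Omega> trace_zero_W1p[OF z] trace_zero_W1p[OF v] p] 1 2 3 4)
qed

lemma trace_zero_approx:
 fixes z :: "real^'n::finite => real"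
 assumes z: "trace_zero p \<Omega> z Z" and e: "e > 0"
 obtains w where "smooth_on UNIV w" "Lp_pow (lebesgue_on \<Omega>) p (\<lambda>x. w x - z x) \<le> ennreal e"
  "Lp_pow (lebesgue_on \<Omega>) p (\<lambda>x. grad w x - Z x) \<le> ennreal e"
  "Lp_pow (surface_measure \<Omega>) p w \<le> ennreal e"
proof -
 obtain w where w: "\<forall>k. smooth_on UNIV (w k)" "tendsto_Lp (lebesgue_on \<Omega>) p w z"
  "tendsto_Lp (lebesgue_on \<Omega>) p (\<lambda>k. grad (w k)) Z" "tendsto_Lp (surface_measure \<Omega>) p w (\<lambda>x. 0)"
  by (rule trace_zeroE[OF z])
 have "\<forall>\<^sub>F k in sequentially. Lp_pow (lebesgue_on \<Omega>) p (\<lambda>x. w k x - z x) \<le> ennreal e"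
  "\<forall>\<^sub>F k in sequentially. Lp_pow (lebesgue_on \<Omega>) p (\<lambda>x. grad (w k) x - Z x) \<le> ennreal e"
  "\<forall>\<^sub>F k in sequentially. Lp_pow (surface_measure \<Omega>) p (w k) \<le> ennreal e"
  using w(2-4) e unfolding tendsto_Lp_iff ennreal_tendsto_0_iff by auto
 then have "\<forall>\<^sub>F k in sequentially. Lp_pow (lebesgue_on \<Omega>) p (\<lambda>x. w k x - z x) \<le> ennreal e \<and>
  Lp_pow (lebesgue_on \<Omega>) p (\<lambda>x. grad (w k) x - Z x) \<le> ennreal e \<and> Lp_pow (surface_measure \<Omega>) p (w k) \<le> ennreal e"
  by (intro eventually_conj)
 then obtain k where "Lp_pow (lebesgue_on \<Omega>) p (\<lambda>x. w k x - z x) \<le> ennreal e \<and>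
  Lp_pow (lebesgue_on \<Omega>) p (\<lambda>x. grad (w k) x - Z x) \<le> ennreal e \<and> Lp_pow (surface_measure \<Omega>) p (w k) \<le> ennreal e"
  by (auto simp: eventually_sequentially)
 then show ?thesis using that[OF w(1)[rule_format, of k]] by blast
qed

lemma inverse_Suc_tendsto_0: "(\<lambda>k. ennreal (1 / real (Suc k))) \<longlonglongrightarrow> 0"
 using tendsto_ennrealI[OF LIMSEQ_inverse_real_of_nat] by (simp add: inverse_eq_divide)

text \<open>A diagonal choice among the approximating smooth functions.\<close>

lemma trace_zero_closed:
 fixes z :: "real^'n::finite => real"
 assumes \<Omega>: "open \<Omega>" "bounded \<Omega>" and p: "1 \<le> p" and zk: "\<And>k. trace_zero p \<Omega> (zk k) (Zk k)"
  and z: "in_Lp (lebesgue_on \<Omega>) p z" "in_Lp (lebesgue_on \<Omega>) p Z"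
  and lim: "tendsto_Lp (lebesgue_on \<Omega>) p zk z" "tendsto_Lp (lebesgue_on \<Omega>) p Zk Z"
 shows "trace_zero p \<Omega> z Z"
proof -
 have W: "W1p p \<Omega> z Z"
  by (rule is_weak_gradient_limit[OF \<Omega> p trace_zero_W1p[OF zk] z lim])
 define P where "P k w \<longleftrightarrow> smooth_on UNIV w \<and>
   Lp_pow (lebesgue_on \<Omega>) p (\<lambda>x. w x - zk k x) \<le> ennreal (1 / real (Suc k)) \<and>
   Lp_pow (lebesgue_on \<Omega>) p (\<lambda>x. grad w x - Zk k x) \<le> ennreal (1 / real (Suc k)) \<and>
   Lp_pow (surface_measure \<Omega>) p w \<le> ennreal (1 / real (Suc k))" for k w
 have "\<exists>w. P k w" for k
 proof -
  have e: "1 / real (Suc k) > 0" by simp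
  show ?thesis unfolding P_def
   by (rule trace_zero_approx[OF zk[of k] e]) (intro exI conjI)
 qed
 then obtain w where P: "\<And>k. P k (w k)" by metis
 have w: "\<And>k. smooth_on UNIV (w k)"
  "\<And>k. Lp_pow (lebesgue_on \<Omega>) p (\<lambda>x. w k x - zk k x) \<le> ennreal (1 / real (Suc k))"
  "\<And>k. Lp_pow (lebesgue_on \<Omega>) p (\<lambda>x. grad (w k) x - Zk k x) \<le> ennreal (1 / real (Suc k))"
  "\<And>k. Lp_pow (surface_measure \<Omega>) p (w k) \<le> ennreal (1 / real (Suc k))"
  using P unfolding P_def by simp_all
 have p0: "0 \<le> p" using p by simp
 have tri: "tendsto_Lp (lebesgue_on \<Omega>) p f h"
  if "\<And>k. Lp_pow (lebesgue_on \<Omega>) p (\<lambda>x. f k x - g k x) \<le> ennreal (1 / real (Suc k))" "tendsto_Lp (lebesgue_on \<Omega>) p g h"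
   "\<And>k. f k \<in> borel_measurable (lebesgue_on \<Omega>)" "\<And>k. g k \<in> borel_measurable (lebesgue_on \<Omega>)"
   "h \<in> borel_measurable (lebesgue_on \<Omega>)"
  for f g :: "nat => real^'n => 'c::euclidean_space" and h
  unfolding tendsto_Lp_iff
 proof (rule ennreal_tendsto_0_mono)
  show "Lp_pow (lebesgue_on \<Omega>) p (\<lambda>x. f k x - h x)
    \<le> ennreal (2 powr p) * (ennreal (1 / real (Suc k)) + Lp_pow (lebesgue_on \<Omega>) p (\<lambda>x. g k x - h x))" for k
   by (rule order_trans[OF Lp_pow_diff_triangle[OF that(3,4,5) p0]], intro mult_left_mono add_mono, rule that(1)) auto
  have "(\<lambda>k. ennreal (2 powr p) * (ennreal (1 / real (Suc k)) + Lp_pow (lebesgue_on \<Omega>) p (\<lambda>x. g k x - h x)))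
    \<longlonglongrightarrow> ennreal (2 powr p) * (0 + 0)"
   using that(2) unfolding tendsto_Lp_iff by (intro ennreal_tendsto_cmult tendsto_add inverse_Suc_tendsto_0) auto
  then show "(\<lambda>k. ennreal (2 powr p) * (ennreal (1 / real (Suc k)) + Lp_pow (lebesgue_on \<Omega>) p (\<lambda>x. g k x - h x))) \<longlonglongrightarrow> 0"
   by simp
 qed
 note D = W1p_D(4,5)[OF trace_zero_W1p[OF zk]] W1p_D(4,5)[OF W]
 have 1: "tendsto_Lp (lebesgue_on \<Omega>) p w z"
  by (rule tri[OF w(2) lim(1) smooth_measurable(1)[OF w(1)] D(1,3)])
 have 2: "tendsto_Lp (lebesgue_on \<Omega>) p (\<lambda>k. grad (w k)) Z"
  by (rule tri[OF w(3) lim(2) smooth_measurable(2)[OF w(1)] D(2,4)])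
 have 3: "tendsto_Lp (surface_measure \<Omega>) p w (\<lambda>x. 0)"
  unfolding tendsto_Lp_iff
  by (rule ennreal_tendsto_0_mono[OF _ inverse_Suc_tendsto_0]) (use w(4) in simp)
 show ?thesis unfolding trace_zero_def by (intro conjI allI exI[of _ w] W w(1) 1 2 3)
qed

section \<open>Hausdorff measure\<close>

definition hcost :: "real => 'a::metric_space set => ennreal" where
 "hcost d U = ennreal (unit_ball_vol d * (diameter U / 2) powr d)"

definition hcover :: "real => 'a::metric_space set => (nat => 'a set) => bool" where
 "hcover \<delta> A U \<longleftrightarrow> A \<subseteq> (\<Union>i. U i) \<and> (\<forall>i. bounded (U i) \<and> diameter (U i) \<le> \<delta>)"

lemma hausdorff_content_eq: "hausdorff_content d \<delta> A = (INF U\<in>{U. hcover \<delta> A U}. \<Sum>i. hcost d (U i))"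
 by (simp add: hausdorff_content_def hcost_def hcover_def)

lemma hcost_empty: "0 < d ==> hcost d {} = 0"
 by (simp add: hcost_def)

lemma content_le: "hcover \<delta> A U ==> hausdorff_content d \<delta> A \<le> (\<Sum>i. hcost d (U i))"
 unfolding hausdorff_content_eq by (rule INF_lower) simp

lemma content_greatest: "(\<And>U. hcover \<delta> A U ==> x \<le> (\<Sum>i. hcost d (U i))) ==> x \<le> hausdorff_content d \<delta> A"
 unfolding hausdorff_content_eq by (rule INF_greatest) simp

lemma content_antimono: "\<delta>' \<le> \<delta> ==> hausdorff_content d \<delta> A \<le> hausdorff_content d \<delta>' A"
 by (rule content_greatest, rule content_le) (auto simp: hcover_def intro: order_trans)

lemma content_mono: "A \<subseteq> B ==> hausdorff_content d \<delta> A \<le> hausdorff_content d \<delta> B"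
 by (rule content_greatest, rule content_le) (auto simp: hcover_def)

lemma content_le_outer: "0 < \<delta> ==> hausdorff_content d \<delta> A \<le> hausdorff_outer d A"
 unfolding hausdorff_outer_def by (rule SUP_upper) simp

lemma outer_least: "(\<And>\<delta>. 0 < \<delta> ==> hausdorff_content d \<delta> A \<le> x) ==> hausdorff_outer d A \<le> x"
 unfolding hausdorff_outer_def by (rule SUP_least) simp

lemma outer_mono: "A \<subseteq> B ==> hausdorff_outer d A \<le> hausdorff_outer d B"
 by (rule outer_least) (metis content_le_outer content_mono order_trans)

lemma outer_empty:
 assumes "0 < d" shows "hausdorff_outer d {} = 0"
proof -
 have "hausdorff_content d \<delta> ({} :: 'a set) \<le> 0" if "0 < \<delta>" for \<delta>
  using content_le[of \<delta> "{}" "\<lambda>i. {}" d] that by (simp add: hcover_def hcost_empty[OF assms])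
 then have "hausdorff_outer d ({} :: 'a set) \<le> 0" by (rule outer_least)
 then show ?thesis by simp
qed

lemma content_countably_subadditive:
 fixes A :: "nat => 'a::metric_space set"
 shows "hausdorff_content d \<delta> (\<Union>i. A i) \<le> (\<Sum>i. hausdorff_content d \<delta> (A i))"
proof (rule ennreal_le_epsilon)
 fix e :: real assume e: "0 < e" and fin: "(\<Sum>i. hausdorff_content d \<delta> (A i)) < top"
 have "\<exists>U. hcover \<delta> (A i) U \<and> (\<Sum>j. hcost d (U j)) \<le> hausdorff_content d \<delta> (A i) + ennreal (e * (1/2)^Suc i)" for i
 proof -
  have "hausdorff_content d \<delta> (A i) < top"
   using fin by (meson ennreal_suminf_lessD)
  then have "hausdorff_content d \<delta> (A i) < hausdorff_content d \<delta> (A i) + ennreal (e * (1/2)^Suc i)"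
   using e by (simp add: ennreal_add_left_cancel_less[where b=0, simplified] less_top)
  then show ?thesis
   unfolding hausdorff_content_eq INF_less_iff by (auto intro: less_imp_le)
 qed
 then obtain U where U: "\<And>i. hcover \<delta> (A i) (U i)"
   "\<And>i. (\<Sum>j. hcost d (U i j)) \<le> hausdorff_content d \<delta> (A i) + ennreal (e * (1/2)^Suc i)" by metis
 define W where "W n = U (fst (prod_decode n)) (snd (prod_decode n))" for n
 have "hcover \<delta> (\<Union>i. A i) W"
  unfolding hcover_def
 proof
  show "(\<Union>i. A i) \<subseteq> (\<Union>n. W n)"
  proof
   fix x assume "x \<in> (\<Union>i. A i)"
   then obtain i j where "x \<in> U i j" using U(1) unfolding hcover_def by blast
   then have "x \<in> W (prod_encode (i, j))" by (simp add: W_def)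
   then show "x \<in> (\<Union>n. W n)" by blast
  qed
 qed (use U(1) in \<open>auto simp: hcover_def W_def\<close>)
 then have "hausdorff_content d \<delta> (\<Union>i. A i) \<le> (\<Sum>n. hcost d (W n))" by (rule content_le)
 also have "\<dots> = (\<Sum>i. \<Sum>j. hcost d (U i j))"
 proof -
  have "(\<Sum>n. (\<lambda>(i,j). hcost d (U i j)) (prod_decode n)) = (\<Sum>i. \<Sum>j. hcost d (U i j))"
   by (rule suminf_ennreal_2dimen) simp
  then show ?thesis by (simp add: W_def case_prod_unfold o_def)
 qed
 also have "\<dots> \<le> (\<Sum>i. hausdorff_content d \<delta> (A i) + ennreal (e * (1/2)^Suc i))"
  by (intro suminf_le U(2)) auto
 also have "\<dots> = (\<Sum>i. hausdorff_content d \<delta> (A i)) + (\<Sum>i. ennreal (e * (1/2)^Suc i))"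
  by (rule suminf_add[symmetric]) auto
 also have "(\<Sum>i. ennreal (e * (1/2)^Suc i)) = ennreal e"
 proof -
  have "(\<lambda>i. e * (1/2)^Suc i) sums (e * 1)" by (intro sums_mult power_half_series)
  then show ?thesis using e by (subst suminf_ennreal2) (auto simp: sums_iff)
 qed
 finally show "hausdorff_content d \<delta> (\<Union>i. A i) \<le> (\<Sum>i. hausdorff_content d \<delta> (A i)) + ennreal e" .
qed

lemma outer_countably_subadditive:
 fixes A :: "nat => 'a::metric_space set"
 shows "hausdorff_outer d (\<Union>i. A i) \<le> (\<Sum>i. hausdorff_outer d (A i))"
proof (rule outer_least)
 fix \<delta> :: real assume "0 < \<delta>"
 have "hausdorff_content d \<delta> (\<Union>i. A i) \<le> (\<Sum>i. hausdorff_content d \<delta> (A i))"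
  by (rule content_countably_subadditive)
 also have "\<dots> \<le> (\<Sum>i. hausdorff_outer d (A i))"
  using \<open>0 < \<delta>\<close> by (intro suminf_le content_le_outer) auto
 finally show "hausdorff_content d \<delta> (\<Union>i. A i) \<le> (\<Sum>i. hausdorff_outer d (A i))" .
qed

lemma outer_subadditive: "0 < d ==> hausdorff_outer d (A \<union> B) \<le> hausdorff_outer d A + hausdorff_outer d B"
proof -
 assume d: "0 < d"
 let ?C = "\<lambda>i::nat. if i = 0 then A else if i = 1 then B else {}"
 have "(\<Union>i. ?C i) = A \<union> B" by (auto split: if_splits)
 then have "hausdorff_outer d (A \<union> B) \<le> (\<Sum>i. hausdorff_outer d (?C i))"
  using outer_countably_subadditive[of d ?C] by simp
 also have "\<dots> = (\<Sum>i<2. hausdorff_outer d (?C i))"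
  by (rule suminf_finite) (auto simp: outer_empty[OF d])
 finally show ?thesis by (simp add: numeral_2_eq_2)
qed

text \<open>Sets of small diameter meet at most one of two sets at positive distance.\<close>

lemma outer_metric_additive:
 fixes A B :: "'a::metric_space set"
 assumes d: "0 < d" and \<eta>: "0 < \<eta>" "\<And>x y. x \<in> A ==> y \<in> B ==> \<eta> \<le> dist x y"
 shows "hausdorff_outer d A + hausdorff_outer d B \<le> hausdorff_outer d (A \<union> B)"
proof -
 have small: "hausdorff_content d \<delta> A + hausdorff_content d \<delta> B \<le> hausdorff_content d \<delta> (A \<union> B)"
  if \<delta>: "0 < \<delta>" "\<delta> < \<eta>" for \<delta>
 proof (rule content_greatest)
  fix U assume U: "hcover \<delta> (A \<union> B) U"
  define UA where "UA i = (if U i \<inter> A = {} then {} else U i)" for i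
  define UB where "UB i = (if U i \<inter> B = {} then {} else U i)" for i
  have "hcover \<delta> A UA" "hcover \<delta> B UB"
   using U \<delta> unfolding hcover_def UA_def UB_def by auto blast+
  then have "hausdorff_content d \<delta> A + hausdorff_content d \<delta> B \<le> (\<Sum>i. hcost d (UA i)) + (\<Sum>i. hcost d (UB i))"
   by (intro add_mono content_le)
  also have "\<dots> = (\<Sum>i. hcost d (UA i) + hcost d (UB i))" by (rule suminf_add) auto
  also have "\<dots> \<le> (\<Sum>i. hcost d (U i))"
  proof (rule suminf_le)
   fix i
   have "U i \<inter> A = {} \<or> U i \<inter> B = {}"
   proof (rule ccontr)
    assume "\<not> ?thesis"
    then obtain x y where "x \<in> U i" "x \<in> A" "y \<in> U i" "y \<in> B" by blast
    then have "dist x y \<le> diameter (U i)" "\<eta> \<le> dist x y"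
     using U \<eta>(2) diameter_bounded_bound unfolding hcover_def by blast+
    moreover have "diameter (U i) \<le> \<delta>" using U unfolding hcover_def by blast
    ultimately show False using \<delta> by linarith
   qed
   then show "hcost d (UA i) + hcost d (UB i) \<le> hcost d (U i)"
    by (auto simp: UA_def UB_def hcost_empty[OF d])
  qed auto
  finally show "hausdorff_content d \<delta> A + hausdorff_content d \<delta> B \<le> (\<Sum>i. hcost d (U i))" .
 qed
 have ab: "hausdorff_content d a A + hausdorff_content d b B \<le> hausdorff_outer d (A \<union> B)"
  if "0 < a" "0 < b" for a b
 proof -
  define \<delta> where "\<delta> = min (min a b) (\<eta> / 2)"
  have \<delta>: "0 < \<delta>" "\<delta> < \<eta>" "\<delta> \<le> a" "\<delta> \<le> b" using that \<eta> by (auto simp: \<delta>_def)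
  have "hausdorff_content d a A + hausdorff_content d b B \<le> hausdorff_content d \<delta> A + hausdorff_content d \<delta> B"
   by (intro add_mono content_antimono \<delta>)
  also have "\<dots> \<le> hausdorff_content d \<delta> (A \<union> B)" by (rule small[OF \<delta>(1,2)])
  also have "\<dots> \<le> hausdorff_outer d (A \<union> B)" by (rule content_le_outer[OF \<delta>(1)])
  finally show ?thesis .
 qed
 have "hausdorff_outer d A + hausdorff_outer d B = (SUP a\<in>{0<..}. hausdorff_content d a A + hausdorff_outer d B)"
  unfolding hausdorff_outer_def[of d A] by (rule ennreal_SUP_add_left[symmetric]) auto
 also have "\<dots> \<le> hausdorff_outer d (A \<union> B)"
 proof (rule SUP_least)
  fix a :: real assume a: "a \<in> {0<..}"
  have "hausdorff_content d a A + hausdorff_outer d B = (SUP b\<in>{0<..}. hausdorff_content d b B + hausdorff_content d a A)"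
   unfolding hausdorff_outer_def[of d B] by (subst ennreal_SUP_add_left) (auto simp: add.commute)
  also have "\<dots> \<le> hausdorff_outer d (A \<union> B)"
  proof (rule SUP_least)
   fix b :: real assume "b \<in> {0<..}"
   then show "hausdorff_content d b B + hausdorff_content d a A \<le> hausdorff_outer d (A \<union> B)"
    using ab[of a b] a by (simp add: add.commute)
  qed
  finally show "hausdorff_content d a A + hausdorff_outer d B \<le> hausdorff_outer d (A \<union> B)" .
 qed
 finally show ?thesis .
qed

lemma ennreal_suminf_tail_tendsto_0:
 fixes f :: "nat => ennreal"
 assumes "(\<Sum>k. f k) < \<infinity>"
 shows "(\<lambda>n. \<Sum>k. f (k + n)) \<longlonglongrightarrow> 0"
proof -
 define g where "g k = enn2real (f k)" for k
 have f: "f k = ennreal (g k)" for k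
  using ennreal_suminf_lessD[OF assms, of k] by (simp add: g_def less_top)
 have g0: "0 \<le> g k" for k by (simp add: g_def)
 have sg: "summable g"
  by (rule summable_suminf_not_top[OF g0]) (use assms in \<open>simp add: f less_top\<close>)
 have "(\<lambda>n. suminf g - (\<Sum>k<n. g k)) \<longlonglongrightarrow> suminf g - suminf g"
  by (intro tendsto_diff tendsto_const summable_LIMSEQ sg)
 then have "(\<lambda>n. \<Sum>k. g (k + n)) \<longlonglongrightarrow> 0" using sg by (simp add: suminf_minus_initial_segment)
 then have "(\<lambda>n. ennreal (\<Sum>k. g (k + n))) \<longlonglongrightarrow> 0" using tendsto_ennrealI by fastforce
 moreover have "(\<Sum>k. f (k + n)) = ennreal (\<Sum>k. g (k + n))" for n
  unfolding f by (rule suminf_ennreal2) (use g0 sg in \<open>auto simp: summable_iff_shift\<close>)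
 ultimately show ?thesis by simp
qed

text \<open>Caratheodory's criterion. The shells \<open>D k\<close> of points at distance about \<open>1 / k\<close> from a closed set
 are at positive distance from each other as soon as their indices differ by two; so the sum of their
 measures is finite, and the points close to the closed set but outside it carry little measure.\<close>

lemma closed_in_lambda_system:
 fixes F :: "'a::metric_space set"
 assumes d: "0 < d" and F: "closed F"
 shows "F \<in> lambda_system UNIV (Pow UNIV) (hausdorff_outer d)"
proof (cases "F = {}")
 case True
 then show ?thesis by (simp add: lambda_system_def outer_empty[OF d])
next
 case False
 let ?\<mu> = "hausdorff_outer d :: 'a set => ennreal"
 have "?\<mu> (F \<inter> X) + ?\<mu> (X - F) \<le> ?\<mu> X" for X
 proof (cases "?\<mu> X = \<infinity>")
  case False
  define g where "g x = infdist x F" for x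
  have gl: "g x \<le> g y + dist x y" for x y unfolding g_def by (rule infdist_triangle)
  have g0: "g x > 0" if "x \<notin> F" for x
   using that F \<open>F \<noteq> {}\<close> unfolding g_def by (metis in_closed_iff_infdist_zero infdist_nonneg order_le_less)
  have gF: "g x = 0" if "x \<in> F" for x using that unfolding g_def by simp
  define r where "r k = 1 / real (Suc k)" for k
  have r: "r k > 0" "r (Suc k) < r k" for k by (auto simp: r_def field_simps)
  have rdec: "r j \<le> r k" if "k \<le> j" for j k using that by (auto simp: r_def field_simps)
  define Y where "Y n = {x \<in> X. r n \<le> g x}" for n
  define D where "D k = {x \<in> X. r (Suc k) \<le> g x \<and> g x < r k}" for k
  have sums: "(\<Sum>i<N. ?\<mu> (D (2*i + c))) \<le> ?\<mu> (\<Union>i<N. D (2*i + c))" for N c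
  proof (induction N)
   case (Suc N)
   have "(\<Sum>i<Suc N. ?\<mu> (D (2*i + c))) \<le> ?\<mu> (\<Union>i<N. D (2*i + c)) + ?\<mu> (D (2*N + c))"
    using Suc by (simp add: add_right_mono)
   also have "\<dots> \<le> ?\<mu> ((\<Union>i<N. D (2*i + c)) \<union> D (2*N + c))"
   proof (cases N)
    case 0
    then show ?thesis by (simp add: outer_empty[OF d])
   next
    case (Suc N')
    show ?thesis
    proof (rule outer_metric_additive[OF d])
     show "0 < r (2*N + c - 1) - r (2*N + c)" using r(2)[of "2*N + c - 1"] Suc by simp
     fix x y assume "x \<in> (\<Union>i<N. D (2*i + c))" "y \<in> D (2*N + c)"
     then obtain i where i: "i < N" "r (Suc (2*i + c)) \<le> g x" and y: "g y < r (2*N + c)"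
      by (auto simp: D_def)
     have "r (2*N + c - 1) \<le> r (Suc (2*i + c))" by (rule rdec) (use i in linarith)
     with i y gl[of x y] show "r (2*N + c - 1) - r (2*N + c) \<le> dist x y" by linarith
    qed
   qed
   also have "(\<Union>i<N. D (2*i + c)) \<union> D (2*N + c) = (\<Union>i<Suc N. D (2*i + c))"
    by (auto simp: less_Suc_eq)
   finally show ?case .
  qed simp
  have fin_c: "(\<Sum>i. ?\<mu> (D (2*i + c))) \<le> ?\<mu> X" for c
  proof (rule suminf_le_const)
   fix N
   have "(\<Sum>i<N. ?\<mu> (D (2*i + c))) \<le> ?\<mu> (\<Union>i<N. D (2*i + c))" by (rule sums)
   also have "\<dots> \<le> ?\<mu> X" by (rule outer_mono) (auto simp: D_def)
   finally show "(\<Sum>i<N. ?\<mu> (D (2*i + c))) \<le> ?\<mu> X" .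
  qed auto
  have part: "(\<Sum>k<2*N. ?\<mu> (D k)) = (\<Sum>i<N. ?\<mu> (D (2*i))) + (\<Sum>i<N. ?\<mu> (D (2*i+1)))" for N
   by (induction N) (auto simp: algebra_simps)
  have "(\<Sum>k. ?\<mu> (D k)) \<le> ?\<mu> X + ?\<mu> X"
  proof (rule suminf_le_const)
   fix N
   have "(\<Sum>k<N. ?\<mu> (D k)) \<le> (\<Sum>k<2*N. ?\<mu> (D k))" by (rule sum_mono2) auto
   also have "\<dots> \<le> (\<Sum>i. ?\<mu> (D (2*i + 0))) + (\<Sum>i. ?\<mu> (D (2*i + 1)))"
   proof -
    have "(\<Sum>i<N. ?\<mu> (D (2*i + c))) \<le> (\<Sum>i. ?\<mu> (D (2*i + c)))" for c
     by (rule sum_le_suminf) auto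
    from add_mono[OF this[of 0] this[of 1]] show ?thesis unfolding part by simp
   qed
   also have "\<dots> \<le> ?\<mu> X + ?\<mu> X" by (intro add_mono fin_c)
   finally show "(\<Sum>k<N. ?\<mu> (D k)) \<le> ?\<mu> X + ?\<mu> X" .
  qed auto
  also have "\<dots> < \<infinity>" using False by (simp add: less_top[symmetric])
  finally have fin: "(\<Sum>k. ?\<mu> (D k)) < \<infinity>" .
  have tail: "(\<lambda>n. \<Sum>k. ?\<mu> (D (k + n))) \<longlonglongrightarrow> 0"
   by (rule ennreal_suminf_tail_tendsto_0[OF fin])
  have step: "?\<mu> (F \<inter> X) + ?\<mu> (X - F) \<le> ?\<mu> X + (\<Sum>k. ?\<mu> (D (k + n)))" for n
  proof -
   have "X - F \<subseteq> Y n \<union> (\<Union>k. D (k + n))"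
   proof
    fix x assume x: "x \<in> X - F"
    then have gx: "g x > 0" using g0 by auto
    show "x \<in> Y n \<union> (\<Union>k. D (k + n))"
    proof (cases "r n \<le> g x")
     case False
     obtain N where N: "r N < g x" unfolding r_def by (rule nat_approx_posE[OF gx])
     define j where "j = (LEAST j. r j \<le> g x)"
     have j: "r j \<le> g x" unfolding j_def by (rule LeastI[of _ N]) (use N in simp)
     have jn: "n < j" using False j rdec[of j n] by (meson leI order_trans)
     have "\<not> r (j - 1) \<le> g x" using not_less_Least[of "j - 1" "\<lambda>j. r j \<le> g x"] jn unfolding j_def by auto
     then have "x \<in> D ((j - 1 - n) + n)" using x j jn by (auto simp: D_def)
     then show ?thesis by blast
    qed (use x in \<open>auto simp: Y_def\<close>)
   qed
   then have "?\<mu> (X - F) \<le> ?\<mu> (Y n \<union> (\<Union>k. D (k + n)))" by (rule outer_mono)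
   also have "\<dots> \<le> ?\<mu> (Y n) + (\<Sum>k. ?\<mu> (D (k + n)))"
    by (rule order_trans[OF outer_subadditive[OF d]]) (intro add_left_mono outer_countably_subadditive)
   finally have "?\<mu> (F \<inter> X) + ?\<mu> (X - F) \<le> ?\<mu> (F \<inter> X) + (?\<mu> (Y n) + (\<Sum>k. ?\<mu> (D (k + n))))"
    by (rule add_left_mono)
   also have "\<dots> = (?\<mu> (F \<inter> X) + ?\<mu> (Y n)) + (\<Sum>k. ?\<mu> (D (k + n)))" by (simp add: add.assoc)
   also have "?\<mu> (F \<inter> X) + ?\<mu> (Y n) \<le> ?\<mu> ((F \<inter> X) \<union> Y n)"
   proof (rule outer_metric_additive[OF d r(1)[of n]])
    fix x y assume "x \<in> F \<inter> X" "y \<in> Y n"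
    then show "r n \<le> dist x y" using gl[of y x] gF[of x] by (simp add: Y_def dist_commute)
   qed
   also have "?\<mu> ((F \<inter> X) \<union> Y n) \<le> ?\<mu> X" by (rule outer_mono) (auto simp: Y_def)
   finally show ?thesis by (simp add: add_right_mono)
  qed
  have "(\<lambda>n. ?\<mu> X + (\<Sum>k. ?\<mu> (D (k + n)))) \<longlonglongrightarrow> ?\<mu> X + 0"
   by (intro tendsto_add tendsto_const tail)
  from LIMSEQ_le_const[OF this, of "?\<mu> (F \<inter> X) + ?\<mu> (X - F)"] step show ?thesis by simp
 qed simp
 moreover have "?\<mu> X \<le> ?\<mu> (F \<inter> X) + ?\<mu> (X - F)" for X
 proof -
  have eq: "(F \<inter> X) \<union> (X - F) = X" by blast
  have "?\<mu> ((F \<inter> X) \<union> (X - F)) \<le> ?\<mu> (F \<inter> X) + ?\<mu> (X - F)" by (rule outer_subadditive[OF d])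
  then show ?thesis unfolding eq .
 qed
 ultimately have "?\<mu> (F \<inter> X) + ?\<mu> (X - F) = ?\<mu> X" for X by (rule antisym)
 moreover have "(UNIV - F) \<inter> X = X - F" for X by blast
 ultimately show ?thesis
  unfolding lambda_system_def by simp
qed

text \<open>By Caratheodory's theorem the measure generated by the outer measure agrees with it once the Borel sets are
 measurable in Caratheodory's sense, and closed sets generate the Borel sets.\<close>

lemma emeasure_hausdorff_measure:
 fixes A :: "'a::metric_space set"
 assumes d: "0 < d" and A: "A \<in> sets borel"
 shows "emeasure (hausdorff_measure d) A = hausdorff_outer d A"
proof -
 interpret P: sigma_algebra UNIV "Pow UNIV :: 'a set set" by (rule sigma_algebra_Pow)
 have oms: "outer_measure_space (Pow UNIV) (hausdorff_outer d :: 'a set => ennreal)"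
  unfolding outer_measure_space_def positive_def increasing_def countably_subadditive_def
  by (auto simp: outer_empty[OF d] outer_mono outer_countably_subadditive)
 let ?L = "lambda_system UNIV (Pow UNIV) (hausdorff_outer d) :: 'a set set"
 have ms: "measure_space UNIV ?L (hausdorff_outer d)" by (rule P.caratheodory_lemma[OF oms])
 then have sa: "sigma_algebra UNIV ?L" by (simp add: measure_space_def)
 have "sets (borel :: 'a measure) = sigma_sets UNIV {S. closed S}"
  by (subst borel_eq_closed) (simp add: sets_measure_of)
 also have "\<dots> \<subseteq> ?L"
  by (rule sigma_algebra.sigma_sets_subset[OF sa]) (use closed_in_lambda_system[OF d] in auto)
 finally have sub: "sets (borel :: 'a measure) \<subseteq> ?L" .
 have "measure_space UNIV (sets borel) (hausdorff_outer d :: 'a set => ennreal)"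
  using measure_down[OF ms _ sub] sets.sigma_algebra_axioms[of "borel :: 'a measure"] by simp
 then show ?thesis
  unfolding hausdorff_measure_def measure_space_def
  by (subst emeasure_measure_of_sigma) (use A in auto)
qed

lemma sets_hausdorff_measure [measurable_cong, simp]:
 "sets (hausdorff_measure d) = sets borel" "space (hausdorff_measure d) = UNIV"
 unfolding hausdorff_measure_def using sets.sigma_sets_eq[of borel] by (auto simp: space_measure_of_conv)

text \<open>The set swept out by moving a set \<open>A\<close> through a distance at most \<open>L\<close> has volume at most a constant
 times \<open>L\<close> times the \<open>(n-1)\<close>-dimensional measure of \<open>A\<close>: cover \<open>A\<close> by sets of diameter at most \<open>L\<close>, and put
 what each of them sweeps out into a box.\<close>

definition sweep_const :: "nat => real" where
 "sweep_const n = 4 ^ n / unit_ball_vol (real n - 1)"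

lemma emeasure_sweep_le:
 fixes A B :: "(real^'n::finite) set"
 assumes n: "2 \<le> CARD('n)" and L: "0 < L" and \<sigma>: "\<bar>\<sigma>\<bar> = 1" and B: "B \<in> sets borel"
  and sweep: "\<And>x. x \<in> B ==> \<exists>t. 0 \<le> t \<and> t \<le> L \<and> x + t *\<^sub>R (\<sigma> *\<^sub>R axis i 1) \<in> A"
 shows "emeasure lborel B \<le> ennreal (sweep_const CARD('n) * L) * hausdorff_outer (real CARD('n) - 1) A"
proof -
 let ?d = "real CARD('n) - 1"
 define c where "c = sweep_const CARD('n) * L"
 have vol: "0 < unit_ball_vol ?d" using n by (intro unit_ball_vol_pos) auto
 have c: "c > 0" using vol L by (simp add: c_def sweep_const_def)
 have le: "emeasure lborel B \<le> ennreal c * (\<Sum>j. hcost ?d (U j))" if U: "hcover L A U" for U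
 proof -
  define a where "a j = (SOME a. a \<in> U j)" for j
  define r where "r j = (\<chi> k. diameter (U j) + (if k = i then L else 0))" for j
  define Q where "Q j = (if U j = {} then {} else cbox (a j - r j) (a j + r j))" for j
  have bU: "bounded (U j)" "diameter (U j) \<le> L" "0 \<le> diameter (U j)" for j
   using U diameter_ge_0 unfolding hcover_def by auto
  have aU: "a j \<in> U j" if "U j \<noteq> {}" for j using that unfolding a_def by (simp add: some_in_eq)
  have "B \<subseteq> (\<Union>j. Q j)"
  proof
   fix x assume "x \<in> B"
   then obtain t where t: "0 \<le> t" "t \<le> L" "x + t *\<^sub>R (\<sigma> *\<^sub>R axis i 1) \<in> A" using sweep by blast
   then obtain j where j: "x + t *\<^sub>R (\<sigma> *\<^sub>R axis i 1) \<in> U j" using U unfolding hcover_def by blast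
   let ?y = "x + t *\<^sub>R (\<sigma> *\<^sub>R axis i 1)"
   have ne: "U j \<noteq> {}" using j by auto
   have "norm (?y - a j) \<le> diameter (U j)"
    using diameter_bounded_bound[OF bU(1) j aU[OF ne]] by (simp add: dist_norm)
   then have yk: "\<bar>?y $ k - a j $ k\<bar> \<le> diameter (U j)" for k
    by (metis component_le_norm_cart order_trans vector_minus_component)
   have "\<bar>x $ k - a j $ k\<bar> \<le> r j $ k" for k
   proof (cases "k = i")
    case True
    have "\<bar>t * \<sigma>\<bar> \<le> L" using t \<sigma> by (simp add: abs_mult)
    then show ?thesis using yk[of k] True by (simp add: r_def axis_def)
   next
    case False
    then show ?thesis using yk[of k] by (simp add: r_def axis_def)
   qed
   then have "x \<in> Q j" using ne
    by (simp add: Q_def mem_box_cart) (smt (verit))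
   then show "x \<in> (\<Union>j. Q j)" by blast
  qed
  then have "emeasure lborel B \<le> emeasure lborel (\<Union>j. Q j)"
   by (rule emeasure_mono) (auto simp: Q_def)
  also have "\<dots> \<le> (\<Sum>j. emeasure lborel (Q j))"
   by (rule emeasure_subadditive_countably) (auto simp: Q_def)
  also have "\<dots> \<le> (\<Sum>j. ennreal c * hcost ?d (U j))"
  proof (rule suminf_le)
   fix j
   show "emeasure lborel (Q j) \<le> ennreal c * hcost ?d (U j)"
   proof (cases "U j = {}")
    case False
    let ?D = "diameter (U j)"
    have D: "0 \<le> ?D" "?D \<le> L" using bU by auto
    have ne: "cbox (a j - r j) (a j + r j) \<noteq> {}"
     using D L by (auto simp: interval_ne_empty_cart r_def)
    have "measure lborel (cbox (a j - r j) (a j + r j)) = (\<Prod>k\<in>UNIV. 2 * r j $ k)"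
     using content_cbox_cart[OF ne] by simp
    also have "\<dots> = 2 * r j $ i * (\<Prod>k\<in>UNIV - {i}. 2 * r j $ k)"
     by (subst prod.remove[of _ i]) auto
    also have "(\<Prod>k\<in>UNIV - {i}. 2 * r j $ k) = (\<Prod>k\<in>UNIV - {i}. 2 * ?D)"
     by (rule prod.cong) (auto simp: r_def)
    also have "\<dots> = (2 * ?D) ^ (CARD('n) - 1)" by (simp add: card_Diff_singleton)
    also have "2 * r j $ i * (2 * ?D) ^ (CARD('n) - 1) \<le> 4 * L * (2 * ?D) ^ (CARD('n) - 1)"
     using D by (intro mult_right_mono) (auto simp: r_def)
    also have "\<dots> = c * (unit_ball_vol ?d * (?D / 2) ^ (CARD('n) - 1))"
    proof -
     have "(2 * ?D) ^ (CARD('n) - 1) = (4 * (?D / 2)) ^ (CARD('n) - 1)" by simp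
     also have "\<dots> = 4 ^ (CARD('n) - 1) * (?D / 2) ^ (CARD('n) - 1)" by (rule power_mult_distrib)
     finally have "4 * L * (2 * ?D) ^ (CARD('n) - 1) = L * (4 * 4 ^ (CARD('n) - 1)) * (?D / 2) ^ (CARD('n) - 1)"
      by simp
     also have "(4::real) * 4 ^ (CARD('n) - 1) = 4 ^ CARD('n)" using n by (simp add: power_eq_if)
     finally have eq: "4 * L * (2 * ?D) ^ (CARD('n) - 1) = L * 4 ^ CARD('n) * (?D / 2) ^ (CARD('n) - 1)" .
     have "q / v * L * v = L * q" if "v > 0" for q v :: real using that by simp
     from this[OF vol] have cv: "c * unit_ball_vol ?d = L * 4 ^ CARD('n)"
      unfolding c_def sweep_const_def .
     show ?thesis unfolding eq cv[symmetric] by (simp only: mult.assoc)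
    qed
    also have "(?D / 2) ^ (CARD('n) - 1) = (?D / 2) powr ?d"
    proof (cases "?D = 0")
     case True
     then show ?thesis using n by simp
    next
     case False
     then have "0 < ?D / 2" using D by simp
     from powr_realpow[OF this, of "CARD('n) - 1"] show ?thesis using n by (simp add: of_nat_diff)
    qed
    finally have "measure lborel (cbox (a j - r j) (a j + r j)) \<le> c * (unit_ball_vol ?d * (?D / 2) powr ?d)" .
    moreover have "emeasure lborel (Q j) = ennreal (measure lborel (cbox (a j - r j) (a j + r j)))"
     using False emeasure_lborel_cbox_finite[of "a j - r j" "a j + r j"]
     by (simp add: Q_def emeasure_eq_ennreal_measure)
    ultimately show ?thesis
     unfolding hcost_def using c vol by (simp add: ennreal_mult[symmetric] ennreal_leI)
   qed (simp add: Q_def)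
  qed auto
  also have "\<dots> = ennreal c * (\<Sum>j. hcost ?d (U j))" by (rule ennreal_suminf_cmult)
  finally show ?thesis .
 qed
 have "ennreal (1 / c) * emeasure lborel B \<le> hausdorff_content ?d L A"
 proof (rule content_greatest)
  fix U assume "hcover L A U"
  from mult_left_mono[OF le[OF this], of "ennreal (1 / c)"]
  show "ennreal (1 / c) * emeasure lborel B \<le> (\<Sum>j. hcost ?d (U j))"
   using c by (simp add: mult.assoc[symmetric] ennreal_mult[symmetric])
 qed
 also have "\<dots> \<le> hausdorff_outer ?d A" by (rule content_le_outer[OF L])
 finally have "ennreal c * (ennreal (1 / c) * emeasure lborel B) \<le> ennreal c * hausdorff_outer ?d A"
  by (rule mult_left_mono) simp
 then show ?thesis using c by (simp add: mult.assoc[symmetric] ennreal_mult[symmetric] c_def[symmetric])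
qed

section \<open>Estimates by the values on the boundary\<close>

definition exit_time :: "(real^'n::finite) set => real^'n => real^'n => real" where
 "exit_time \<Omega> e x = Inf {t. 0 \<le> t \<and> x + t *\<^sub>R e \<notin> \<Omega>}"

context
 fixes \<Omega> :: "(real^'n::finite) set" and e :: "real^'n"
 assumes \<Omega>: "open \<Omega>" "bounded \<Omega>" and e: "norm e = 1"
begin

lemma exit_time:
 shows "0 \<le> exit_time \<Omega> e x" "x + exit_time \<Omega> e x *\<^sub>R e \<notin> \<Omega>"
  "\<And>t. 0 \<le> t ==> x + t *\<^sub>R e \<notin> \<Omega> ==> exit_time \<Omega> e x \<le> t"
  "\<And>t. 0 \<le> t ==> t < exit_time \<Omega> e x ==> x + t *\<^sub>R e \<in> \<Omega>"
proof -
 let ?S = "{t. 0 \<le> t \<and> x + t *\<^sub>R e \<notin> \<Omega>}"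
 obtain R where R: "R > 0" "\<And>y. y \<in> \<Omega> ==> norm y \<le> R" using \<Omega>(2) unfolding bounded_pos by blast
 have "x + (R + norm x + 1) *\<^sub>R e \<notin> \<Omega>"
 proof
  assume "x + (R + norm x + 1) *\<^sub>R e \<in> \<Omega>"
  then have "norm (x + (R + norm x + 1) *\<^sub>R e) \<le> R" by (rule R)
  moreover have "norm ((R + norm x + 1) *\<^sub>R e) - norm x \<le> norm (x + (R + norm x + 1) *\<^sub>R e)"
   using norm_diff_ineq[of "(R + norm x + 1) *\<^sub>R e" x] by (simp add: add.commute)
  ultimately show False using R(1) e by simp
 qed
 then have ne: "?S \<noteq> {}" using R(1) by (auto intro!: exI[of _ "R + norm x + 1"] add_nonneg_nonneg)
 have bd: "bdd_below ?S" by (rule bdd_belowI[of _ 0]) simp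
 have "closed ((\<lambda>t. x + t *\<^sub>R e) -` (- \<Omega>))"
  by (rule continuous_closed_vimage) (use \<Omega> in \<open>auto intro!: continuous_intros\<close>)
 then have "closed ({0..} \<inter> (\<lambda>t. x + t *\<^sub>R e) -` (- \<Omega>))" by (intro closed_Int) auto
 also have "{0..} \<inter> (\<lambda>t. x + t *\<^sub>R e) -` (- \<Omega>) = ?S" by auto
 finally have "closed ?S" .
 from closed_contains_Inf[OF ne bd this] have "exit_time \<Omega> e x \<in> ?S" by (simp add: exit_time_def)
 then show 1: "0 \<le> exit_time \<Omega> e x" "x + exit_time \<Omega> e x *\<^sub>R e \<notin> \<Omega>" by auto
 show 3: "exit_time \<Omega> e x \<le> t" if "0 \<le> t" "x + t *\<^sub>R e \<notin> \<Omega>" for t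
  unfolding exit_time_def by (rule cInf_lower[OF _ bd]) (use that in auto)
 show "x + t *\<^sub>R e \<in> \<Omega>" if "0 \<le> t" "t < exit_time \<Omega> e x" for t
  using 3[of t] that by force
qed

lemma exit_point_frontier:
 assumes "x \<in> \<Omega>"
 shows "x + exit_time \<Omega> e x *\<^sub>R e \<in> frontier \<Omega>"
proof -
 let ?t = "exit_time \<Omega> e x"
 have "?t \<noteq> 0" using exit_time(2)[of x] assms by auto
 then have t: "?t > 0" using exit_time(1)[of x] by simp
 have "x + ?t *\<^sub>R e \<in> closure \<Omega>"
  unfolding closure_approachable
 proof (intro allI impI)
  fix \<epsilon> :: real assume \<epsilon>: "0 < \<epsilon>"
  let ?s = "max 0 (?t - \<epsilon> / 2)"
  have s: "0 \<le> ?s" "?s < ?t" "?t - ?s < \<epsilon>" using t \<epsilon> by auto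
  have "dist (x + ?s *\<^sub>R e) (x + ?t *\<^sub>R e) = \<bar>?s - ?t\<bar>"
   using e by (simp add: dist_norm scaleR_diff_left[symmetric])
  then show "\<exists>y\<in>\<Omega>. dist y (x + ?t *\<^sub>R e) < \<epsilon>"
   using exit_time(4)[OF s(1,2)] s by (intro bexI[of _ "x + ?s *\<^sub>R e"]) auto
 qed
 then show ?thesis using exit_time(2)[of x] \<Omega>(1) by (simp add: frontier_def interior_open)
qed

lemma exit_time_measurable: "exit_time \<Omega> e \<in> borel_measurable borel"
 unfolding borel_measurable_iff_greater
proof
 fix a :: real
 show "{x \<in> space borel. a < exit_time \<Omega> e x} \<in> sets borel"
 proof (cases "a < 0")
  case True
  then have "{x \<in> space borel. a < exit_time \<Omega> e x} = UNIV"
   using exit_time(1) by (auto intro: less_le_trans)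
  then show ?thesis by simp
 next
  case False
  have cl: "closed (\<Union>y\<in>- \<Omega>. \<Union>z\<in>(\<lambda>t. (- t) *\<^sub>R e) ` {0..a}. {y + z})"
   by (rule closed_compact_sums) (use \<Omega> in \<open>auto intro!: compact_continuous_image continuous_intros\<close>)
  have eq: "{x \<in> space borel. a < exit_time \<Omega> e x}
    = - (\<Union>y\<in>- \<Omega>. \<Union>z\<in>(\<lambda>t. (- t) *\<^sub>R e) ` {0..a}. {y + z})" (is "_ = - ?T")
  proof (rule set_eqI)
   fix x
   have "exit_time \<Omega> e x \<le> a \<longleftrightarrow> x \<in> ?T"
   proof
    assume "exit_time \<Omega> e x \<le> a"
    then show "x \<in> ?T" using exit_time(1,2)[of x]
     by (intro UN_I[of "x + exit_time \<Omega> e x *\<^sub>R e"] UN_I[of "(- exit_time \<Omega> e x) *\<^sub>R e"]) auto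
   next
    assume "x \<in> ?T"
    then obtain y t where "y \<notin> \<Omega>" "0 \<le> t" "t \<le> a" "x = y + (- t) *\<^sub>R e" by auto
    then have "x + t *\<^sub>R e \<notin> \<Omega>" by simp
    from exit_time(3)[OF \<open>0 \<le> t\<close> this] \<open>t \<le> a\<close> show "exit_time \<Omega> e x \<le> a" by simp
   qed
   then show "x \<in> {x \<in> space borel. a < exit_time \<Omega> e x} \<longleftrightarrow> x \<in> - ?T" by auto
  qed
  show ?thesis unfolding eq by (rule borel_comp[OF borel_closed[OF cl]])
 qed
qed

end

lemma integral_powr_le:
 fixes h :: "real => real"
 assumes h: "continuous_on {0..\<tau>} h" "\<And>t. 0 \<le> h t" and \<tau>: "0 < \<tau>" and p: "1 \<le> p"
 shows "(integral {0..\<tau>} h) powr p \<le> \<tau> powr (p - 1) * integral {0..\<tau>} (\<lambda>t. h t powr p)"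
proof -
 define b where "b = integral {0..\<tau>} h / \<tau>"
 have ih: "h integrable_on {0..\<tau>}" by (rule integrable_continuous_real[OF h(1)])
 have ihp: "(\<lambda>t. h t powr p) integrable_on {0..\<tau>}"
  by (intro integrable_continuous_real continuous_on_powr'[OF h(1) continuous_on_const]) (use h p in auto)
 have I0: "0 \<le> integral {0..\<tau>} h" by (rule integral_nonneg[OF ih]) (use h in auto)
 have b0: "0 \<le> b" using I0 \<tau> by (simp add: b_def)
 have "((\<lambda>t. (b powr p - p * b powr (p-1) * b) + p * b powr (p-1) * h t) has_integral
   (b powr p - p * b powr (p-1) * b) * \<tau> + p * b powr (p-1) * integral {0..\<tau>} h) {0..\<tau>}"
  using has_integral_const_real[of "b powr p - p * b powr (p-1) * b" 0 \<tau>] \<tau>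
  by (intro has_integral_add has_integral_mult_right integrable_integral[OF ih]) (simp_all add: mult.commute)
 then have "(b powr p - p * b powr (p-1) * b) * \<tau> + p * b powr (p-1) * integral {0..\<tau>} h
   \<le> integral {0..\<tau>} (\<lambda>t. h t powr p)"
 proof (rule has_integral_le[OF _ integrable_integral[OF ihp]])
  fix t
  show "(b powr p - p * b powr (p-1) * b) + p * b powr (p-1) * h t \<le> h t powr p"
   using powr_tangent[OF h(2) b0 p, of t] by (simp add: algebra_simps)
 qed
 moreover have "integral {0..\<tau>} h = b * \<tau>" using \<tau> by (simp add: b_def)
 ultimately have "b powr p * \<tau> \<le> integral {0..\<tau>} (\<lambda>t. h t powr p)" by (simp add: algebra_simps)
 then have "\<tau> powr (p - 1) * (b powr p * \<tau>) \<le> \<tau> powr (p - 1) * integral {0..\<tau>} (\<lambda>t. h t powr p)"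
  by (rule mult_left_mono) simp
 moreover have "(integral {0..\<tau>} h) powr p = \<tau> powr (p - 1) * (b powr p * \<tau>)"
 proof -
  have "(integral {0..\<tau>} h) powr p = b powr p * \<tau> powr p"
   using \<tau> b0 \<open>integral {0..\<tau>} h = b * \<tau>\<close> by (simp add: powr_mult)
  also have "\<tau> powr p = \<tau> powr (p - 1) * \<tau>" using \<tau> powr_mult_base[of \<tau> "p - 1"] by (simp add: mult.commute)
  finally show ?thesis by simp
 qed
 ultimately show ?thesis by simp
qed

text \<open>Along the segment from \<open>x\<close> to the exit point, the fundamental theorem of calculus bounds \<open>w x\<close> by
 the value at the exit point and by the gradient in between. Integration over \<open>x\<close> turns the first term
 into a boundary integral, since the points that leave through a piece of the boundary form a set
 swept out by that piece.\<close>

lemma exit_estimate: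
 fixes \<Omega> E E' :: "(real^'n::finite) set"
 assumes \<Omega>: "open \<Omega>" "bounded \<Omega>" and n: "2 \<le> CARD('n)" and p: "1 \<le> p" and L: "0 < L"
  and \<sigma>: "\<bar>\<sigma>\<bar> = 1" and E: "E \<in> sets borel" "E \<subseteq> \<Omega>" and E': "E' \<in> sets borel"
  and leave: "\<And>x. x \<in> E ==> \<exists>t. 0 \<le> t \<and> t \<le> L \<and> x + t *\<^sub>R (\<sigma> *\<^sub>R axis i 1) \<notin> \<Omega>"
  and stay: "\<And>x t. x \<in> E ==> 0 \<le> t ==> t \<le> L ==> x + t *\<^sub>R (\<sigma> *\<^sub>R axis i 1) \<in> \<Omega>
    ==> x + t *\<^sub>R (\<sigma> *\<^sub>R axis i 1) \<in> E'"
  and w: "smooth_on UNIV w"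
 shows "(\<integral>\<^sup>+x. ennreal (\<bar>w x\<bar> powr p) * indicator E x \<partial>lborel) \<le> ennreal (2 powr p) *
   (ennreal (sweep_const CARD('n) * L) * Lp_pow (surface_measure \<Omega>) p w
    + ennreal (L powr p) * (\<integral>\<^sup>+x. ennreal (norm (grad w x) powr p) * indicator E' x \<partial>lborel))"
proof -
 define e where "e = \<sigma> *\<^sub>R (axis i 1 :: real^'n)"
 have e: "norm e = 1" using \<sigma> by (simp add: e_def norm_axis_1)
 note leave = leave[folded e_def] and stay = stay[folded e_def]
 note ex = exit_time[OF \<Omega> e] exit_point_frontier[OF \<Omega> e]
 define \<tau> where "\<tau> = exit_time \<Omega> e"
 note ex = ex[folded \<tau>_def]
 define b where "b x = x + \<tau> x *\<^sub>R e" for x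
 have \<tau>L: "\<tau> x \<le> L" if "x \<in> E" for x using leave[OF that] ex(3) by force
 have \<tau>pos: "0 < \<tau> x" if "x \<in> E" for x
 proof -
  have "\<tau> x \<noteq> 0" using ex(2)[of x] that E(2) by auto
  then show ?thesis using ex(1)[of x] by simp
 qed
 have [measurable]: "\<tau> \<in> borel_measurable borel" unfolding \<tau>_def by (rule exit_time_measurable[OF \<Omega> e])
 have mb[measurable]: "b \<in> borel_measurable borel" unfolding b_def[abs_def] by measurable
 note mw[measurable] = smooth_measurable(4,5)[OF w]
 note [measurable] = E(1) E'
 let ?g = "\<lambda>y. ennreal (norm (grad w y) powr p)"
 have pt: "ennreal (\<bar>w x\<bar> powr p) \<le> ennreal (2 powr p) * (ennreal (\<bar>w (b x)\<bar> powr p)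
   + ennreal (L powr (p - 1)) * (\<integral>\<^sup>+t. indicator {0..L} t * (?g (x + t *\<^sub>R e) * indicator E' (x + t *\<^sub>R e)) \<partial>lborel))"
  if x: "x \<in> E" for x
 proof -
  let ?h = "\<lambda>t. norm (grad w (x + t *\<^sub>R e))"
  let ?T = "\<tau> x"
  have T: "0 < ?T" "?T \<le> L" using \<tau>pos \<tau>L x by auto
  have ch: "continuous_on S ?h" for S
   by (intro continuous_on_norm continuous_on_compose2[OF smooth_grad_continuous[OF w]]) (auto intro!: continuous_intros)
  have ihp: "(\<lambda>t. ?h t powr p) integrable_on {0..?T}"
   by (intro integrable_continuous_real continuous_on_powr'[OF ch continuous_on_const]) (use p in auto)
  have der: "((\<lambda>t. w (x + t *\<^sub>R e)) has_vector_derivative (grad w (x + t *\<^sub>R e) \<bullet> e)) (at t within {0..?T})" for t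
  proof -
   have "((\<lambda>t. x + t *\<^sub>R e) has_derivative (\<lambda>h. h *\<^sub>R e)) (at t within {0..?T})"
    by (auto intro!: derivative_eq_intros)
   from has_derivative_compose[OF this has_derivative_grad[OF smooth_differentiable[OF w]]]
   show ?thesis by (simp add: has_vector_derivative_def)
  qed
  have ftc: "((\<lambda>t. grad w (x + t *\<^sub>R e) \<bullet> e) has_integral (w (b x) - w x)) {0..?T}"
   using fundamental_theorem_of_calculus[of 0 ?T "\<lambda>t. w (x + t *\<^sub>R e)" "\<lambda>t. grad w (x + t *\<^sub>R e) \<bullet> e"] T der
   by (simp add: b_def)
  have "norm (w (b x) - w x) \<le> integral {0..?T} ?h"
   unfolding integral_unique[OF ftc, symmetric]
  proof (rule integral_norm_bound_integral)
   show "?h integrable_on {0..?T}" by (rule integrable_continuous_real[OF ch])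
   show "norm (grad w (x + t *\<^sub>R e) \<bullet> e) \<le> ?h t" for t
    using Cauchy_Schwarz_ineq2[of "grad w (x + t *\<^sub>R e)" e] e by simp
  qed (use ftc in blast)
  then have "\<bar>w (b x) - w x\<bar> powr p \<le> (integral {0..?T} ?h) powr p" using p by (intro powr_mono2) auto
  also have "\<dots> \<le> ?T powr (p - 1) * integral {0..?T} (\<lambda>t. ?h t powr p)"
   by (rule integral_powr_le[OF ch _ T(1) p]) simp
  also have "\<dots> \<le> L powr (p - 1) * integral {0..?T} (\<lambda>t. ?h t powr p)"
   using T p by (intro mult_right_mono powr_mono2 Henstock_Kurzweil_Integration.integral_nonneg ihp) auto
  finally have 1: "\<bar>w (b x) - w x\<bar> powr p \<le> L powr (p - 1) * integral {0..?T} (\<lambda>t. ?h t powr p)" .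
  have 2: "ennreal (integral {0..?T} (\<lambda>t. ?h t powr p))
    \<le> (\<integral>\<^sup>+t. indicator {0..L} t * (?g (x + t *\<^sub>R e) * indicator E' (x + t *\<^sub>R e)) \<partial>lborel)"
  proof -
   have "ennreal (integral {0..?T} (\<lambda>t. ?h t powr p)) = (\<integral>\<^sup>+t. indicator {0..?T} t * (?h t powr p) \<partial>lborel)"
    using nn_integral_has_integral_lebesgue[OF _ integrable_integral[OF ihp]] by simp
   also have "\<dots> \<le> (\<integral>\<^sup>+t. indicator {0..L} t * (?g (x + t *\<^sub>R e) * indicator E' (x + t *\<^sub>R e)) \<partial>lborel)"
   proof (rule nn_integral_mono_AE, use AE_lborel_singleton[of ?T] in eventually_elim)
    case (elim t)
    show ?case
    proof (cases "t \<in> {0..?T}")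
     case True
     then have "x + t *\<^sub>R e \<in> \<Omega>" using elim ex(4)[of t x] by auto
     then have "x + t *\<^sub>R e \<in> E'" using stay[OF x, of t] True T by auto
     then show ?thesis using True T by (simp add: ennreal_mult)
    qed simp
   qed
   finally show ?thesis .
  qed
  have "\<bar>w x\<bar> powr p \<le> 2 powr p * (\<bar>w (b x)\<bar> powr p + \<bar>w (b x) - w x\<bar> powr p)"
   using norm_diff_powr_le[of p "w (b x)" "w (b x) - w x"] p by simp
  also have "\<dots> \<le> 2 powr p * (\<bar>w (b x)\<bar> powr p + L powr (p - 1) * integral {0..?T} (\<lambda>t. ?h t powr p))"
   by (intro mult_left_mono add_left_mono 1) simp
  finally have "ennreal (\<bar>w x\<bar> powr p) \<le> ennreal (2 powr p * (\<bar>w (b x)\<bar> powr p + L powr (p - 1) * integral {0..?T} (\<lambda>t. ?h t powr p)))"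
   by (rule ennreal_leI)
  also have "\<dots> = ennreal (2 powr p) * (ennreal (\<bar>w (b x)\<bar> powr p) + ennreal (L powr (p - 1)) * ennreal (integral {0..?T} (\<lambda>t. ?h t powr p)))"
   using Henstock_Kurzweil_Integration.integral_nonneg[OF ihp] by (simp add: ennreal_mult ennreal_plus)
  also have "\<dots> \<le> ennreal (2 powr p) * (ennreal (\<bar>w (b x)\<bar> powr p)
   + ennreal (L powr (p - 1)) * (\<integral>\<^sup>+t. indicator {0..L} t * (?g (x + t *\<^sub>R e) * indicator E' (x + t *\<^sub>R e)) \<partial>lborel))"
   by (intro mult_left_mono add_left_mono 2) auto
  finally show ?thesis .
 qed
 have bdry: "(\<integral>\<^sup>+x. ennreal (\<bar>w (b x)\<bar> powr p) * indicator E x \<partial>lborel)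
   \<le> ennreal (sweep_const CARD('n) * L) * Lp_pow (surface_measure \<Omega>) p w"
 proof -
  let ?H = "hausdorff_measure (real CARD('n) - 1) :: (real^'n) measure"
  let ?F = "frontier \<Omega>"
  let ?c = "ennreal (sweep_const CARD('n) * L)"
  let ?N = "distr (density lborel (indicator E)) borel b"
  let ?M = "density ?H (\<lambda>y. ?c * indicator ?F y)"
  have [measurable]: "?F \<in> sets borel" by (simp add: borel_closed)
  have NM: "?N \<le> ?M"
  proof (subst le_measure)
   show "sets ?N = sets ?M" by simp
   show "\<forall>A\<in>sets ?N. emeasure ?N A \<le> emeasure ?M A"
   proof
    fix A assume "A \<in> sets ?N"
    then have A[measurable]: "A \<in> sets borel" by simp
    have "emeasure ?N A = emeasure (density lborel (indicator E)) (b -` A)"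
     by (subst emeasure_distr) (auto simp: space_borel)
    also have "\<dots> = emeasure lborel (E \<inter> b -` A)"
    proof -
     have "b -` A \<in> sets borel" using measurable_sets[OF mb A] by simp
     then show ?thesis by (subst emeasure_density) (auto simp: indicator_inter_arith[symmetric] Int_commute)
    qed
    also have "\<dots> \<le> ?c * hausdorff_outer (real CARD('n) - 1) (A \<inter> ?F)"
    proof (rule emeasure_sweep_le[OF n L \<sigma>])
     show "E \<inter> b -` A \<in> sets borel" using measurable_sets[OF mb A] E(1) by auto
     fix x assume x: "x \<in> E \<inter> b -` A"
     then have "b x \<in> A \<inter> ?F" using ex(5)[of x] E(2) by (auto simp: b_def)
     then show "\<exists>t. 0 \<le> t \<and> t \<le> L \<and> x + t *\<^sub>R (\<sigma> *\<^sub>R axis i 1) \<in> A \<inter> ?F"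
      using \<tau>L[of x] ex(1)[of x] x by (intro exI[of _ "\<tau> x"]) (auto simp: b_def e_def)
    qed
    also have "hausdorff_outer (real CARD('n) - 1) (A \<inter> ?F) = emeasure ?H (A \<inter> ?F)"
     by (rule emeasure_hausdorff_measure[symmetric]) (use n in auto)
    also have "?c * emeasure ?H (A \<inter> ?F) = emeasure ?M A"
     by (subst emeasure_density)
      (auto simp: mult.assoc indicator_inter_arith[symmetric] Int_commute nn_integral_cmult)
    finally show "emeasure ?N A \<le> emeasure ?M A" .
   qed
  qed
  have "(\<integral>\<^sup>+x. ennreal (\<bar>w (b x)\<bar> powr p) * indicator E x \<partial>lborel) = (\<integral>\<^sup>+y. ennreal (\<bar>w y\<bar> powr p) \<partial>?N)"
   by (subst nn_integral_distr) (auto simp: nn_integral_density mult.commute)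
  also have "\<dots> \<le> (\<integral>\<^sup>+y. ennreal (\<bar>w y\<bar> powr p) \<partial>?M)"
   by (rule nn_integral_mono_measure[OF _ NM]) simp
  also have "\<dots> = ?c * (\<integral>\<^sup>+y. ennreal (\<bar>w y\<bar> powr p) * indicator ?F y \<partial>?H)"
   by (subst nn_integral_density) (auto simp: mult_ac nn_integral_cmult[symmetric])
  also have "(\<integral>\<^sup>+y. ennreal (\<bar>w y\<bar> powr p) * indicator ?F y \<partial>?H) = Lp_pow (surface_measure \<Omega>) p w"
   unfolding Lp_pow_def surface_measure_def by (subst nn_integral_restrict_space) (auto simp: borel_closed)
  finally show ?thesis .
 qed
 have inner: "(\<integral>\<^sup>+x. (\<integral>\<^sup>+t. indicator {0..L} t * (?g (x + t *\<^sub>R e) * indicator E' (x + t *\<^sub>R e)) \<partial>lborel) \<partial>lborel)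
   = ennreal L * (\<integral>\<^sup>+x. ?g x * indicator E' x \<partial>lborel)"
 proof -
  have "(\<integral>\<^sup>+x. (\<integral>\<^sup>+t. indicator {0..L} t * (?g (x + t *\<^sub>R e) * indicator E' (x + t *\<^sub>R e)) \<partial>lborel) \<partial>lborel)
    = (\<integral>\<^sup>+t. (\<integral>\<^sup>+x. indicator {0..L} t * (?g (x + t *\<^sub>R e) * indicator E' (x + t *\<^sub>R e)) \<partial>lborel) \<partial>lborel)"
   by (rule lborel_pair.Fubini') measurable
  also have "\<dots> = (\<integral>\<^sup>+t. indicator {0..L} t * (\<integral>\<^sup>+x. ?g x * indicator E' x \<partial>lborel) \<partial>lborel)"
  proof (rule nn_integral_cong)
   fix t :: real
   have "(\<integral>\<^sup>+x. indicator {0..L} t * (?g (x + t *\<^sub>R e) * indicator E' (x + t *\<^sub>R e)) \<partial>lborel)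
     = indicator {0..L} t * (\<integral>\<^sup>+x. ?g (x + t *\<^sub>R e) * indicator E' (x + t *\<^sub>R e) \<partial>lborel)"
    by (rule nn_integral_cmult) measurable
   also have "(\<integral>\<^sup>+x. ?g (x + t *\<^sub>R e) * indicator E' (x + t *\<^sub>R e) \<partial>lborel) = (\<integral>\<^sup>+x. ?g x * indicator E' x \<partial>lborel)"
    by (rule nn_integral_lborel_shift) measurable
   finally show "(\<integral>\<^sup>+x. indicator {0..L} t * (?g (x + t *\<^sub>R e) * indicator E' (x + t *\<^sub>R e)) \<partial>lborel)
     = indicator {0..L} t * (\<integral>\<^sup>+x. ?g x * indicator E' x \<partial>lborel)" .
  qed
  also have "\<dots> = ennreal L * (\<integral>\<^sup>+x. ?g x * indicator E' x \<partial>lborel)"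
   using L by (subst nn_integral_multc) auto
  finally show ?thesis .
 qed
 have "(\<integral>\<^sup>+x. ennreal (\<bar>w x\<bar> powr p) * indicator E x \<partial>lborel)
   \<le> (\<integral>\<^sup>+x. ennreal (2 powr p) * (ennreal (\<bar>w (b x)\<bar> powr p) * indicator E x
   + ennreal (L powr (p - 1)) * (\<integral>\<^sup>+t. indicator {0..L} t * (?g (x + t *\<^sub>R e) * indicator E' (x + t *\<^sub>R e)) \<partial>lborel)) \<partial>lborel)"
  by (intro nn_integral_mono) (use pt in \<open>auto simp: indicator_def\<close>)
 also have "\<dots> = ennreal (2 powr p) * ((\<integral>\<^sup>+x. ennreal (\<bar>w (b x)\<bar> powr p) * indicator E x \<partial>lborel)
   + ennreal (L powr (p - 1)) * (ennreal L * (\<integral>\<^sup>+x. ?g x * indicator E' x \<partial>lborel)))"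
  by (subst nn_integral_cmult, measurable, subst nn_integral_add, measurable, subst nn_integral_cmult, measurable)
   (simp only: inner)
 also have "ennreal (L powr (p - 1)) * (ennreal L * (\<integral>\<^sup>+x. ?g x * indicator E' x \<partial>lborel))
   = ennreal (L powr p) * (\<integral>\<^sup>+x. ?g x * indicator E' x \<partial>lborel)"
 proof -
  have "L powr (p - 1) * L = L powr p" using L powr_mult_base[of L "p - 1"] by (simp add: mult.commute)
  then show ?thesis using L by (simp add: mult.assoc[symmetric] ennreal_mult[symmetric])
 qed
 also have "ennreal (2 powr p) * ((\<integral>\<^sup>+x. ennreal (\<bar>w (b x)\<bar> powr p) * indicator E x \<partial>lborel)
   + ennreal (L powr p) * (\<integral>\<^sup>+x. ?g x * indicator E' x \<partial>lborel))
  \<le> ennreal (2 powr p) * (ennreal (sweep_const CARD('n) * L) * Lp_pow (surface_measure \<Omega>) p w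
   + ennreal (L powr p) * (\<integral>\<^sup>+x. ?g x * indicator E' x \<partial>lborel))"
  by (intro mult_left_mono add_right_mono bdry) simp
 finally show ?thesis .
qed

lemma Lp_pow_lebesgue_on:
 assumes "S \<in> sets borel"
 shows "Lp_pow (lebesgue_on S) p f = (\<integral>\<^sup>+x. ennreal (norm (f x) powr p) * indicator S x \<partial>lborel)"
proof -
 have "S \<inter> space lebesgue \<in> sets lebesgue" using assms by auto
 then show ?thesis
  unfolding Lp_pow_def by (simp add: nn_integral_restrict_space nn_integral_completion)
qed

lemma Lp_pow_subset:
 assumes "S \<in> sets borel" "T \<in> sets borel" "S \<subseteq> T"
 shows "Lp_pow (lebesgue_on S) p f \<le> Lp_pow (lebesgue_on T) p f"
 unfolding Lp_pow_lebesgue_on[OF assms(1)] Lp_pow_lebesgue_on[OF assms(2)]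
 by (intro nn_integral_mono mult_left_mono) (use assms(3) in \<open>auto simp: indicator_def\<close>)

lemma measurable_lebesgue_on_subset:
 fixes f :: "real^'n::finite => 'b::euclidean_space"
 assumes "f \<in> borel_measurable (lebesgue_on T)" "S \<subseteq> T"
 shows "f \<in> borel_measurable (lebesgue_on S)"
 using measurable_restrict_mono[OF assms] .

text \<open>The exit estimate passes to limits of smooth functions whose boundary values tend to zero, and the
 boundary term disappears.\<close>

lemma trace_zero_exit_estimate:
 fixes \<Omega> E E' :: "(real^'n::finite) set"
 assumes \<Omega>: "open \<Omega>" "bounded \<Omega>" and n: "2 \<le> CARD('n)" and p: "1 \<le> p" and L: "0 < L"
  and \<sigma>: "\<bar>\<sigma>\<bar> = 1" and E: "E \<in> sets borel" "E \<subseteq> \<Omega>" and E': "E' \<in> sets borel" "E' \<subseteq> \<Omega>"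
  and leave: "\<And>x. x \<in> E ==> \<exists>t. 0 \<le> t \<and> t \<le> L \<and> x + t *\<^sub>R (\<sigma> *\<^sub>R axis i 1) \<notin> \<Omega>"
  and stay: "\<And>x t. x \<in> E ==> 0 \<le> t ==> t \<le> L ==> x + t *\<^sub>R (\<sigma> *\<^sub>R axis i 1) \<in> \<Omega>
    ==> x + t *\<^sub>R (\<sigma> *\<^sub>R axis i 1) \<in> E'"
  and z: "trace_zero p \<Omega> z Z"
 shows "Lp_pow (lebesgue_on E) p z \<le> ennreal (8 powr p * L powr p) * Lp_pow (lebesgue_on E') p Z"
proof -
 have p0: "0 \<le> p" using p by simp
 have S\<Omega>: "\<Omega> \<in> sets borel" using \<Omega> by simp
 note D = W1p_D(4,5)[OF trace_zero_W1p[OF z]]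
 define q where "q = (2::real) powr p"
 have q: "q > 0" by (simp add: q_def)
 define a where "a = q * (1 + q * (sweep_const CARD('n) * L + L powr p * q))"
 have sc: "0 \<le> sweep_const CARD('n)" using n by (simp add: sweep_const_def)
 have bound: "Lp_pow (lebesgue_on E) p z
   \<le> ennreal a * ennreal \<epsilon> + ennreal (8 powr p * L powr p) * Lp_pow (lebesgue_on E') p Z"
  if \<epsilon>: "\<epsilon> > 0" for \<epsilon>
 proof (rule trace_zero_approx[OF z \<epsilon>])
  fix w assume w: "smooth_on UNIV w" "Lp_pow (lebesgue_on \<Omega>) p (\<lambda>x. w x - z x) \<le> ennreal \<epsilon>"
   "Lp_pow (lebesgue_on \<Omega>) p (\<lambda>x. grad w x - Z x) \<le> ennreal \<epsilon>"
   "Lp_pow (surface_measure \<Omega>) p w \<le> ennreal \<epsilon>"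
  note mw = smooth_measurable[OF w(1)]
  let ?A = "Lp_pow (lebesgue_on E') p Z"
  have g: "Lp_pow (lebesgue_on E') p (grad w) \<le> ennreal q * (ennreal \<epsilon> + ?A)"
  proof -
   have "Lp_pow (lebesgue_on E') p (grad w) = Lp_pow (lebesgue_on E') p (\<lambda>x. (grad w x - Z x) + Z x)" by simp
   also have "\<dots> \<le> ennreal q * (Lp_pow (lebesgue_on E') p (\<lambda>x. grad w x - Z x) + ?A)"
    unfolding q_def
    by (rule Lp_pow_add_le[OF _ _ p0])
     (use measurable_lebesgue_on_subset[OF D(2) E'(2)] smooth_measurable(2)[OF w(1)] in auto)
   also have "Lp_pow (lebesgue_on E') p (\<lambda>x. grad w x - Z x) \<le> ennreal \<epsilon>"
    by (rule order_trans[OF Lp_pow_subset[OF E'(1) S\<Omega> E'(2)] w(3)])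
   finally show ?thesis by (simp add: add_right_mono mult_left_mono)
  qed
  have "Lp_pow (lebesgue_on E) p z = Lp_pow (lebesgue_on E) p (\<lambda>x. (z x - w x) + w x)" by simp
  also have "\<dots> \<le> ennreal q * (Lp_pow (lebesgue_on E) p (\<lambda>x. z x - w x) + Lp_pow (lebesgue_on E) p w)"
   unfolding q_def
   by (rule Lp_pow_add_le[OF _ _ p0])
    (use measurable_lebesgue_on_subset[OF D(1) E(2)] smooth_measurable(1)[OF w(1)] in auto)
  also have "Lp_pow (lebesgue_on E) p (\<lambda>x. z x - w x) \<le> ennreal \<epsilon>"
   unfolding Lp_pow_diff_commute[of _ p z w]
   by (rule order_trans[OF Lp_pow_subset[OF E(1) S\<Omega> E(2)] w(2)])
  also have "Lp_pow (lebesgue_on E) p w \<le> ennreal q * (ennreal (sweep_const CARD('n) * L) * ennreal \<epsilon>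
    + ennreal (L powr p) * (ennreal q * (ennreal \<epsilon> + ?A)))"
  proof -
   have "Lp_pow (lebesgue_on E) p w \<le> ennreal q * (ennreal (sweep_const CARD('n) * L) * Lp_pow (surface_measure \<Omega>) p w
    + ennreal (L powr p) * Lp_pow (lebesgue_on E') p (grad w))"
    using exit_estimate[OF \<Omega> n p L \<sigma> E E'(1) leave stay w(1)]
    by (simp add: Lp_pow_lebesgue_on[OF E(1)] Lp_pow_lebesgue_on[OF E'(1)] q_def)
   also have "\<dots> \<le> ennreal q * (ennreal (sweep_const CARD('n) * L) * ennreal \<epsilon>
    + ennreal (L powr p) * (ennreal q * (ennreal \<epsilon> + ?A)))"
    by (intro mult_left_mono add_mono w g) auto
   finally show ?thesis .
  qed
  also have "ennreal q * (ennreal \<epsilon> + ennreal q * (ennreal (sweep_const CARD('n) * L) * ennreal \<epsilon>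
    + ennreal (L powr p) * (ennreal q * (ennreal \<epsilon> + ?A))))
   = ennreal a * ennreal \<epsilon> + ennreal (8 powr p * L powr p) * ?A"
  proof -
   have 1: "ennreal a = ennreal q * (1 + ennreal q * (ennreal (sweep_const CARD('n) * L) + ennreal (L powr p) * ennreal q))"
    unfolding a_def using q sc L by (simp add: ennreal_mult ennreal_plus)
   have "8 powr p = q * (q * q)" unfolding q_def by (simp add: powr_mult[symmetric])
   then have 2: "ennreal (8 powr p * L powr p) = ennreal q * (ennreal q * (ennreal (L powr p) * ennreal q))"
    using q by (simp add: ennreal_mult[symmetric] mult_ac)
   show ?thesis unfolding 1 2 by (simp add: algebra_simps)
  qed
  finally show ?thesis by (simp add: add_left_mono add_right_mono mult_left_mono)
 qed
 have lim: "(\<lambda>k. ennreal a * ennreal (1 / real (Suc k)) + ennreal (8 powr p * L powr p) * Lp_pow (lebesgue_on E') p Z)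
   \<longlonglongrightarrow> ennreal a * 0 + ennreal (8 powr p * L powr p) * Lp_pow (lebesgue_on E') p Z"
  by (intro tendsto_add tendsto_const ennreal_tendsto_cmult inverse_Suc_tendsto_0) simp
 have "Lp_pow (lebesgue_on E) p z \<le> ennreal a * ennreal (1 / real (Suc k)) + ennreal (8 powr p * L powr p) * Lp_pow (lebesgue_on E') p Z" for k
  by (rule bound) simp
 from LIMSEQ_le_const[OF lim] this show ?thesis by simp
qed

text \<open>In a bounded domain every sufficiently long segment leaves, so the exit estimate applies to the whole domain.\<close>

lemma poincare_trace_zero:
 fixes \<Omega> :: "(real^'n::finite) set"
 assumes \<Omega>: "open \<Omega>" "bounded \<Omega>" and n: "2 \<le> CARD('n)" and p: "1 \<le> p"
 obtains C where "C > 0"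
  "\<And>z Z. trace_zero p \<Omega> z Z ==> Lp_pow (lebesgue_on \<Omega>) p z \<le> ennreal C * Lp_pow (lebesgue_on \<Omega>) p Z"
proof -
 obtain R where R: "R > 0" "\<And>x. x \<in> \<Omega> ==> norm x \<le> R" using \<Omega>(2) unfolding bounded_pos by blast
 define L where "L = 2 * R + 1"
 have L: "L > 0" using R by (simp add: L_def)
 obtain i :: 'n where True by auto
 have S: "\<Omega> \<in> sets borel" using \<Omega> by simp
 have leave: "\<exists>t. 0 \<le> t \<and> t \<le> L \<and> x + t *\<^sub>R (1 *\<^sub>R axis i 1) \<notin> \<Omega>" if "x \<in> \<Omega>" for x
 proof (intro exI[of _ L] conjI)
  show "x + L *\<^sub>R (1 *\<^sub>R axis i 1) \<notin> \<Omega>"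
  proof
   assume "x + L *\<^sub>R (1 *\<^sub>R axis i 1) \<in> \<Omega>"
   then have "norm (x + L *\<^sub>R axis i 1) \<le> R" using R by simp
   moreover have "norm (L *\<^sub>R axis i 1 :: real^'n) - norm x \<le> norm (x + L *\<^sub>R axis i 1)"
    using norm_diff_ineq[of "L *\<^sub>R axis i 1" x] by (simp add: add.commute)
   moreover have "norm (L *\<^sub>R axis i 1 :: real^'n) = L" using L by simp
   ultimately show False using R(2)[OF that] R(1) by (simp add: L_def)
  qed
 qed (use L in auto)
 show ?thesis
 proof (rule that[of "8 powr p * L powr p"])
  show "0 < 8 powr p * L powr p" using L by simp
  fix z Z assume z: "trace_zero p \<Omega> z Z"
  show "Lp_pow (lebesgue_on \<Omega>) p z \<le> ennreal (8 powr p * L powr p) * Lp_pow (lebesgue_on \<Omega>) p Z"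
   by (rule trace_zero_exit_estimate[where \<sigma>=1 and i=i, OF \<Omega> n p L _ S _ S _ leave _ z]) auto
 qed
qed

lemma Lp_pow_components_le:
 fixes f :: "'a => real^'n::finite"
 assumes [measurable]: "\<And>i. (\<lambda>x. f x $ i) \<in> borel_measurable M" and p: "0 \<le> p"
 shows "Lp_pow M p f \<le> ennreal (real CARD('n) powr p) * (\<Sum>i\<in>UNIV. Lp_pow M p (\<lambda>x. f x $ i))"
proof -
 have pt: "norm (v :: real^'n) powr p \<le> real CARD('n) powr p * (\<Sum>i\<in>UNIV. \<bar>v $ i\<bar> powr p)" for v
 proof -
  let ?m = "Max (range (\<lambda>i. \<bar>v $ i\<bar>))"
  have "?m \<in> range (\<lambda>i. \<bar>v $ i\<bar>)" by (rule Max_in) auto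
  then obtain j where "?m = (\<lambda>i. \<bar>v $ i\<bar>) j" by (rule rangeE)
  then have j: "?m = \<bar>v $ j\<bar>" by simp
  have "norm v \<le> (\<Sum>i\<in>UNIV. \<bar>v $ i\<bar>)" by (rule norm_le_l1_cart)
  also have "\<dots> \<le> (\<Sum>i\<in>(UNIV::'n set). ?m)" by (intro sum_mono Max_ge) auto
  finally have "norm v \<le> real CARD('n) * \<bar>v $ j\<bar>" by (simp add: j)
  then have "norm v powr p \<le> (real CARD('n) * \<bar>v $ j\<bar>) powr p" using p by (intro powr_mono2) auto
  also have "\<dots> = real CARD('n) powr p * \<bar>v $ j\<bar> powr p" by (simp add: powr_mult)
  also have "\<bar>v $ j\<bar> powr p \<le> (\<Sum>i\<in>UNIV. \<bar>v $ i\<bar> powr p)" by (rule member_le_sum) auto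
  finally show ?thesis by (simp add: mult_left_mono)
 qed
 have "Lp_pow M p f \<le> (\<integral>\<^sup>+x. ennreal (real CARD('n) powr p) * (\<Sum>i\<in>UNIV. ennreal (norm (f x $ i) powr p)) \<partial>M)"
  unfolding Lp_pow_def
 proof (rule nn_integral_mono)
  fix x
  show "ennreal (norm (f x) powr p) \<le> ennreal (real CARD('n) powr p) * (\<Sum>i\<in>UNIV. ennreal (norm (f x $ i) powr p))"
   using ennreal_leI[OF pt[of "f x"]] by (simp add: sum_ennreal ennreal_mult sum_nonneg)
 qed
 also have "\<dots> = ennreal (real CARD('n) powr p) * (\<Sum>i\<in>UNIV. Lp_pow M p (\<lambda>x. f x $ i))"
  unfolding Lp_pow_def by (subst nn_integral_cmult, measurable, subst nn_integral_sum) measurable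
 finally show ?thesis .
qed

lemma measurable_components:
 fixes f :: "'a => real^'n::finite"
 assumes "f \<in> borel_measurable M"
 shows "(\<lambda>x. f x $ i) \<in> borel_measurable M"
 by (rule measurable_compose[OF assms borel_measurable_continuous_onI]) (intro continuous_intros)

text \<open>A Sobolev function with compact support in the domain has trace zero: its mollifications vanish on the
 boundary.\<close>

lemma trace_zero_compact_support:
 fixes \<Omega> :: "(real^'n::finite) set"
 assumes \<Omega>: "open \<Omega>" and p: "1 \<le> p" and \<eta>: "test_fun \<Omega> \<eta>" and s: "W1p p \<Omega> s S"
 shows "trace_zero p \<Omega> (\<lambda>x. \<eta> x * s x) (\<lambda>x. \<eta> x *\<^sub>R S x + s x *\<^sub>R grad \<eta> x)"
proof -
 have p0: "0 \<le> p" using p by simp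
 have S\<Omega>: "\<Omega> \<in> sets borel" "\<Omega> \<in> sets lebesgue" using \<Omega> by auto
 define t where "t = (\<lambda>x. \<eta> x * s x)"
 define T where "T = (\<lambda>x. \<eta> x *\<^sub>R S x + s x *\<^sub>R grad \<eta> x)"
 note D = W1p_D[OF s]
 note m = is_weak_gradient_mult[OF \<Omega> \<eta> D(3), folded t_def T_def]
 note s\<eta> = test_funD(1)[OF \<eta>]
 obtain R where R: "supported_in_ball R \<eta>" using test_funD(4)[OF \<eta>] by blast
 obtain M0 where M0: "M0 > 0" "\<And>x. \<bar>\<eta> x\<bar> \<le> M0" using supported_bounded[OF smooth_continuous[OF s\<eta>] R] by blast
 have "\<exists>M. \<forall>x. \<bar>partial i \<eta> x\<bar> \<le> M" for i
  using supported_bounded[OF smooth_continuous[OF smooth_partial[OF s\<eta>]] supported_partial[OF R]] by metis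
 then obtain Mi where Mi: "\<And>i x. \<bar>partial i \<eta> x\<bar> \<le> Mi i" by metis
 define M1 where "M1 = (\<Sum>i\<in>UNIV. Mi i)"
 have M1: "norm (grad \<eta> x) \<le> M1" for x
 proof -
  have "norm (grad \<eta> x) \<le> (\<Sum>i\<in>UNIV. \<bar>grad \<eta> x $ i\<bar>)" by (rule norm_le_l1_cart)
  also have "\<dots> \<le> M1" unfolding M1_def grad_def by (intro sum_mono) (simp add: Mi)
  finally show ?thesis .
 qed
 have M1': "0 \<le> M1" using M1[of 0] norm_ge_zero order_trans by blast
 have mT: "t \<in> borel_measurable lebesgue" "T \<in> borel_measurable lebesgue" using m by auto
 have t\<Omega>: "in_Lp (lebesgue_on \<Omega>) p t"
 proof (rule in_Lp_bound[OF in_Lp_linear[OF D(1) D(1) p0, of M0 0]])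
  show "t \<in> borel_measurable (lebesgue_on \<Omega>)" using mT(1) by (rule measurable_restrict_space1)
  show "norm (t x) \<le> norm (M0 *\<^sub>R s x + 0 *\<^sub>R s x)" for x
   using M0 by (simp add: t_def abs_mult mult_right_mono)
 qed (rule p0)
 have T\<Omega>: "in_Lp (lebesgue_on \<Omega>) p T"
 proof -
  have a: "in_Lp (lebesgue_on \<Omega>) p (\<lambda>x. \<eta> x *\<^sub>R S x)"
  proof (rule in_Lp_bound[OF in_Lp_linear[OF D(2) D(2) p0, of M0 0]])
   show "(\<lambda>x. \<eta> x *\<^sub>R S x) \<in> borel_measurable (lebesgue_on \<Omega>)"
    using D(5) smooth_measurable(1)[OF s\<eta>, of \<Omega>] by measurable
   show "norm (\<eta> x *\<^sub>R S x) \<le> norm (M0 *\<^sub>R S x + 0 *\<^sub>R S x)" for x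
    using M0 by (simp add: mult_right_mono)
  qed (rule p0)
  have b: "in_Lp (lebesgue_on \<Omega>) p (\<lambda>x. s x *\<^sub>R grad \<eta> x)"
  proof (rule in_Lp_bound[OF in_Lp_linear[OF D(1) D(1) p0, of M1 0]])
   show "(\<lambda>x. s x *\<^sub>R grad \<eta> x) \<in> borel_measurable (lebesgue_on \<Omega>)"
    using D(4) smooth_measurable(2)[OF s\<eta>, of \<Omega>] by measurable
   show "norm (s x *\<^sub>R grad \<eta> x) \<le> norm (M1 *\<^sub>R s x + 0 *\<^sub>R s x)" for x
    using mult_left_mono[OF M1[of x], of "\<bar>s x\<bar>"] M1' by (simp add: abs_mult mult.commute)
  qed (rule p0)
  show ?thesis unfolding T_def by (rule in_Lp_add[OF a b p0])
 qed
 have "is_weak_gradient \<Omega> t T" unfolding is_weak_gradient_def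
 proof (intro conjI allI impI)
  show "locally_integrable \<Omega> t" "locally_integrable \<Omega> T"
   using is_weak_gradientD(1,2)[OF m(3)] by (auto simp: locally_integrable_def)
  fix \<psi> :: "real^'n => real" and i assume \<psi>: "test_fun \<Omega> \<psi>"
  then have "test_fun UNIV \<psi>" by (simp add: test_fun_def)
  from is_weak_gradientD(3)[OF m(3) this, of i]
  show "(\<integral>x. t x * partial i \<psi> x \<partial>lebesgue_on \<Omega>) = - (\<integral>x. T x $ i * \<psi> x \<partial>lebesgue_on \<Omega>)"
   unfolding test_integral_UNIV[OF \<Omega> \<psi>] by (simp add: lebesgue_on_UNIV_eq)
 qed
 then have W: "W1p p \<Omega> t T" using t\<Omega> T\<Omega> by (simp add: W1p_def)
 have zero_off: "t x = 0" "T x = 0" if "x \<notin> \<Omega>" for x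
  using that test_fun_zero_off[OF \<eta>, of x] test_funD(3)[OF \<eta>] grad_zero_off_closure(1)[of x \<eta>]
  by (auto simp: t_def T_def)
 have full: "(\<integral>\<^sup>+x. ennreal (norm (f x) powr p) \<partial>lebesgue) = Lp_pow (lebesgue_on \<Omega>) p f"
  if "\<And>x. x \<notin> \<Omega> ==> f x = 0" for f :: "real^'n => 'c::euclidean_space"
  unfolding Lp_pow_lebesgue_on[OF S\<Omega>(1)] nn_integral_completion
  by (rule nn_integral_cong) (use that p in \<open>auto simp: indicator_def\<close>)
 have e: "1 / real (Suc k) > 0" for k by simp
 define w where "w k = conv t (moll_seq k)" for k
 have sw: "smooth_on UNIV (w k)" for k
  unfolding w_def by (rule smooth_conv[OF m(1) smooth_mollifier[OF e] supported_mollifier[OF e]])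
 have restr: "Lp_pow (lebesgue_on \<Omega>) p f \<le> (\<integral>\<^sup>+x. ennreal (norm (f x) powr p) \<partial>lebesgue)" for f :: "real^'n => real"
  unfolding Lp_pow_lebesgue_on[OF S\<Omega>(1)] nn_integral_completion
  by (intro nn_integral_mono) (auto simp: indicator_def)
 have mol: "(\<lambda>k. Lp_pow (lebesgue_on \<Omega>) p (\<lambda>x. conv h (moll_seq k) x - h x)) \<longlonglongrightarrow> 0"
  if h: "integrable lebesgue h" "\<And>x. x \<notin> \<Omega> ==> h x = 0" "Lp_pow (lebesgue_on \<Omega>) p h < \<infinity>" for h
 proof (rule ennreal_tendsto_0_mono[OF restr])
  show "(\<lambda>k. \<integral>\<^sup>+x. ennreal (norm (conv h (moll_seq k) x - h x) powr p) \<partial>lebesgue) \<longlonglongrightarrow> 0"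
   using mollify_tendsto_Lp[OF h(1) p] full[OF h(2)] h(3) by simp
 qed
 have c1: "tendsto_Lp (lebesgue_on \<Omega>) p w t"
  unfolding tendsto_Lp_iff w_def by (rule mol[OF m(1) zero_off(1)]) (use t\<Omega> in \<open>auto simp: in_Lp_iff\<close>)
 have gw: "grad (w k) x $ i = conv (\<lambda>x. T x $ i) (moll_seq k) x" for k x i
  unfolding grad_def w_def using partial_mollified[OF m(1,3) e, of i k] by simp
 have Ti: "integrable lebesgue (\<lambda>x. T x $ i)" for i
  by (rule integrable_bounded_linear[OF bounded_linear_vec_nth m(2)])
 have mTi[measurable]: "(\<lambda>x. T x $ i) \<in> borel_measurable (lebesgue_on \<Omega>)" for i
  using borel_measurable_integrable[OF Ti] by (rule measurable_restrict_space1)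
 have mg[measurable]: "(\<lambda>x. grad (w k) x $ i) \<in> borel_measurable (lebesgue_on \<Omega>)" for k i
  by (rule measurable_components[OF smooth_measurable(2)[OF sw]])
 have c2: "tendsto_Lp (lebesgue_on \<Omega>) p (\<lambda>k. grad (w k)) T"
  unfolding tendsto_Lp_iff
 proof (rule ennreal_tendsto_0_mono)
  show "Lp_pow (lebesgue_on \<Omega>) p (\<lambda>x. grad (w k) x - T x) \<le> ennreal (real CARD('n) powr p) *
    (\<Sum>i\<in>UNIV. Lp_pow (lebesgue_on \<Omega>) p (\<lambda>x. conv (\<lambda>x. T x $ i) (moll_seq k) x - T x $ i))" for k
   using Lp_pow_components_le[of "\<lambda>x. grad (w k) x - T x" "lebesgue_on \<Omega>" p] p0 mTi mg[of k] gw
   by simp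
  have "(\<lambda>k. ennreal (real CARD('n) powr p) *
    (\<Sum>i\<in>UNIV. Lp_pow (lebesgue_on \<Omega>) p (\<lambda>x. conv (\<lambda>x. T x $ i) (moll_seq k) x - T x $ i)))
    \<longlonglongrightarrow> ennreal (real CARD('n) powr p) * (\<Sum>i\<in>(UNIV::'n set). 0)"
  proof (intro ennreal_tendsto_cmult tendsto_sum mol Ti)
   fix i
   have "Lp_pow (lebesgue_on \<Omega>) p (\<lambda>x. T x $ i) \<le> Lp_pow (lebesgue_on \<Omega>) p T"
    by (rule Lp_pow_mono[OF _ p0]) (simp add: component_le_norm_cart)
   then show "Lp_pow (lebesgue_on \<Omega>) p (\<lambda>x. T x $ i) < \<infinity>"
    using T\<Omega> by (auto simp: in_Lp_iff intro: le_less_trans)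
  qed (auto simp: zero_off)
  then show "(\<lambda>k. ennreal (real CARD('n) powr p) *
    (\<Sum>i\<in>UNIV. Lp_pow (lebesgue_on \<Omega>) p (\<lambda>x. conv (\<lambda>x. T x $ i) (moll_seq k) x - T x $ i))) \<longlonglongrightarrow> 0" by simp
 qed
 let ?K = "closure {x. \<eta> x \<noteq> 0}"
 have "closed (- \<Omega>)" "?K \<inter> - \<Omega> = {}" using \<Omega> test_funD(3)[OF \<eta>] by auto
 from separate_compact_closed[OF test_funD(2)[OF \<eta>] this]
 obtain d where d: "d > 0" "\<And>x y. x \<in> ?K ==> y \<in> - \<Omega> ==> d \<le> dist x y" by blast
 obtain N where N: "1 / real (Suc N) < d" by (rule nat_approx_posE[OF d(1)])
 have w0: "w k x = 0" if "k \<ge> N" "x \<notin> \<Omega>" for k x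
 proof -
  have k: "1 / real (Suc k) \<le> d" using that N frac_le[of 1 1 "real (Suc N)" "real (Suc k)"] by simp
  have "t y * moll_seq k (x - y) = 0" for y
  proof (cases "\<eta> y = 0")
   case False
   then have "y \<in> ?K" by (intro subsetD[OF closure_subset]) simp
   from d(2)[OF this, of x] that(2) have "d \<le> dist y x" by simp
   then have "1 / real (Suc k) \<le> norm (x - y)" using k by (simp add: dist_norm norm_minus_commute)
   then show ?thesis using supported_mollifier[OF e, of k, where 'n='n] by (simp add: supported_in_ball_def)
  qed (simp add: t_def)
  then have "w k x = (\<integral>y. 0 \<partial>(lebesgue :: (real^'n) measure))" unfolding w_def conv_def
   by (rule Bochner_Integration.integral_cong[OF refl])
  then show ?thesis by simp
 qed
 have c3: "tendsto_Lp (surface_measure \<Omega>) p w (\<lambda>x. 0)"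
  unfolding tendsto_Lp_iff
 proof (rule tendsto_eventually)
  have "Lp_pow (surface_measure \<Omega>) p (\<lambda>x. w k x - 0) = 0" if "k \<ge> N" for k
  proof -
   have "Lp_pow (surface_measure \<Omega>) p (\<lambda>x. w k x - 0) = (\<integral>\<^sup>+x. 0 \<partial>surface_measure \<Omega>)"
    unfolding Lp_pow_def
   proof (rule nn_integral_cong)
    fix x assume "x \<in> space (surface_measure \<Omega>)"
    then have "x \<notin> \<Omega>" using \<Omega> by (auto simp: surface_measure_def space_restrict_space frontier_def interior_open)
    then show "ennreal (norm (w k x - 0) powr p) = 0" using w0[OF that] by simp
   qed
   then show ?thesis by simp
  qed
  then show "\<forall>\<^sub>F k in sequentially. Lp_pow (surface_measure \<Omega>) p (\<lambda>x. w k x - 0) = 0"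
   by (auto simp: eventually_sequentially)
 qed
 show ?thesis
  unfolding trace_zero_def t_def[symmetric] T_def[symmetric]
  by (intro conjI allI exI[of _ w] W sw c1 c2 c3)
qed

section \<open>Smooth boundaries\<close>

text \<open>Near a boundary point some partial derivative of the defining function is bounded away from zero, so
 moving in that coordinate direction makes the function grow at a definite rate. Within distance \<open>d\<close> of
 the complement the function is at least a constant times \<open>- d\<close>.\<close>

definition exits_near :: "(real^'n::finite) set => real^'n => real => real => real => real => 'n => bool" where
 "exits_near \<Omega> x0 r \<kappa> \<delta> \<sigma> i \<longleftrightarrow> 0 < r \<and> 0 < \<kappa> \<and> 0 < \<delta> \<and> \<bar>\<sigma>\<bar> = 1 \<and>
   (\<forall>d x y. 0 < d \<and> d \<le> \<delta> \<and> x \<in> \<Omega> \<and> dist x0 x < r \<and> y \<notin> \<Omega> \<and> dist x y < d \<longrightarrow>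
    x + (\<kappa> * d) *\<^sub>R (\<sigma> *\<^sub>R axis i 1) \<notin> \<Omega>)"

lemma boundary_exits_near:
 fixes \<Omega> :: "(real^'n::finite) set"
 assumes dom: "bounded_smooth_domain \<Omega>" and x0: "x0 \<in> frontier \<Omega>"
 shows "\<exists>r \<kappa> \<delta> \<sigma> i. exits_near \<Omega> x0 r \<kappa> \<delta> \<sigma> i"
proof -
 obtain U \<rho> where U: "open U" "x0 \<in> U" "smooth_on U \<rho>" "\<forall>y\<in>U. grad \<rho> y \<noteq> 0" "\<Omega> \<inter> U = {y\<in>U. \<rho> y < 0}"
  using dom x0 unfolding bounded_smooth_domain_def by blast
 have C1: "Ck_on (Suc 0) U \<rho>" by (rule smooth_Ck[OF U(3)])
 then have diff: "\<And>y. y \<in> U ==> \<rho> differentiable (at y)" and cp: "\<And>i. continuous_on U (partial i \<rho>)" by auto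
 have "grad \<rho> x0 \<noteq> 0" using U by blast
 then obtain i where i: "partial i \<rho> x0 \<noteq> 0" by (auto simp: grad_def vec_eq_iff)
 define \<sigma> where "\<sigma> = sgn (partial i \<rho> x0)"
 define a where "a = \<bar>partial i \<rho> x0\<bar> / 2"
 have a: "a > 0" using i by (simp add: a_def)
 have \<sigma>: "\<bar>\<sigma>\<bar> = 1" using i by (simp add: \<sigma>_def abs_sgn_eq)
 have cg: "continuous_on U (grad \<rho>)" unfolding grad_def by (intro continuous_on_vec_lambda cp)
 define M where "M = norm (grad \<rho> x0) + 1"
 have M: "M > 0" by (simp add: M_def add_nonneg_pos)
 have "isCont (grad \<rho>) x0" using cg U(1,2) continuous_on_eq_continuous_at by blast
 then obtain R1 where R1: "R1 > 0" "\<And>y. dist y x0 < R1 ==> dist (grad \<rho> y) (grad \<rho> x0) < min a 1"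
  using a continuous_at_eps_delta[THEN iffD1, rule_format, of x0 "grad \<rho>" "min a 1"] by auto
 obtain R2 where R2: "R2 > 0" "ball x0 R2 \<subseteq> U" by (rule openE[OF U(1,2)])
 define R where "R = min R1 R2"
 have R: "R > 0" "\<And>y. y \<in> ball x0 R ==> y \<in> U" "\<And>y. y \<in> ball x0 R ==> norm (grad \<rho> y - grad \<rho> x0) < min a 1"
  using R1 R2 by (auto simp: R_def dist_norm norm_minus_commute subset_iff)
 have gM: "norm (grad \<rho> y) \<le> M" if "y \<in> ball x0 R" for y
  using R(3)[OF that] norm_triangle_sub[of "grad \<rho> y" "grad \<rho> x0"] by (simp add: M_def)
 have pa: "a \<le> \<sigma> * partial i \<rho> y" if "y \<in> ball x0 R" for y
 proof -
  have "\<bar>partial i \<rho> y - partial i \<rho> x0\<bar> \<le> norm (grad \<rho> y - grad \<rho> x0)"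
   using component_le_norm_cart[of "grad \<rho> y - grad \<rho> x0" i] by (simp add: grad_def)
  then have *: "\<bar>partial i \<rho> y - partial i \<rho> x0\<bar> < a" using R(3)[OF that] by simp
  have "\<bar>u\<bar> / 2 \<le> sgn u * v" if "\<bar>v - u\<bar> < \<bar>u\<bar> / 2" for u v :: real
   using that by (cases "u > 0"; cases "u = 0") (auto simp: sgn_if abs_if split: if_splits)
  from this[OF *[unfolded a_def]] show ?thesis unfolding \<sigma>_def a_def .
 qed
 define \<kappa> where "\<kappa> = M / a"
 have \<kappa>: "\<kappa> > 0" using M a by (simp add: \<kappa>_def)
 define r where "r = R / 2"
 define \<delta> where "\<delta> = R / (4 * (\<kappa> + 1))"
 have \<delta>: "\<delta> > 0" using R \<kappa> by (simp add: \<delta>_def)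
 have \<delta>R: "\<delta> * (\<kappa> + 1) = R / 4" 
 proof -
  have "R / (4 * q) * q = R / 4" if "q > 0" for q :: real using that by simp
  from this[of "\<kappa> + 1"] \<kappa> show ?thesis unfolding \<delta>_def by linarith
 qed
 have "x + (\<kappa> * d) *\<^sub>R (\<sigma> *\<^sub>R axis i 1) \<notin> \<Omega>"
  if d: "0 < d" "d \<le> \<delta>" and x: "x \<in> \<Omega>" "dist x0 x < r" and y: "y \<notin> \<Omega>" "dist x y < d" for d x y
 proof -
  let ?e = "\<sigma> *\<^sub>R axis i 1 :: real^'n"
  have ne: "norm ?e = 1" using \<sigma> by (simp add: norm_axis_1)
  have "d * (\<kappa> + 1) \<le> \<delta> * (\<kappa> + 1)" using d \<kappa> by (intro mult_right_mono) auto
  then have "d * (\<kappa> + 1) \<le> R / 4" unfolding \<delta>R .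
  then have small: "d + \<kappa> * d \<le> R / 4" by (simp add: algebra_simps)
  then have dR: "d \<le> R / 4" "\<kappa> * d \<le> R / 4" 
  proof -
   have "0 \<le> \<kappa> * d" using \<kappa> d by simp
   then show "d \<le> R / 4" "\<kappa> * d \<le> R / 4" using small d(1) by linarith+
  qed
  have xb: "x \<in> ball x0 R" unfolding mem_ball using x(2) R(1) r_def by linarith
  have yb: "y \<in> ball x0 R"
   unfolding mem_ball using dist_triangle[of x0 y x] x(2) y(2) dR(1) R(1) r_def by linarith
  have "norm (\<rho> y - \<rho> x) \<le> M * norm (y - x)"
  proof (rule differentiable_bound[of "ball x0 R" \<rho> "\<lambda>z v. grad \<rho> z \<bullet> v"])
   fix z assume z: "z \<in> ball x0 R"
   show "(\<rho> has_derivative (\<bullet>) (grad \<rho> z)) (at z within ball x0 R)"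
    by (rule has_derivative_at_withinI[OF has_derivative_grad[OF diff[OF R(2)[OF z]]]])
   show "onorm ((\<bullet>) (grad \<rho> z)) \<le> M"
   proof (rule onorm_le)
    fix v
    have "\<bar>grad \<rho> z \<bullet> v\<bar> \<le> norm (grad \<rho> z) * norm v" by (rule Cauchy_Schwarz_ineq2)
    also have "\<dots> \<le> M * norm v" by (intro mult_right_mono gM z) simp
    finally show "norm (grad \<rho> z \<bullet> v) \<le> M * norm v" by simp
   qed
  qed (use xb yb in auto)
  also have "\<dots> \<le> M * d" using y(2) M by (intro mult_left_mono) (auto simp: dist_norm norm_minus_commute)
  finally have "\<rho> y - \<rho> x \<le> M * d" by simp
  moreover have "\<rho> y \<ge> 0"
  proof (rule ccontr)
   assume "\<not> \<rho> y \<ge> 0"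
   then have "y \<in> {y\<in>U. \<rho> y < 0}" using R(2)[OF yb] by simp
   then show False using y(1) U(5) by blast
  qed
  ultimately have \<rho>x: "- M * d \<le> \<rho> x" by simp
  have seg: "x + t *\<^sub>R ?e \<in> ball x0 R" if "0 \<le> t" "t \<le> \<kappa> * d" for t
  proof -
   have "dist x0 (x + t *\<^sub>R ?e) \<le> dist x0 x + norm (t *\<^sub>R ?e)"
    using dist_triangle[of x0 "x + t *\<^sub>R ?e" x] by (simp add: dist_norm)
   also have "norm (t *\<^sub>R ?e) = t" using ne that by (simp only: norm_scaleR)
   finally show ?thesis unfolding mem_ball using x(2) that(2) dR(2) R(1) r_def by linarith
  qed
  have kd: "0 < \<kappa> * d" using \<kappa> d by simp
  have der: "((\<lambda>t. \<rho> (x + t *\<^sub>R ?e)) has_real_derivative \<sigma> * partial i \<rho> (x + t *\<^sub>R ?e)) (at t)"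
   if "0 \<le> t" "t \<le> \<kappa> * d" for t
  proof -
   have "((\<lambda>t. x + t *\<^sub>R ?e) has_derivative (\<lambda>h. h *\<^sub>R ?e)) (at t)"
    by (auto intro!: derivative_eq_intros)
   from has_derivative_compose[OF this has_derivative_grad[OF diff[OF R(2)[OF seg[OF that]]]]]
   show ?thesis by (rule has_derivative_imp_has_field_derivative) (simp add: inner_axis grad_def)
  qed
  obtain t where t: "0 < t" "t < \<kappa> * d" "\<rho> (x + (\<kappa> * d) *\<^sub>R ?e) - \<rho> (x + 0 *\<^sub>R ?e)
    = (\<kappa> * d - 0) * (\<sigma> * partial i \<rho> (x + t *\<^sub>R ?e))"
   using MVT2[OF kd, of "\<lambda>t. \<rho> (x + t *\<^sub>R ?e)" "\<lambda>t. \<sigma> * partial i \<rho> (x + t *\<^sub>R ?e)"] der by blast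
  have "\<kappa> * d * a \<le> \<kappa> * d * (\<sigma> * partial i \<rho> (x + t *\<^sub>R ?e))"
   using pa[OF seg[of t]] t kd by (intro mult_left_mono) auto
  then have "\<rho> (x + (\<kappa> * d) *\<^sub>R ?e) \<ge> \<rho> x + \<kappa> * d * a" using t(3) by simp
  moreover have "\<kappa> * d * a = M * d" using a by (simp add: \<kappa>_def)
  ultimately have "\<rho> (x + (\<kappa> * d) *\<^sub>R ?e) \<ge> 0" using \<rho>x by simp
  then have "x + (\<kappa> * d) *\<^sub>R ?e \<notin> {y\<in>U. \<rho> y < 0}" by simp
  moreover have "x + (\<kappa> * d) *\<^sub>R ?e \<in> U" by (rule R(2)[OF seg]) (use kd in auto)
  ultimately show ?thesis using U(5) by blast
 qed
 then have "exits_near \<Omega> x0 r \<kappa> \<delta> \<sigma> i"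
  unfolding exits_near_def using R(1) \<kappa> \<delta> \<sigma> by (auto simp: r_def)
 then show ?thesis by blast
qed

definition inner_strip :: "(real^'n::finite) set => real => (real^'n) set" where
 "inner_strip \<Omega> d = {x \<in> \<Omega>. infdist x (- \<Omega>) < d}"

lemma inner_strip_measurable:
 assumes "open (\<Omega> :: (real^'n::finite) set)"
 shows "inner_strip \<Omega> d \<in> sets borel" "inner_strip \<Omega> d \<subseteq> \<Omega>" "open (inner_strip \<Omega> d)"
proof -
 have "inner_strip \<Omega> d = \<Omega> \<inter> {x. infdist x (- \<Omega>) < d}" by (auto simp: inner_strip_def)
 moreover have "open {x. infdist x (- \<Omega>) < d}" by (intro open_Collect_less continuous_intros)
 ultimately show "open (inner_strip \<Omega> d)" using assms by auto
 then show "inner_strip \<Omega> d \<in> sets borel" by simp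
qed (auto simp: inner_strip_def)

lemma Lp_pow_finite_cover:
 fixes S :: "(real^'n::finite) set" and z :: "real^'n => 'b::euclidean_space"
 assumes "finite T" "S \<subseteq> (\<Union>j\<in>T. E j)" "S \<in> sets borel" "\<And>j. j \<in> T ==> E j \<in> sets borel"
  and z: "z \<in> borel_measurable (lebesgue_on S)"
 shows "Lp_pow (lebesgue_on S) p z \<le> (\<Sum>j\<in>T. Lp_pow (lebesgue_on (S \<inter> E j)) p z)"
proof -
 have SE: "S \<inter> E j \<in> sets borel" if "j \<in> T" for j using assms that by auto
 have zm: "(\<lambda>x. ennreal (norm (z x) powr p) * indicator (S \<inter> E j) x) \<in> borel_measurable lebesgue" if "j \<in> T" for j
 proof -
  have S: "S \<in> sets lebesgue" "S \<inter> E j \<in> sets lebesgue" using assms(3) SE[OF that] by auto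
  have "(\<lambda>x. if x \<in> S then z x else 0) \<in> borel_measurable lebesgue" using z by (simp add: borel_measurable_if[OF S(1)])
  then have "(\<lambda>x. ennreal (norm (if x \<in> S then z x else 0) powr p) * indicator (S \<inter> E j) x) \<in> borel_measurable lebesgue"
   using S(2) by measurable
  then show ?thesis by (rule measurable_cong[THEN iffD1, rotated]) (auto simp: indicator_def)
 qed
 have "Lp_pow (lebesgue_on S) p z = (\<integral>\<^sup>+x. ennreal (norm (z x) powr p) * indicator S x \<partial>lebesgue)"
  unfolding Lp_pow_lebesgue_on[OF assms(3)] nn_integral_completion ..
 also have "\<dots> \<le> (\<integral>\<^sup>+x. (\<Sum>j\<in>T. ennreal (norm (z x) powr p) * indicator (S \<inter> E j) x) \<partial>lebesgue)"
 proof (rule nn_integral_mono)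
  fix x
  show "ennreal (norm (z x) powr p) * indicator S x \<le> (\<Sum>j\<in>T. ennreal (norm (z x) powr p) * indicator (S \<inter> E j) x)"
  proof (cases "x \<in> S")
   case True
   then obtain j where j: "j \<in> T" "x \<in> E j" using assms(2) by blast
   have "ennreal (norm (z x) powr p) * indicator S x = ennreal (norm (z x) powr p) * indicator (S \<inter> E j) x"
    using True j by simp
   also have "\<dots> \<le> (\<Sum>j\<in>T. ennreal (norm (z x) powr p) * indicator (S \<inter> E j) x)"
    by (rule member_le_sum) (use j assms(1) in auto)
   finally show ?thesis .
  qed simp
 qed
 also have "\<dots> = (\<Sum>j\<in>T. \<integral>\<^sup>+x. ennreal (norm (z x) powr p) * indicator (S \<inter> E j) x \<partial>lebesgue)"
  by (rule nn_integral_sum) (rule zm)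
 also have "\<dots> = (\<Sum>j\<in>T. Lp_pow (lebesgue_on (S \<inter> E j)) p z)"
  by (rule sum.cong) (simp_all add: Lp_pow_lebesgue_on SE nn_integral_completion)
 finally show ?thesis .
qed

text \<open>By compactness finitely many of the neighbourhoods of \<open>boundary_exits_near\<close> cover the boundary; in each
 of them a segment of length proportional to \<open>d\<close> leads out of the domain.\<close>

lemma strip_estimate:
 fixes \<Omega> :: "(real^'n::finite) set"
 assumes dom: "bounded_smooth_domain \<Omega>" and n: "2 \<le> CARD('n)" and p: "1 \<le> p"
 obtains C \<kappa> \<delta> where "C > 0" "\<kappa> > 0" "\<delta> > 0"
  "\<And>d z Z. 0 < d ==> d \<le> \<delta> ==> trace_zero p \<Omega> z Z ==>
    Lp_pow (lebesgue_on (inner_strip \<Omega> d)) p z \<le> ennreal (C * d powr p) * Lp_pow (lebesgue_on (inner_strip \<Omega> (\<kappa> * d))) p Z"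
proof -
 have \<Omega>: "open \<Omega>" "bounded \<Omega>" "\<Omega> \<noteq> {}" using dom by (auto simp: bounded_smooth_domain_def)
 have cne: "- \<Omega> \<noteq> {}" using \<Omega>(2) not_bounded_UNIV by (metis Compl_UNIV_eq double_compl)
 let ?F = "frontier \<Omega>"
 have cF: "compact ?F" using \<Omega>(2) by (rule compact_frontier_bounded)
 have "\<forall>x0\<in>?F. \<exists>r \<kappa> \<delta> \<sigma> i. exits_near \<Omega> x0 r \<kappa> \<delta> \<sigma> i" using boundary_exits_near[OF dom] by blast
 then obtain r \<kappa> \<delta> \<sigma> i where ex: "\<And>x0. x0 \<in> ?F ==> exits_near \<Omega> x0 (r x0) (\<kappa> x0) (\<delta> x0) (\<sigma> x0) (i x0)" by metis
 have pos: "0 < r x0 / 2" "0 < r x0" "0 < \<delta> x0" if "x0 \<in> ?F" for x0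
  using ex[OF that] by (auto simp: exits_near_def)
 have "?F \<subseteq> (\<Union>x0\<in>?F. ball x0 (r x0 / 2))"
 proof
  fix x assume "x \<in> ?F"
  then show "x \<in> (\<Union>x0\<in>?F. ball x0 (r x0 / 2))" using pos(1)[of x] by (intro UN_I[of x]) auto
 qed
 then obtain T where T: "T \<subseteq> ?F" "finite T" "?F \<subseteq> (\<Union>x0\<in>T. ball x0 (r x0 / 2))"
  by (rule compactE_image[OF cF open_ball])
 define \<delta>0 where "\<delta>0 = Min (insert 1 ((\<lambda>x0. min (\<delta> x0) (r x0 / 2)) ` T))"
 define \<kappa>0 where "\<kappa>0 = Max (insert 1 (\<kappa> ` T))"
 have \<delta>0: "\<delta>0 > 0" 
 proof -
  have "0 < min (\<delta> x0) (r x0 / 2)" if "x0 \<in> T" for x0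
   using pos(1,3)[of x0] that T(1) by auto
  then show ?thesis unfolding \<delta>0_def using T(2) by (subst Min_gr_iff) auto
 qed
 have \<delta>0T: "\<delta>0 \<le> \<delta> x0" "\<delta>0 \<le> r x0 / 2" if "x0 \<in> T" for x0
 proof -
  have "\<delta>0 \<le> min (\<delta> x0) (r x0 / 2)" unfolding \<delta>0_def using T(2) that by (intro Min_le) auto
  then show "\<delta>0 \<le> \<delta> x0" "\<delta>0 \<le> r x0 / 2" by auto
 qed
 have \<kappa>0: "1 \<le> \<kappa>0" unfolding \<kappa>0_def using T(2) by (intro Max_ge) auto
 have \<kappa>0T: "\<kappa> x0 \<le> \<kappa>0" if "x0 \<in> T" for x0 unfolding \<kappa>0_def using T(2) that by (intro Max_ge) auto
 define C where "C = real (card T) * (8 powr p * \<kappa>0 powr p) + 1"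
 have C: "C > 0" using \<kappa>0 by (simp add: C_def add_nonneg_pos)
 show ?thesis
 proof (rule that[OF C _ \<delta>0])
  show "0 < \<kappa>0 + 1" using \<kappa>0 by simp
  fix d z Z assume d: "0 < d" "d \<le> \<delta>0" and z: "trace_zero p \<Omega> z Z"
  let ?S = "inner_strip \<Omega> d" and ?E' = "inner_strip \<Omega> ((\<kappa>0 + 1) * d)"
  note mS = inner_strip_measurable[OF \<Omega>(1)]
  have near: "\<exists>y. y \<notin> \<Omega> \<and> dist x y < d" if "x \<in> ?S" for x
   using cInf_lessD[of "(\<lambda>a. dist x a) ` (- \<Omega>)" d] that cne
   by (auto simp: inner_strip_def infdist_notempty)
  have cover: "?S \<subseteq> (\<Union>x0\<in>T. ball x0 (r x0))"
  proof
   fix x assume x: "x \<in> ?S"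
   then obtain y where y: "y \<notin> \<Omega>" "dist x y < d" using near by blast
   have "closed_segment x y \<inter> ?F \<noteq> {}"
    by (rule connected_Int_frontier) (use x y in \<open>auto simp: inner_strip_def\<close>)
   then obtain q where q: "q \<in> closed_segment x y" "q \<in> ?F" by blast
   have xq: "dist x q < d" using segment_bound(1)[OF q(1)] y(2) by (simp add: dist_norm norm_minus_commute)
   obtain x0 where x0: "x0 \<in> T" "q \<in> ball x0 (r x0 / 2)" using T(3) q(2) by blast
   have "dist x0 x < r x0" using dist_triangle[of x0 x q] x0 xq d \<delta>0T(2)[OF x0(1)] by (simp add: dist_commute)
   then show "x \<in> (\<Union>x0\<in>T. ball x0 (r x0))" using x0(1) by auto
  qed
  have piece: "Lp_pow (lebesgue_on (?S \<inter> ball x0 (r x0))) p z \<le> ennreal (8 powr p * (\<kappa>0 * d) powr p) * Lp_pow (lebesgue_on ?E') p Z"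
   if x0: "x0 \<in> T" for x0
  proof -
   have e: "exits_near \<Omega> x0 (r x0) (\<kappa> x0) (\<delta> x0) (\<sigma> x0) (i x0)" using ex T(1) x0 by blast
   have \<kappa>p: "0 < \<kappa> x0" and \<sigma>1: "\<bar>\<sigma> x0\<bar> = 1" using e by (auto simp: exits_near_def)
   have kd: "\<kappa> x0 * d \<le> \<kappa>0 * d" using \<kappa>0T[OF x0] d by (intro mult_right_mono) auto
   have "Lp_pow (lebesgue_on (?S \<inter> ball x0 (r x0))) p z \<le> ennreal (8 powr p * (\<kappa>0 * d) powr p) * Lp_pow (lebesgue_on ?E') p Z"
   proof (rule trace_zero_exit_estimate[OF \<Omega>(1,2) n p _ \<sigma>1 _ _ mS(1,2) _ _ z])
    show "0 < \<kappa>0 * d" using \<kappa>0 d by simp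
    show "?S \<inter> ball x0 (r x0) \<in> sets borel" "?S \<inter> ball x0 (r x0) \<subseteq> \<Omega>" using mS(1,2) by auto
    fix x assume x: "x \<in> ?S \<inter> ball x0 (r x0)"
    then obtain y where y: "y \<notin> \<Omega>" "dist x y < d" using near by blast
    have "x + (\<kappa> x0 * d) *\<^sub>R (\<sigma> x0 *\<^sub>R axis (i x0) 1) \<notin> \<Omega>"
    proof -
     have "0 < d \<and> d \<le> \<delta> x0 \<and> x \<in> \<Omega> \<and> dist x0 x < r x0 \<and> y \<notin> \<Omega> \<and> dist x y < d"
      using d \<delta>0T(1)[OF x0] x y by (simp add: inner_strip_def)
     then show ?thesis using e unfolding exits_near_def by blast
    qed
    then show "\<exists>t. 0 \<le> t \<and> t \<le> \<kappa>0 * d \<and> x + t *\<^sub>R (\<sigma> x0 *\<^sub>R axis (i x0) 1) \<notin> \<Omega>"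
     using kd \<kappa>p d by (intro exI[of _ "\<kappa> x0 * d"]) auto
    fix t assume t: "0 \<le> t" "t \<le> \<kappa>0 * d" "x + t *\<^sub>R (\<sigma> x0 *\<^sub>R axis (i x0) 1) \<in> \<Omega>"
    have "infdist (x + t *\<^sub>R (\<sigma> x0 *\<^sub>R axis (i x0) 1)) (- \<Omega>) \<le> infdist x (- \<Omega>) + dist (x + t *\<^sub>R (\<sigma> x0 *\<^sub>R axis (i x0) 1)) x"
     by (rule infdist_triangle)
    also have "dist (x + t *\<^sub>R (\<sigma> x0 *\<^sub>R axis (i x0) 1)) x = t" using t \<sigma>1 by (simp add: dist_norm norm_axis_1 abs_mult)
    finally show "x + t *\<^sub>R (\<sigma> x0 *\<^sub>R axis (i x0) 1) \<in> ?E'"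
     using x t by (simp add: inner_strip_def algebra_simps)
   qed
   then show ?thesis .
  qed
  have "Lp_pow (lebesgue_on ?S) p z \<le> (\<Sum>x0\<in>T. Lp_pow (lebesgue_on (?S \<inter> ball x0 (r x0))) p z)"
   by (rule Lp_pow_finite_cover[OF T(2) cover mS(1) _ measurable_lebesgue_on_subset[OF W1p_D(4)[OF trace_zero_W1p[OF z]] mS(2)]]) simp
  also have "\<dots> \<le> (\<Sum>x0\<in>T. ennreal (8 powr p * (\<kappa>0 * d) powr p) * Lp_pow (lebesgue_on ?E') p Z)"
   by (rule sum_mono) (rule piece)
  also have "\<dots> = ennreal (real (card T) * (8 powr p * (\<kappa>0 * d) powr p)) * Lp_pow (lebesgue_on ?E') p Z"
   by (simp add: ennreal_mult ennreal_of_nat_eq_real_of_nat mult.assoc)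
  also have "\<dots> \<le> ennreal (C * d powr p) * Lp_pow (lebesgue_on ?E') p Z"
  proof (intro mult_right_mono ennreal_leI)
   show "real (card T) * (8 powr p * (\<kappa>0 * d) powr p) \<le> C * d powr p"
    using d \<kappa>0 by (simp add: C_def powr_mult algebra_simps)
  qed simp
  finally show "Lp_pow (lebesgue_on ?S) p z \<le> ennreal (C * d powr p) * Lp_pow (lebesgue_on ?E') p Z" .
 qed
qed

lemma inner_strip_tendsto_0:
 fixes \<Omega> :: "(real^'n::finite) set" and f :: "real^'n => 'b::euclidean_space"
 assumes \<Omega>: "open \<Omega>" "bounded \<Omega>" and f: "in_Lp (lebesgue_on \<Omega>) p f" and d: "d \<longlonglongrightarrow> 0"
 shows "(\<lambda>k. Lp_pow (lebesgue_on (inner_strip \<Omega> (d k))) p f) \<longlonglongrightarrow> 0"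
proof -
 note mS = inner_strip_measurable[OF \<Omega>(1)]
 have S\<Omega>: "\<Omega> \<in> sets borel" "\<Omega> \<in> sets lebesgue" using \<Omega> by auto
 have cne: "- \<Omega> \<noteq> {}" using \<Omega>(2) not_bounded_UNIV by (metis Compl_UNIV_eq double_compl)
 define g where "g x = (if x \<in> \<Omega> then f x else 0)" for x
 have [measurable]: "g \<in> borel_measurable lebesgue"
  unfolding g_def using f by (simp add: borel_measurable_if[OF S\<Omega>(2)] in_Lp_iff)
 have [measurable]: "inner_strip \<Omega> (d k) \<in> sets lebesgue" for k using mS(1)[of "d k"] by auto
 have eq: "Lp_pow (lebesgue_on (inner_strip \<Omega> (d k))) p f
   = (\<integral>\<^sup>+x. ennreal (norm (g x) powr p) * indicator (inner_strip \<Omega> (d k)) x \<partial>lebesgue)" for k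
  unfolding Lp_pow_lebesgue_on[OF mS(1)] nn_integral_completion
  by (rule nn_integral_cong) (use mS(2)[of "d k"] in \<open>auto simp: g_def indicator_def\<close>)
 have "(\<lambda>k. \<integral>\<^sup>+x. ennreal (norm (g x) powr p) * indicator (inner_strip \<Omega> (d k)) x \<partial>lebesgue)
   \<longlonglongrightarrow> (\<integral>\<^sup>+x. 0 \<partial>(lebesgue :: (real^'n) measure))"
 proof (rule nn_integral_dominated_convergence[where w="\<lambda>x. ennreal (norm (g x) powr p) * indicator \<Omega> x"])
  show "AE x in lebesgue. ennreal (norm (g x) powr p) * indicator (inner_strip \<Omega> (d k)) x
    \<le> ennreal (norm (g x) powr p) * indicator \<Omega> x" for k
   by (intro AE_I2 mult_left_mono) (use mS(2)[of "d k"] in \<open>auto simp: indicator_def\<close>)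
  have "(\<integral>\<^sup>+x. ennreal (norm (g x) powr p) * indicator \<Omega> x \<partial>lebesgue) = Lp_pow (lebesgue_on \<Omega>) p f"
   unfolding Lp_pow_lebesgue_on[OF S\<Omega>(1)] nn_integral_completion
   by (rule nn_integral_cong) (auto simp: g_def indicator_def)
  then show "(\<integral>\<^sup>+x. ennreal (norm (g x) powr p) * indicator \<Omega> x \<partial>lebesgue) < \<infinity>"
   using f by (simp add: in_Lp_iff)
  show "AE x in lebesgue. (\<lambda>k. ennreal (norm (g x) powr p) * indicator (inner_strip \<Omega> (d k)) x) \<longlonglongrightarrow> 0"
  proof (rule AE_I2)
   fix x
   show "(\<lambda>k. ennreal (norm (g x) powr p) * indicator (inner_strip \<Omega> (d k)) x) \<longlonglongrightarrow> 0"
   proof (cases "x \<in> \<Omega>")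
    case True
    have "infdist x (- \<Omega>) \<noteq> 0" using True \<Omega>(1) cne by (metis ComplD closed_Compl in_closed_iff_infdist_zero)
    then have "infdist x (- \<Omega>) > 0" using infdist_nonneg[of x "- \<Omega>"] by simp
    then have "\<forall>\<^sub>F k in sequentially. d k < infdist x (- \<Omega>)" by (rule order_tendstoD(2)[OF d])
    then have "\<forall>\<^sub>F k in sequentially. ennreal (norm (g x) powr p) * indicator (inner_strip \<Omega> (d k)) x = 0"
     by eventually_elim (simp add: inner_strip_def)
    then show ?thesis by (rule tendsto_eventually)
   next
    case False
    then have "indicator (inner_strip \<Omega> (d k)) x = (0::ennreal)" for k by (simp add: inner_strip_def)
    then show ?thesis by simp
   qed
  qed
 qed (use S\<Omega>(2) in measurable)
 then show ?thesis unfolding eq by simp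
qed

text \<open>Multiplying \<open>s\<close> by a cutoff function that vanishes near the boundary costs, in the gradient, the term
 \<open>s grad \<eta>\<close>. It lives in a strip of width \<open>d\<close> and has size \<open>|z| / d\<close>, which the strip estimate bounds by
 the gradient of \<open>z\<close> over a slightly larger strip.\<close>

lemma trace_zero_dominated:
 fixes \<Omega> :: "(real^'n::finite) set"
 assumes dom: "bounded_smooth_domain \<Omega>" and n: "2 \<le> CARD('n)" and p: "1 \<le> p"
  and z: "trace_zero p \<Omega> z Z" and s: "W1p p \<Omega> s S"
  and le: "AE x in lebesgue_on \<Omega>. \<bar>s x\<bar> \<le> \<bar>z x\<bar>"
 shows "trace_zero p \<Omega> s S"
proof -
 have p0: "0 \<le> p" using p by simp
 have \<Omega>: "open \<Omega>" "bounded \<Omega>" "\<Omega> \<noteq> {}" using dom by (auto simp: bounded_smooth_domain_def)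
 have S\<Omega>: "\<Omega> \<in> sets borel" using \<Omega> by simp
 have cne: "- \<Omega> \<noteq> {}" using \<Omega>(2) not_bounded_UNIV by (metis Compl_UNIV_eq double_compl)
 note D = W1p_D[OF s] and Dz = W1p_D[OF trace_zero_W1p[OF z]]
 note mS = inner_strip_measurable[OF \<Omega>(1)]
 obtain C \<kappa> \<delta> where C: "C > 0" "\<kappa> > 0" "\<delta> > 0"
  "\<And>d z Z. 0 < d ==> d \<le> \<delta> ==> trace_zero p \<Omega> z Z ==>
    Lp_pow (lebesgue_on (inner_strip \<Omega> d)) p z \<le> ennreal (C * d powr p) * Lp_pow (lebesgue_on (inner_strip \<Omega> (\<kappa> * d))) p Z"
  using strip_estimate[OF dom n p] by blast
 obtain K where K: "K > 0" "\<And>(A :: (real^'n) set) \<delta>. A \<noteq> {} ==> bounded A ==> 0 < \<delta> ==>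
    \<exists>\<eta>. smooth_on UNIV \<eta> \<and> (\<forall>x. 0 \<le> \<eta> x \<and> \<eta> x \<le> 1) \<and> (\<forall>x. infdist x A < \<delta> \<longrightarrow> \<eta> x = 1) \<and>
     (\<forall>x. 2 * \<delta> \<le> infdist x A \<longrightarrow> \<eta> x = 0) \<and> (\<forall>x i. \<bar>partial i \<eta> x\<bar> \<le> K / \<delta>)"
  using cutoff_exists[where 'n='n] by blast
 obtain x1 where x1: "x1 \<in> \<Omega>" using \<Omega>(3) by blast
 have "infdist x1 (- \<Omega>) \<noteq> 0" using x1 \<Omega>(1) cne by (metis ComplD closed_Compl in_closed_iff_infdist_zero)
 then have \<delta>1: "infdist x1 (- \<Omega>) > 0" using infdist_nonneg[of x1 "- \<Omega>"] by simp
 define \<delta>' where "\<delta>' = min \<delta> (infdist x1 (- \<Omega>))"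
 have \<delta>': "\<delta>' > 0" using C(3) \<delta>1 by (simp add: \<delta>'_def)
 define d where "d k = \<delta>' / real (Suc k)" for k
 have d0: "d k > 0" for k using \<delta>' by (simp add: d_def)
 have dle: "d k \<le> \<delta>'" for k using \<delta>' by (simp add: d_def divide_le_eq)
 have dlim: "d \<longlonglongrightarrow> 0"
  unfolding d_def[abs_def] using tendsto_mult_left[OF LIMSEQ_inverse_real_of_nat, of \<delta>'] by (simp add: divide_inverse)
 define M where "M k = real CARD('n) * (4 * K / d k)" for k
 define P where "P k \<eta> \<longleftrightarrow> test_fun \<Omega> \<eta> \<and> (\<forall>x. 0 \<le> \<eta> x \<and> \<eta> x \<le> 1) \<and>
   (\<forall>x\<in>\<Omega> - inner_strip \<Omega> (d k). \<eta> x = 1 \<and> grad \<eta> x = 0) \<and> (\<forall>x. norm (grad \<eta> x) \<le> M k)" for k \<eta>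
 have "\<exists>\<eta>. P k \<eta>" for k
 proof -
  let ?A = "{x. d k \<le> infdist x (- \<Omega>)}"
  have A\<Omega>: "{x. c \<le> infdist x (- \<Omega>)} \<subseteq> \<Omega>" if "c > 0" for c
  proof
   fix x assume "x \<in> {x. c \<le> infdist x (- \<Omega>)}"
   then show "x \<in> \<Omega>" using that infdist_zero[of x "- \<Omega>"] by (cases "x \<in> \<Omega>") auto
  qed
  have Ane: "?A \<noteq> {}" using dle[of k] by (auto simp: \<delta>'_def)
  have Ab: "bounded ?A" using A\<Omega>[OF d0[of k]] \<Omega>(2) bounded_subset by blast
  have "d k / 4 > 0" using d0[of k] by simp
  from K(2)[OF Ane Ab this] obtain \<eta> where \<eta>: "smooth_on UNIV \<eta>" "\<And>x. 0 \<le> \<eta> x \<and> \<eta> x \<le> 1"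
   "\<And>x. infdist x ?A < d k / 4 ==> \<eta> x = 1" "\<And>x. 2 * (d k / 4) \<le> infdist x ?A ==> \<eta> x = 0"
   "\<And>x i. \<bar>partial i \<eta> x\<bar> \<le> K / (d k / 4)" by blast
  have "test_fun \<Omega> \<eta>"
  proof (rule test_funI[where K="{x. d k / 2 \<le> infdist x (- \<Omega>)}"])
   show "closed {x. d k / 2 \<le> infdist x (- \<Omega>)}" by (intro closed_Collect_le continuous_intros)
   show sub: "{x. d k / 2 \<le> infdist x (- \<Omega>)} \<subseteq> \<Omega>" by (rule A\<Omega>) (use d0[of k] in simp)
   show "bounded {x. d k / 2 \<le> infdist x (- \<Omega>)}" using sub \<Omega>(2) bounded_subset by blast
   fix x assume x: "x \<notin> {x. d k / 2 \<le> infdist x (- \<Omega>)}"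
   have "d k / 2 \<le> infdist x ?A"
    unfolding infdist_notempty[OF Ane]
   proof (rule cINF_greatest[OF Ane])
    fix a assume a: "a \<in> ?A"
    have "infdist a (- \<Omega>) \<le> infdist x (- \<Omega>) + dist a x" by (rule infdist_triangle)
    then show "d k / 2 \<le> dist x a" using a x by (simp add: dist_commute)
   qed
   then show "\<eta> x = 0" using \<eta>(4)[of x] by simp
  qed (rule \<eta>(1))
  moreover have "\<eta> x = 1 \<and> grad \<eta> x = 0" if "x \<in> \<Omega> - inner_strip \<Omega> (d k)" for x
  proof -
   have "x \<in> ?A" using that by (auto simp: inner_strip_def)
   then have 0: "infdist x ?A < d k / 4" using d0[of k] by (simp add: infdist_zero)
   have "(\<bullet>) 0 = (\<lambda>v::real^'n. 0 :: real)" by auto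
   then have "((\<lambda>x. 1) has_derivative (\<bullet>) 0) (at x)" by simp
   moreover have "open {x. infdist x ?A < d k / 4}" by (intro open_Collect_less continuous_intros)
   ultimately have "(\<eta> has_derivative (\<bullet>) 0) (at x)"
    by (rule has_derivative_transform_within_open) (use 0 \<eta>(3) in auto)
   from partial_gradI(2)[OF this] \<eta>(3)[OF 0] show ?thesis by simp
  qed
  moreover have "norm (grad \<eta> x) \<le> M k" for x
  proof -
   have "norm (grad \<eta> x) \<le> (\<Sum>i\<in>UNIV. \<bar>grad \<eta> x $ i\<bar>)" by (rule norm_le_l1_cart)
   also have "\<dots> \<le> (\<Sum>i\<in>(UNIV::'n set). K / (d k / 4))" by (rule sum_mono) (use \<eta>(5) in \<open>simp add: grad_def\<close>)
   finally show ?thesis by (simp add: M_def mult.commute)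
  qed
  ultimately have "P k \<eta>" unfolding P_def using \<eta>(2) by blast
  then show ?thesis by blast
 qed
 then obtain \<eta> where P: "\<And>k. P k (\<eta> k)" by metis
 have t: "test_fun \<Omega> (\<eta> k)" and \<eta>01: "0 \<le> \<eta> k x" "\<eta> k x \<le> 1"
  and out: "x \<in> \<Omega> ==> x \<notin> inner_strip \<Omega> (d k) ==> \<eta> k x = 1 \<and> grad (\<eta> k) x = 0"
  and gM: "norm (grad (\<eta> k) x) \<le> M k" for k x
  using P[of k] by (auto simp: P_def)
 note comp = trace_zero_compact_support[OF \<Omega>(1) p t s]
 have lim1: "tendsto_Lp (lebesgue_on \<Omega>) p (\<lambda>k x. \<eta> k x * s x) s"
  unfolding tendsto_Lp_iff
 proof (rule ennreal_tendsto_0_mono[OF _ inner_strip_tendsto_0[OF \<Omega>(1,2) D(1) dlim]])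
  fix k
  show "Lp_pow (lebesgue_on \<Omega>) p (\<lambda>x. \<eta> k x * s x - s x) \<le> Lp_pow (lebesgue_on (inner_strip \<Omega> (d k))) p s"
   unfolding Lp_pow_lebesgue_on[OF S\<Omega>] Lp_pow_lebesgue_on[OF mS(1)]
  proof (rule nn_integral_mono)
   fix x
   show "ennreal (norm (\<eta> k x * s x - s x) powr p) * indicator \<Omega> x
     \<le> ennreal (norm (s x) powr p) * indicator (inner_strip \<Omega> (d k)) x"
   proof (cases "x \<in> inner_strip \<Omega> (d k)")
    case True
    have "\<bar>\<eta> k x - 1\<bar> * \<bar>s x\<bar> \<le> 1 * \<bar>s x\<bar>" using \<eta>01[of k x] by (intro mult_right_mono) auto
    moreover have "\<eta> k x * s x - s x = (\<eta> k x - 1) * s x" by (simp add: algebra_simps)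
    ultimately have "norm (\<eta> k x * s x - s x) \<le> norm (s x)" by (simp add: abs_mult)
    then have "norm (\<eta> k x * s x - s x) powr p \<le> norm (s x) powr p" using p by (intro powr_mono2) auto
    then show ?thesis using True mS(2)[of "d k"] by (auto intro: ennreal_leI)
   next
    case False
    then show ?thesis using out[of x k] by (cases "x \<in> \<Omega>") auto
   qed
  qed
 qed
 let ?c = "C * (4 * real CARD('n) * K) powr p"
 let ?R = "\<lambda>k. ennreal (2 powr p) * (Lp_pow (lebesgue_on (inner_strip \<Omega> (d k))) p S
   + ennreal ?c * Lp_pow (lebesgue_on (inner_strip \<Omega> (\<kappa> * d k))) p Z)"
 have lim2: "tendsto_Lp (lebesgue_on \<Omega>) p (\<lambda>k x. \<eta> k x *\<^sub>R S x + s x *\<^sub>R grad (\<eta> k) x) S"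
  unfolding tendsto_Lp_iff
 proof (rule ennreal_tendsto_0_mono[of _ ?R])
  have "(\<lambda>k. \<kappa> * d k) \<longlonglongrightarrow> 0" using tendsto_mult_left[OF dlim, of \<kappa>] by simp
  from inner_strip_tendsto_0[OF \<Omega>(1,2) Dz(2) this]
  have "?R \<longlonglongrightarrow> ennreal (2 powr p) * (0 + ennreal ?c * 0)"
   by (intro ennreal_tendsto_cmult tendsto_add inner_strip_tendsto_0[OF \<Omega>(1,2) D(2) dlim]) auto
  then show "?R \<longlonglongrightarrow> 0" by simp
  fix k
  let ?I = "inner_strip \<Omega> (d k)"
  have M0: "0 \<le> M k" using K(1) d0[of k] by (simp add: M_def)
  have mS': "S \<in> borel_measurable (lebesgue_on ?I)" "s \<in> borel_measurable (lebesgue_on ?I)"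
   using measurable_lebesgue_on_subset[OF _ mS(2)] D(4,5) by auto
  have mg: "grad (\<eta> k) \<in> borel_measurable (lebesgue_on ?I)" "\<eta> k \<in> borel_measurable (lebesgue_on ?I)"
   by (intro smooth_measurable test_funD(1)[OF t])+
  have "Lp_pow (lebesgue_on \<Omega>) p (\<lambda>x. \<eta> k x *\<^sub>R S x + s x *\<^sub>R grad (\<eta> k) x - S x)
    = Lp_pow (lebesgue_on ?I) p (\<lambda>x. (\<eta> k x - 1) *\<^sub>R S x + s x *\<^sub>R grad (\<eta> k) x)"
   unfolding Lp_pow_lebesgue_on[OF S\<Omega>] Lp_pow_lebesgue_on[OF mS(1)]
  proof (rule nn_integral_cong)
   fix x
   show "ennreal (norm (\<eta> k x *\<^sub>R S x + s x *\<^sub>R grad (\<eta> k) x - S x) powr p) * indicator \<Omega> x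
     = ennreal (norm ((\<eta> k x - 1) *\<^sub>R S x + s x *\<^sub>R grad (\<eta> k) x) powr p) * indicator ?I x"
   proof (cases "x \<in> ?I")
    case True
    then show ?thesis using mS(2)[of "d k"] by (auto simp: algebra_simps)
   next
    case False
    then show ?thesis using out[of x k] by (cases "x \<in> \<Omega>") auto
   qed
  qed
  also have "\<dots> \<le> ennreal (2 powr p) * (Lp_pow (lebesgue_on ?I) p (\<lambda>x. (\<eta> k x - 1) *\<^sub>R S x)
    + Lp_pow (lebesgue_on ?I) p (\<lambda>x. s x *\<^sub>R grad (\<eta> k) x))"
   using mS' mg by (intro Lp_pow_add_le[OF _ _ p0] borel_measurable_scaleR borel_measurable_diff borel_measurable_const)
  also have "\<dots> \<le> ?R k"
  proof (intro mult_left_mono add_mono)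
   show "Lp_pow (lebesgue_on ?I) p (\<lambda>x. (\<eta> k x - 1) *\<^sub>R S x) \<le> Lp_pow (lebesgue_on ?I) p S"
   proof (rule Lp_pow_mono[OF _ p0])
    fix x
    have "\<bar>\<eta> k x - 1\<bar> * norm (S x) \<le> 1 * norm (S x)" using \<eta>01[of k x] by (intro mult_right_mono) auto
    then show "norm ((\<eta> k x - 1) *\<^sub>R S x) \<le> norm (S x)" by simp
   qed
   have "Lp_pow (lebesgue_on ?I) p (\<lambda>x. s x *\<^sub>R grad (\<eta> k) x) \<le> Lp_pow (lebesgue_on ?I) p (\<lambda>x. M k *\<^sub>R s x)"
   proof (rule Lp_pow_mono[OF _ p0])
    fix x
    show "norm (s x *\<^sub>R grad (\<eta> k) x) \<le> norm (M k *\<^sub>R s x)"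
     using mult_left_mono[OF gM[of k x], of "\<bar>s x\<bar>"] M0 by (simp add: abs_mult mult.commute)
   qed
   also have "\<dots> = ennreal (M k powr p) * Lp_pow (lebesgue_on ?I) p s"
    using Lp_pow_scaleR[OF mS'(2), of p "M k"] M0 by simp
   also have "Lp_pow (lebesgue_on ?I) p s \<le> Lp_pow (lebesgue_on ?I) p z"
    unfolding Lp_pow_lebesgue_on[OF mS(1)]
   proof (rule nn_integral_mono_AE)
    have "AE x in lborel. x \<in> \<Omega> \<longrightarrow> \<bar>s x\<bar> \<le> \<bar>z x\<bar>"
     using le unfolding AE_lebesgue_on_iff[OF \<Omega>(1)] AE_completion_iff .
    then show "AE x in lborel. ennreal (norm (s x) powr p) * indicator ?I x \<le> ennreal (norm (z x) powr p) * indicator ?I x"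
    proof eventually_elim
     case (elim x)
     then show ?case using mS(2)[of "d k"] p0
      by (cases "x \<in> ?I") (auto intro!: ennreal_leI powr_mono2)
    qed
   qed
   also have "Lp_pow (lebesgue_on ?I) p z \<le> ennreal (C * d k powr p) * Lp_pow (lebesgue_on (inner_strip \<Omega> (\<kappa> * d k))) p Z"
    by (rule C(4)[OF d0 _ z]) (use dle[of k] in \<open>simp add: \<delta>'_def\<close>)
   also have "ennreal (M k powr p) * (ennreal (C * d k powr p) * Lp_pow (lebesgue_on (inner_strip \<Omega> (\<kappa> * d k))) p Z)
     = ennreal ?c * Lp_pow (lebesgue_on (inner_strip \<Omega> (\<kappa> * d k))) p Z"
   proof -
    have "M k powr p * (C * d k powr p) = C * (M k * d k) powr p" using M0 d0[of k] by (simp add: powr_mult)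
    also have "M k * d k = 4 * real CARD('n) * K" using d0[of k] by (simp add: M_def)
    finally have e: "M k powr p * (C * d k powr p) = ?c" .
    have "ennreal (M k powr p) * (ennreal (C * d k powr p) * T) = ennreal (M k powr p * (C * d k powr p)) * T" for T
     using C(1) by (subst ennreal_mult) (auto simp: mult.assoc)
    then show ?thesis unfolding e .
   qed
   finally show "Lp_pow (lebesgue_on ?I) p (\<lambda>x. s x *\<^sub>R grad (\<eta> k) x)
     \<le> ennreal ?c * Lp_pow (lebesgue_on (inner_strip \<Omega> (\<kappa> * d k))) p Z"
    by (simp add: mult_left_mono)
  qed auto
  finally show "Lp_pow (lebesgue_on \<Omega>) p (\<lambda>x. \<eta> k x *\<^sub>R S x + s x *\<^sub>R grad (\<eta> k) x - S x) \<le> ?R k" .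
 qed
 show ?thesis
  by (rule trace_zero_closed[OF \<Omega>(1,2) p comp D(1,2) lim1 lim2])
qed

section \<open>Uniform convexity\<close>

lemma powr_superadditive:
 fixes x y q :: real
 assumes "0 \<le> x" "0 \<le> y" "1 \<le> q"
 shows "x powr q + y powr q \<le> (x + y) powr q"
proof -
 have "u powr q \<le> u * (x + y) powr (q - 1)" if "0 \<le> u" "u \<le> x + y" for u
 proof -
  have "u powr q = u * u powr (q - 1)" using powr_mult_base[of u "q - 1"] that(1) by simp
  also have "\<dots> \<le> u * (x + y) powr (q - 1)" using that assms by (intro mult_left_mono powr_mono2) auto
  finally show ?thesis .
 qed
 from add_mono[OF this[of x] this[of y]] assms
 have "x powr q + y powr q \<le> (x + y) * (x + y) powr (q - 1)" by (simp add: distrib_right)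
 also have "\<dots> = (x + y) powr q" using powr_mult_base[of "x + y" "q - 1"] assms by simp
 finally show ?thesis .
qed

lemma powr_midpoint_le:
 fixes x y q :: real
 assumes "0 \<le> x" "0 \<le> y" "1 \<le> q"
 shows "((x + y) / 2) powr q \<le> (x powr q + y powr q) / 2"
proof -
 let ?b = "(x + y) / 2"
 have "?b powr q + q * ?b powr (q - 1) * (x - ?b) \<le> x powr q"
  and "?b powr q + q * ?b powr (q - 1) * (y - ?b) \<le> y powr q"
  using assms by (auto intro!: powr_tangent)
 then have "2 * ?b powr q + q * ?b powr (q - 1) * ((x - ?b) + (y - ?b)) \<le> x powr q + y powr q"
  unfolding distrib_left by linarith
 moreover have "(x - ?b) + (y - ?b) = 0" by simp
 ultimately show ?thesis by simp
qed

text \<open>Clarkson's inequality for exponents at least two, which for values in a Euclidean space follows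
 pointwise from the parallelogram law.\<close>

lemma clarkson:
 fixes a b :: "'b::euclidean_space"
 assumes p: "2 \<le> p"
 shows "norm ((1/2) *\<^sub>R (a + b)) powr p + norm ((1/2) *\<^sub>R (a - b)) powr p \<le> (norm a powr p + norm b powr p) / 2"
proof -
 have sq: "norm v powr p = (norm v ^ 2) powr (p / 2)" for v :: 'b
 proof (cases "v = 0")
  case False
  then have "norm v ^ 2 = norm v powr 2" by simp
  then show ?thesis by (simp only: powr_powr) simp
 qed simp
 have par: "norm ((1/2) *\<^sub>R (a + b)) ^ 2 + norm ((1/2) *\<^sub>R (a - b)) ^ 2 = (norm a ^ 2 + norm b ^ 2) / 2"
  by (simp add: power2_norm_eq_inner algebra_simps inner_add_left inner_add_right inner_diff_left inner_diff_right inner_commute)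
 have "norm ((1/2) *\<^sub>R (a + b)) powr p + norm ((1/2) *\<^sub>R (a - b)) powr p
   \<le> (norm ((1/2) *\<^sub>R (a + b)) ^ 2 + norm ((1/2) *\<^sub>R (a - b)) ^ 2) powr (p / 2)"
  unfolding sq[of "(1/2) *\<^sub>R (a + b)"] sq[of "(1/2) *\<^sub>R (a - b)"] by (rule powr_superadditive) (use p in auto)
 also have "\<dots> = ((norm a ^ 2 + norm b ^ 2) / 2) powr (p / 2)" unfolding par ..
 also have "\<dots> \<le> ((norm a ^ 2) powr (p / 2) + (norm b ^ 2) powr (p / 2)) / 2"
  by (rule powr_midpoint_le) (use p in auto)
 finally show ?thesis unfolding sq[symmetric] .
qed

text \<open>Closure of a tail of a sequence under midpoints. It takes the place of the convex hull of the tail.\<close>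

inductive_set midhull :: "(nat => 'a => 'b::real_vector) => nat => ('a => 'b) set"
 for V :: "nat => 'a => 'b" and n :: nat where
 base: "n \<le> k ==> V k \<in> midhull V n"
| mid: "f \<in> midhull V n ==> g \<in> midhull V n ==> (\<lambda>x. (1/2) *\<^sub>R (f x + g x)) \<in> midhull V n"

lemma midhull_antimono: "n \<le> m ==> f \<in> midhull V m ==> f \<in> midhull V n"
 by (rotate_tac 1, induction rule: midhull.induct) (auto intro: midhull.intros)

lemma midhull_in_Lp:
 assumes "\<And>k. in_Lp M p (V k)" "0 \<le> p" "f \<in> midhull V n"
 shows "in_Lp M p f"
 using assms(3)
proof (induction rule: midhull.induct)
 case (mid f g)
 then show ?case using in_Lp_linear[of M p f g "1/2" "1/2"] assms(2) by (simp add: scaleR_add_right)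
qed (rule assms(1))

definition Lp_real :: "'a measure => real => ('a => 'b::real_normed_vector) => real" where
 "Lp_real M p f = enn2real (Lp_pow M p f)"

lemma Lp_real: "in_Lp M p f ==> Lp_pow M p f = ennreal (Lp_real M p f)" "0 \<le> Lp_real M p f"
 by (auto simp: Lp_real_def in_Lp_iff less_top)

lemma Lp_clarkson:
 fixes f g :: "'a => 'b::euclidean_space"
 assumes f: "in_Lp M p f" and g: "in_Lp M p g" and p: "2 \<le> p"
 shows "Lp_real M p (\<lambda>x. (1/2) *\<^sub>R (f x + g x)) + Lp_real M p (\<lambda>x. (1/2) *\<^sub>R (f x - g x))
   \<le> (Lp_real M p f + Lp_real M p g) / 2"
proof -
 have p0: "0 \<le> p" using p by simp
 have [measurable]: "f \<in> borel_measurable M" "g \<in> borel_measurable M" using f g by (auto simp: in_Lp_iff)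
 let ?s = "\<lambda>x. (1/2) *\<^sub>R (f x + g x)" and ?d = "\<lambda>x. (1/2) *\<^sub>R (f x - g x)"
 have s: "in_Lp M p ?s" "in_Lp M p ?d"
  using in_Lp_linear[OF f g p0, of "1/2" "1/2"] in_Lp_linear[OF f g p0, of "1/2" "- (1/2)"]
  by (simp_all add: scaleR_add_right scaleR_diff_right)
 have half: "ennreal (1/2) * (ennreal a + ennreal b) = ennreal ((a + b) / 2)" if "0 \<le> a" "0 \<le> b" for a b
  using that ennreal_mult[of "1/2" "a + b"] by (simp add: ennreal_plus)
 have "ennreal (Lp_real M p ?s + Lp_real M p ?d) = Lp_pow M p ?s + Lp_pow M p ?d"
  using Lp_real(1)[OF s(1)] Lp_real(1)[OF s(2)] by (simp add: ennreal_plus Lp_real(2))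
 also have "\<dots> = (\<integral>\<^sup>+x. ennreal (norm (?s x) powr p + norm (?d x) powr p) \<partial>M)"
  unfolding Lp_pow_def by (subst nn_integral_add[symmetric]) (auto simp: ennreal_plus)
 also have "\<dots> \<le> (\<integral>\<^sup>+x. ennreal (1/2) * (ennreal (norm (f x) powr p) + ennreal (norm (g x) powr p)) \<partial>M)"
 proof (rule nn_integral_mono)
  fix x
  show "ennreal (norm (?s x) powr p + norm (?d x) powr p) \<le> ennreal (1/2) * (ennreal (norm (f x) powr p) + ennreal (norm (g x) powr p))"
  proof -
   from half[of "norm (f x) powr p" "norm (g x) powr p"] ennreal_leI[OF clarkson[OF p, of "f x" "g x"]]
   show ?thesis by (simp only: powr_ge_zero)
  qed
 qed
 also have "\<dots> = ennreal (1/2) * (Lp_pow M p f + Lp_pow M p g)"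
  unfolding Lp_pow_def by (subst nn_integral_cmult, measurable, subst nn_integral_add) measurable
 also have "\<dots> = ennreal ((Lp_real M p f + Lp_real M p g) / 2)"
  using Lp_real(1)[OF f] Lp_real(1)[OF g] half[OF Lp_real(2) Lp_real(2)] by simp
 finally show ?thesis using Lp_real(2)[of M p f] Lp_real(2)[of M p g] by (subst (asm) ennreal_le_iff) auto
qed

text \<open>In the midpoint hulls of the tails of a bounded sequence, almost minimizers of the norm form a
 Cauchy sequence: the midpoint of two of them is not much shorter than either, so by Clarkson's inequality
 they are close. This replaces weak compactness and Mazur's lemma.\<close>

lemma midhull_cauchy:
 fixes V :: "nat => 'a => 'b::euclidean_space"
 assumes p: "2 \<le> p" and V: "\<And>k. in_Lp M p (V k)" "\<And>k. Lp_pow M p (V k) \<le> ennreal B"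
 obtains W where "\<And>n. W n \<in> midhull V n"
  "\<And>\<eta>. 0 < \<eta> ==> \<exists>N. \<forall>m\<ge>N. \<forall>n\<ge>N. Lp_pow M p (\<lambda>x. W m x - W n x) \<le> ennreal \<eta>"
proof -
 have p0: "0 \<le> p" using p by simp
 let ?J = "Lp_real M p :: ('a => 'b) => real"
 note in_Lp = midhull_in_Lp[of M p V, OF V(1) p0]
 define D where "D n = Inf (?J ` midhull V n)" for n
 have ne: "?J ` midhull V n \<noteq> {}" for n using midhull.base[of n n V] by auto
 have bd: "bdd_below (?J ` midhull V n)" for n by (rule bdd_belowI[of _ 0]) (auto simp: Lp_real(2))
 have D_le: "D n \<le> ?J f" if "f \<in> midhull V n" for f n
  unfolding D_def by (rule cInf_lower[OF _ bd]) (use that in auto)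
 have "D n \<le> max B 0" for n
 proof -
  have "ennreal (?J (V n)) \<le> ennreal (max B 0)"
   using order_trans[OF V(2)[of n] ennreal_leI[of B "max B 0"]] Lp_real(1)[OF V(1)[of n]] by simp
  then have "?J (V n) \<le> max B 0" by (subst (asm) ennreal_le_iff) auto
  then show ?thesis using D_le[OF midhull.base[of n n V]] by simp
 qed
 moreover have inc: "incseq D"
 proof (rule incseq_SucI)
  fix n
  have "?J ` midhull V (Suc n) \<subseteq> ?J ` midhull V n" using midhull_antimono[of n "Suc n" _ V] by auto
  then show "D n \<le> D (Suc n)" unfolding D_def by (rule cInf_superset_mono[OF ne bd])
 qed
 ultimately obtain L where L: "D \<longlonglongrightarrow> L" "\<And>n. D n \<le> L"
  using incseq_convergent[of D "max B 0"] by blast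
 have "\<exists>f. f \<in> midhull V n \<and> ?J f < D n + 1 / real (Suc n)" for n
 proof -
  have "Inf (?J ` midhull V n) < D n + 1 / real (Suc n)" by (simp add: D_def)
  from cInf_lessD[OF ne this] show ?thesis by blast
 qed
 then obtain W where W: "\<And>n. W n \<in> midhull V n" "\<And>n. ?J (W n) < D n + 1 / real (Suc n)" by metis
 have est: "?J (\<lambda>x. W m x - W n x) \<le> 2 powr p * (L - D N + 1 / real (Suc N))" if mn: "N \<le> m" "N \<le> n" for m n N
 proof -
  have h: "W m \<in> midhull V N" "W n \<in> midhull V N" using midhull_antimono W(1) mn by blast+
  note l = in_Lp[OF h(1)] in_Lp[OF h(2)]
  have fr: "1 / real (Suc k) \<le> 1 / real (Suc N)" if "N \<le> k" for k using that by (simp add: frac_le)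
  have "?J (\<lambda>x. (1/2) *\<^sub>R (W m x - W n x)) \<le> (?J (W m) + ?J (W n)) / 2 - D N"
   using Lp_clarkson[OF l p] D_le[OF midhull.mid[OF h]] by linarith
  also have "\<dots> \<le> L - D N + 1 / real (Suc N)"
   using W(2)[of m] W(2)[of n] L(2)[of m] L(2)[of n] fr[OF mn(1)] fr[OF mn(2)] by argo
  finally have half: "?J (\<lambda>x. (1/2) *\<^sub>R (W m x - W n x)) \<le> L - D N + 1 / real (Suc N)" .
  have d: "in_Lp M p (\<lambda>x. (1/2) *\<^sub>R (W m x - W n x))"
   using in_Lp_linear[OF l p0, of "1/2" "- (1/2)"] by (simp add: scaleR_diff_right)
  have "Lp_pow M p (\<lambda>x. W m x - W n x) = Lp_pow M p (\<lambda>x. 2 *\<^sub>R ((1/2) *\<^sub>R (W m x - W n x)))" by simp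
  also have "\<dots> = ennreal (2 powr p) * Lp_pow M p (\<lambda>x. (1/2) *\<^sub>R (W m x - W n x))"
   using d by (subst Lp_pow_scaleR) (auto simp: in_Lp_iff)
  finally have "?J (\<lambda>x. W m x - W n x) = 2 powr p * ?J (\<lambda>x. (1/2) *\<^sub>R (W m x - W n x))"
   by (simp add: Lp_real_def enn2real_mult)
  then show ?thesis using half by (simp add: mult_left_mono)
 qed
 show ?thesis
 proof (rule that[OF W(1)])
  fix \<eta> :: real assume \<eta>: "0 < \<eta>"
  have "(\<lambda>N. 2 powr p * (L - D N + 1 / real (Suc N))) \<longlonglongrightarrow> 2 powr p * (L - L + 0)"
   using LIMSEQ_inverse_real_of_nat by (intro tendsto_intros L(1)) (simp add: inverse_eq_divide)
  then have "\<forall>\<^sub>F N in sequentially. 2 powr p * (L - D N + 1 / real (Suc N)) < \<eta>"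
   by (rule order_tendstoD(2)) (simp add: \<eta>)
  then obtain N where N: "2 powr p * (L - D N + 1 / real (Suc N)) < \<eta>" by (auto simp: eventually_sequentially)
  have "Lp_pow M p (\<lambda>x. W m x - W n x) \<le> ennreal \<eta>" if "N \<le> m" "N \<le> n" for m n
  proof -
   have "in_Lp M p (\<lambda>x. W m x - W n x)" by (rule in_Lp_diff[OF in_Lp[OF W(1)] in_Lp[OF W(1)] p0])
   then show ?thesis using est[OF that] N Lp_real(1) by (metis ennreal_leI less_imp_le order_trans)
  qed
  then show "\<exists>N. \<forall>m\<ge>N. \<forall>n\<ge>N. Lp_pow M p (\<lambda>x. W m x - W n x) \<le> ennreal \<eta>" by blast
 qed
qed

section \<open>Completeness\<close>

text \<open>If the integrals of \<open>d\<close> along the subsequence are at most \<open>4\<^sup>-\<^sup>j\<close>, the sum of \<open>2\<^sup>j d\<close> has a finite integral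
 and is therefore finite almost everywhere.\<close>

lemma fast_subsequence:
 fixes d :: "nat => nat => 'a => real"
 assumes m: "\<And>m n. d m n \<in> borel_measurable M" and d0: "\<And>m n x. 0 \<le> d m n x"
  and cauchy: "\<And>\<eta>. 0 < \<eta> ==> \<exists>N. \<forall>m\<ge>N. \<forall>n\<ge>N. (\<integral>\<^sup>+x. ennreal (d m n x) \<partial>M) \<le> ennreal \<eta>"
 obtains r :: "nat => nat" where "strict_mono r"
  "AE x in M. \<forall>\<^sub>F j in sequentially. d (r j) (r (Suc j)) x \<le> (1/2) ^ j"
proof -
 have "\<exists>N. \<forall>m\<ge>N. \<forall>n\<ge>N. (\<integral>\<^sup>+x. ennreal (d m n x) \<partial>M) \<le> ennreal ((1/4) ^ j)" for j :: nat
  by (rule cauchy) simp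
 then obtain N where N: "\<And>j m n. N j \<le> m ==> N j \<le> n ==> (\<integral>\<^sup>+x. ennreal (d m n x) \<partial>M) \<le> ennreal ((1/4) ^ j)" by metis
 define r where "r j = (\<Sum>i\<le>j. N i) + j" for j
 have r: "strict_mono r" unfolding r_def by (rule strict_mono_Suc_iff[THEN iffD2]) simp
 have Nr: "N j \<le> r j" "N j \<le> r (Suc j)" for j
 proof -
  have "N j \<le> (\<Sum>i\<le>j. N i)" by (rule member_le_sum) auto
  then show "N j \<le> r j" by (simp add: r_def)
  also have "r j \<le> r (Suc j)" using r by (simp add: strict_mono_Suc_iff less_imp_le)
  finally show "N j \<le> r (Suc j)" .
 qed
 note [measurable] = m
 let ?f = "\<lambda>j x. ennreal (2 ^ j * d (r j) (r (Suc j)) x)"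
 have "(\<integral>\<^sup>+x. (\<Sum>j. ?f j x) \<partial>M) = (\<Sum>j. \<integral>\<^sup>+x. ?f j x \<partial>M)"
  by (rule nn_integral_suminf) measurable
 also have "\<dots> \<le> (\<Sum>j. ennreal ((1/2) ^ j))"
 proof (rule suminf_le)
  fix j
  have "(\<integral>\<^sup>+x. ?f j x \<partial>M) = ennreal (2 ^ j) * (\<integral>\<^sup>+x. ennreal (d (r j) (r (Suc j)) x) \<partial>M)"
   by (subst nn_integral_cmult[symmetric]) (auto simp: ennreal_mult d0)
  also have "\<dots> \<le> ennreal (2 ^ j) * ennreal ((1/4) ^ j)" by (intro mult_left_mono N Nr) simp
  also have "\<dots> = ennreal ((1/2) ^ j)" by (simp add: ennreal_mult[symmetric] power_mult_distrib[symmetric])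
  finally show "(\<integral>\<^sup>+x. ?f j x \<partial>M) \<le> ennreal ((1/2) ^ j)" .
 qed (rule summableI)+
 finally have le: "(\<integral>\<^sup>+x. (\<Sum>j. ?f j x) \<partial>M) \<le> (\<Sum>j. ennreal ((1/2) ^ j))" .
 have "(\<Sum>j. ennreal ((1/2) ^ j)) \<noteq> top" by (rule ennreal_suminf_neq_top) (simp_all add: summable_geometric)
 with le have "(\<integral>\<^sup>+x. (\<Sum>j. ?f j x) \<partial>M) \<noteq> \<infinity>" by (metis infinity_ennreal_def neq_top_trans)
 then have "AE x in M. (\<Sum>j. ?f j x) \<noteq> \<infinity>" by (intro nn_integral_PInf_AE) auto
 then have "AE x in M. \<forall>\<^sub>F j in sequentially. d (r j) (r (Suc j)) x \<le> (1/2) ^ j"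
 proof eventually_elim
  case (elim x)
  then have "(\<Sum>j. ?f j x) < \<infinity>" by (simp only: infinity_ennreal_def top.not_eq_extremum)
  from ennreal_suminf_tail_tendsto_0[OF this, unfolded ennreal_tendsto_0_iff, rule_format, OF zero_less_one]
  have "\<forall>\<^sub>F n in sequentially. (\<Sum>k. ?f (k + n) x) \<le> ennreal 1" .
  then show ?case
  proof eventually_elim
   case (elim j)
   have "?f j x = (\<Sum>k<1. ?f (k + j) x)" by simp
   also have "\<dots> \<le> (\<Sum>k. ?f (k + j) x)" by (rule sum_le_suminf) auto
   also have "\<dots> \<le> ennreal 1" by (rule elim)
   finally have "2 ^ j * d (r j) (r (Suc j)) x \<le> 1" by (subst (asm) ennreal_le_iff) auto
   then show ?case by (simp add: field_simps)
  qed
 qed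
 with r show ?thesis by (rule that)
qed

lemma convergent_if_fast:
 fixes x :: "nat => 'b::banach"
 assumes "\<forall>\<^sub>F j in sequentially. norm (x (Suc j) - x j) \<le> c ^ j" "0 \<le> c" "c < 1"
 shows "convergent x"
proof -
 have "summable (\<lambda>j. x (Suc j) - x j)"
  by (rule summable_comparison_test_ev[OF assms(1)]) (use assms in \<open>auto intro: summable_geometric\<close>)
 from summable_LIMSEQ[OF this] obtain l where "(\<lambda>n. x n - x 0) \<longlonglongrightarrow> l" by (simp add: sum_lessThan_telescope)
 then have "(\<lambda>n. (x n - x 0) + x 0) \<longlonglongrightarrow> l + x 0" by (intro tendsto_intros)
 then show ?thesis by (auto simp: convergent_def)
qed

lemma Lp_complete:
 fixes W :: "nat => 'a => 'b::euclidean_space"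
 assumes p: "1 \<le> p" and W: "\<And>n. in_Lp M p (W n)"
  and cauchy: "\<And>\<eta>. 0 < \<eta> ==> \<exists>N. \<forall>m\<ge>N. \<forall>n\<ge>N. Lp_pow M p (\<lambda>x. W m x - W n x) \<le> ennreal \<eta>"
 obtains f and r :: "nat => nat" where "strict_mono r" "in_Lp M p f" "AE x in M. (\<lambda>j. W (r j) x) \<longlonglongrightarrow> f x" "tendsto_Lp M p W f"
proof -
 have p0: "0 \<le> p" using p by simp
 have [measurable]: "W n \<in> borel_measurable M" for n using W by (simp add: in_Lp_iff)
 obtain r where r: "strict_mono r"
  "AE x in M. \<forall>\<^sub>F j in sequentially. norm (W (r j) x - W (r (Suc j)) x) powr p \<le> (1/2) ^ j"
  by (rule fast_subsequence[of "\<lambda>m n x. norm (W m x - W n x) powr p" M])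
   (use cauchy in \<open>auto simp: Lp_pow_def\<close>)
 define f where "f x = lim (\<lambda>j. W (r j) x)" for x
 have ae: "AE x in M. (\<lambda>j. W (r j) x) \<longlonglongrightarrow> f x"
  using r(2)
 proof eventually_elim
  case (elim x)
  let ?c = "(1/2) powr (1 / p) :: real"
  have "\<forall>\<^sub>F j in sequentially. norm (W (r (Suc j)) x - W (r j) x) \<le> ?c ^ j"
   using elim
  proof eventually_elim
   case (elim j)
   have "norm (W (r (Suc j)) x - W (r j) x) = (norm (W (r j) x - W (r (Suc j)) x) powr p) powr (1 / p)"
    using p by (simp add: powr_powr norm_minus_commute)
   also have "\<dots> \<le> ((1/2) ^ j) powr (1 / p)" using elim p by (intro powr_mono2) auto
   also have "\<dots> = ?c ^ j" using p by (simp add: powr_realpow[symmetric] powr_powr mult.commute)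
   finally show ?case .
  qed
  then have "convergent (\<lambda>j. W (r j) x)"
   by (rule convergent_if_fast) (use p powr_less_mono2[of "1/p" "1/2" 1] in simp_all)
  then show ?case unfolding f_def by (simp add: convergent_LIMSEQ_iff)
 qed
 have mf[measurable]: "f \<in> borel_measurable M" unfolding f_def by (rule borel_measurable_lim_metric) measurable
 have fatou: "Lp_pow M p (\<lambda>x. W n x - f x) \<le> ennreal \<eta>"
  if N: "\<forall>m\<ge>N. \<forall>n\<ge>N. Lp_pow M p (\<lambda>x. W m x - W n x) \<le> ennreal \<eta>" and n: "N \<le> n" for n N \<eta>
 proof -
  have "Lp_pow M p (\<lambda>x. W n x - f x) = (\<integral>\<^sup>+x. liminf (\<lambda>j. ennreal (norm (W n x - W (r j) x) powr p)) \<partial>M)"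
   unfolding Lp_pow_def
  proof (rule nn_integral_cong_AE, use ae in eventually_elim)
   case (elim x)
   have "(\<lambda>j. norm (W n x - W (r j) x) powr p) \<longlonglongrightarrow> norm (W n x - f x) powr p"
    using elim p by (intro tendsto_powr' tendsto_intros) auto
   from lim_imp_Liminf[OF sequentially_bot tendsto_ennrealI[OF this]]
   show ?case by (rule sym)
  qed
  also have "\<dots> \<le> liminf (\<lambda>j. Lp_pow M p (\<lambda>x. W n x - W (r j) x))"
   unfolding Lp_pow_def by (rule nn_integral_liminf) measurable
  also have "\<dots> \<le> liminf (\<lambda>j::nat. ennreal \<eta>)"
  proof (rule Liminf_mono)
   have "Lp_pow M p (\<lambda>x. W n x - W (r j) x) \<le> ennreal \<eta>" if "N \<le> j" for j
    by (rule N[rule_format, OF n le_trans[OF that seq_suble[OF r(1)]]])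
   then show "\<forall>\<^sub>F j in sequentially. Lp_pow M p (\<lambda>x. W n x - W (r j) x) \<le> ennreal \<eta>"
    by (auto simp: eventually_sequentially)
  qed
  finally show ?thesis by (simp add: Liminf_const)
 qed
 have tend: "tendsto_Lp M p W f"
  unfolding tendsto_Lp_iff ennreal_tendsto_0_iff
 proof (intro allI impI)
  fix \<eta> :: real assume "0 < \<eta>"
  from cauchy[OF this] obtain N where N: "\<forall>m\<ge>N. \<forall>n\<ge>N. Lp_pow M p (\<lambda>x. W m x - W n x) \<le> ennreal \<eta>" by blast
  show "\<forall>\<^sub>F k in sequentially. Lp_pow M p (\<lambda>x. W k x - f x) \<le> ennreal \<eta>"
   unfolding eventually_sequentially by (intro exI[of _ N] allI impI fatou[OF N])
 qed
 obtain N where N: "\<forall>m\<ge>N. \<forall>n\<ge>N. Lp_pow M p (\<lambda>x. W m x - W n x) \<le> ennreal 1" using cauchy[of 1] by auto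
 have "Lp_pow M p (\<lambda>x. W N x - f x) < \<infinity>"
  using le_less_trans[OF fatou[OF N order_refl]] by simp
 then have "in_Lp M p (\<lambda>x. W N x - f x)" by (simp add: in_Lp_iff)
 from in_Lp_diff[OF W[of N] this p0] have "in_Lp M p f" by simp
 from that[OF r(1) this ae tend] show ?thesis .
qed

section \<open>Compactness\<close>

text \<open>Integrate the gradient along the segment from \<open>x\<close> to \<open>x + h\<close> and then, by Tonelli, over \<open>x\<close>.\<close>

lemma nn_integral_translation_le:
 fixes \<psi> :: "real^'n::finite => real"
 assumes \<psi>: "smooth_on UNIV \<psi>"
 shows "(\<integral>\<^sup>+x. ennreal \<bar>\<psi> x - \<psi> (x + h)\<bar> \<partial>lborel) \<le> ennreal (norm h) * (\<integral>\<^sup>+x. ennreal (norm (grad \<psi> x)) \<partial>lborel)"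
proof -
 let ?g = "\<lambda>x. ennreal (norm (grad \<psi> x))"
 have [measurable]: "grad \<psi> \<in> borel_measurable borel" by (rule smooth_measurable(5)[OF \<psi>])
 have pt: "ennreal \<bar>\<psi> x - \<psi> (x + h)\<bar> \<le> ennreal (norm h) * (\<integral>\<^sup>+t. indicator {0..1} t * ?g (x + t *\<^sub>R h) \<partial>lborel)" for x
 proof -
  let ?n = "\<lambda>t. norm (grad \<psi> (x + t *\<^sub>R h))"
  have cn: "continuous_on {0..1} ?n"
   by (intro continuous_on_norm continuous_on_compose2[OF smooth_grad_continuous[OF \<psi>]]) (auto intro!: continuous_intros)
  have i: "?n integrable_on {0..1}" by (rule integrable_continuous_real[OF cn])
  have der: "((\<lambda>t. \<psi> (x + t *\<^sub>R h)) has_vector_derivative (grad \<psi> (x + t *\<^sub>R h) \<bullet> h)) (at t within {0..1})" for t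
  proof -
   have "((\<lambda>t. x + t *\<^sub>R h) has_derivative (\<lambda>s. s *\<^sub>R h)) (at t within {0..1})"
    by (auto intro!: derivative_eq_intros)
   from has_derivative_compose[OF this has_derivative_grad[OF smooth_differentiable[OF \<psi>]]]
   show ?thesis by (simp add: has_vector_derivative_def)
  qed
  have ftc: "((\<lambda>t. grad \<psi> (x + t *\<^sub>R h) \<bullet> h) has_integral (\<psi> (x + h) - \<psi> x)) {0..1}"
   using fundamental_theorem_of_calculus[of 0 1 "\<lambda>t. \<psi> (x + t *\<^sub>R h)" "\<lambda>t. grad \<psi> (x + t *\<^sub>R h) \<bullet> h"] der by simp
  have "norm (\<psi> (x + h) - \<psi> x) \<le> integral {0..1} (\<lambda>t. norm h * ?n t)"
   unfolding integral_unique[OF ftc, symmetric]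
  proof (rule integral_norm_bound_integral)
   show "(\<lambda>t. norm h * ?n t) integrable_on {0..1}" by (rule integrable_on_mult_right[OF i])
   show "norm (grad \<psi> (x + t *\<^sub>R h) \<bullet> h) \<le> norm h * ?n t" for t
    using Cauchy_Schwarz_ineq2[of "grad \<psi> (x + t *\<^sub>R h)" h] by (simp add: mult.commute)
  qed (use ftc in blast)
  then have "\<bar>\<psi> x - \<psi> (x + h)\<bar> \<le> norm h * integral {0..1} ?n" by (simp add: abs_minus_commute)
  then have "ennreal \<bar>\<psi> x - \<psi> (x + h)\<bar> \<le> ennreal (norm h * integral {0..1} ?n)" by (rule ennreal_leI)
  also have "\<dots> = ennreal (norm h) * ennreal (integral {0..1} ?n)"
   by (rule ennreal_mult) (auto intro: Henstock_Kurzweil_Integration.integral_nonneg[OF i])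
  also have "ennreal (integral {0..1} ?n) = (\<integral>\<^sup>+t. indicator {0..1} t * ?n t \<partial>lborel)"
   using nn_integral_has_integral_lebesgue[OF _ integrable_integral[OF i]] by simp
  also have "\<dots> = (\<integral>\<^sup>+t. indicator {0..1} t * ?g (x + t *\<^sub>R h) \<partial>lborel)"
   by (rule nn_integral_cong) (auto simp: indicator_def)
  finally show ?thesis .
 qed
 have "(\<integral>\<^sup>+x. ennreal \<bar>\<psi> x - \<psi> (x + h)\<bar> \<partial>lborel)
   \<le> (\<integral>\<^sup>+x. ennreal (norm h) * (\<integral>\<^sup>+t. indicator {0..1} t * ?g (x + t *\<^sub>R h) \<partial>lborel) \<partial>lborel)"
  by (rule nn_integral_mono) (rule pt)
 also have "\<dots> = ennreal (norm h) * (\<integral>\<^sup>+x. (\<integral>\<^sup>+t. indicator {0..1} t * ?g (x + t *\<^sub>R h) \<partial>lborel) \<partial>lborel)"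
  by (rule nn_integral_cmult) measurable
 also have "(\<integral>\<^sup>+x. (\<integral>\<^sup>+t. indicator {0..1} t * ?g (x + t *\<^sub>R h) \<partial>lborel) \<partial>lborel)
   = (\<integral>\<^sup>+t. (\<integral>\<^sup>+x. indicator {0..1} t * ?g (x + t *\<^sub>R h) \<partial>lborel) \<partial>(lborel :: real measure))"
  by (rule lborel_pair.Fubini') measurable
 also have "\<dots> = (\<integral>\<^sup>+t. indicator {0..1} t * (\<integral>\<^sup>+x. ?g x \<partial>lborel) \<partial>(lborel :: real measure))"
 proof (rule nn_integral_cong)
  fix t :: real
  have "(\<integral>\<^sup>+x. indicator {0..1} t * ?g (x + t *\<^sub>R h) \<partial>lborel) = indicator {0..1} t * (\<integral>\<^sup>+x. ?g (x + t *\<^sub>R h) \<partial>lborel)"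
   by (rule nn_integral_cmult) measurable
  also have "(\<integral>\<^sup>+x. ?g (x + t *\<^sub>R h) \<partial>lborel) = (\<integral>\<^sup>+x. ?g x \<partial>lborel)"
   by (rule nn_integral_lborel_shift) measurable
  finally show "(\<integral>\<^sup>+x. indicator {0..1} t * ?g (x + t *\<^sub>R h) \<partial>lborel) = indicator {0..1} t * (\<integral>\<^sup>+x. ?g x \<partial>lborel)" .
 qed
 also have "\<dots> = (\<integral>\<^sup>+x. ?g x \<partial>lborel)" by (subst nn_integral_multc) auto
 finally show ?thesis .
qed

text \<open>A mollification is an average of translates by vectors shorter than \<open>e\<close>.\<close>

lemma nn_integral_mollification_error_le:
 fixes \<psi> :: "real^'n::finite => real"
 assumes \<psi>: "smooth_on UNIV \<psi>" "integrable lebesgue \<psi>" and e: "0 < e"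
 shows "(\<integral>\<^sup>+x. ennreal \<bar>\<psi> x - conv \<psi> (mollifier e) x\<bar> \<partial>lborel) \<le> ennreal e * (\<integral>\<^sup>+x. ennreal (norm (grad \<psi> x)) \<partial>lborel)"
proof -
 let ?\<rho> = "mollifier e :: real^'n => real"
 let ?C = "\<integral>\<^sup>+x. ennreal (norm (grad \<psi> x)) \<partial>lborel"
 have [measurable]: "\<psi> \<in> borel_measurable borel" by (rule smooth_measurable(4)[OF \<psi>(1)])
 have [measurable]: "?\<rho> \<in> borel_measurable borel"
  by (rule borel_measurable_lebesgue_continuous(2)[OF continuous_mollifier[OF e]])
 have pt: "ennreal \<bar>\<psi> x - conv \<psi> ?\<rho> x\<bar> \<le> (\<integral>\<^sup>+z. ennreal (?\<rho> (- z)) * ennreal \<bar>\<psi> x - \<psi> (x + z)\<bar> \<partial>lborel)" for x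
 proof -
  have i: "integrable lebesgue (\<lambda>y. \<psi> x * ?\<rho> (x - y))" "integrable lebesgue (\<lambda>y. \<psi> y * ?\<rho> (x - y))"
   using mollifier_reflected_integral(1)[OF e, of x] conv_integrable[OF \<psi>(2) continuous_mollifier[OF e] supported_mollifier[OF e]]
   by auto
  have "\<psi> x - conv \<psi> ?\<rho> x = (\<integral>y. \<psi> x * ?\<rho> (x - y) - \<psi> y * ?\<rho> (x - y) \<partial>lebesgue)"
   unfolding Bochner_Integration.integral_diff[OF i] conv_def using mollifier_reflected_integral(2)[OF e, of x] by simp
  then have "ennreal \<bar>\<psi> x - conv \<psi> ?\<rho> x\<bar> \<le> (\<integral>\<^sup>+y. ennreal (norm (\<psi> x * ?\<rho> (x - y) - \<psi> y * ?\<rho> (x - y))) \<partial>lebesgue)"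
   using integral_norm_bound_ennreal[OF Bochner_Integration.integrable_diff[OF i]] by simp
  also have "\<dots> = (\<integral>\<^sup>+y. ennreal (?\<rho> (x - y)) * ennreal \<bar>\<psi> x - \<psi> y\<bar> \<partial>lborel)"
   unfolding nn_integral_completion
  proof (rule nn_integral_cong)
   fix y
   have "norm (\<psi> x * ?\<rho> (x - y) - \<psi> y * ?\<rho> (x - y)) = ?\<rho> (x - y) * \<bar>\<psi> x - \<psi> y\<bar>"
    using mollifier_nonneg[OF e, of "x - y"] by (simp add: left_diff_distrib[symmetric] abs_mult)
   then show "ennreal (norm (\<psi> x * ?\<rho> (x - y) - \<psi> y * ?\<rho> (x - y))) = ennreal (?\<rho> (x - y)) * ennreal \<bar>\<psi> x - \<psi> y\<bar>"
    using mollifier_nonneg[OF e, of "x - y"] by (simp add: ennreal_mult)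
  qed
  also have "\<dots> = (\<integral>\<^sup>+z. ennreal (?\<rho> (x - (z + x))) * ennreal \<bar>\<psi> x - \<psi> (z + x)\<bar> \<partial>lborel)"
   by (rule nn_integral_lborel_shift[symmetric]) measurable
  finally show ?thesis by (simp add: add.commute)
 qed
 have "(\<integral>\<^sup>+x. ennreal \<bar>\<psi> x - conv \<psi> ?\<rho> x\<bar> \<partial>lborel)
   \<le> (\<integral>\<^sup>+x. (\<integral>\<^sup>+z. ennreal (?\<rho> (- z)) * ennreal \<bar>\<psi> x - \<psi> (x + z)\<bar> \<partial>lborel) \<partial>lborel)"
  by (rule nn_integral_mono) (rule pt)
 also have "\<dots> = (\<integral>\<^sup>+z. (\<integral>\<^sup>+x. ennreal (?\<rho> (- z)) * ennreal \<bar>\<psi> x - \<psi> (x + z)\<bar> \<partial>lborel) \<partial>lborel)"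
  by (rule lborel_pair.Fubini') measurable
 also have "\<dots> \<le> (\<integral>\<^sup>+z. ennreal (?\<rho> (0 - z)) * (ennreal e * ?C) \<partial>lborel)"
 proof (rule nn_integral_mono)
  fix z :: "real^'n"
  have "(\<integral>\<^sup>+x. ennreal (?\<rho> (- z)) * ennreal \<bar>\<psi> x - \<psi> (x + z)\<bar> \<partial>lborel)
    = ennreal (?\<rho> (- z)) * (\<integral>\<^sup>+x. ennreal \<bar>\<psi> x - \<psi> (x + z)\<bar> \<partial>lborel)"
   by (rule nn_integral_cmult) measurable
  also have "\<dots> \<le> ennreal (?\<rho> (0 - z)) * (ennreal e * ?C)"
  proof (cases "e \<le> norm z")
   case True
   then have "?\<rho> (- z) = 0" using supported_mollifier[OF e, where 'n='n] by (simp add: supported_in_ball_def)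
   then show ?thesis by simp
  next
   case False
   have "(\<integral>\<^sup>+x. ennreal \<bar>\<psi> x - \<psi> (x + z)\<bar> \<partial>lborel) \<le> ennreal (norm z) * ?C"
    by (rule nn_integral_translation_le[OF \<psi>(1)])
   also have "\<dots> \<le> ennreal e * ?C" by (intro mult_right_mono ennreal_leI) (use False in auto)
   finally show ?thesis by (simp add: mult_left_mono)
  qed
  finally show "(\<integral>\<^sup>+x. ennreal (?\<rho> (- z)) * ennreal \<bar>\<psi> x - \<psi> (x + z)\<bar> \<partial>lborel) \<le> ennreal (?\<rho> (0 - z)) * (ennreal e * ?C)" .
 qed
 also have "\<dots> = (\<integral>\<^sup>+z. ennreal (?\<rho> (0 - z)) \<partial>lborel) * (ennreal e * ?C)"
  by (rule nn_integral_multc) measurable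
 also have "(\<integral>\<^sup>+z. ennreal (?\<rho> (0 - z)) \<partial>lborel) = 1" by (rule mollifier_nn_integral(2)[OF e])
 finally show ?thesis by simp
qed

lemma supported_lipschitz:
 fixes \<rho> :: "real^'n::finite => real"
 assumes \<rho>: "smooth_on UNIV \<rho>" "supported_in_ball R \<rho>"
 obtains L where "L > 0" "\<And>x y. \<bar>\<rho> x - \<rho> y\<bar> \<le> L * norm (x - y)" "\<And>x. norm (grad \<rho> x) \<le> L"
proof -
 have "\<exists>M>0. \<forall>x. \<bar>partial i \<rho> x\<bar> \<le> M" for i
  by (rule supported_bounded[OF smooth_continuous[OF smooth_partial[OF \<rho>(1)]] supported_partial[OF \<rho>(2)]]) auto
 then obtain M where M: "\<And>i. M i > 0" "\<And>i x. \<bar>partial i \<rho> x\<bar> \<le> M i" by metis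
 let ?L = "\<Sum>i\<in>UNIV. M i"
 have g: "norm (grad \<rho> x) \<le> ?L" for x
 proof -
  have "norm (grad \<rho> x) \<le> (\<Sum>i\<in>UNIV. \<bar>grad \<rho> x $ i\<bar>)" by (rule norm_le_l1_cart)
  also have "\<dots> \<le> ?L" by (rule sum_mono) (use M(2) in \<open>simp add: grad_def\<close>)
  finally show ?thesis .
 qed
 show ?thesis
 proof (rule that[OF _ _ g])
  show "?L > 0" by (rule sum_pos) (use M(1) in auto)
  fix x y
  have "norm (\<rho> x - \<rho> y) \<le> ?L * norm (x - y)"
  proof (rule differentiable_bound[of UNIV])
   show "(\<rho> has_derivative (\<lambda>v. grad \<rho> z \<bullet> v)) (at z within UNIV)" for z
    using has_derivative_grad[OF smooth_differentiable[OF \<rho>(1)]] by simp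
   show "onorm (\<lambda>v. grad \<rho> z \<bullet> v) \<le> ?L" for z
   proof (rule onorm_le)
    fix v
    show "norm (grad \<rho> z \<bullet> v) \<le> ?L * norm v"
     using Cauchy_Schwarz_ineq2[of "grad \<rho> z" v] mult_right_mono[OF g[of z], of "norm v"] by simp
   qed
  qed auto
  then show "\<bar>\<rho> x - \<rho> y\<bar> \<le> ?L * norm (x - y)" by simp
 qed
qed

lemma integral_mult_bounded_le:
 fixes h q :: "'a => real"
 assumes h: "integrable M h" and hq: "integrable M (\<lambda>x. h x * q x)" and q: "\<And>x. \<bar>q x\<bar> \<le> C"
  and B: "(\<integral>\<^sup>+x. ennreal \<bar>h x\<bar> \<partial>M) \<le> ennreal B" "0 \<le> B"
 shows "\<bar>\<integral>x. h x * q x \<partial>M\<bar> \<le> C * B"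
proof -
 have C: "0 \<le> C" using q[of undefined] by simp
 have iB: "(\<integral>x. \<bar>h x\<bar> \<partial>M) \<le> B"
 proof -
  have "ennreal (\<integral>x. \<bar>h x\<bar> \<partial>M) = (\<integral>\<^sup>+x. ennreal \<bar>h x\<bar> \<partial>M)"
   by (rule nn_integral_eq_integral[symmetric]) (use h in auto)
  then show ?thesis using B by (metis ennreal_le_iff)
 qed
 have "\<bar>\<integral>x. h x * q x \<partial>M\<bar> \<le> (\<integral>x. \<bar>h x * q x\<bar> \<partial>M)" by (rule integral_abs_bound)
 also have "\<dots> \<le> (\<integral>x. C * \<bar>h x\<bar> \<partial>M)"
 proof (rule integral_mono)
  show "integrable M (\<lambda>x. \<bar>h x * q x\<bar>)" "integrable M (\<lambda>x. C * \<bar>h x\<bar>)" using h hq by auto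
  show "\<bar>h x * q x\<bar> \<le> C * \<bar>h x\<bar>" for x using mult_right_mono[OF q[of x], of "\<bar>h x\<bar>"] by (simp add: abs_mult mult.commute)
 qed
 also have "\<dots> = C * (\<integral>x. \<bar>h x\<bar> \<partial>M)" by simp
 also have "\<dots> \<le> C * B" by (rule mult_left_mono[OF iB C])
 finally show ?thesis .
qed

lemma finite_pointwise_convergent_subsequence:
 fixes F :: "nat => 'a => real"
 assumes "finite A" and F: "\<And>k x. \<bar>F k x\<bar> \<le> M"
 shows "\<exists>r :: nat => nat. strict_mono r \<and> (\<forall>x\<in>A. convergent (\<lambda>k. F (r k) x))"
 using assms(1)
proof (induction A rule: finite_induct)
 case empty
 show ?case by (rule exI[of _ id]) (simp add: strict_mono_def)
next
 case (insert a A)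
 then obtain r where r: "strict_mono r" "\<And>x. x \<in> A ==> convergent (\<lambda>k. F (r k) x)" by auto
 have "\<forall>k. F (r k) a \<in> {- M..M}" using F by (auto simp: abs_le_iff minus_le_iff)
 moreover have "seq_compact {- M..M}" by (simp add: compact_imp_seq_compact)
 ultimately obtain l r' where r': "strict_mono r'" "((\<lambda>k. F (r k) a) \<circ> r') \<longlonglongrightarrow> l"
  using seq_compactE[of "{- M..M}" "\<lambda>k. F (r k) a"] by metis
 have "convergent (\<lambda>k. F ((r \<circ> r') k) x)" if "x \<in> insert a A" for x
 proof (cases "x = a")
  case True
  then show ?thesis using r'(2) by (auto simp: convergent_def o_def)
 next
  case False
  then show ?thesis using convergent_subseq_convergent[OF r(2) r'(1), of x] that by (simp add: o_def)
 qed
 then show ?case using strict_mono_o[OF r(1) r'(1)] by blast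
qed

lemma nn_integral_lebesgue_on:
 assumes "S \<in> sets borel"
 shows "(\<integral>\<^sup>+x. f x \<partial>lebesgue_on S) = (\<integral>\<^sup>+x. f x * indicator S x \<partial>lborel)"
proof -
 have "S \<inter> space lebesgue \<in> sets lebesgue" using assms by auto
 then show ?thesis by (simp add: nn_integral_restrict_space nn_integral_completion)
qed

text \<open>The three-step proof of Rellich's theorem, with the truncated distance so that a thin strip along the
 boundary may be ignored: cut off near the boundary, mollify, and select a subsequence along which the
 mollified functions, being equi-Lipschitz, vary little on a finite net.\<close>

lemma almost_cauchy_subsequence:
 fixes w :: "nat => real^'n::finite => real"
 assumes \<Omega>: "open \<Omega>" "bounded \<Omega>" and w: "\<And>k. smooth_on UNIV (w k)" and B: "0 \<le> B"
  and wB: "\<And>k. (\<integral>\<^sup>+x. ennreal \<bar>w k x\<bar> \<partial>lebesgue_on \<Omega>) \<le> ennreal B"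
  and gB: "\<And>k. (\<integral>\<^sup>+x. ennreal (norm (grad (w k) x)) \<partial>lebesgue_on \<Omega>) \<le> ennreal B"
  and \<epsilon>: "0 < \<epsilon>"
 shows "\<exists>r :: nat => nat. strict_mono r \<and>
  (\<forall>k l. (\<integral>\<^sup>+x. ennreal (min 1 \<bar>w (r k) x - w (r l) x\<bar>) \<partial>lebesgue_on \<Omega>) \<le> ennreal \<epsilon>)"
proof -
 have S\<Omega>[measurable]: "\<Omega> \<in> sets borel" using \<Omega> by simp
 note [measurable] = smooth_measurable(4)[OF w] smooth_measurable(5)[OF w]
 note mS = inner_strip_measurable[OF \<Omega>(1)]
 obtain d where d: "d > 0" "emeasure lborel (inner_strip \<Omega> d) \<le> ennreal (\<epsilon>/4)"
 proof -
  interpret finite_measure "lebesgue_on \<Omega>" by (rule finite_measure_bounded_open[OF \<Omega>])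
  have "in_Lp (lebesgue_on \<Omega>) 1 (\<lambda>x. 1::real)" by (simp add: in_Lp_def)
  from inner_strip_tendsto_0[OF \<Omega> this LIMSEQ_inverse_real_of_nat]
  have "(\<lambda>k. emeasure lborel (inner_strip \<Omega> (inverse (real (Suc k))))) \<longlonglongrightarrow> 0"
   unfolding Lp_pow_lebesgue_on[OF mS(1)] using mS(1) by simp
  from this[unfolded ennreal_tendsto_0_iff, rule_format, of "\<epsilon>/4"] \<epsilon>
  obtain k where "emeasure lborel (inner_strip \<Omega> (inverse (real (Suc k)))) \<le> ennreal (\<epsilon>/4)"
   by (auto simp: eventually_sequentially)
  then show ?thesis by (intro that[of "inverse (real (Suc k))"]) auto
 qed
 let ?K = "{x. d \<le> infdist x (- \<Omega>)}"
 have K\<Omega>: "?K \<subseteq> \<Omega>"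
 proof
  fix x assume "x \<in> ?K"
  then show "x \<in> \<Omega>" using d(1) infdist_zero[of x "- \<Omega>"] by (cases "x \<in> \<Omega>") auto
 qed
 have "closed ?K" by (intro closed_Collect_le continuous_intros)
 then have "compact ?K" using K\<Omega> \<Omega>(2) by (simp add: compact_eq_bounded_closed bounded_subset)
 then obtain \<eta> U where \<eta>: "test_fun \<Omega> \<eta>" "\<And>x. 0 \<le> \<eta> x \<and> \<eta> x \<le> 1" "open U" "?K \<subseteq> U" "\<And>x. x \<in> U ==> \<eta> x = 1"
  using test_fun_cutoff[OF _ K\<Omega> \<Omega>(1)] by metis
 obtain R where R: "supported_in_ball R \<eta>" using test_funD(4)[OF \<eta>(1)] ..
 obtain M where M: "M > 0" "\<And>x. norm (grad \<eta> x) \<le> M"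
  using supported_lipschitz[OF test_funD(1)[OF \<eta>(1)] R] by metis
 define \<psi> where "\<psi> k x = w k x * \<eta> x" for k x
 have t\<psi>: "test_fun \<Omega> (\<psi> k)" for k
  using test_fun_mult_left[OF \<eta>(1) w[of k]] by (simp add: \<psi>_def[abs_def])
 note s\<psi> = test_funD(1)[OF t\<psi>]
 have [measurable]: "\<psi> k \<in> borel_measurable borel" for k by (rule smooth_measurable(4)[OF s\<psi>])
 have i\<psi>: "integrable lebesgue (\<psi> k)" for k
  using test_funD(4)[OF t\<psi>[of k]] supported_integrable(1)[OF smooth_continuous[OF s\<psi>[of k]]] by blast
 have \<psi>B: "(\<integral>\<^sup>+x. ennreal \<bar>\<psi> k x\<bar> \<partial>lborel) \<le> ennreal B" for k
 proof -
  have "(\<integral>\<^sup>+x. ennreal \<bar>\<psi> k x\<bar> \<partial>lborel) \<le> (\<integral>\<^sup>+x. ennreal \<bar>w k x\<bar> * indicator \<Omega> x \<partial>lborel)"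
  proof (rule nn_integral_mono)
   fix x
   have "\<bar>\<psi> k x\<bar> \<le> \<bar>w k x\<bar>" using \<eta>(2)[of x] by (simp add: \<psi>_def abs_mult mult_left_le)
   then show "ennreal \<bar>\<psi> k x\<bar> \<le> ennreal \<bar>w k x\<bar> * indicator \<Omega> x"
    using test_fun_zero_off[OF t\<psi>, of x k] by (cases "x \<in> \<Omega>") (auto intro: ennreal_leI)
  qed
  also have "\<dots> \<le> ennreal B" using wB[of k] by (simp add: nn_integral_lebesgue_on[OF S\<Omega>])
  finally show ?thesis .
 qed
 define C where "C = B + M * B"
 have C0: "0 \<le> C" using B M(1) by (simp add: C_def)
 have g\<psi>B: "(\<integral>\<^sup>+x. ennreal (norm (grad (\<psi> k) x)) \<partial>lborel) \<le> ennreal C" for k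
 proof -
  have "(\<integral>\<^sup>+x. ennreal (norm (grad (\<psi> k) x)) \<partial>lborel)
    \<le> (\<integral>\<^sup>+x. ennreal (norm (grad (w k) x)) * indicator \<Omega> x + ennreal M * (ennreal \<bar>w k x\<bar> * indicator \<Omega> x) \<partial>lborel)"
  proof (rule nn_integral_mono)
   fix x
   show "ennreal (norm (grad (\<psi> k) x))
     \<le> ennreal (norm (grad (w k) x)) * indicator \<Omega> x + ennreal M * (ennreal \<bar>w k x\<bar> * indicator \<Omega> x)"
   proof (cases "x \<in> \<Omega>")
    case True
    note dw = has_derivative_grad[OF smooth_differentiable[OF w], of k x]
    note d\<eta> = has_derivative_grad[OF smooth_differentiable[OF test_funD(1)[OF \<eta>(1)]], of x]
    have "(\<psi> k has_derivative (\<lambda>v. (w k x *\<^sub>R grad \<eta> x + \<eta> x *\<^sub>R grad (w k) x) \<bullet> v)) (at x)"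
     unfolding \<psi>_def[abs_def] using has_derivative_mult[OF dw d\<eta>]
     by (rule has_derivative_eq_rhs) (auto simp: fun_eq_iff inner_add_left algebra_simps)
    then have g: "grad (\<psi> k) x = w k x *\<^sub>R grad \<eta> x + \<eta> x *\<^sub>R grad (w k) x" by (rule partial_gradI(2))
    have "norm (grad (\<psi> k) x) \<le> \<bar>w k x\<bar> * norm (grad \<eta> x) + \<bar>\<eta> x\<bar> * norm (grad (w k) x)"
     unfolding g by (rule order_trans[OF norm_triangle_ineq]) simp
    also have "\<dots> \<le> \<bar>w k x\<bar> * M + 1 * norm (grad (w k) x)"
     using M(2)[of x] \<eta>(2)[of x] by (intro add_mono mult_left_mono mult_right_mono) auto
    finally have "norm (grad (\<psi> k) x) \<le> norm (grad (w k) x) + M * \<bar>w k x\<bar>" by (simp add: algebra_simps)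
    then have "ennreal (norm (grad (\<psi> k) x)) \<le> ennreal (norm (grad (w k) x) + M * \<bar>w k x\<bar>)" by (rule ennreal_leI)
    then show ?thesis using True M(1) by (simp add: ennreal_plus ennreal_mult)
   next
    case False
    then have "x \<notin> closure {x. \<psi> k x \<noteq> 0}" using test_funD(3)[OF t\<psi>] by blast
    from grad_zero_off_closure(1)[OF this] show ?thesis by simp
   qed
  qed
  also have "\<dots> = (\<integral>\<^sup>+x. ennreal (norm (grad (w k) x)) * indicator \<Omega> x \<partial>lborel)
    + ennreal M * (\<integral>\<^sup>+x. ennreal \<bar>w k x\<bar> * indicator \<Omega> x \<partial>lborel)"
   by (subst nn_integral_add, measurable, subst nn_integral_cmult) measurable
  also have "\<dots> \<le> ennreal B + ennreal M * ennreal B"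
   using wB[of k] gB[of k] unfolding nn_integral_lebesgue_on[OF S\<Omega>] by (intro add_mono mult_left_mono) auto
  also have "\<dots> = ennreal C" using M(1) B by (simp add: C_def ennreal_mult ennreal_plus)
  finally show ?thesis .
 qed
 define e where "e = \<epsilon> / (4 * (C + 1))"
 have e: "0 < e" using \<epsilon> C0 by (simp add: e_def)
 have eC: "e * C \<le> \<epsilon> / 4" using \<epsilon> C0 by (simp add: e_def field_simps)
 let ?\<rho> = "mollifier e :: real^'n => real"
 define c where "c k = conv (\<psi> k) ?\<rho>" for k
 have [measurable]: "c k \<in> borel_measurable borel" for k
  unfolding c_def by (rule smooth_measurable(4)[OF smooth_conv[OF i\<psi> smooth_mollifier[OF e] supported_mollifier[OF e]]])
 have err: "(\<integral>\<^sup>+x. ennreal \<bar>\<psi> k x - c k x\<bar> \<partial>lborel) \<le> ennreal (\<epsilon>/4)" for k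
 proof -
  have "(\<integral>\<^sup>+x. ennreal \<bar>\<psi> k x - c k x\<bar> \<partial>lborel) \<le> ennreal e * ennreal C"
   unfolding c_def by (rule order_trans[OF nn_integral_mollification_error_le[OF s\<psi> i\<psi> e] mult_left_mono[OF g\<psi>B]]) simp
  also have "\<dots> \<le> ennreal (\<epsilon>/4)" using eC e C0 by (simp add: ennreal_mult[symmetric] ennreal_leI)
  finally show ?thesis .
 qed
 note ci = conv_integrable[OF i\<psi> continuous_mollifier[OF e] supported_mollifier[OF e]]
 have \<psi>B': "(\<integral>\<^sup>+x. ennreal \<bar>\<psi> k x\<bar> \<partial>lebesgue) \<le> ennreal B" for k using \<psi>B[of k] by (simp add: nn_integral_completion)
 obtain M1 where M1: "\<And>x. \<bar>?\<rho> x\<bar> \<le> M1" using supported_bounded[OF continuous_mollifier[OF e] supported_mollifier[OF e]] by metis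
 have cb: "\<bar>c k x\<bar> \<le> M1 * B" for k x
  unfolding c_def conv_def by (rule integral_mult_bounded_le[OF i\<psi> ci _ \<psi>B' B]) (rule M1)
 obtain L where L: "L > 0" "\<And>x y. \<bar>?\<rho> x - ?\<rho> y\<bar> \<le> L * norm (x - y)"
  using supported_lipschitz[OF smooth_mollifier[OF e] supported_mollifier[OF e]] by metis
 have cl: "\<bar>c k x - c k y\<bar> \<le> L * norm (x - y) * B" for k x y
 proof -
  have "c k x - c k y = (\<integral>z. \<psi> k z * (?\<rho> (x - z) - ?\<rho> (y - z)) \<partial>lebesgue)"
   unfolding c_def conv_def by (simp add: right_diff_distrib Bochner_Integration.integral_diff[OF ci ci])
  moreover have "\<bar>\<integral>z. \<psi> k z * (?\<rho> (x - z) - ?\<rho> (y - z)) \<partial>lebesgue\<bar> \<le> L * norm (x - y) * B"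
  proof (rule integral_mult_bounded_le[OF i\<psi> _ _ \<psi>B' B])
   show "integrable lebesgue (\<lambda>z. \<psi> k z * (?\<rho> (x - z) - ?\<rho> (y - z)))"
    using Bochner_Integration.integrable_diff[OF ci ci] by (simp add: right_diff_distrib)
   show "\<bar>?\<rho> (x - z) - ?\<rho> (y - z)\<bar> \<le> L * norm (x - y)" for z using L(2)[of "x - z" "y - z"] by simp
  qed
  ultimately show ?thesis by simp
 qed
 obtain \<mu> where \<mu>: "emeasure lborel \<Omega> = ennreal \<mu>" "0 \<le> \<mu>"
  using emeasure_bounded_finite[OF \<Omega>(2)] by (cases "emeasure lborel \<Omega>") auto
 define \<delta> where "\<delta> = \<epsilon> / (12 * (\<mu> + 1))"
 have \<delta>: "\<delta> > 0" "3 * \<delta> * \<mu> \<le> \<epsilon> / 4" using \<epsilon> \<mu>(2) by (auto simp: \<delta>_def field_simps)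
 define \<delta>' where "\<delta>' = \<delta> / (L * B + 1)"
 have LB: "0 < L * B + 1" using L(1) B by (intro add_nonneg_pos) auto
 have "L * \<delta>' * B = \<delta> * (L * B) / (L * B + 1)" by (simp add: \<delta>'_def)
 also have "\<dots> \<le> \<delta>" unfolding pos_divide_le_eq[OF LB] using \<delta>(1) by (simp add: distrib_left)
 finally have \<delta>': "\<delta>' > 0" "L * \<delta>' * B \<le> \<delta>" using \<delta>(1) LB by (auto simp: \<delta>'_def)
 have "compact (closure \<Omega>)" using \<Omega>(2) by (simp add: compact_closure)
 then obtain A where A: "finite A" "closure \<Omega> \<subseteq> (\<Union>a\<in>A. ball a \<delta>')"
  unfolding compact_eq_totally_bounded using \<delta>'(1) by blast
 obtain r :: "nat => nat" where r: "strict_mono r" "\<forall>x\<in>A. convergent (\<lambda>k. c (r k) x)"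
  using finite_pointwise_convergent_subsequence[where F=c, OF A(1) cb] by (elim exE conjE)
 have "\<exists>N. \<forall>a\<in>A. \<forall>k\<ge>N. \<forall>l\<ge>N. \<bar>c (r k) a - c (r l) a\<bar> < \<delta>"
 proof -
  have "\<forall>a\<in>A. \<exists>N. \<forall>k\<ge>N. \<forall>l\<ge>N. \<bar>c (r k) a - c (r l) a\<bar> < \<delta>"
  proof
   fix a assume "a \<in> A"
   then have "Cauchy (\<lambda>k. c (r k) a)" using r(2) Cauchy_convergent_iff by blast
   from CauchyD[OF this \<delta>(1)] show "\<exists>N. \<forall>k\<ge>N. \<forall>l\<ge>N. \<bar>c (r k) a - c (r l) a\<bar> < \<delta>" by simp
  qed
  from bchoice[OF this] obtain N where N: "\<forall>a\<in>A. \<forall>k\<ge>N a. \<forall>l\<ge>N a. \<bar>c (r k) a - c (r l) a\<bar> < \<delta>" ..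
  have "N a \<le> Max (N ` A)" if "a \<in> A" for a using that A(1) by simp
  with N show ?thesis by (intro exI[of _ "Max (N ` A)"]) (meson le_trans)
 qed
 then obtain N where N: "\<And>a k l. a \<in> A ==> k \<ge> N ==> l \<ge> N ==> \<bar>c (r k) a - c (r l) a\<bar> < \<delta>" by blast
 have mid: "\<bar>c (r k) x - c (r l) x\<bar> \<le> 3 * \<delta>" if x: "x \<in> \<Omega>" and kl: "N \<le> k" "N \<le> l" for x k l
 proof -
  obtain a where a: "a \<in> A" "dist a x < \<delta>'" using A(2) x closure_subset[of \<Omega>] by auto
  have 1: "\<bar>c i x - c i a\<bar> \<le> \<delta>" for i
  proof -
   have "L * norm (x - a) * B \<le> L * \<delta>' * B"
    using a(2) L(1) B by (intro mult_right_mono mult_left_mono) (auto simp: dist_norm norm_minus_commute)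
   then show ?thesis using cl[of i x a] \<delta>'(2) by linarith
  qed
  show ?thesis using 1[of "r k"] 1[of "r l"] N[OF a(1) kl] by (auto simp: abs_le_iff abs_less_iff)
 qed
 have main: "(\<integral>\<^sup>+x. ennreal (min 1 \<bar>w (r k) x - w (r l) x\<bar>) \<partial>lebesgue_on \<Omega>) \<le> ennreal \<epsilon>" if kl: "N \<le> k" "N \<le> l" for k l
 proof -
  let ?s = "\<lambda>x. indicator (inner_strip \<Omega> d) x :: ennreal"
  have [measurable]: "inner_strip \<Omega> d \<in> sets borel" by (rule mS(1))
  have "(\<integral>\<^sup>+x. ennreal (min 1 \<bar>w (r k) x - w (r l) x\<bar>) \<partial>lebesgue_on \<Omega>)
    \<le> (\<integral>\<^sup>+x. (?s x + ennreal \<bar>\<psi> (r k) x - c (r k) x\<bar>) + (ennreal \<bar>\<psi> (r l) x - c (r l) x\<bar> + ennreal (3 * \<delta>) * indicator \<Omega> x) \<partial>lborel)"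
   unfolding nn_integral_lebesgue_on[OF S\<Omega>]
  proof (rule nn_integral_mono)
   fix x
   let ?a = "\<bar>\<psi> (r k) x - c (r k) x\<bar>" and ?b = "\<bar>\<psi> (r l) x - c (r l) x\<bar>"
   show "ennreal (min 1 \<bar>w (r k) x - w (r l) x\<bar>) * indicator \<Omega> x
     \<le> (?s x + ennreal ?a) + (ennreal ?b + ennreal (3 * \<delta>) * indicator \<Omega> x)"
   proof (cases "x \<in> \<Omega> \<and> x \<notin> inner_strip \<Omega> d")
    case True
    then have "x \<in> U" using \<eta>(4) by (auto simp: inner_strip_def)
    then have "\<psi> i x = w i x" for i using \<eta>(5) by (simp add: \<psi>_def)
    then have "min 1 \<bar>w (r k) x - w (r l) x\<bar> \<le> ?a + (?b + 3 * \<delta>)"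
     using mid[OF _ kl, of x] True by (auto simp: min_def abs_le_iff)
    then have "ennreal (min 1 \<bar>w (r k) x - w (r l) x\<bar>) \<le> ennreal (?a + (?b + 3 * \<delta>))" by (rule ennreal_leI)
    then show ?thesis using True \<delta>(1) by (simp add: ennreal_plus)
   next
    case False
    show ?thesis
    proof (cases "x \<in> \<Omega>")
     case True
     have "ennreal (min 1 \<bar>w (r k) x - w (r l) x\<bar>) * indicator \<Omega> x \<le> ?s x"
      using True False ennreal_leI[of "min 1 \<bar>w (r k) x - w (r l) x\<bar>" 1] by simp
     then show ?thesis by (meson add_increasing2 order_trans zero_le)
    qed simp
   qed
  qed
  also have "\<dots> = (emeasure lborel (inner_strip \<Omega> d) + (\<integral>\<^sup>+x. ennreal \<bar>\<psi> (r k) x - c (r k) x\<bar> \<partial>lborel))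
    + ((\<integral>\<^sup>+x. ennreal \<bar>\<psi> (r l) x - c (r l) x\<bar> \<partial>lborel) + ennreal (3 * \<delta>) * emeasure lborel \<Omega>)"
   by (simp add: nn_integral_add nn_integral_cmult)
  also have "\<dots> \<le> (ennreal (\<epsilon>/4) + ennreal (\<epsilon>/4)) + (ennreal (\<epsilon>/4) + ennreal (\<epsilon>/4))"
  proof (intro add_mono err d(2))
   show "ennreal (3 * \<delta>) * emeasure lborel \<Omega> \<le> ennreal (\<epsilon>/4)"
    unfolding \<mu>(1) using \<delta> \<mu>(2) by (simp add: ennreal_mult[symmetric] ennreal_leI)
  qed
  also have "\<dots> = ennreal \<epsilon>" using \<epsilon> by (simp add: ennreal_plus[symmetric] del: ennreal_plus)
  finally show ?thesis .
 qed
 show ?thesis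
 proof (intro exI conjI allI)
  show "strict_mono (\<lambda>k. r (k + N))" using r(1) by (simp add: strict_mono_def)
  show "(\<integral>\<^sup>+x. ennreal (min 1 \<bar>w (r (k + N)) x - w (r (l + N)) x\<bar>) \<partial>lebesgue_on \<Omega>) \<le> ennreal \<epsilon>" for k l
   by (rule main) auto
 qed
qed

text \<open>A diagonal sequence is Cauchy in measure and so has a subsequence that converges almost everywhere.\<close>

lemma rellich_AE:
 fixes w :: "nat => real^'n::finite => real"
 assumes \<Omega>: "open \<Omega>" "bounded \<Omega>" and w: "\<And>k. smooth_on UNIV (w k)" and B: "0 \<le> B"
  and wB: "\<And>k. (\<integral>\<^sup>+x. ennreal \<bar>w k x\<bar> \<partial>lebesgue_on \<Omega>) \<le> ennreal B"
  and gB: "\<And>k. (\<integral>\<^sup>+x. ennreal (norm (grad (w k) x)) \<partial>lebesgue_on \<Omega>) \<le> ennreal B"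
 obtains r :: "nat => nat" where "strict_mono r" "AE x in lebesgue_on \<Omega>. convergent (\<lambda>k. w (r k) x)"
proof -
 let ?D = "\<lambda>r k l. \<integral>\<^sup>+x. ennreal (min 1 \<bar>w (r k) x - w (r l) x\<bar>) \<partial>lebesgue_on \<Omega>"
 let ?P = "\<lambda>n (r :: nat => nat). \<forall>k l. ?D r k l \<le> ennreal (inverse (real (Suc n)))"
 interpret subseqs ?P
 proof
  fix n :: nat and s :: "nat => nat" assume s: "strict_mono s"
  have pos: "0 < inverse (real (Suc n))" by simp
  from almost_cauchy_subsequence[OF \<Omega>, of "\<lambda>k. w (s k)", OF w B wB gB pos]
  show "\<exists>r'. strict_mono r' \<and> ?P n (s \<circ> r')" by (simp only: o_def)
 qed
 define r where "r = diagseq"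
 have r: "strict_mono r" unfolding r_def by (rule subseq_diagseq)
 have P: "?P n (r \<circ> (+) (Suc n))" for n
  unfolding r_def by (rule diagseq_holds) simp
 obtain r' where r': "strict_mono r'"
  "AE x in lebesgue_on \<Omega>. \<forall>\<^sub>F j in sequentially. min 1 \<bar>w (r (r' j)) x - w (r (r' (Suc j))) x\<bar> \<le> (1/2) ^ j"
 proof (rule fast_subsequence[of "\<lambda>k l x. min 1 \<bar>w (r k) x - w (r l) x\<bar>" "lebesgue_on \<Omega>"])
  note [measurable] = smooth_measurable(1)[OF w]
  show "(\<lambda>x. min 1 \<bar>w (r k) x - w (r l) x\<bar>) \<in> borel_measurable (lebesgue_on \<Omega>)" for k l by measurable
  fix \<eta> :: real assume "0 < \<eta>"
  then obtain n where n: "inverse (real (Suc n)) < \<eta>" using reals_Archimedean by blast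
  have "?D r k l \<le> ennreal \<eta>" if kl: "Suc n \<le> k" "Suc n \<le> l" for k l
  proof -
   have "?D r k l \<le> ennreal (inverse (real (Suc n)))"
    using P[rule_format, of n "k - Suc n" "l - Suc n"] kl by simp
   then show ?thesis using n by (meson ennreal_leI less_imp_le order_trans)
  qed
  then show "\<exists>N. \<forall>k\<ge>N. \<forall>l\<ge>N. ?D r k l \<le> ennreal \<eta>" by blast
 qed (use that in auto)
 show ?thesis
 proof (rule that[OF strict_mono_o[OF r r'(1)]])
  show "AE x in lebesgue_on \<Omega>. convergent (\<lambda>k. w ((r \<circ> r') k) x)"
   using r'(2)
  proof eventually_elim
   case (elim x)
   show ?case
   proof (rule convergent_if_fast[of _ "1/2"])
    show "\<forall>\<^sub>F j in sequentially. norm (w ((r \<circ> r') (Suc j)) x - w ((r \<circ> r') j) x) \<le> (1/2) ^ j"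
     using elim eventually_gt_at_top[of 0]
    proof eventually_elim
     case (elim j)
     have "(1/2::real) ^ j < 1" using elim(2) by (simp add: power_less_one_iff)
     then show ?case using elim(1) by (simp add: min_def abs_minus_commute split: if_splits)
    qed
   qed auto
  qed
 qed
qed

section \<open>The energy\<close>

lemma powr_le_const_plus_small:
 fixes \<theta> m p s :: real
 assumes "1 \<le> m" "m < p" "0 < \<theta>"
 obtains A where "0 < A" "\<And>s. 0 \<le> s ==> s powr m \<le> A + \<theta> * s powr p"
proof -
 let ?q = "p / m" and ?A = "\<theta> powr (1 / (1 - p / m))"
 have q: "1 < ?q" using assms by simp
 show ?thesis
 proof (rule that)
  show "0 < ?A" using assms by simp
  fix s :: real assume "0 \<le> s"
  have "s powr m \<le> ?A + ?A powr (1 - ?q) * (s powr m) powr ?q"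
   by (rule real_le_eps_plus_powr) (use assms q in auto)
  moreover have "?A powr (1 - ?q) = \<theta>" unfolding powr_powr using q assms by simp
  moreover have "(s powr m) powr ?q = s powr p" using assms by (simp add: powr_powr)
  ultimately show "s powr m \<le> ?A + \<theta> * s powr p" by simp
 qed
qed

lemma Lp_real_eq_integral: "in_Lp M p h ==> Lp_real M p h = (\<integral>x. norm (h x) powr p \<partial>M)"
 unfolding Lp_real_def Lp_pow_def in_Lp_def by (subst integral_eq_nn_integral) auto

lemma Lp_real_le: "in_Lp M p h ==> Lp_pow M p h \<le> ennreal b ==> 0 \<le> b ==> Lp_real M p h \<le> b"
 using Lp_real(1)[of M p h] by simp

lemma Lp_real_add_le:
 fixes f g :: "'a => 'b::euclidean_space"
 assumes f: "in_Lp M p f" and g: "in_Lp M p g" and p: "0 \<le> p"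
 shows "Lp_real M p (\<lambda>x. f x + g x) \<le> 2 powr p * (Lp_real M p f + Lp_real M p g)"
proof (rule Lp_real_le[OF in_Lp_add[OF f g p]])
 have "Lp_pow M p (\<lambda>x. f x + g x) \<le> ennreal (2 powr p) * (Lp_pow M p f + Lp_pow M p g)"
  by (rule Lp_pow_add_le[OF _ _ p]) (use f g in \<open>auto simp: in_Lp_iff\<close>)
 then show "Lp_pow M p (\<lambda>x. f x + g x) \<le> ennreal (2 powr p * (Lp_real M p f + Lp_real M p g))"
  by (simp add: Lp_real(1)[OF f] Lp_real(1)[OF g] Lp_real(2) ennreal_mult ennreal_plus)
qed (simp add: Lp_real(2))

lemma Lp_real_diff_le:
 fixes f g :: "'a => 'b::euclidean_space"
 assumes f: "in_Lp M p f" and g: "in_Lp M p g" and p: "0 \<le> p"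
 shows "Lp_real M p (\<lambda>x. f x - g x) \<le> 2 powr p * (Lp_real M p f + Lp_real M p g)"
proof -
 have "in_Lp M p (\<lambda>x. - g x)" using g by (simp add: in_Lp_def)
 from Lp_real_add_le[OF f this p] show ?thesis by (simp add: Lp_real_def Lp_pow_def)
qed

text \<open>Fatou's lemma for integrands that are lower semicontinuous along the sequence.\<close>

lemma fatou_real:
 fixes hk :: "nat => 'a => real"
 assumes hk: "\<And>k. integrable M (hk k)" "\<And>k. AE x in M. 0 \<le> hk k x" and h: "integrable M h" "AE x in M. 0 \<le> h x"
  and lsc: "AE x in M. \<exists>a. a \<longlonglongrightarrow> h x \<and> (\<forall>\<^sub>F k in sequentially. a k \<le> hk k x)"
  and s: "\<forall>\<^sub>F k in sequentially. (\<integral>x. hk k x \<partial>M) \<le> s"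
 shows "(\<integral>x. h x \<partial>M) \<le> s"
proof -
 have hk0: "0 \<le> (\<integral>x. hk k x \<partial>M)" for k by (rule integral_nonneg_AE[OF hk(2)])
 then have s0: "0 \<le> s" using eventually_happens[OF s] by (auto intro: order_trans)
 have "ennreal (\<integral>x. h x \<partial>M) = (\<integral>\<^sup>+x. ennreal (h x) \<partial>M)" by (rule nn_integral_eq_integral[OF h, symmetric])
 also have "\<dots> \<le> (\<integral>\<^sup>+x. liminf (\<lambda>k. ennreal (hk k x)) \<partial>M)"
 proof (rule nn_integral_mono_AE, use lsc in eventually_elim)
  case (elim x)
  then obtain a where a: "a \<longlonglongrightarrow> h x" "\<forall>\<^sub>F k in sequentially. a k \<le> hk k x" by blast
  have "ennreal (h x) = liminf (\<lambda>k. ennreal (a k))"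
   using lim_imp_Liminf[OF sequentially_bot tendsto_ennrealI[OF a(1)]] by (rule sym)
  also have "\<dots> \<le> liminf (\<lambda>k. ennreal (hk k x))"
   by (rule Liminf_mono, rule eventually_mono[OF a(2)]) (rule ennreal_leI)
  finally show ?case .
 qed
 also have "\<dots> \<le> liminf (\<lambda>k. \<integral>\<^sup>+x. ennreal (hk k x) \<partial>M)"
  by (rule nn_integral_liminf) (use hk(1) in auto)
 also have "\<dots> \<le> liminf (\<lambda>k::nat. ennreal s)"
 proof (rule Liminf_mono, use s in eventually_elim)
  case (elim k)
  then show ?case unfolding nn_integral_eq_integral[OF hk] by (rule ennreal_leI)
 qed
 also have "\<dots> = ennreal s" by (simp add: Liminf_const)
 finally show ?thesis using s0 by simp
qed

locale two_phase_functional =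
 fixes \<Omega> :: "(real^'n::finite) set"
  and p m c K \<epsilon> \<beta> :: real
  and \<phi> f Q :: "real^'n => real"
  and F :: "real^'n => real => real^'n => real"
  and G :: "real^'n => real^'n => real"
  and g :: "real^'n => real => real"
 assumes domain: "bounded_smooth_domain \<Omega>"
  and p: "2 \<le> p" "p < real CARD('n)"
  and phi: "\<phi> \<in> sobolev p \<Omega>" "AE X in lebesgue_on \<Omega>. 0 \<le> \<phi> X"
  and F: "\<forall>X\<in>\<Omega>. \<forall>s \<xi>. F X s \<xi> = G X \<xi> + g X s"
  and G_cont: "\<forall>\<xi>. continuous_on \<Omega> (\<lambda>X. G X \<xi>)"
  and G_growth: "0 < c"
   "\<forall>X\<in>\<Omega>. \<forall>\<xi>. c * norm \<xi> powr p \<le> G X \<xi> \<and> G X \<xi> \<le> inverse c * norm \<xi> powr p"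
  and G_struct: "AE X in lebesgue_on \<Omega>.
   strictly_convex (G X) \<and> (\<forall>\<xi>. (G X) differentiable (at \<xi>)) \<and>
   (\<forall>t \<xi>. G X (t *\<^sub>R \<xi>) = \<bar>t\<bar> powr p * G X \<xi>)"
  and g: "\<forall>X\<in>\<Omega>. \<forall>s. g X s = f X * (max s 0) powr m + Q X * (if 0 < s then 1 else 0)"
  and m: "1 \<le> m" "m < p"
  and f: "f \<in> borel_measurable (lebesgue_on \<Omega>)" "0 < K" "\<forall>X\<in>\<Omega>. - K \<le> f X \<and> f X \<le> K"
  and Q: "0 < \<beta>" "holder_on \<beta> \<Omega> Q" "0 < \<epsilon>" "\<forall>X\<in>\<Omega>. \<epsilon> < Q X \<and> Q X < inverse \<epsilon>"
begin

abbreviation "M \<equiv> lebesgue_on \<Omega>"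

lemma \<Omega>: "open \<Omega>" "bounded \<Omega>" and S\<Omega>: "\<Omega> \<in> sets lebesgue" and fin: "finite_measure M"
 and n2: "2 \<le> CARD('n)" and p0: "0 \<le> p" and p1: "1 \<le> p" and space_M: "space M = \<Omega>"
proof -
 show \<Omega>: "open \<Omega>" "bounded \<Omega>" using domain by (auto simp: bounded_smooth_domain_def)
 then show "\<Omega> \<in> sets lebesgue" "finite_measure M" by (auto intro: finite_measure_bounded_open)
 show "2 \<le> CARD('n)" using p by linarith
qed (use p in \<open>auto simp: space_restrict_space\<close>)

lemma AE_\<Omega>: "AE X in M. X \<in> \<Omega>" using AE_space[of M] by (simp add: space_M)

lemma G_continuous: "AE X in M. continuous_on UNIV (G X)"
 using G_struct
proof eventually_elim
 case (elim X)
 then show ?case by (auto simp: continuous_on_eq_continuous_at intro!: differentiable_imp_continuous_within)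
qed

text \<open>\<open>G\<close> is a Caratheodory function: compose with simple functions and pass to the limit, using continuity in
 the second variable.\<close>

lemma G_measurable:
 assumes V: "V \<in> borel_measurable M"
 shows "(\<lambda>X. G X (V X)) \<in> borel_measurable M"
proof -
 obtain s where s: "\<And>i. simple_function M (s i)" "\<And>x. x \<in> space M ==> (\<lambda>i. s i x) \<longlonglongrightarrow> V x"
  using borel_measurable_implies_sequence_metric[OF V] by metis
 have [measurable]: "(\<lambda>X. G X (s i X)) \<in> borel_measurable M" for i
 proof (rule measurable_compose_countable'[where f="\<lambda>v X. G X v" and I="s i ` space M"])
  show "(\<lambda>X. G X v) \<in> borel_measurable M" for v
   by (rule continuous_imp_measurable_on_sets_lebesgue[OF _ S\<Omega>]) (use G_cont in auto)
  have fi: "finite (s i ` space M)" by (rule simple_functionD(1)[OF s(1)])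
  then show "countable (s i ` space M)" by (rule countable_finite)
  show "s i \<in> M \<rightarrow>\<^sub>M count_space (s i ` space M)"
   unfolding measurable_count_space_eq2[OF fi] using simple_functionD(2)[OF s(1)] by auto
 qed
 have "(\<lambda>X. lim (\<lambda>i. G X (s i X))) \<in> borel_measurable M" by (rule borel_measurable_lim_metric) measurable
 then show ?thesis
 proof (rule measurable_lebesgue_on_AE_cong[OF \<Omega>(1)])
  show "AE X in M. lim (\<lambda>i. G X (s i X)) = G X (V X)"
   using G_continuous AE_\<Omega>
  proof eventually_elim
   case (elim X)
   have "(\<lambda>i. G X (s i X)) \<longlonglongrightarrow> G X (V X)"
    by (rule continuous_on_tendsto_compose[OF elim(1) s(2)]) (use elim(2) in \<open>auto simp: space_M\<close>)
   then show ?case by (rule limI)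
  qed
 qed
qed

lemma G_nonneg: "X \<in> \<Omega> ==> 0 \<le> G X \<xi>"
 using G_growth by (meson mult_nonneg_nonneg order_less_imp_le order_trans powr_ge_zero)

lemma G_integrable:
 assumes "in_Lp M p V"
 shows "integrable M (\<lambda>X. G X (V X))"
proof (rule Bochner_Integration.integrable_bound)
 show "integrable M (\<lambda>X. inverse c * norm (V X) powr p)" using assms by (simp add: in_Lp_def)
 show "(\<lambda>X. G X (V X)) \<in> borel_measurable M" by (rule G_measurable) (use assms in \<open>simp add: in_Lp_def\<close>)
 show "AE X in M. norm (G X (V X)) \<le> norm (inverse c * norm (V X) powr p)"
  using AE_\<Omega>
 proof eventually_elim
  case (elim X)
  then show ?case using G_growth G_nonneg[OF elim, of "V X"] by auto
 qed
qed

lemma Q_measurable: "Q \<in> borel_measurable M"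
proof (rule continuous_imp_measurable_on_sets_lebesgue[OF _ S\<Omega>])
 obtain C where C: "\<forall>x\<in>\<Omega>. \<forall>y\<in>\<Omega>. \<bar>Q x - Q y\<bar> \<le> C * dist x y powr \<beta>" using Q(2) unfolding holder_on_def ..
 show "continuous_on \<Omega> Q"
  unfolding continuous_on_def
 proof
  fix x assume x: "x \<in> \<Omega>"
  have "((\<lambda>y. C * dist y x powr \<beta>) \<longlongrightarrow> C * 0) (at x within \<Omega>)"
  proof (intro tendsto_mult tendsto_const)
   have "((\<lambda>y. dist y x) \<longlongrightarrow> dist x x) (at x within \<Omega>)" by (intro tendsto_intros)
   then have "((\<lambda>y. dist y x powr \<beta>) \<longlongrightarrow> dist x x powr \<beta>) (at x within \<Omega>)"
    by (rule tendsto_powr'[OF _ tendsto_const]) (use Q(1) in auto)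
   then show "((\<lambda>y. dist y x powr \<beta>) \<longlongrightarrow> 0) (at x within \<Omega>)" by simp
  qed
  then have lim0: "((\<lambda>y. C * dist y x powr \<beta>) \<longlongrightarrow> 0) (at x within \<Omega>)" by simp
  have "((\<lambda>y. Q y - Q x) \<longlongrightarrow> 0) (at x within \<Omega>)"
   by (rule Lim_null_comparison[OF _ lim0]) (use C x in \<open>auto simp: eventually_at_filter\<close>)
  then show "(Q \<longlongrightarrow> Q x) (at x within \<Omega>)" by (simp add: LIM_zero_iff)
 qed
qed

lemma g_measurable:
 assumes [measurable]: "u \<in> borel_measurable M"
 shows "(\<lambda>X. g X (u X)) \<in> borel_measurable M"
proof -
 note [measurable] = f(1) Q_measurable
 have "(\<lambda>X. f X * (max (u X) 0) powr m + Q X * (if 0 < u X then 1 else 0)) \<in> borel_measurable M" by measurable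
 then show ?thesis by (rule measurable_cong[THEN iffD1, rotated]) (use g in \<open>simp add: space_M\<close>)
qed

lemma g_upper: "X \<in> \<Omega> ==> \<bar>g X s\<bar> \<le> K * (max s 0) powr m + inverse \<epsilon>"
proof -
 assume X: "X \<in> \<Omega>"
 have "\<bar>f X\<bar> \<le> K" using f(3) X by (auto simp: abs_le_iff minus_le_iff)
 then have "\<bar>f X * (max s 0) powr m\<bar> \<le> K * (max s 0) powr m" by (simp add: abs_mult mult_right_mono)
 moreover have "\<bar>Q X * (if 0 < s then 1 else 0)\<bar> \<le> inverse \<epsilon>" using Q X by force
 ultimately show ?thesis using g X by (auto simp: abs_le_iff)
qed

lemma g_lower: "X \<in> \<Omega> ==> - (K * (max s 0) powr m) \<le> f X * (max s 0) powr m \<and> f X * (max s 0) powr m \<le> g X s"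
proof -
 assume X: "X \<in> \<Omega>"
 have "(- K) * (max s 0) powr m \<le> f X * (max s 0) powr m" using f(3) X by (intro mult_right_mono) auto
 moreover have "0 \<le> Q X" using Q X by force
 ultimately show ?thesis using g X by simp
qed

lemma powr_m_le:
 assumes "\<And>s. 0 \<le> s ==> s powr m \<le> A + \<theta> * s powr p" "0 \<le> \<theta>"
 shows "(max s 0) powr m \<le> A + \<theta> * \<bar>s\<bar> powr p"
proof -
 have "(max s 0) powr p \<le> \<bar>s\<bar> powr p" using p by (intro powr_mono2) auto
 then show ?thesis using assms(1)[of "max s 0"] mult_left_mono[OF _ assms(2)] by force
qed

lemma g_integrable:
 assumes u: "in_Lp M p u"
 shows "integrable M (\<lambda>X. g X (u X))"
proof -
 interpret finite_measure M by (rule fin)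
 obtain A where A: "\<And>s. 0 \<le> s ==> s powr m \<le> A + 1 * s powr p"
  using powr_le_const_plus_small[OF m zero_less_one] by metis
 show ?thesis
 proof (rule Bochner_Integration.integrable_bound)
  show "integrable M (\<lambda>X. K * (A + 1 * norm (u X) powr p) + inverse \<epsilon>)" using u by (simp add: in_Lp_def)
  show "(\<lambda>X. g X (u X)) \<in> borel_measurable M" by (rule g_measurable) (use u in \<open>simp add: in_Lp_def\<close>)
  show "AE X in M. norm (g X (u X)) \<le> norm (K * (A + 1 * norm (u X) powr p) + inverse \<epsilon>)"
   using AE_\<Omega>
  proof eventually_elim
   case (elim X)
   have "K * (max (u X) 0) powr m \<le> K * (A + 1 * \<bar>u X\<bar> powr p)"
    by (intro mult_left_mono powr_m_le A) (use f(2) in auto)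
   then show ?case using g_upper[OF elim, of "u X"] by simp
  qed
 qed
qed

definition "IG V = (\<integral>X. G X (V X) \<partial>M)"
definition "Ig u = (\<integral>X. g X (u X) \<partial>M)"

lemma energy_eq:
 assumes u: "W1p p \<Omega> u V"
 shows "energy \<Omega> F u = IG V + Ig u"
proof -
 note D = W1p_D[OF u]
 have ae: "AE X in M. weak_grad \<Omega> u X = V X" by (rule weak_grad_AE[OF \<Omega>(1) D(3)])
 have ae': "AE X in M. V X = weak_grad \<Omega> u X" using ae by eventually_elim simp
 have mw: "weak_grad \<Omega> u \<in> borel_measurable M" by (rule measurable_lebesgue_on_AE_cong[OF \<Omega>(1) D(5) ae'])
 have "energy \<Omega> F u = (\<integral>X. G X (weak_grad \<Omega> u X) + g X (u X) \<partial>M)"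
  unfolding energy_def by (rule Bochner_Integration.integral_cong[OF refl]) (use F in \<open>simp add: space_M\<close>)
 also have "\<dots> = (\<integral>X. G X (V X) + g X (u X) \<partial>M)"
  by (rule integral_cong_AE) (use ae in \<open>auto intro!: borel_measurable_add G_measurable g_measurable mw D(4,5)\<close>)
 also have "\<dots> = IG V + Ig u"
  unfolding IG_def Ig_def by (rule Bochner_Integration.integral_add[OF G_integrable[OF D(2)] g_integrable[OF D(1)]])
 finally show ?thesis .
qed

lemma IG_lower:
 assumes "in_Lp M p V"
 shows "c * Lp_real M p V \<le> IG V" "0 \<le> IG V" "IG V \<le> inverse c * Lp_real M p V"
proof -
 have i: "integrable M (\<lambda>X. norm (V X) powr p)" using assms by (simp add: in_Lp_def)
 have "(\<integral>X. c * norm (V X) powr p \<partial>M) \<le> (\<integral>X. G X (V X) \<partial>M)"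
  by (rule integral_mono) (use G_growth i G_integrable[OF assms] in \<open>auto simp: space_M\<close>)
 then show "c * Lp_real M p V \<le> IG V" by (simp add: IG_def Lp_real_eq_integral[OF assms])
 then show "0 \<le> IG V" using G_growth(1) Lp_real(2)[of M p V] by (meson mult_nonneg_nonneg order_less_imp_le order_trans)
 have "(\<integral>X. G X (V X) \<partial>M) \<le> (\<integral>X. inverse c * norm (V X) powr p \<partial>M)"
  by (rule integral_mono) (use G_growth i G_integrable[OF assms] in \<open>auto simp: space_M\<close>)
 then show "IG V \<le> inverse c * Lp_real M p V" by (simp add: IG_def Lp_real_eq_integral[OF assms])
qed

lemma Ig_lower:
 assumes u: "in_Lp M p u" and A: "\<And>s. 0 \<le> s ==> s powr m \<le> A + \<theta> * s powr p" "0 \<le> \<theta>"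
 shows "- (K * (A * measure M \<Omega> + \<theta> * Lp_real M p u)) \<le> Ig u"
proof -
 interpret finite_measure M by (rule fin)
 have i: "integrable M (\<lambda>X. norm (u X) powr p)" using u by (simp add: in_Lp_def)
 have "(\<integral>X. - (K * (A + \<theta> * norm (u X) powr p)) \<partial>M) \<le> (\<integral>X. g X (u X) \<partial>M)"
 proof (rule integral_mono)
  fix X assume "X \<in> space M"
  then have "X \<in> \<Omega>" by (simp add: space_M)
  moreover have "K * (max (u X) 0) powr m \<le> K * (A + \<theta> * \<bar>u X\<bar> powr p)"
   by (intro mult_left_mono powr_m_le A) (use f(2) in auto)
  ultimately show "- (K * (A + \<theta> * norm (u X) powr p)) \<le> g X (u X)" using g_lower[of X "u X"] by simp
 qed (use i g_integrable[OF u] in auto)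
 also have "(\<integral>X. - (K * (A + \<theta> * norm (u X) powr p)) \<partial>M) = - (K * (A * measure M \<Omega> + \<theta> * Lp_real M p u))"
  using i by (simp add: Lp_real_eq_integral[OF u] space_M algebra_simps)
 finally show ?thesis by (simp add: Ig_def)
qed

section \<open>Admissible functions\<close>

definition "\<Phi> = (SOME V. W1p p \<Omega> \<phi> V)"

lemma phi_W1p: "W1p p \<Omega> \<phi> \<Phi>"
 unfolding \<Phi>_def using phi(1) by (simp add: sobolev_W1p[OF \<Omega>(1)] someI_ex)

text \<open>Competitors together with one of their weak gradients. These pairs form a convex set that is closed under
 strong convergence.\<close>

definition "adm u V \<longleftrightarrow> trace_zero p \<Omega> (\<lambda>X. u X - \<phi> X) (\<lambda>X. V X - \<Phi> X)"

lemma adm_W1p: "adm u V ==> W1p p \<Omega> u V"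
 using W1p_linear[OF \<Omega>(1) trace_zero_W1p phi_W1p p0, of "\<lambda>X. u X - \<phi> X" "\<lambda>X. V X - \<Phi> X" 1 1]
 by (simp add: adm_def)

lemma adm_in_Lp: "adm u V ==> in_Lp M p u" "adm u V ==> in_Lp M p V"
 using W1p_D(1,2)[OF adm_W1p] by auto

lemma sobolev_bdry_iff: "u \<in> sobolev_bdry p \<Omega> \<phi> \<longleftrightarrow> (\<exists>V. adm u V)"
proof
 assume "u \<in> sobolev_bdry p \<Omega> \<phi>"
 then obtain Z where "trace_zero p \<Omega> (\<lambda>X. u X - \<phi> X) Z"
  by (auto simp: sobolev_bdry_def has_trace_zero_iff[OF \<Omega>(1)])
 then have "adm u (\<lambda>X. Z X + \<Phi> X)" by (simp add: adm_def)
 then show "\<exists>V. adm u V" by blast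
next
 assume "\<exists>V. adm u V"
 then obtain V where "adm u V" ..
 then show "u \<in> sobolev_bdry p \<Omega> \<phi>"
  using adm_W1p unfolding sobolev_bdry_def adm_def sobolev_W1p[OF \<Omega>(1)] has_trace_zero_iff[OF \<Omega>(1)] by blast
qed

lemma adm_phi: "adm \<phi> \<Phi>"
proof -
 have t: "test_fun \<Omega> (\<lambda>x. 0)" by (rule test_funI[where K="{}"]) (auto intro: smooth_const)
 have "(\<bullet>) 0 = (\<lambda>v::real^'n. 0 :: real)" by auto
 then have "((\<lambda>x. 0) has_derivative (\<bullet>) (0::real^'n)) (at x)" for x :: "real^'n" by simp
 from partial_gradI(2)[OF this] trace_zero_compact_support[OF \<Omega>(1) p1 t phi_W1p]
 show ?thesis by (simp add: adm_def)
qed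

lemma adm_mid:
 assumes "adm u V" "adm v W"
 shows "adm (\<lambda>X. (1/2) * (u X + v X)) (\<lambda>X. (1/2) *\<^sub>R (V X + W X))"
proof -
 have "(\<lambda>X. (1/2) * (u X + v X) - \<phi> X) = (\<lambda>X. (1/2) * (u X - \<phi> X) + (1/2) * (v X - \<phi> X))"
  by (simp add: fun_eq_iff field_simps)
 moreover have "(\<lambda>X. (1/2) *\<^sub>R (V X + W X) - \<Phi> X) = (\<lambda>X. (1/2) *\<^sub>R (V X - \<Phi> X) + (1/2) *\<^sub>R (W X - \<Phi> X))"
  by (simp add: fun_eq_iff vec_eq_iff field_simps)
 ultimately show ?thesis
  using trace_zero_linear[OF \<Omega>(1) assms[unfolded adm_def] p0, of "1/2" "1/2"] by (simp only: adm_def)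
qed

text \<open>The term of lower order costs at most an arbitrarily small multiple of the norm of \<open>u\<close>, which by
 Poincare's inequality is controlled by the gradient.\<close>

lemma coercive:
 obtains D where "0 \<le> D" "\<And>u V. adm u V ==> c / 2 * Lp_real M p V \<le> IG V + Ig u + D"
  "\<And>u V. adm u V ==> Lp_real M p u \<le> D * (1 + Lp_real M p V)"
proof -
 obtain C where C: "C > 0" "\<And>z Z. trace_zero p \<Omega> z Z ==> Lp_pow M p z \<le> ennreal C * Lp_pow M p Z"
  using poincare_trace_zero[OF \<Omega> n2 p1] by blast
 let ?a = "Lp_real M p \<phi>" and ?b = "Lp_real M p \<Phi>"
 note \<phi>L = W1p_D(1,2)[OF phi_W1p]
 have a0: "0 \<le> ?a" "0 \<le> ?b" by (rule Lp_real(2))+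
 define T where "T = 2 powr p * (C * 2 powr p)"
 define T0 where "T0 = 2 powr p * (C * (2 powr p * ?b) + ?a)"
 have T: "T > 0" "T0 \<ge> 0" using C(1) a0 by (simp_all add: T_def T0_def)
 have Lu: "Lp_real M p u \<le> T * Lp_real M p V + T0" if u: "adm u V" for u V
 proof -
  have z: "trace_zero p \<Omega> (\<lambda>X. u X - \<phi> X) (\<lambda>X. V X - \<Phi> X)" using u by (simp add: adm_def)
  note zL = W1p_D(1,2)[OF trace_zero_W1p[OF z]]
  have "Lp_real M p (\<lambda>X. u X - \<phi> X) \<le> C * Lp_real M p (\<lambda>X. V X - \<Phi> X)"
   using C(2)[OF z] C(1) Lp_real(1)[OF zL(2)]
   by (intro Lp_real_le[OF zL(1)]) (auto simp: ennreal_mult Lp_real(2))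
  also have "\<dots> \<le> C * (2 powr p * (Lp_real M p V + ?b))"
   using C(1) Lp_real_diff_le[OF adm_in_Lp(2)[OF u] \<phi>L(2) p0] by simp
  finally have "Lp_real M p (\<lambda>X. u X - \<phi> X) \<le> C * (2 powr p * (Lp_real M p V + ?b))" .
  moreover have "Lp_real M p u \<le> 2 powr p * (Lp_real M p (\<lambda>X. u X - \<phi> X) + ?a)"
   using Lp_real_add_le[OF zL(1) \<phi>L(1) p0] by simp
  ultimately have "Lp_real M p u \<le> 2 powr p * (C * (2 powr p * (Lp_real M p V + ?b)) + ?a)"
   by (meson add_right_mono mult_left_mono order_trans powr_ge_zero)
  then show ?thesis by (simp add: T_def T0_def algebra_simps)
 qed
 define \<theta> where "\<theta> = c / (2 * K * T)"
 have \<theta>: "0 < \<theta>" using G_growth(1) f(2) T(1) by (simp add: \<theta>_def)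
 have K\<theta>: "K * (\<theta> * T) = c / 2" using f(2) T(1) by (simp add: \<theta>_def field_simps)
 obtain A where A: "0 < A" "\<And>s. 0 \<le> s ==> s powr m \<le> A + \<theta> * s powr p" using powr_le_const_plus_small[OF m \<theta>] by metis
 define D0 where "D0 = K * (A * measure M \<Omega> + \<theta> * T0)"
 have D0: "0 \<le> D0" using f(2) A(1) \<theta> T(2) by (simp add: D0_def)
 show ?thesis
 proof (rule that[of "T + T0 + D0"])
  show "0 \<le> T + T0 + D0" using T D0 by simp
  fix u V assume u: "adm u V"
  have L0: "0 \<le> Lp_real M p V" by (rule Lp_real(2))
  have "K * (\<theta> * Lp_real M p u) \<le> K * (\<theta> * (T * Lp_real M p V + T0))"
   using f(2) \<theta> Lu[OF u] by (intro mult_left_mono) auto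
  also have "\<dots> = (K * (\<theta> * T)) * Lp_real M p V + K * (\<theta> * T0)" by (simp add: algebra_simps)
  finally have "K * (\<theta> * Lp_real M p u) \<le> c / 2 * Lp_real M p V + K * (\<theta> * T0)" unfolding K\<theta> .
  moreover have "- (K * (A * measure M \<Omega> + \<theta> * Lp_real M p u)) \<le> Ig u"
   by (rule Ig_lower[OF adm_in_Lp(1)[OF u] A(2)]) (use \<theta> in auto)
  moreover have "c * Lp_real M p V \<le> IG V" by (rule IG_lower(1)[OF adm_in_Lp(2)[OF u]])
  ultimately show "c / 2 * Lp_real M p V \<le> IG V + Ig u + (T + T0 + D0)"
   using T by (simp add: D0_def distrib_left)
  have "T * Lp_real M p V + T0 \<le> (T + T0 + D0) * (1 + Lp_real M p V)"
   using T D0 mult_nonneg_nonneg[OF T(2) L0] mult_nonneg_nonneg[OF D0 L0] by (simp add: distrib_left distrib_right)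
  then show "Lp_real M p u \<le> (T + T0 + D0) * (1 + Lp_real M p V)" using Lu[OF u] by linarith
 qed
qed

lemma nn_integral_norm_near_le:
 fixes w z :: "real^'n => 'b::euclidean_space"
 assumes z: "in_Lp M p z" and w[measurable]: "w \<in> borel_measurable M" and d: "Lp_pow M p (\<lambda>x. w x - z x) \<le> ennreal 1"
 shows "(\<integral>\<^sup>+x. ennreal (norm (w x)) \<partial>M) \<le> ennreal (measure M \<Omega> + 2 powr p * (1 + Lp_real M p z))"
proof -
 interpret finite_measure M by (rule fin)
 have dL: "in_Lp M p (\<lambda>x. w x - z x)" using d z by (auto simp: in_Lp_iff intro: le_less_trans)
 have wL: "in_Lp M p w" using in_Lp_add[OF dL z p0] by simp
 have "Lp_real M p w \<le> 2 powr p * (Lp_real M p (\<lambda>x. w x - z x) + Lp_real M p z)"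
  using Lp_real_add_le[OF dL z p0] by simp
 also have "\<dots> \<le> 2 powr p * (1 + Lp_real M p z)"
  by (intro mult_left_mono add_right_mono Lp_real_le[OF dL d]) auto
 finally have le: "Lp_real M p w \<le> 2 powr p * (1 + Lp_real M p z)" .
 have "(\<integral>\<^sup>+x. ennreal (norm (w x)) \<partial>M) \<le> (\<integral>\<^sup>+x. 1 + ennreal (norm (w x) powr p) \<partial>M)"
 proof (rule nn_integral_mono)
  fix x
  have "ennreal (norm (w x)) \<le> ennreal (1 + norm (w x) powr p)"
   using real_le_eps_plus_powr[of "norm (w x)" 1 p] p1 by (intro ennreal_leI) simp
  then show "ennreal (norm (w x)) \<le> 1 + ennreal (norm (w x) powr p)" by (simp add: ennreal_plus)
 qed
 also have "\<dots> = emeasure M \<Omega> + Lp_pow M p w"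
  unfolding Lp_pow_def by (subst nn_integral_add) (auto simp: space_M)
 also have "\<dots> = ennreal (measure M \<Omega> + Lp_real M p w)"
  by (simp add: emeasure_eq_measure Lp_real(1)[OF wL] Lp_real(2) ennreal_plus)
 also have "\<dots> \<le> ennreal (measure M \<Omega> + 2 powr p * (1 + Lp_real M p z))"
  using le by (intro ennreal_leI) simp
 finally show ?thesis .
qed

text \<open>Rellich's theorem is applied to smooth functions whose distance to \<open>u\<^sub>k - \<phi>\<close> tends to zero.\<close>

lemma adm_AE_convergent_subsequence:
 assumes adm: "\<And>k. adm (u k) (V k)" and B: "\<And>k. Lp_real M p (u k) \<le> B" "\<And>k. Lp_real M p (V k) \<le> B"
 obtains r :: "nat => nat" where "strict_mono r" "AE X in M. convergent (\<lambda>k. u (r k) X)"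
proof -
 let ?z = "\<lambda>k X. u k X - \<phi> X" and ?Z = "\<lambda>k X. V k X - \<Phi> X"
 have z: "trace_zero p \<Omega> (?z k) (?Z k)" for k using adm by (simp add: adm_def)
 note zL = W1p_D(1,2)[OF trace_zero_W1p[OF z]]
 define P where "P k w \<longleftrightarrow> smooth_on UNIV w \<and> Lp_pow M p (\<lambda>x. w x - ?z k x) \<le> ennreal ((1/2) ^ k)
   \<and> Lp_pow M p (\<lambda>x. grad w x - ?Z k x) \<le> ennreal ((1/2) ^ k)" for k w
 have "\<forall>k. \<exists>w. P k w"
 proof
  fix k
  show "\<exists>w. P k w"
   by (rule trace_zero_approx[OF z[of k], of "(1/2) ^ k"]) (simp, unfold P_def, blast)
 qed
 from choice[OF this] obtain w where P: "\<forall>k. P k (w k)" ..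
 then have w: "\<And>k. smooth_on UNIV (w k)" "\<And>k. Lp_pow M p (\<lambda>x. w k x - ?z k x) \<le> ennreal ((1/2) ^ k)"
   "\<And>k. Lp_pow M p (\<lambda>x. grad (w k) x - ?Z k x) \<le> ennreal ((1/2) ^ k)" by (auto simp: P_def)
 note mw = smooth_measurable(1)[OF w(1)] smooth_measurable(2)[OF w(1)]
 have le1: "ennreal ((1/2) ^ k) \<le> ennreal 1" for k by (intro ennreal_leI power_le_one) auto
 let ?T = "Lp_real M p \<phi> + Lp_real M p \<Phi>"
 define C where "C = measure M \<Omega> + 2 powr p * (1 + 2 powr p * (B + ?T))"
 note \<phi>L = W1p_D(1,2)[OF phi_W1p]
 have T0: "Lp_real M p \<phi> \<le> ?T" "Lp_real M p \<Phi> \<le> ?T" using Lp_real(2)[of M p \<phi>] Lp_real(2)[of M p \<Phi>] by auto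
 have "0 \<le> B" using Lp_real(2)[of M p "u 0"] B(1)[of 0] by linarith
 then have C0: "0 \<le> C" using Lp_real(2)[of M p \<phi>] Lp_real(2)[of M p \<Phi>] by (simp add: C_def)
 have "Lp_real M p (?z k) \<le> 2 powr p * (B + ?T)" for k
  by (rule order_trans[OF Lp_real_diff_le[OF adm_in_Lp(1)[OF adm] \<phi>L(1) p0]])
   (intro mult_left_mono add_mono B T0 powr_ge_zero)
 then have "measure M \<Omega> + 2 powr p * (1 + Lp_real M p (?z k)) \<le> C" for k
  unfolding C_def by (intro add_left_mono mult_left_mono) auto
 then have wC: "(\<integral>\<^sup>+x. ennreal (norm (w k x)) \<partial>M) \<le> ennreal C" for k
  by (intro order_trans[OF nn_integral_norm_near_le[OF zL(1) mw(1) order_trans[OF w(2) le1]]] ennreal_leI)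
 have "Lp_real M p (?Z k) \<le> 2 powr p * (B + ?T)" for k
  by (rule order_trans[OF Lp_real_diff_le[OF adm_in_Lp(2)[OF adm] \<phi>L(2) p0]])
   (intro mult_left_mono add_mono B T0 powr_ge_zero)
 then have "measure M \<Omega> + 2 powr p * (1 + Lp_real M p (?Z k)) \<le> C" for k
  unfolding C_def by (intro add_left_mono mult_left_mono) auto
 then have gC: "(\<integral>\<^sup>+x. ennreal (norm (grad (w k) x)) \<partial>M) \<le> ennreal C" for k
  by (intro order_trans[OF nn_integral_norm_near_le[OF zL(2) mw(2) order_trans[OF w(3) le1]]] ennreal_leI)
 obtain r :: "nat => nat" where r: "strict_mono r" "AE x in M. convergent (\<lambda>k. w (r k) x)"
  by (rule rellich_AE[OF \<Omega> w(1) C0 _ gC]) (use wC in auto)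
 let ?d = "\<lambda>k (l::nat) x. norm (w (r k) x - ?z (r k) x) powr p"
 obtain r' where r': "strict_mono r'" "AE x in M. \<forall>\<^sub>F j in sequentially. ?d (r' j) (r' (Suc j)) x \<le> (1/2) ^ j"
 proof (rule fast_subsequence[of ?d M])
  have [measurable]: "?z k \<in> borel_measurable M" "w k \<in> borel_measurable M" for k
   using zL(1)[of k] mw(1) by (auto simp: in_Lp_iff)
  show "?d k l \<in> borel_measurable M" for k l by measurable
  fix \<eta> :: real assume "0 < \<eta>"
  then obtain N where N: "(1/2) ^ N < \<eta>" using real_arch_pow_inv[of \<eta> "1/2"] by auto
  have "(\<integral>\<^sup>+x. ennreal (?d k l x) \<partial>M) \<le> ennreal \<eta>" if "N \<le> k" for k l
  proof -
   have "N \<le> r k" using that seq_suble[OF r(1), of k] by simp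
   then have "(1/2::real) ^ r k \<le> (1/2) ^ N" by (intro power_decreasing) auto
   then have "(1/2::real) ^ r k \<le> \<eta>" using N by linarith
   from order_trans[OF w(2)[of "r k", unfolded Lp_pow_def] ennreal_leI[OF this]] show ?thesis .
  qed
  then show "\<exists>N. \<forall>k\<ge>N. \<forall>l\<ge>N. (\<integral>\<^sup>+x. ennreal (?d k l x) \<partial>M) \<le> ennreal \<eta>" by blast
 qed (use that in auto)
 show ?thesis
 proof (rule that[OF strict_mono_o[OF r(1) r'(1)]])
  show "AE X in M. convergent (\<lambda>k. u ((r \<circ> r') k) X)"
   using r(2) r'(2)
  proof eventually_elim
   case (elim X)
   let ?e = "\<lambda>j. w (r (r' j)) X - ?z (r (r' j)) X"
   have "(\<lambda>j. norm (?e j) powr p) \<longlonglongrightarrow> 0"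
    by (rule tendsto_sandwich[OF _ elim(2) tendsto_const]) (simp_all add: LIMSEQ_power_zero)
   then have "(\<lambda>j. (norm (?e j) powr p) powr (1 / p)) \<longlonglongrightarrow> 0 powr (1 / p)"
    by (rule tendsto_powr'[OF _ tendsto_const]) (use p1 in auto)
   moreover have "(norm (?e j) powr p) powr (1 / p) = norm (?e j)" for j using p1 by (simp add: powr_powr)
   ultimately have "(\<lambda>j. norm (?e j)) \<longlonglongrightarrow> 0" by (simp only: powr_0)
   then have e: "?e \<longlonglongrightarrow> 0" by (rule tendsto_norm_zero_cancel)
   obtain l where "(\<lambda>k. w (r k) X) \<longlonglongrightarrow> l" using elim(1) by (auto simp: convergent_def)
   from LIMSEQ_subseq_LIMSEQ[OF this r'(1)] have "(\<lambda>j. w (r (r' j)) X) \<longlonglongrightarrow> l" by (simp add: o_def)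
   from tendsto_add[OF tendsto_diff[OF this e] tendsto_const[of "\<phi> X"]]
   have "(\<lambda>j. u (r (r' j)) X) \<longlonglongrightarrow> l + \<phi> X" by simp
   then show ?case by (auto simp: convergent_def o_def)
  qed
 qed
qed

lemma IG_mid:
 assumes V: "in_Lp M p V" and W: "in_Lp M p W" and s: "IG V \<le> s" "IG W \<le> s"
 shows "IG (\<lambda>X. (1/2) *\<^sub>R (V X + W X)) \<le> s"
proof -
 have mid: "in_Lp M p (\<lambda>X. (1/2) *\<^sub>R (V X + W X))"
  using in_Lp_linear[OF V W p0, of "1/2" "1/2"] by (simp add: scaleR_add_right)
 note i = G_integrable[OF V] G_integrable[OF W]
 have "IG (\<lambda>X. (1/2) *\<^sub>R (V X + W X)) \<le> (\<integral>X. (1/2) * (G X (V X) + G X (W X)) \<partial>M)"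
  unfolding IG_def
 proof (rule integral_mono_AE[OF G_integrable[OF mid]])
  show "AE X in M. G X ((1/2) *\<^sub>R (V X + W X)) \<le> (1/2) * (G X (V X) + G X (W X))"
   using G_struct
  proof eventually_elim
   case (elim X)
   show ?case
   proof (cases "V X = W X")
    case True
    then show ?thesis by (simp add: scaleR_2[symmetric])
   next
    case False
    from elim have "strictly_convex (G X)" by simp
    from this[unfolded strictly_convex_def, rule_format, of "V X" "W X" "1/2"] False
    show ?thesis by (simp add: scaleR_add_right)
   qed
  qed
 qed (use i in auto)
 also have "\<dots> = (1/2) * (IG V + IG W)" unfolding IG_def using i by simp
 finally show ?thesis using s by simp
qed

lemma midhull_adm:
 assumes h: "h \<in> midhull (\<lambda>k X. (u k X, V k X)) n" and adm: "\<And>k. adm (u k) (V k)"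
 shows "adm (\<lambda>X. fst (h X)) (\<lambda>X. snd (h X))" (is ?a)
  and "(\<And>k. n \<le> k ==> IG (V k) \<le> s) ==> IG (\<lambda>X. snd (h X)) \<le> s"
  and "(\<And>k. n \<le> k ==> \<bar>u k X - l\<bar> \<le> e) ==> \<bar>fst (h X) - l\<bar> \<le> e"
proof -
 show a: ?a using h
 proof (induction rule: midhull.induct)
  case (mid f g)
  then show ?case using adm_mid[OF mid.IH] by simp
 qed (simp add: adm)
 show "IG (\<lambda>X. snd (h X)) \<le> s" if "\<And>k. n \<le> k ==> IG (V k) \<le> s"
 proof -
  have "in_Lp M p (\<lambda>X. snd (h X)) \<and> IG (\<lambda>X. snd (h X)) \<le> s" using h
  proof (induction rule: midhull.induct)
   case (mid f g)
   then have i: "in_Lp M p (\<lambda>X. snd (f X))" "in_Lp M p (\<lambda>X. snd (g X))" by auto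
   show ?case using IG_mid[OF i] mid.IH in_Lp_linear[OF i p0, of "1/2" "1/2"] by (simp add: scaleR_add_right)
  qed (simp add: that adm_in_Lp(2)[OF adm])
  then show ?thesis ..
 qed
 show "\<bar>fst (h X) - l\<bar> \<le> e" if "\<And>k. n \<le> k ==> \<bar>u k X - l\<bar> \<le> e" using h
 proof (induction rule: midhull.induct)
  case (mid f g)
  have "fst ((1/2) *\<^sub>R (f X + g X)) - l = ((fst (f X) - l) + (fst (g X) - l)) / 2" by (simp add: field_simps)
  moreover have "\<bar>(fst (f X) - l) + (fst (g X) - l)\<bar> \<le> e + e"
   by (rule order_trans[OF abs_triangle_ineq add_mono[OF mid.IH]])
  ultimately show ?case by (simp only: abs_divide abs_numeral) simp
 qed (simp add: that)
qed

section \<open>Existence of a minimizer\<close>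

lemma in_Lp_pair:
 fixes u :: "real^'n => real" and V :: "real^'n => real^'n"
 assumes u: "in_Lp M p u" and V: "in_Lp M p V"
 shows "in_Lp M p (\<lambda>X. (u X, V X))" "Lp_pow M p (\<lambda>X. (u X, V X)) \<le> ennreal (2 powr p) * (Lp_pow M p u + Lp_pow M p V)"
proof -
 have [measurable]: "u \<in> borel_measurable M" "V \<in> borel_measurable M" using u V by (auto simp: in_Lp_iff)
 let ?a = "\<lambda>X. (u X, 0 :: real^'n)" and ?b = "\<lambda>X. (0 :: real, V X)"
 have ab: "in_Lp M p ?a" "in_Lp M p ?b" using u V by (auto simp: in_Lp_def intro!: borel_measurable_Pair)
 show "in_Lp M p (\<lambda>X. (u X, V X))" using in_Lp_add[OF ab p0] by simp
 have "Lp_pow M p (\<lambda>X. ?a X + ?b X) \<le> ennreal (2 powr p) * (Lp_pow M p ?a + Lp_pow M p ?b)"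
  by (rule Lp_pow_add_le[OF _ _ p0]) (intro borel_measurable_Pair; measurable)+
 then show "Lp_pow M p (\<lambda>X. (u X, V X)) \<le> ennreal (2 powr p) * (Lp_pow M p u + Lp_pow M p V)"
  by (simp add: Lp_pow_def)
qed

text \<open>The part with \<open>f\<close> is continuous in \<open>u\<close> but may be negative. Adding a constant and \<open>\<theta> |u|\<^sup>p\<close> makes it
 nonnegative, so that Fatou's lemma applies; the integrals of the added term are of order \<open>\<theta>\<close>. The part with
 \<open>Q\<close> is lower semicontinuous because \<open>{u > 0}\<close> is an open condition.\<close>

lemma Ig_lower_semicontinuous:
 assumes uk: "\<And>k. in_Lp M p (uk k)" "\<And>k. Lp_real M p (uk k) \<le> B" and u: "in_Lp M p u"
  and ae: "AE X in M. (\<lambda>k. uk k X) \<longlonglongrightarrow> u X" and L: "(\<lambda>k. Ig (uk k)) \<longlonglongrightarrow> L"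
 shows "Ig u \<le> L"
proof (rule field_le_epsilon)
 fix \<eta> :: real assume \<eta>: "0 < \<eta>"
 interpret finite_measure M by (rule fin)
 have B0: "0 \<le> B" using Lp_real(2)[of M p "uk 0"] uk(2)[of 0] by linarith
 define \<theta> where "\<theta> = \<eta> / 2 / (K * (B + 1))"
 have \<theta>: "0 < \<theta>" using \<eta> f(2) B0 by (simp add: \<theta>_def)
 have "K * (\<theta> * B) = \<eta> / 2 * (B / (B + 1))" using f(2) by (simp add: \<theta>_def)
 also have "\<dots> \<le> \<eta> / 2 * 1" using \<eta> B0 by (intro mult_left_mono) auto
 finally have \<theta>B: "K * (\<theta> * B) \<le> \<eta> / 2" by simp
 obtain A where A: "0 < A" "\<And>s. 0 \<le> s ==> s powr m \<le> A + \<theta> * s powr p" using powr_le_const_plus_small[OF m \<theta>] by metis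
 define P where "P v X = K * (A + \<theta> * \<bar>v X\<bar> powr p)" for v :: "real^'n => real" and X
 have P_i: "integrable M (P v)" "(\<integral>X. P v X \<partial>M) = K * (A * measure M \<Omega> + \<theta> * Lp_real M p v)" if "in_Lp M p v" for v
 proof -
  have i: "integrable M (\<lambda>X. \<bar>v X\<bar> powr p)" using that by (simp add: in_Lp_def)
  then show "integrable M (P v)" unfolding P_def by simp
  show "(\<integral>X. P v X \<partial>M) = K * (A * measure M \<Omega> + \<theta> * Lp_real M p v)"
   unfolding P_def using i by (simp add: Lp_real_eq_integral[OF that] space_M algebra_simps)
 qed
 have low: "0 \<le> f X * (max (v X) 0) powr m + P v X" "f X * (max (v X) 0) powr m \<le> g X (v X)" if "X \<in> \<Omega>" for X v
 proof -
  have "K * (max (v X) 0) powr m \<le> P v X"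
   unfolding P_def by (intro mult_left_mono powr_m_le A(2)) (use f(2) \<theta> in auto)
  then show "0 \<le> f X * (max (v X) 0) powr m + P v X" "f X * (max (v X) 0) powr m \<le> g X (v X)"
   using g_lower[OF that, of "v X"] by auto
 qed
 have nn: "AE X in M. 0 \<le> g X (v X) + P v X" for v
  using AE_\<Omega>
 proof eventually_elim
  case (elim X)
  from low(1,2)[OF elim, of v] show ?case by linarith
 qed
 have "(\<integral>X. g X (u X) + P u X \<partial>M) \<le> L + \<eta> / 2 + K * (A * measure M \<Omega> + \<theta> * B)"
 proof (rule fatou_real[where hk="\<lambda>k X. g X (uk k X) + P (uk k) X"])
  show "integrable M (\<lambda>X. g X (uk k X) + P (uk k) X)" for k
   by (rule Bochner_Integration.integrable_add[OF g_integrable[OF uk(1)] P_i(1)[OF uk(1)]])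
  show "integrable M (\<lambda>X. g X (u X) + P u X)"
   by (rule Bochner_Integration.integrable_add[OF g_integrable[OF u] P_i(1)[OF u]])
  show "AE X in M. 0 \<le> g X (uk k X) + P (uk k) X" for k by (rule nn)
  show "AE X in M. 0 \<le> g X (u X) + P u X" by (rule nn)
  show "AE X in M. \<exists>a. a \<longlonglongrightarrow> g X (u X) + P u X \<and> (\<forall>\<^sub>F k in sequentially. a k \<le> g X (uk k X) + P (uk k) X)"
   using ae AE_\<Omega>
  proof eventually_elim
   case (elim X)
   let ?\<chi> = "if 0 < u X then 1 else 0 :: real"
   let ?a = "\<lambda>k. f X * (max (uk k X) 0) powr m + Q X * ?\<chi> + P (uk k) X"
   have 1: "(\<lambda>k. (max (uk k X) 0) powr m) \<longlonglongrightarrow> (max (u X) 0) powr m"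
    using m by (intro tendsto_powr'[OF tendsto_max[OF elim(1) tendsto_const] tendsto_const]) auto
   have 2: "(\<lambda>k. \<bar>uk k X\<bar> powr p) \<longlonglongrightarrow> \<bar>u X\<bar> powr p"
    using p by (intro tendsto_powr'[OF tendsto_rabs[OF elim(1)] tendsto_const]) auto
   have "?a \<longlonglongrightarrow> f X * (max (u X) 0) powr m + Q X * ?\<chi> + P u X"
    unfolding P_def by (intro tendsto_intros 1 2)
   moreover have "\<forall>\<^sub>F k in sequentially. ?a k \<le> g X (uk k X) + P (uk k) X"
   proof (cases "0 < u X")
    case True
    from order_tendstoD(1)[OF elim(1) True] show ?thesis
     by eventually_elim (use g elim(2) True in simp)
   next
    case False
    then show ?thesis using low(2)[OF elim(2)] by simp
   qed
   ultimately show ?case using g elim(2) by (intro exI[of _ ?a]) simp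
  qed
  have "\<forall>\<^sub>F k in sequentially. Ig (uk k) < L + \<eta> / 2" by (rule order_tendstoD(2)[OF L]) (use \<eta> in simp)
  then show "\<forall>\<^sub>F k in sequentially. (\<integral>X. g X (uk k X) + P (uk k) X \<partial>M) \<le> L + \<eta> / 2 + K * (A * measure M \<Omega> + \<theta> * B)"
  proof eventually_elim
   case (elim k)
   have "(\<integral>X. g X (uk k X) + P (uk k) X \<partial>M) = Ig (uk k) + K * (A * measure M \<Omega> + \<theta> * Lp_real M p (uk k))"
    unfolding Ig_def Bochner_Integration.integral_add[OF g_integrable[OF uk(1)] P_i(1)[OF uk(1)]] P_i(2)[OF uk(1)] ..
   moreover have "K * (A * measure M \<Omega> + \<theta> * Lp_real M p (uk k)) \<le> K * (A * measure M \<Omega> + \<theta> * B)"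
    using uk(2)[of k] \<theta> f(2) by (intro mult_left_mono add_left_mono) auto
   ultimately show ?case using elim by simp
  qed
 qed
 moreover have "(\<integral>X. g X (u X) + P u X \<partial>M) = Ig u + K * (A * measure M \<Omega> + \<theta> * Lp_real M p u)"
  unfolding Ig_def Bochner_Integration.integral_add[OF g_integrable[OF u] P_i(1)[OF u]] P_i(2)[OF u] ..
 moreover have "K * (A * measure M \<Omega>) \<le> K * (A * measure M \<Omega> + \<theta> * Lp_real M p u)"
  using f(2) \<theta> Lp_real(2)[of M p u] by (intro mult_left_mono) auto
 ultimately show "Ig u \<le> L + \<eta>" using \<theta>B by (simp add: distrib_left)
qed

text \<open>The gradients are treated by convexity: midpoint combinations of a minimizing sequence converge
 strongly. The zeroth order terms are not convex in \<open>u\<close>; they are treated along the sequence itself, which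
 converges almost everywhere. Both limits agree because the combinations are formed from tails.\<close>

lemma minimizer_exists:
 obtains u V where "adm u V" "\<And>v W. adm v W ==> IG V + Ig u \<le> IG W + Ig v"
proof -
 obtain D where D: "0 \<le> D" "\<And>u V. adm u V ==> c / 2 * Lp_real M p V \<le> IG V + Ig u + D"
  "\<And>u V. adm u V ==> Lp_real M p u \<le> D * (1 + Lp_real M p V)" using coercive by blast
 define S where "S = {IG W + Ig v | v W. adm v W}"
 define I where "I = Inf S"
 have "- D \<le> s" if "s \<in> S" for s
 proof -
  from that obtain v W where "adm v W" "s = IG W + Ig v" by (auto simp: S_def)
  moreover have "0 \<le> c / 2 * Lp_real M p W" using G_growth(1) Lp_real(2)[of M p W] by simp
  ultimately show ?thesis using D(2)[of v W] by linarith
 qed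
 then have bd: "bdd_below S" by (rule bdd_belowI)
 have ne: "S \<noteq> {}" using adm_phi by (auto simp: S_def)
 have I_le: "I \<le> IG W + Ig v" if "adm v W" for v W
  unfolding I_def by (rule cInf_lower[OF _ bd]) (use that in \<open>auto simp: S_def\<close>)
 have "\<exists>uV. adm (fst uV) (snd uV) \<and> IG (snd uV) + Ig (fst uV) < I + inverse (real (Suc k))" for k
 proof -
  have "Inf S < I + inverse (real (Suc k))" by (simp add: I_def)
  from cInf_lessD[OF ne this] show ?thesis by (auto simp: S_def)
 qed
 then obtain uV where uV: "\<And>k. adm (fst (uV k)) (snd (uV k))"
  "\<And>k. IG (snd (uV k)) + Ig (fst (uV k)) < I + inverse (real (Suc k))" by metis
 define B1 where "B1 = 2 / c * (I + 1 + D)"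
 have VB: "Lp_real M p (snd (uV k)) \<le> B1" for k
 proof -
  have "inverse (real (Suc k)) \<le> 1" by (simp add: inverse_le_1_iff)
  then have "c / 2 * Lp_real M p (snd (uV k)) \<le> I + 1 + D" using D(2)[OF uV(1)[of k]] uV(2)[of k] by linarith
  then show ?thesis using G_growth(1) by (simp add: B1_def field_simps)
 qed
 have B10: "0 \<le> B1" using VB[of 0] Lp_real(2)[of M p "snd (uV 0)"] by linarith
 define B where "B = B1 + D * (1 + B1)"
 have DB: "0 \<le> D * (1 + B1)" using D(1) B10 by simp
 have bounds: "Lp_real M p (snd (uV k)) \<le> B" "Lp_real M p (fst (uV k)) \<le> B" for k
 proof -
  show "Lp_real M p (snd (uV k)) \<le> B" using VB[of k] DB by (simp add: B_def)
  have "Lp_real M p (fst (uV k)) \<le> D * (1 + B1)"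
   using D(3)[OF uV(1)[of k]] mult_left_mono[OF _ D(1), of "1 + Lp_real M p (snd (uV k))" "1 + B1"] VB[of k] by linarith
  then show "Lp_real M p (fst (uV k)) \<le> B" using B10 by (simp add: B_def)
 qed
 obtain r1 :: "nat => nat" where r1: "strict_mono r1" "AE X in M. convergent (\<lambda>k. fst (uV (r1 k)) X)"
  by (rule adm_AE_convergent_subsequence[OF uV(1) bounds(2,1)])
 have "\<bar>IG (snd (uV (r1 k)))\<bar> \<le> inverse c * B" for k
 proof -
  note i = IG_lower[OF adm_in_Lp(2)[OF uV(1)[of "r1 k"]]]
  have "inverse c * Lp_real M p (snd (uV (r1 k))) \<le> inverse c * B"
   using bounds(1) G_growth(1) by (intro mult_left_mono) auto
  then show ?thesis using i by linarith
 qed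
 from finite_pointwise_convergent_subsequence[of "{()}" "\<lambda>k _. IG (snd (uV (r1 k)))", OF _ this]
 obtain r2 :: "nat => nat" where r2: "strict_mono r2" "convergent (\<lambda>k. IG (snd (uV (r1 (r2 k)))))" by auto
 define uk where "uk k = fst (uV (r1 (r2 k)))" for k
 define Vk where "Vk k = snd (uV (r1 (r2 k)))" for k
 have adm: "adm (uk k) (Vk k)" and Bk: "Lp_real M p (uk k) \<le> B" "Lp_real M p (Vk k) \<le> B" for k
  using uV(1) bounds by (auto simp: uk_def Vk_def)
 define u0 where "u0 X = lim (\<lambda>k. uk k X)" for X
 have u0: "AE X in M. (\<lambda>k. uk k X) \<longlonglongrightarrow> u0 X"
  using r1(2)
 proof eventually_elim
  case (elim X)
  have "convergent (\<lambda>k. uk k X)"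
   using convergent_subseq_convergent[OF elim r2(1)] by (simp add: uk_def o_def)
  then show ?case by (simp add: u0_def convergent_LIMSEQ_iff)
 qed
 obtain \<gamma> where \<gamma>: "(\<lambda>k. IG (Vk k)) \<longlonglongrightarrow> \<gamma>" using r2(2) by (auto simp: Vk_def convergent_def)
 have "(\<lambda>k. IG (Vk k) + Ig (uk k)) \<longlonglongrightarrow> I"
 proof (rule tendsto_sandwich)
  show "\<forall>\<^sub>F k in sequentially. I \<le> IG (Vk k) + Ig (uk k)" by (rule always_eventually) (use I_le[OF adm] in blast)
  have "IG (Vk k) + Ig (uk k) \<le> I + inverse (real (Suc k))" for k
  proof -
   have "k \<le> r1 (r2 k)" using seq_suble[OF r1(1), of "r2 k"] seq_suble[OF r2(1), of k] by simp
   then have "inverse (real (Suc (r1 (r2 k)))) \<le> inverse (real (Suc k))" by (intro le_imp_inverse_le) auto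
   then show ?thesis using uV(2)[of "r1 (r2 k)"] unfolding uk_def Vk_def by linarith
  qed
  then show "\<forall>\<^sub>F k in sequentially. IG (Vk k) + Ig (uk k) \<le> I + inverse (real (Suc k))" by (intro always_eventually allI)
  show "(\<lambda>k. I + inverse (real (Suc k))) \<longlonglongrightarrow> I" using tendsto_add[OF tendsto_const LIMSEQ_inverse_real_of_nat] by simp
 qed simp
 from tendsto_diff[OF this \<gamma>] have Ig_lim: "(\<lambda>k. Ig (uk k)) \<longlonglongrightarrow> I - \<gamma>" by simp

 let ?P = "\<lambda>k X. (uk k X, Vk k X)"
 note uL = adm_in_Lp(1)[OF adm] and VL = adm_in_Lp(2)[OF adm]
 have PL: "in_Lp M p (?P k)" for k by (rule in_Lp_pair(1)[OF uL VL])
 have PB: "Lp_pow M p (?P k) \<le> ennreal (2 powr p * (B + B))" for k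
 proof -
  have B0: "0 \<le> B" using DB B10 by (simp add: B_def)
  have "Lp_pow M p (?P k) \<le> ennreal (2 powr p) * (ennreal (Lp_real M p (uk k)) + ennreal (Lp_real M p (Vk k)))"
   using in_Lp_pair(2)[OF uL VL, of k k] by (simp add: Lp_real(1)[OF uL] Lp_real(1)[OF VL])
  also have "\<dots> \<le> ennreal (2 powr p) * (ennreal B + ennreal B)"
   by (intro mult_left_mono add_mono ennreal_leI Bk) auto
  also have "\<dots> = ennreal (2 powr p * (B + B))"
   using B0 by (simp only: ennreal_mult ennreal_plus powr_ge_zero add_nonneg_nonneg)
  finally show ?thesis .
 qed
 let ?C = "\<lambda>W. \<forall>\<eta>>0. \<exists>N. \<forall>m\<ge>N. \<forall>n\<ge>N. Lp_pow M p (\<lambda>x. W m x - W n x) \<le> ennreal \<eta>"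
 have "\<exists>W. (\<forall>n. W n \<in> midhull ?P n) \<and> ?C W"
 proof (rule midhull_cauchy[OF p(1) PL PB])
  fix W assume W: "\<And>n. W n \<in> midhull ?P n"
   "\<And>\<eta>. 0 < \<eta> ==> \<exists>N. \<forall>m\<ge>N. \<forall>n\<ge>N. Lp_pow M p (\<lambda>x. W m x - W n x) \<le> ennreal \<eta>"
  show ?thesis by (intro exI[of _ W] conjI allI impI W)
 qed
 then obtain W where "\<forall>n. W n \<in> midhull ?P n" and W2: "?C W" by (elim exE conjE)
 then have W: "W n \<in> midhull ?P n" for n by (elim allE)
 have WL: "in_Lp M p (W n)" for n by (rule midhull_in_Lp[OF PL p0 W])
 obtain h and r :: "nat => nat" where h: "strict_mono r" "in_Lp M p h" "AE X in M. (\<lambda>j. W (r j) X) \<longlonglongrightarrow> h X" "tendsto_Lp M p W h"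
  by (rule Lp_complete[OF p1 WL W2[rule_format]])
 define u where "u X = fst (h X)" for X
 define V where "V X = snd (h X)" for X
 have [measurable]: "h \<in> borel_measurable M" using h(2) by (simp add: in_Lp_iff)
 have nf: "norm (fst z) \<le> norm z" "norm (snd z) \<le> norm z" for z :: "real \<times> (real^'n)"
  using norm_fst_le[of "fst z" "snd z"] norm_snd_le[of "snd z" "fst z"] by auto
 have hL: "in_Lp M p u" "in_Lp M p V"
 proof -
  have [measurable]: "fst \<in> borel_measurable (borel :: (real \<times> (real^'n)) measure)"
   "snd \<in> borel_measurable (borel :: (real \<times> (real^'n)) measure)"
   by (intro borel_measurable_continuous_onI continuous_intros)+
  have "u \<in> borel_measurable M" unfolding u_def[abs_def] by measurable
  then show "in_Lp M p u" by (intro in_Lp_bound[OF h(2) _ _ p0]) (simp_all add: u_def nf del: real_norm_def)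
  have "V \<in> borel_measurable M" unfolding V_def[abs_def] by measurable
  then show "in_Lp M p V" by (intro in_Lp_bound[OF h(2) _ _ p0]) (simp_all add: V_def nf)
 qed
 have admW: "adm (\<lambda>X. fst (W n X)) (\<lambda>X. snd (W n X))" for n by (rule midhull_adm(1)[OF W adm])
 have admu: "adm u V"
  unfolding adm_def
 proof (rule trace_zero_closed[OF \<Omega> p1, where zk="\<lambda>n X. fst (W n X) - \<phi> X" and Zk="\<lambda>n X. snd (W n X) - \<Phi> X"])
  show "trace_zero p \<Omega> (\<lambda>X. fst (W n X) - \<phi> X) (\<lambda>X. snd (W n X) - \<Phi> X)" for n using admW by (simp add: adm_def)
  show "in_Lp M p (\<lambda>X. u X - \<phi> X)" by (rule in_Lp_diff[OF hL(1) W1p_D(1)[OF phi_W1p] p0])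
  show "in_Lp M p (\<lambda>X. V X - \<Phi> X)" by (rule in_Lp_diff[OF hL(2) W1p_D(2)[OF phi_W1p] p0])
  note lim = h(4)[unfolded tendsto_Lp_iff]
  show "tendsto_Lp M p (\<lambda>n X. fst (W n X) - \<phi> X) (\<lambda>X. u X - \<phi> X)"
   unfolding tendsto_Lp_iff
  proof (rule ennreal_tendsto_0_mono[OF _ lim], rule Lp_pow_mono[OF _ p0])
   show "norm (fst (W n X) - \<phi> X - (u X - \<phi> X)) \<le> norm (W n X - h X)" for n X
    using nf(1)[of "W n X - h X"] by (simp add: u_def)
  qed
  show "tendsto_Lp M p (\<lambda>n X. snd (W n X) - \<Phi> X) (\<lambda>X. V X - \<Phi> X)"
   unfolding tendsto_Lp_iff
  proof (rule ennreal_tendsto_0_mono[OF _ lim], rule Lp_pow_mono[OF _ p0])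
   show "norm (snd (W n X) - \<Phi> X - (V X - \<Phi> X)) \<le> norm (W n X - h X)" for n X
    using nf(2)[of "W n X - h X"] by (simp add: V_def)
  qed
 qed
 have uu: "AE X in M. (\<lambda>k. uk k X) \<longlonglongrightarrow> u X"
  using u0 h(3)
 proof eventually_elim
  case (elim X)
  have "(\<lambda>j. fst (W (r j) X)) \<longlonglongrightarrow> u0 X"
   unfolding LIMSEQ_iff
  proof (intro allI impI)
   fix e :: real assume "0 < e"
   then obtain N where N: "\<And>k. N \<le> k ==> \<bar>uk k X - u0 X\<bar> < e / 2"
    using elim(1)[unfolded LIMSEQ_iff, rule_format, of "e/2"] by auto
   have "\<bar>fst (W (r j) X) - u0 X\<bar> \<le> e / 2" if "N \<le> j" for j
    by (rule midhull_adm(3)[OF W adm]) (use N seq_suble[OF h(1), of j] that in \<open>auto intro: less_imp_le\<close>)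
   then show "\<exists>N. \<forall>j\<ge>N. norm (fst (W (r j) X) - u0 X) < e" using \<open>0 < e\<close> by (intro exI[of _ N]) fastforce
  qed
  from LIMSEQ_unique[OF this tendsto_fst[OF elim(2)]] elim(1) show ?case by (simp add: u_def)
 qed
 have "Ig u \<le> I - \<gamma>" by (rule Ig_lower_semicontinuous[OF uL Bk(1) hL(1) uu Ig_lim])
 moreover have "IG V \<le> \<gamma>"
 proof (rule field_le_epsilon)
  fix \<eta> :: real assume "0 < \<eta>"
  then have "\<forall>\<^sub>F k in sequentially. IG (Vk k) < \<gamma> + \<eta>" by (intro order_tendstoD(2)[OF \<gamma>]) simp
  then obtain N where N: "\<And>k. N \<le> k ==> IG (Vk k) < \<gamma> + \<eta>" by (auto simp: eventually_sequentially)
  show "IG V \<le> \<gamma> + \<eta>"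
   unfolding IG_def
  proof (rule fatou_real[where hk="\<lambda>j X. G X (snd (W (r j) X))"])
   show "integrable M (\<lambda>X. G X (snd (W (r j) X)))" for j by (rule G_integrable[OF adm_in_Lp(2)[OF admW]])
   show "integrable M (\<lambda>X. G X (V X))" by (rule G_integrable[OF hL(2)])
   show "AE X in M. 0 \<le> G X (snd (W (r j) X))" for j using AE_\<Omega> by eventually_elim (rule G_nonneg)
   show "AE X in M. 0 \<le> G X (V X)" using AE_\<Omega> by eventually_elim (rule G_nonneg)
   show "AE X in M. \<exists>a. a \<longlonglongrightarrow> G X (V X) \<and> (\<forall>\<^sub>F j in sequentially. a j \<le> G X (snd (W (r j) X)))"
    using h(3) G_continuous
   proof eventually_elim
    case (elim X)
    have "(\<lambda>j. G X (snd (W (r j) X))) \<longlonglongrightarrow> G X (V X)"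
     unfolding V_def by (rule continuous_on_tendsto_compose[OF elim(2) tendsto_snd[OF elim(1)]]) auto
    then show ?case by (intro exI[of _ "\<lambda>j. G X (snd (W (r j) X))"]) simp
   qed
   have "IG (\<lambda>X. snd (W (r j) X)) \<le> \<gamma> + \<eta>" if "N \<le> j" for j
    by (rule midhull_adm(2)[OF W adm]) (use N seq_suble[OF h(1), of j] that in \<open>auto intro: less_imp_le\<close>)
   then show "\<forall>\<^sub>F j in sequentially. (\<integral>X. G X (snd (W (r j) X)) \<partial>M) \<le> \<gamma> + \<eta>"
    unfolding eventually_sequentially IG_def by blast
  qed
 qed
 ultimately have "IG V + Ig u \<le> I" by simp
 then show ?thesis using that[OF admu] I_le by (meson order_trans)
qed

text \<open>Replacing \<open>u\<close> by its positive part keeps the boundary values, because \<open>u\<^sup>- \<le> |u - \<phi>|\<close> and \<open>u - \<phi>\<close>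
 has trace zero, and it does not increase the energy.\<close>

lemma nonneg_minimizer_exists:
 "\<exists>u. is_minimizer p \<Omega> \<phi> F u \<and> (AE X in M. 0 \<le> u X)"
proof -
 obtain u V where u: "adm u V" "\<And>v W. adm v W ==> IG V + Ig u \<le> IG W + Ig v" using minimizer_exists by blast
 note D = W1p_D[OF adm_W1p[OF u(1)]]
 define s where "s X = max 0 (- u X)" for X
 define S where "S X = ((sgn (u X) - 1) / 2) *\<^sub>R V X" for X
 have [measurable]: "u \<in> borel_measurable M" "V \<in> borel_measurable M" by (rule D)+
 have sg: "\<bar>(sgn (u X) - 1) / 2\<bar> \<le> 1" "\<bar>1 + (sgn (u X) - 1) / 2\<bar> \<le> 1" for X by (auto simp: sgn_if)
 have "W1p p \<Omega> s S"
  unfolding W1p_def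
 proof (intro conjI)
  show "is_weak_gradient \<Omega> s S"
   unfolding s_def[abs_def] S_def[abs_def] by (rule is_weak_gradient_negpart[OF \<Omega>(1) D(3)])
  show "in_Lp M p s" by (rule in_Lp_bound[OF D(1) _ _ p0]) (auto simp: s_def[abs_def])
  show "in_Lp M p S"
  proof (rule in_Lp_bound[OF D(2) _ _ p0])
   show "S \<in> borel_measurable M" unfolding S_def[abs_def] by measurable
   show "norm (S X) \<le> norm (V X)" for X
    using mult_right_mono[OF sg(1)[of X], of "norm (V X)"] by (simp add: S_def)
  qed
 qed
 moreover have "AE X in M. \<bar>s X\<bar> \<le> \<bar>u X - \<phi> X\<bar>"
  using phi(2) by eventually_elim (auto simp: s_def)
 ultimately have "trace_zero p \<Omega> s S"
  using trace_zero_dominated[OF domain n2 p1 u(1)[unfolded adm_def]] by blast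
 from trace_zero_linear[OF \<Omega>(1) u(1)[unfolded adm_def] this p0, of 1 1]
 have adm': "adm (\<lambda>X. u X + s X) (\<lambda>X. V X + S X)" by (simp add: adm_def algebra_simps)
 have "Ig (\<lambda>X. u X + s X) = Ig u"
  unfolding Ig_def
 proof (rule Bochner_Integration.integral_cong[OF refl])
  fix X assume "X \<in> space M"
  moreover have "max (u X + s X) 0 = max (u X) 0" "0 < u X + s X \<longleftrightarrow> 0 < u X" by (auto simp: s_def)
  ultimately show "g X (u X + s X) = g X (u X)" using g by (simp add: space_M)
 qed
 moreover have "IG (\<lambda>X. V X + S X) \<le> IG V"
  unfolding IG_def
 proof (rule integral_mono_AE[OF G_integrable[OF adm_in_Lp(2)[OF adm']] G_integrable[OF D(2)]])
  show "AE X in M. G X (V X + S X) \<le> G X (V X)"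
   using G_struct AE_\<Omega>
  proof eventually_elim
   case (elim X)
   let ?t = "1 + (sgn (u X) - 1) / 2"
   have "V X + S X = ?t *\<^sub>R V X" unfolding S_def scaleR_add_left by simp
   then have "G X (V X + S X) = \<bar>?t\<bar> powr p * G X (V X)" using elim(1) by simp
   also have "\<dots> \<le> 1 * G X (V X)"
    using sg(2)[of X] p0 by (intro mult_right_mono G_nonneg[OF elim(2)] powr_le1) auto
   finally show ?case by simp
  qed
 qed
 ultimately have le: "IG (\<lambda>X. V X + S X) + Ig (\<lambda>X. u X + s X) \<le> IG W + Ig v" if "adm v W" for v W
  using u(2)[OF that] by simp
 show ?thesis
 proof (intro exI[of _ "\<lambda>X. u X + s X"] conjI)
  show "AE X in M. 0 \<le> u X + s X" by (simp add: s_def)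
  show "is_minimizer p \<Omega> \<phi> F (\<lambda>X. u X + s X)"
   unfolding is_minimizer_def
  proof (intro conjI ballI)
   show "(\<lambda>X. u X + s X) \<in> sobolev_bdry p \<Omega> \<phi>" using adm' sobolev_bdry_iff by blast
   fix v assume "v \<in> sobolev_bdry p \<Omega> \<phi>"
   then obtain W where v: "adm v W" using sobolev_bdry_iff by blast
   show "energy \<Omega> F (\<lambda>X. u X + s X) \<le> energy \<Omega> F v"
    unfolding energy_eq[OF adm_W1p[OF adm']] energy_eq[OF adm_W1p[OF v]] by (rule le[OF v])
  qed
 qed
qed

end

theorem theorem2p1:
  fixes \<Omega> :: "(real^'n::finite) set"
    and p m c K \<epsilon> \<beta> :: real
    and \<phi> f Q :: "real^'n \<Rightarrow> real"
    and F :: "real^'n \<Rightarrow> real \<Rightarrow> real^'n \<Rightarrow> real"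
    and G :: "real^'n \<Rightarrow> real^'n \<Rightarrow> real"
    and g :: "real^'n \<Rightarrow> real \<Rightarrow> real"
  assumes domain: "bounded_smooth_domain \<Omega>"
    and p: "2 \<le> p" "p < real CARD('n)"
    and phi: "\<phi> \<in> sobolev p \<Omega>"
      "AE X in lebesgue_on \<Omega>. 0 \<le> \<phi> X"
      "\<exists>B. AE X in lebesgue_on \<Omega>. \<phi> X \<le> B"
    and F: "\<forall>X\<in>\<Omega>. \<forall>s \<xi>. F X s \<xi> = G X \<xi> + g X s"
    and G_cont: "\<forall>\<xi>. continuous_on \<Omega> (\<lambda>X. G X \<xi>)"
    and G_growth: "0 < c"
      "\<forall>X\<in>\<Omega>. \<forall>\<xi>. c * norm \<xi> powr p \<le> G X \<xi> \<and> G X \<xi> \<le> inverse c * norm \<xi> powr p"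
    and G_struct: "AE X in lebesgue_on \<Omega>.
      strictly_convex (G X) \<and> (\<forall>\<xi>. (G X) differentiable (at \<xi>)) \<and>
      (\<forall>t \<xi>. G X (t *\<^sub>R \<xi>) = \<bar>t\<bar> powr p * G X \<xi>)"
    and g: "\<forall>X\<in>\<Omega>. \<forall>s. g X s = f X * (max s 0) powr m + Q X * (if 0 < s then 1 else 0)"
    and m: "1 \<le> m" "m < p"
    and f: "f \<in> borel_measurable (lebesgue_on \<Omega>)" "0 < K" "\<forall>X\<in>\<Omega>. - K \<le> f X \<and> f X \<le> K"
    and Q: "0 < \<beta>" "\<beta> \<le> 1" "holder_on \<beta> \<Omega> Q"
      "0 < \<epsilon>" "\<forall>X\<in>\<Omega>. \<epsilon> < Q X \<and> Q X < inverse \<epsilon>"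
  shows "\<exists>u. is_minimizer p \<Omega> \<phi> F u \<and> (AE X in lebesgue_on \<Omega>. 0 \<le> u X)"
proof -
  interpret two_phase_functional \<Omega> p m c K \<epsilon> \<beta> \<phi> f Q F G g
    by unfold_locales (fact assms)+
  show ?thesis by (rule nonneg_minimizer_exists)
qed

end
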